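(* Let $q\in(0,1)$. The $*$-map $$\pi:\mathcal{O}(SU_q(3))\longrightarrow\mathcal{O}(U_q(2)),\qquad \mathbf{u}\mapsto\mathbf{v}\quad(\text{i.e. } u_{ij}\mapsto v_{ij}),$$ is an epimorphism of Hopf $*$-algebras compatible with the $\mathbb{Z}^2$-gradings of $\mathcal{O}(SU_q(3))$ and $\mathcal{O}(U_q(2))$ or, equivalently, such that $\hat\pi_1\circ\pi=\hat\pi_0$, where $\hat\pi_0:\mathcal{O}(SU_q(3))\to\mathcal{O}(\mathbb{T}^2)$ and $\hat\pi_1:\mathcal{O}(U_q(2))\to\mathcal{O}(\mathbb{T}^2)$ are the Hopf $*$-algebra epimorphisms given by $\mathbf{u}\mapsto\mathrm{diag}(U_1,U_2,U_1^*U_2^* )$ and $\mathbf{v}\mapsto\mathrm{diag}(U_1,U_2,U_1^*U_2^* )$, respectively.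
   Context: All algebras are unital, associative, over $\mathbb{C}$; $\otimes=\otimes_{\mathbb{C}}$; $q\in(0,1)$. **$SU_q(3)$.** $C(SU_q(3))$ is the universal $C^*$-algebra generated by $u_{ij}$, $i,j=1,2,3$, such that the matrix $\mathbf{u}=(u_{ij})$ is unitary and $\sum_{i_1,i_2,i_3=1}^3E_{i_1i_2i_3}u_{j_1i_1}u_{j_2i_2}u_{j_3i_3}=E_{j_1j_2j_3}$ for all $j_1,j_2,j_3\in\{1,2,3\}$, where $E_{i_1i_2i_3}=(-q)^{I(i_1,i_2,i_3)}$ if $i_1,i_2,i_3$ are distinct ($I$ = number of inversions) and $0$ otherwise. The following relations also hold: $u_{ij}u_{ik}=qu_{ik}u_{ij}$ and $u_{ji}u_{ki}=qu_{ki}u_{ji}$ for $j<k$; $u_{ij}u_{km}=u_{km}u_{ij}$ for $i<k$, $j>m$; $u_{ij}u_{km}-u_{km}u_{ij}=(q-q^{-1})u_{im}u_{kj}$ for $i<k$, $j<m$. $\mathcal{O}(SU_q(3))$ is the subalgebra generated by the $u_{ij}$; it is a Hopf $*$-algebra with $\Delta(u_{ij})=\sum_k u_{ik}\otimes u_{kj}$, $\varepsilon(u_{ij})=\delta_{ij}$, $S(u_{ij})=u_{ji}^*$. It is $\mathbb{Z}^2$-graded by $\deg(u_{i1})=(1,0)$, $\deg(u_{i2})=(0,1)$, $\deg(u_{i3})=(-1,-1)$, $i=1,2,3$. **$U_q(2)$.** $\mathcal{O}(U_q(2))$ is the $*$-algebra generated by a central unitary $u$ and by $\alpha,\gamma$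 subject to $\alpha\gamma=q\gamma\alpha$, $\gamma\gamma^*=\gamma^*\gamma$, $\alpha\gamma^*=q\gamma^*\alpha$, $\alpha^*\alpha+\gamma\gamma^*=1$, $\alpha\alpha^*+q^2\gamma\gamma^*=1$. Put $$\mathbf{v}=(v_{ij})=\begin{pmatrix}u&0&0\\0&\alpha&-q\gamma^*u^*\\0&\gamma&\alpha^*u^*\end{pmatrix}.$$ It is a Hopf $*$-algebra with $\Delta(v_{ij})=\sum_kv_{ik}\otimes v_{kj}$, $\varepsilon(v_{ij})=\delta_{ij}$, $S(v_{ij})=v_{ji}^*$. It is $\mathbb{Z}^2$-graded by $\deg(u)=(1,0)$, $\deg(\alpha)=\deg(\gamma)=(0,1)$, with $\deg(x^* )=-\deg(x)$ for homogeneous $x$. **Torus.** $\mathcal{O}(\mathbb{T}^2)$ is the Hopf $*$-algebra of Laurent polynomials in two unitary group-like generators $U_1,U_2$. The gradings correspond to the right $\mathcal{O}(\mathbb{T}^2)$-coactions $(\mathrm{id}\otimes\hat\pi_0)\circ\Delta$ and $(\mathrm{id}\otimes\hat\pi_1)\circ\Delta$: an element $x$ has degree $(m,n)$ iff it is sent to $x\otimes U_1^mU_2^n$. *)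

theory Defs
  imports
    Complex_Main
    "HOL-Algebra.Module"
    "HOL-Library.FuncSet"
    "HOL-Library.Poly_Mapping"
    "HOL-Library.Product_Plus"
begin

section \<open>Unital \<open>*\<close>-algebras over the complex numbers\<close>

record 'a star_alg = "(complex, 'a) module" +
  star :: "'a \<Rightarrow> 'a"

definition complex_alg :: "complex star_alg" where
  "complex_alg = \<lparr>carrier = UNIV, monoid.mult = (*), one = 1, zero = 0, add = (+),
                  smult = (*), star = cnj\<rparr>"

locale star_algebra = module complex_alg A + ring A
  for A :: "('a, 'm) star_alg_scheme" (structure) +
  assumes smult_mult_left:
      "\<lbrakk>x \<in> carrier A; y \<in> carrier A\<rbrakk> \<Longrightarrow> (c \<odot> x) \<otimes> y = c \<odot> (x \<otimes> y)"
    and smult_mult_right: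
      "\<lbrakk>x \<in> carrier A; y \<in> carrier A\<rbrakk> \<Longrightarrow> x \<otimes> (c \<odot> y) = c \<odot> (x \<otimes> y)"
    and star_closed: "x \<in> carrier A \<Longrightarrow> star A x \<in> carrier A"
    and star_star: "x \<in> carrier A \<Longrightarrow> star A (star A x) = x"
    and star_add:
      "\<lbrakk>x \<in> carrier A; y \<in> carrier A\<rbrakk> \<Longrightarrow> star A (x \<oplus> y) = star A x \<oplus> star A y"
    and star_smult: "x \<in> carrier A \<Longrightarrow> star A (c \<odot> x) = cnj c \<odot> star A x"
    and star_mult:
      "\<lbrakk>x \<in> carrier A; y \<in> carrier A\<rbrakk> \<Longrightarrow> star A (x \<otimes> y) = star A y \<otimes> star A x"

definition linear_map ::
  "('a, 'm) star_alg_scheme \<Rightarrow> ('b, 'n) star_alg_scheme \<Rightarrow> ('a \<Rightarrow> 'b) \<Rightarrow> bool" where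
  "linear_map A B f \<longleftrightarrow>
     f \<in> carrier A \<rightarrow> carrier B \<and>
     (\<forall>x\<in>carrier A. \<forall>y\<in>carrier A. f (x \<oplus>\<^bsub>A\<^esub> y) = f x \<oplus>\<^bsub>B\<^esub> f y) \<and>
     (\<forall>c. \<forall>x\<in>carrier A. f (c \<odot>\<^bsub>A\<^esub> x) = c \<odot>\<^bsub>B\<^esub> f x)"

definition alg_hom ::
  "('a, 'm) star_alg_scheme \<Rightarrow> ('b, 'n) star_alg_scheme \<Rightarrow> ('a \<Rightarrow> 'b) \<Rightarrow> bool" where
  "alg_hom A B f \<longleftrightarrow> f \<in> ring_hom A B \<and> linear_map A B f"

definition star_hom ::
  "('a, 'm) star_alg_scheme \<Rightarrow> ('b, 'n) star_alg_scheme \<Rightarrow> ('a \<Rightarrow> 'b) \<Rightarrow> bool" where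
  "star_hom A B f \<longleftrightarrow> alg_hom A B f \<and> (\<forall>x\<in>carrier A. f (star A x) = star B (f x))"

definition opposite :: "('a, 'm) star_alg_scheme \<Rightarrow> ('a, 'm) star_alg_scheme" where
  "opposite A = A\<lparr>monoid.mult := \<lambda>x y. y \<otimes>\<^bsub>A\<^esub> x\<rparr>"

text \<open>The unital subalgebra, respectively \<open>*\<close>-subalgebra, generated by a set; \<open>0\<close> and
  additive inverses are obtained as scalar multiples.\<close>

inductive_set generated_alg :: "('a, 'm) star_alg_scheme \<Rightarrow> 'a set \<Rightarrow> 'a set"
  for A :: "('a, 'm) star_alg_scheme" and X :: "'a set" where
  incl: "x \<in> X \<Longrightarrow> x \<in> generated_alg A X"
| one: "\<one>\<^bsub>A\<^esub> \<in> generated_alg A X"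
| add: "x \<in> generated_alg A X \<Longrightarrow> y \<in> generated_alg A X \<Longrightarrow> x \<oplus>\<^bsub>A\<^esub> y \<in> generated_alg A X"
| mult: "x \<in> generated_alg A X \<Longrightarrow> y \<in> generated_alg A X \<Longrightarrow> x \<otimes>\<^bsub>A\<^esub> y \<in> generated_alg A X"
| smult: "x \<in> generated_alg A X \<Longrightarrow> c \<odot>\<^bsub>A\<^esub> x \<in> generated_alg A X"

definition generated_star_alg :: "('a, 'm) star_alg_scheme \<Rightarrow> 'a set \<Rightarrow> 'a set" where
  "generated_star_alg A X = generated_alg A (X \<union> star A ` X)"


section \<open>Tensor products\<close>

definition bilinear_form ::
  "('a, 'm) star_alg_scheme \<Rightarrow> ('b, 'n) star_alg_scheme \<Rightarrow> ('a \<Rightarrow> 'b \<Rightarrow> complex) \<Rightarrow> bool" where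
  "bilinear_form A B \<beta> \<longleftrightarrow>
     (\<forall>b\<in>carrier B. linear_map A complex_alg (\<lambda>a. \<beta> a b)) \<and>
     (\<forall>a\<in>carrier A. linear_map B complex_alg (\<lambda>b. \<beta> a b))"

text \<open>The algebraic tensor product \<open>A \<otimes> B\<close> is realised inside the dual of the space of bilinear
  forms on \<open>A \<times> B\<close>: the elementary tensor \<open>a \<otimes> b\<close> is evaluation at \<open>(a, b)\<close>, and \<open>A \<otimes> B\<close> is the
  linear span of these. Functionals are set to \<open>0\<close> outside the bilinear forms.\<close>

type_synonym ('a, 'b) tensor = "('a \<Rightarrow> 'b \<Rightarrow> complex) \<Rightarrow> complex"

definition pure_tensor ::
  "('a, 'm) star_alg_scheme \<Rightarrow> ('b, 'n) star_alg_scheme \<Rightarrow> 'a \<Rightarrow> 'b \<Rightarrow> ('a, 'b) tensor" where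
  "pure_tensor A B a b = (\<lambda>\<beta>. if bilinear_form A B \<beta> then \<beta> a b else 0)"

text \<open>The product and the involution are determined by
  \<open>(a \<otimes> b)(c \<otimes> d) = ac \<otimes> bd\<close> and \<open>(a \<otimes> b)\<^sup>* = a\<^sup>* \<otimes> b\<^sup>*\<close>.\<close>

definition tensor_alg ::
  "('a, 'm) star_alg_scheme \<Rightarrow> ('b, 'n) star_alg_scheme \<Rightarrow> ('a, 'b) tensor star_alg" where
  "tensor_alg A B =
     \<lparr>carrier = {t. \<exists>(n::nat) a b. (\<forall>i<n. a i \<in> carrier A \<and> b i \<in> carrier B) \<and>
                    t = (\<lambda>\<beta>. \<Sum>i<n. pure_tensor A B (a i) (b i) \<beta>)},
      monoid.mult = (\<lambda>s t \<beta>. if bilinear_form A B \<beta>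
                      then s (\<lambda>a b. t (\<lambda>c d. \<beta> (a \<otimes>\<^bsub>A\<^esub> c) (b \<otimes>\<^bsub>B\<^esub> d))) else 0),
      one = pure_tensor A B \<one>\<^bsub>A\<^esub> \<one>\<^bsub>B\<^esub>,
      zero = (\<lambda>\<beta>. 0),
      add = (\<lambda>s t \<beta>. s \<beta> + t \<beta>),
      smult = (\<lambda>c t \<beta>. c * t \<beta>),
      star = (\<lambda>t \<beta>. if bilinear_form A B \<beta>
                then cnj (t (\<lambda>a b. cnj (\<beta> (star A a) (star B b)))) else 0)\<rparr>"

text \<open>\<open>f \<otimes> g : A \<otimes> B \<longrightarrow> C \<otimes> D\<close>; since a tensor carries its domain, only \<open>C\<close> and \<open>D\<close> occur.\<close>

definition tensor_map ::
  "('c, 'm) star_alg_scheme \<Rightarrow> ('d, 'n) star_alg_scheme \<Rightarrow> ('a \<Rightarrow> 'c) \<Rightarrow> ('b \<Rightarrow> 'd) \<Rightarrow>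
   ('a, 'b) tensor \<Rightarrow> ('c, 'd) tensor" where
  "tensor_map C D f g t =
     (\<lambda>\<beta>. if bilinear_form C D \<beta> then t (\<lambda>a b. \<beta> (f a) (g b)) else 0)"

text \<open>\<open>(A \<otimes> B) \<otimes> C \<longrightarrow> A \<otimes> (B \<otimes> C)\<close>, \<open>(a \<otimes> b) \<otimes> c \<mapsto> a \<otimes> (b \<otimes> c)\<close>.\<close>

definition tensor_assoc ::
  "('a, 'm) star_alg_scheme \<Rightarrow> ('b, 'n) star_alg_scheme \<Rightarrow> ('c, 'k) star_alg_scheme \<Rightarrow>
   (('a, 'b) tensor, 'c) tensor \<Rightarrow> ('a, ('b, 'c) tensor) tensor" where
  "tensor_assoc A B C t =
     (\<lambda>\<beta>. if bilinear_form A (tensor_alg B C) \<beta>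
           then t (\<lambda>s c. s (\<lambda>a b. \<beta> a (pure_tensor B C b c))) else 0)"

text \<open>The linear map \<open>A \<otimes> B \<longrightarrow> C\<close>, \<open>a \<otimes> b \<mapsto> g a b\<close> for bilinear \<open>g\<close>; its value is pinned down by
  the linear functionals on \<open>C\<close>.\<close>

definition tensor_lift ::
  "('c, 'm) star_alg_scheme \<Rightarrow> ('a \<Rightarrow> 'b \<Rightarrow> 'c) \<Rightarrow> ('a, 'b) tensor \<Rightarrow> 'c" where
  "tensor_lift C g t =
     (THE y. y \<in> carrier C \<and>
        (\<forall>\<phi>. linear_map C complex_alg \<phi> \<longrightarrow> \<phi> y = t (\<lambda>a b. \<phi> (g a b))))"


section \<open>Hopf \<open>*\<close>-algebras\<close>

record 'a hopf = "'a star_alg" +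
  comult :: "'a \<Rightarrow> ('a, 'a) tensor"
  counit :: "'a \<Rightarrow> complex"
  antipode :: "'a \<Rightarrow> 'a"

definition make_hopf ::
  "'a star_alg \<Rightarrow> ('a \<Rightarrow> ('a, 'a) tensor) \<Rightarrow> ('a \<Rightarrow> complex) \<Rightarrow> ('a \<Rightarrow> 'a) \<Rightarrow> 'a hopf" where
  "make_hopf A D e S =
     \<lparr>carrier = carrier A, monoid.mult = monoid.mult A, one = one A, zero = zero A, add = add A,
      smult = smult A, star = star A, comult = D, counit = e, antipode = S\<rparr>"

locale hopf_star_algebra = star_algebra H
  for H :: "('a, 'm) hopf_scheme" (structure) +
  assumes comult_hom: "star_hom H (tensor_alg H H) (comult H)"
    and coassoc: "x \<in> carrier H \<Longrightarrow>
      tensor_assoc H H H (tensor_map (tensor_alg H H) H (comult H) (\<lambda>a. a) (comult H x)) =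
      tensor_map H (tensor_alg H H) (\<lambda>a. a) (comult H) (comult H x)"
    and counit_hom: "star_hom H complex_alg (counit H)"
    and counit_left: "x \<in> carrier H \<Longrightarrow>
      tensor_lift H (\<lambda>a b. counit H a \<odot> b) (comult H x) = x"
    and counit_right: "x \<in> carrier H \<Longrightarrow>
      tensor_lift H (\<lambda>a b. counit H b \<odot> a) (comult H x) = x"
    and antipode_linear: "linear_map H H (antipode H)"
    and antipode_left: "x \<in> carrier H \<Longrightarrow>
      tensor_lift H (\<lambda>a b. antipode H a \<otimes> b) (comult H x) = counit H x \<odot> \<one>"
    and antipode_right: "x \<in> carrier H \<Longrightarrow>
      tensor_lift H (\<lambda>a b. a \<otimes> antipode H b) (comult H x) = counit H x \<odot> \<one>"

definition hopf_star_hom ::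
  "('a, 'm) hopf_scheme \<Rightarrow> ('b, 'n) hopf_scheme \<Rightarrow> ('a \<Rightarrow> 'b) \<Rightarrow> bool" where
  "hopf_star_hom H K f \<longleftrightarrow>
     hopf_star_algebra H \<and> hopf_star_algebra K \<and> star_hom H K f \<and>
     (\<forall>x\<in>carrier H. comult K (f x) = tensor_map K K f f (comult H x)) \<and>
     (\<forall>x\<in>carrier H. counit K (f x) = counit H x) \<and>
     (\<forall>x\<in>carrier H. antipode K (f x) = f (antipode H x))"

definition hopf_star_epi ::
  "('a, 'm) hopf_scheme \<Rightarrow> ('b, 'n) hopf_scheme \<Rightarrow> ('a \<Rightarrow> 'b) \<Rightarrow> bool" where
  "hopf_star_epi H K f \<longleftrightarrow> hopf_star_hom H K f \<and> f ` carrier H = carrier K"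

text \<open>The \<open>*\<close>-map (resp. algebra map) sending the entries of one \<open>3 \<times> 3\<close> matrix to those of another.
  Matrices are indexed by \<open>{1..3}\<close>; maps are extensional, so that uniqueness is meaningful.\<close>

definition is_matrix_star_map ::
  "('a, 'm) star_alg_scheme \<Rightarrow> ('b, 'n) star_alg_scheme \<Rightarrow> (nat \<Rightarrow> nat \<Rightarrow> 'a) \<Rightarrow>
   (nat \<Rightarrow> nat \<Rightarrow> 'b) \<Rightarrow> ('a \<Rightarrow> 'b) \<Rightarrow> bool" where
  "is_matrix_star_map A B a b f \<longleftrightarrow>
     f \<in> extensional (carrier A) \<and> star_hom A B f \<and> (\<forall>i\<in>{1..3}. \<forall>j\<in>{1..3}. f (a i j) = b i j)"

definition matrix_star_map ::
  "('a, 'm) star_alg_scheme \<Rightarrow> ('b, 'n) star_alg_scheme \<Rightarrow> (nat \<Rightarrow> nat \<Rightarrow> 'a) \<Rightarrow>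
   (nat \<Rightarrow> nat \<Rightarrow> 'b) \<Rightarrow> 'a \<Rightarrow> 'b" where
  "matrix_star_map A B a b = (THE f. is_matrix_star_map A B a b f)"

definition matrix_alg_map ::
  "('a, 'm) star_alg_scheme \<Rightarrow> ('b, 'n) star_alg_scheme \<Rightarrow> (nat \<Rightarrow> nat \<Rightarrow> 'a) \<Rightarrow>
   (nat \<Rightarrow> nat \<Rightarrow> 'b) \<Rightarrow> 'a \<Rightarrow> 'b" where
  "matrix_alg_map A B a b =
     (THE f. f \<in> extensional (carrier A) \<and> alg_hom A B f \<and>
             (\<forall>i\<in>{1..3}. \<forall>j\<in>{1..3}. f (a i j) = b i j))"

text \<open>The Hopf structure for which \<open>a\<close> is a unitary corepresentation:
  \<open>\<Delta>(a\<^sub>i\<^sub>j) = \<Sum>\<^sub>k a\<^sub>i\<^sub>k \<otimes> a\<^sub>k\<^sub>j\<close>, \<open>\<epsilon>(a\<^sub>i\<^sub>j) = \<delta>\<^sub>i\<^sub>j\<close>, and \<open>S\<close> antimultiplicative with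
  \<open>S(a\<^sub>i\<^sub>j) = a\<^sub>j\<^sub>i\<^sup>*\<close>.\<close>

definition matrix_hopf :: "'a star_alg \<Rightarrow> (nat \<Rightarrow> nat \<Rightarrow> 'a) \<Rightarrow> 'a hopf" where
  "matrix_hopf A a = make_hopf A
     (matrix_star_map A (tensor_alg A A) a
        (\<lambda>i j. \<Oplus>\<^bsub>tensor_alg A A\<^esub>k\<in>{1..3}. pure_tensor A A (a i k) (a k j)))
     (matrix_star_map A complex_alg a (\<lambda>i j. if i = j then 1 else 0))
     (matrix_alg_map A (opposite A) a (\<lambda>i j. star A (a j i)))"


section \<open>Bounded operators on \<open>\<ell>\<^sup>2(\<nat>)\<close> and universal \<open>C\<^sup>*\<close>-algebras\<close>

definition l2 :: "(nat \<Rightarrow> complex) set" where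
  "l2 = {x. summable (\<lambda>n. (cmod (x n))\<^sup>2)}"

definition l2_inner :: "(nat \<Rightarrow> complex) \<Rightarrow> (nat \<Rightarrow> complex) \<Rightarrow> complex" where
  "l2_inner x y = suminf (\<lambda>n. x n * cnj (y n))"

definition l2_norm :: "(nat \<Rightarrow> complex) \<Rightarrow> real" where
  "l2_norm x = sqrt (suminf (\<lambda>n. (cmod (x n))\<^sup>2))"

type_synonym l2_op = "(nat \<Rightarrow> complex) \<Rightarrow> (nat \<Rightarrow> complex)"

definition bounded_l2_ops :: "l2_op set" where
  "bounded_l2_ops = {T \<in> l2 \<rightarrow>\<^sub>E l2.
     (\<forall>x\<in>l2. \<forall>y\<in>l2. T (\<lambda>n. x n + y n) = (\<lambda>n. T x n + T y n)) \<and>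
     (\<forall>c. \<forall>x\<in>l2. T (\<lambda>n. c * x n) = (\<lambda>n. c * T x n)) \<and>
     (\<exists>K. \<forall>x\<in>l2. l2_norm (T x) \<le> K * l2_norm x)}"

definition l2_adjoint :: "l2_op \<Rightarrow> l2_op" where
  "l2_adjoint T =
     (THE S. S \<in> bounded_l2_ops \<and> (\<forall>x\<in>l2. \<forall>y\<in>l2. l2_inner (T x) y = l2_inner x (S y)))"

definition l2_op_norm :: "l2_op \<Rightarrow> real" where
  "l2_op_norm T = (SUP x\<in>{x \<in> l2. l2_norm x \<le> 1}. l2_norm (T x))"

definition B_l2 :: "l2_op star_alg" where
  "B_l2 =
     \<lparr>carrier = bounded_l2_ops,
      monoid.mult = (\<lambda>S T. \<lambda>x\<in>l2. S (T x)),
      one = (\<lambda>x\<in>l2. x),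
      zero = (\<lambda>x\<in>l2. (\<lambda>n. 0)),
      add = (\<lambda>S T. \<lambda>x\<in>l2. (\<lambda>n. S x n + T x n)),
      smult = (\<lambda>c T. \<lambda>x\<in>l2. (\<lambda>n. c * T x n)),
      star = l2_adjoint\<rparr>"

text \<open>The \<open>\<ell>\<^sup>\<infinity>\<close>-direct product of copies of \<open>B(\<ell>\<^sup>2)\<close> indexed by a set \<open>R\<close>.\<close>

definition B_l2_product :: "'r set \<Rightarrow> ('r \<Rightarrow> l2_op) star_alg" where
  "B_l2_product R =
     \<lparr>carrier = {a \<in> R \<rightarrow>\<^sub>E carrier B_l2. \<exists>K. \<forall>r\<in>R. l2_op_norm (a r) \<le> K},
      monoid.mult = (\<lambda>a b. \<lambda>r\<in>R. a r \<otimes>\<^bsub>B_l2\<^esub> b r),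
      one = (\<lambda>r\<in>R. \<one>\<^bsub>B_l2\<^esub>),
      zero = (\<lambda>r\<in>R. \<zero>\<^bsub>B_l2\<^esub>),
      add = (\<lambda>a b. \<lambda>r\<in>R. a r \<oplus>\<^bsub>B_l2\<^esub> b r),
      smult = (\<lambda>c a. \<lambda>r\<in>R. c \<odot>\<^bsub>B_l2\<^esub> a r),
      star = (\<lambda>a. \<lambda>r\<in>R. star B_l2 (a r))\<rparr>"

text \<open>Let \<open>R\<close> be the set of all families of operators on \<open>\<ell>\<^sup>2(\<nat>)\<close>, indexed by the set \<open>G\<close> of
  generators, that satisfy the defining relations. The universal \<open>C\<^sup>*\<close>-algebra is the
  \<open>C\<^sup>*\<close>-subalgebra of the product over \<open>R\<close> generated by the tautological families
  \<open>r \<mapsto> r g\<close>; its norm is the supremum over all representations. For countable \<open>G\<close> the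
  restriction to \<open>\<ell>\<^sup>2(\<nat>)\<close> is harmless: a \<open>C\<^sup>*\<close>-algebra generated by a family satisfying the
  relations is separable, hence (if nonzero) acts faithfully and unitally on \<open>\<ell>\<^sup>2(\<nat>)\<close>.\<close>

definition universal_gen :: "('g \<Rightarrow> l2_op) set \<Rightarrow> 'g \<Rightarrow> (('g \<Rightarrow> l2_op) \<Rightarrow> l2_op)" where
  "universal_gen R g = (\<lambda>r\<in>R. r g)"

definition universal_cstar ::
  "'g set \<Rightarrow> ('g \<Rightarrow> l2_op) set \<Rightarrow> (('g \<Rightarrow> l2_op) \<Rightarrow> l2_op) star_alg" where
  "universal_cstar G R = (B_l2_product R)
     \<lparr>carrier := {a \<in> carrier (B_l2_product R). \<forall>e>0.
        \<exists>b\<in>generated_star_alg (B_l2_product R) (universal_gen R ` G).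
          \<forall>r\<in>R. l2_op_norm (a r \<oplus>\<^bsub>B_l2\<^esub> (- 1) \<odot>\<^bsub>B_l2\<^esub> b r) \<le> e}\<rparr>"


section \<open>The quantum group \<open>SU\<^sub>q(3)\<close>\<close>

definition inversions3 :: "nat \<Rightarrow> nat \<Rightarrow> nat \<Rightarrow> nat" where
  "inversions3 i j k = of_bool (i > j) + of_bool (i > k) + of_bool (j > k)"

definition E_tensor :: "real \<Rightarrow> nat \<Rightarrow> nat \<Rightarrow> nat \<Rightarrow> complex" where
  "E_tensor q i j k =
     (if distinct [i, j, k] then (- complex_of_real q) ^ inversions3 i j k else 0)"

definition is_unitary_matrix ::
  "('a, 'm) star_alg_scheme \<Rightarrow> (nat \<Rightarrow> nat \<Rightarrow> 'a) \<Rightarrow> bool" where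
  "is_unitary_matrix A a \<longleftrightarrow>
     (\<forall>i\<in>{1..3}. \<forall>j\<in>{1..3}.
        (\<Oplus>\<^bsub>A\<^esub>k\<in>{1..3}. a i k \<otimes>\<^bsub>A\<^esub> star A (a j k)) = (if i = j then \<one>\<^bsub>A\<^esub> else \<zero>\<^bsub>A\<^esub>) \<and>
        (\<Oplus>\<^bsub>A\<^esub>k\<in>{1..3}. star A (a k i) \<otimes>\<^bsub>A\<^esub> a k j) = (if i = j then \<one>\<^bsub>A\<^esub> else \<zero>\<^bsub>A\<^esub>))"

definition SUq3_relations ::
  "real \<Rightarrow> ('a, 'm) star_alg_scheme \<Rightarrow> (nat \<Rightarrow> nat \<Rightarrow> 'a) \<Rightarrow> bool" where
  "SUq3_relations q A a \<longleftrightarrow>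
     (\<forall>i\<in>{1..3}. \<forall>j\<in>{1..3}. a i j \<in> carrier A) \<and>
     is_unitary_matrix A a \<and>
     (\<forall>j1\<in>{1..3}. \<forall>j2\<in>{1..3}. \<forall>j3\<in>{1..3}.
        (\<Oplus>\<^bsub>A\<^esub>i1\<in>{1..3}. \<Oplus>\<^bsub>A\<^esub>i2\<in>{1..3}. \<Oplus>\<^bsub>A\<^esub>i3\<in>{1..3}.
            E_tensor q i1 i2 i3 \<odot>\<^bsub>A\<^esub> (a j1 i1 \<otimes>\<^bsub>A\<^esub> a j2 i2 \<otimes>\<^bsub>A\<^esub> a j3 i3))
        = E_tensor q j1 j2 j3 \<odot>\<^bsub>A\<^esub> \<one>\<^bsub>A\<^esub>)"

type_synonym SUq3_elem = "(nat \<times> nat \<Rightarrow> l2_op) \<Rightarrow> l2_op"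

definition SUq3_reps :: "real \<Rightarrow> (nat \<times> nat \<Rightarrow> l2_op) set" where
  "SUq3_reps q = {r \<in> extensional ({1..3} \<times> {1..3}). SUq3_relations q B_l2 (curry r)}"

definition C_SUq3 :: "real \<Rightarrow> SUq3_elem star_alg" where
  "C_SUq3 q = universal_cstar ({1..3} \<times> {1..3}) (SUq3_reps q)"

definition u_SUq3 :: "real \<Rightarrow> nat \<Rightarrow> nat \<Rightarrow> SUq3_elem" where
  "u_SUq3 q i j = universal_gen (SUq3_reps q) (i, j)"

definition O_SUq3 :: "real \<Rightarrow> SUq3_elem hopf" where
  "O_SUq3 q = matrix_hopf
     ((C_SUq3 q)\<lparr>carrier :=
        generated_alg (C_SUq3 q) {u_SUq3 q i j |i j. i \<in> {1..3} \<and> j \<in> {1..3}}\<rparr>)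
     (u_SUq3 q)"


section \<open>\<open>*\<close>-algebras given by generators and relations, and \<open>U\<^sub>q(2)\<close>\<close>

datatype 'g star_term =
  Gen 'g | One | Add "'g star_term" "'g star_term" | Mult "'g star_term" "'g star_term" |
  Smult complex "'g star_term" | Star "'g star_term"

text \<open>The least congruence that contains the relations \<open>R\<close> and whose quotient is a unital
  \<open>*\<close>-algebra, with \<open>0\<close> represented by \<open>0 \<cdot> 1\<close>.\<close>

inductive pres_eq :: "('g star_term \<times> 'g star_term) set \<Rightarrow> 'g star_term \<Rightarrow> 'g star_term \<Rightarrow> bool"
  for R :: "('g star_term \<times> 'g star_term) set" where
  rel: "(x, y) \<in> R \<Longrightarrow> pres_eq R x y"
| refl: "pres_eq R x x"
| sym: "pres_eq R x y \<Longrightarrow> pres_eq R y x"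
| trans: "pres_eq R x y \<Longrightarrow> pres_eq R y z \<Longrightarrow> pres_eq R x z"
| cong_add: "pres_eq R x x' \<Longrightarrow> pres_eq R y y' \<Longrightarrow> pres_eq R (Add x y) (Add x' y')"
| cong_mult: "pres_eq R x x' \<Longrightarrow> pres_eq R y y' \<Longrightarrow> pres_eq R (Mult x y) (Mult x' y')"
| cong_smult: "pres_eq R x x' \<Longrightarrow> pres_eq R (Smult c x) (Smult c x')"
| cong_star: "pres_eq R x x' \<Longrightarrow> pres_eq R (Star x) (Star x')"
| add_assoc: "pres_eq R (Add (Add x y) z) (Add x (Add y z))"
| add_comm: "pres_eq R (Add x y) (Add y x)"
| add_zero: "pres_eq R (Add (Smult 0 One) x) x"
| add_inv: "pres_eq R (Add (Smult (- 1) x) x) (Smult 0 One)"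
| mult_assoc: "pres_eq R (Mult (Mult x y) z) (Mult x (Mult y z))"
| mult_one_left: "pres_eq R (Mult One x) x"
| mult_one_right: "pres_eq R (Mult x One) x"
| distrib_left: "pres_eq R (Mult x (Add y z)) (Add (Mult x y) (Mult x z))"
| distrib_right: "pres_eq R (Mult (Add x y) z) (Add (Mult x z) (Mult y z))"
| smult_add: "pres_eq R (Smult c (Add x y)) (Add (Smult c x) (Smult c y))"
| add_smult: "pres_eq R (Smult (c + d) x) (Add (Smult c x) (Smult d x))"
| smult_smult: "pres_eq R (Smult c (Smult d x)) (Smult (c * d) x)"
| smult_one: "pres_eq R (Smult 1 x) x"
| smult_mult_left: "pres_eq R (Mult (Smult c x) y) (Smult c (Mult x y))"
| smult_mult_right: "pres_eq R (Mult x (Smult c y)) (Smult c (Mult x y))"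
| star_star: "pres_eq R (Star (Star x)) x"
| star_add: "pres_eq R (Star (Add x y)) (Add (Star x) (Star y))"
| star_smult: "pres_eq R (Star (Smult c x)) (Smult (cnj c) (Star x))"
| star_mult: "pres_eq R (Star (Mult x y)) (Mult (Star y) (Star x))"

definition pres_class ::
  "('g star_term \<times> 'g star_term) set \<Rightarrow> 'g star_term \<Rightarrow> 'g star_term set" where
  "pres_class R x = {y. pres_eq R x y}"

definition presented_star_alg ::
  "('g star_term \<times> 'g star_term) set \<Rightarrow> 'g star_term set star_alg" where
  "presented_star_alg R =
     \<lparr>carrier = range (pres_class R),
      monoid.mult = (\<lambda>X Y. {z. \<exists>x\<in>X. \<exists>y\<in>Y. pres_eq R (Mult x y) z}),
      one = pres_class R One,
      zero = pres_class R (Smult 0 One),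
      add = (\<lambda>X Y. {z. \<exists>x\<in>X. \<exists>y\<in>Y. pres_eq R (Add x y) z}),
      smult = (\<lambda>c X. {z. \<exists>x\<in>X. pres_eq R (Smult c x) z}),
      star = (\<lambda>X. {z. \<exists>x\<in>X. pres_eq R (Star x) z})\<rparr>"

datatype Uq2_gen = Gen_u | Gen_alpha | Gen_gamma

abbreviation "t_u \<equiv> Gen Gen_u"
abbreviation "t_alpha \<equiv> Gen Gen_alpha"
abbreviation "t_gamma \<equiv> Gen Gen_gamma"

definition Uq2_relations :: "real \<Rightarrow> (Uq2_gen star_term \<times> Uq2_gen star_term) set" where
  "Uq2_relations q =
     {(Mult t_u x, Mult x t_u) |x. True} \<union>
     {(Mult t_u (Star t_u), One),
      (Mult (Star t_u) t_u, One),
      (Mult t_alpha t_gamma, Smult (complex_of_real q) (Mult t_gamma t_alpha)),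
      (Mult t_gamma (Star t_gamma), Mult (Star t_gamma) t_gamma),
      (Mult t_alpha (Star t_gamma), Smult (complex_of_real q) (Mult (Star t_gamma) t_alpha)),
      (Add (Mult (Star t_alpha) t_alpha) (Mult t_gamma (Star t_gamma)), One),
      (Add (Mult t_alpha (Star t_alpha))
           (Smult ((complex_of_real q)\<^sup>2) (Mult t_gamma (Star t_gamma))), One)}"

type_synonym Uq2_elem = "Uq2_gen star_term set"

definition Uq2_alg :: "real \<Rightarrow> Uq2_elem star_alg" where
  "Uq2_alg q = presented_star_alg (Uq2_relations q)"

definition gen_Uq2 :: "real \<Rightarrow> Uq2_gen \<Rightarrow> Uq2_elem" where
  "gen_Uq2 q g = pres_class (Uq2_relations q) (Gen g)"

definition v_Uq2 :: "real \<Rightarrow> nat \<Rightarrow> nat \<Rightarrow> Uq2_elem" where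
  "v_Uq2 q i j =
     (let A = Uq2_alg q; u = gen_Uq2 q Gen_u; \<alpha> = gen_Uq2 q Gen_alpha; \<gamma> = gen_Uq2 q Gen_gamma in
      if (i, j) = (1, 1) then u
      else if (i, j) = (2, 2) then \<alpha>
      else if (i, j) = (2, 3) then (- complex_of_real q) \<odot>\<^bsub>A\<^esub> (star A \<gamma> \<otimes>\<^bsub>A\<^esub> star A u)
      else if (i, j) = (3, 2) then \<gamma>
      else if (i, j) = (3, 3) then star A \<alpha> \<otimes>\<^bsub>A\<^esub> star A u
      else \<zero>\<^bsub>A\<^esub>)"

definition O_Uq2 :: "real \<Rightarrow> Uq2_elem hopf" where
  "O_Uq2 q = matrix_hopf (Uq2_alg q) (v_Uq2 q)"


section \<open>The torus\<close>

text \<open>A Laurent polynomial is a finitely supported function on \<open>\<int>\<^sup>2\<close>; the product of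
  \<^typ>\<open>(int \<times> int) \<Rightarrow>\<^sub>0 complex\<close> is convolution.\<close>

type_synonym laurent2 = "(int \<times> int) \<Rightarrow>\<^sub>0 complex"

definition torus_alg :: "laurent2 star_alg" where
  "torus_alg =
     \<lparr>carrier = UNIV, monoid.mult = (*), one = 1, zero = 0, add = (+),
      smult = (\<lambda>c p. Poly_Mapping.map ((*) c) p),
      star = (\<lambda>p. Poly_Mapping.map_key uminus (Poly_Mapping.map cnj p))\<rparr>"

definition U_monom :: "int \<times> int \<Rightarrow> laurent2" where
  "U_monom d = Poly_Mapping.single d 1"

definition O_T2 :: "laurent2 hopf" where
  "O_T2 = make_hopf torus_alg
     (\<lambda>p. \<Oplus>\<^bsub>tensor_alg torus_alg torus_alg\<^esub>d\<in>Poly_Mapping.keys p.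
        Poly_Mapping.lookup p d \<odot>\<^bsub>tensor_alg torus_alg torus_alg\<^esub>
          pure_tensor torus_alg torus_alg (U_monom d) (U_monom d))
     (\<lambda>p. \<Sum>d\<in>Poly_Mapping.keys p. Poly_Mapping.lookup p d)
     (\<lambda>p. Poly_Mapping.map_key uminus p)"

definition diag_T2 :: "nat \<Rightarrow> nat \<Rightarrow> laurent2" where
  "diag_T2 i j =
     (let U1 = U_monom (1, 0); U2 = U_monom (0, 1) in
      if i \<noteq> j then 0
      else if i = 1 then U1
      else if i = 2 then U2
      else star torus_alg U1 * star torus_alg U2)"


section \<open>Gradings\<close>

text \<open>\<open>(x, d) \<in> homogeneous A X\<close> means that \<open>x\<close> lies in the degree-\<open>d\<close> component of the
  \<open>\<int>\<^sup>2\<close>-grading of \<open>A\<close> determined by the degrees \<open>X\<close> assigned to generators.\<close>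

inductive_set homogeneous ::
  "('a, 'm) star_alg_scheme \<Rightarrow> ('a \<times> (int \<times> int)) set \<Rightarrow> ('a \<times> (int \<times> int)) set"
  for A :: "('a, 'm) star_alg_scheme" and X :: "('a \<times> (int \<times> int)) set" where
  gen: "(x, d) \<in> X \<Longrightarrow> (x, d) \<in> homogeneous A X"
| one: "(\<one>\<^bsub>A\<^esub>, (0, 0)) \<in> homogeneous A X"
| zero: "(\<zero>\<^bsub>A\<^esub>, d) \<in> homogeneous A X"
| mult: "(x, d) \<in> homogeneous A X \<Longrightarrow> (y, e) \<in> homogeneous A X \<Longrightarrow>
    (x \<otimes>\<^bsub>A\<^esub> y, d + e) \<in> homogeneous A X"
| add: "(x, d) \<in> homogeneous A X \<Longrightarrow> (y, d) \<in> homogeneous A X \<Longrightarrow>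
    (x \<oplus>\<^bsub>A\<^esub> y, d) \<in> homogeneous A X"
| smult: "(x, d) \<in> homogeneous A X \<Longrightarrow> (c \<odot>\<^bsub>A\<^esub> x, d) \<in> homogeneous A X"

definition column_degree :: "nat \<Rightarrow> int \<times> int" where
  "column_degree j = (if j = 1 then (1, 0) else if j = 2 then (0, 1) else (- 1, - 1))"

definition graded_SUq3 :: "real \<Rightarrow> (SUq3_elem \<times> (int \<times> int)) set" where
  "graded_SUq3 q = homogeneous (O_SUq3 q)
     {(u_SUq3 q i j, column_degree j) |i j. i \<in> {1..3} \<and> j \<in> {1..3}}"

fun degree_Uq2 :: "Uq2_gen \<Rightarrow> int \<times> int" where
  "degree_Uq2 Gen_u = (1, 0)"
| "degree_Uq2 Gen_alpha = (0, 1)"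
| "degree_Uq2 Gen_gamma = (0, 1)"

definition graded_Uq2 :: "real \<Rightarrow> (Uq2_elem \<times> (int \<times> int)) set" where
  "graded_Uq2 q = homogeneous (O_Uq2 q)
     ({(gen_Uq2 q g, degree_Uq2 g) |g. True} \<union>
      {(star (O_Uq2 q) (gen_Uq2 q g), - degree_Uq2 g) |g. True})"

definition compatible_with_gradings :: "real \<Rightarrow> (SUq3_elem \<Rightarrow> Uq2_elem) \<Rightarrow> bool" where
  "compatible_with_gradings q f \<longleftrightarrow>
     (\<forall>x d. (x, d) \<in> graded_SUq3 q \<longrightarrow> (f x, d) \<in> graded_Uq2 q)"


section \<open>The maps \<open>\<pi>\<close>, \<open>\<pi>\<^sub>0\<close> and \<open>\<pi>\<^sub>1\<close>\<close>

definition pi_map :: "real \<Rightarrow> SUq3_elem \<Rightarrow> Uq2_elem" where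
  "pi_map q = matrix_star_map (O_SUq3 q) (O_Uq2 q) (u_SUq3 q) (v_Uq2 q)"

definition pi0_hat :: "real \<Rightarrow> SUq3_elem \<Rightarrow> laurent2" where
  "pi0_hat q = matrix_star_map (O_SUq3 q) O_T2 (u_SUq3 q) diag_T2"

definition pi1_hat :: "real \<Rightarrow> Uq2_elem \<Rightarrow> laurent2" where
  "pi1_hat q = matrix_star_map (O_Uq2 q) O_T2 (v_Uq2 q) diag_T2"

end

theory Submission
  imports Defs "HOL-Analysis.Infinite_Sum"
begin

text \<open>Both algebras are generated by the entries of their fundamental matrix, so all maps are determined
  there, and everything reduces to existence. Call a \<open>*\<close>-algebra residual if its representations on
  \<open>\<ell>\<^sup>2(\<nat>)\<close> separate points. A polynomial relation that holds in all \<open>\<ell>\<^sup>2\<close>-representations of the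
  \<open>SU\<^sub>q(3)\<close>-relations holds for every solution in a residual algebra; hence \<open>\<O>(SU\<^sub>q(3))\<close> is universal with
  respect to residual targets. Residual algebras are stable under tensor products and opposites, and
  \<open>\<O>(U\<^sub>q(2))\<close> and \<open>\<O>(\<T>\<^sup>2)\<close> are residual: the matrix coefficients of a spanning set of monomials
  \<open>\<gamma>\<^sup>b \<gamma>\<^sup>*\<^sup>c u\<^sup>k \<alpha>\<^sup>a\<close> in the representations on \<open>\<ell>\<^sup>2\<close> are, up to nonzero factors, distinct characters of a
  semigroup. This gives \<open>\<Delta>\<close>, \<open>\<pi>\<close>, \<open>\<pi>\<^sub>0\<close> and the unitary antipode; the antipode itself is not a
  \<open>*\<close>-map and is obtained from the latter by rescaling with the nonunimodular points of the torus.
  On the side of \<open>U\<^sub>q(2)\<close> a solution whose matrix is block diagonal gives a solution of the relations of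
  \<open>u, \<alpha>, \<gamma>\<close>, so \<open>\<O>(U\<^sub>q(2))\<close> is the quotient of \<open>\<O>(SU\<^sub>q(3))\<close> by the entries outside the diagonal blocks.

  The degree \<open>d\<close> part of \<open>\<O>(U\<^sub>q(2))\<close> is the set of \<open>y\<close> with \<open>(id \<otimes> \<pi>\<^sub>1) \<Delta> y = y \<otimes> U\<^sup>d\<close>. For a Hopf
  \<open>*\<close>-homomorphism \<open>f\<close> one has \<open>(id \<otimes> \<pi>\<^sub>1) \<Delta> f = (f \<otimes> \<pi>\<^sub>1 f) \<Delta>\<close>, so \<open>f\<close> preserves degrees if \<open>\<pi>\<^sub>1 f = \<pi>\<^sub>0\<close>;
  conversely, applying \<open>\<epsilon> \<otimes> id\<close> recovers \<open>\<pi>\<^sub>1 f\<close> on the generators from their degrees.\<close>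

section \<open>Star algebras\<close>

text \<open>An element of O(SU_q(3)) is a family of operators indexed by representations, whereas an
  element of O(U_q(2)) is a class of formal terms. A map out of the former exists once equality in
  the target is visible in representations; for a target made of terms this is the analytic core. A
  spanning set is enough there, because a combination killed by all representations turns out to
  have zero coefficients. The determinant relation does the algebraic work. Solved for one factor it
  writes starred entries as quadratic polynomials, so the algebra generated by the entries is closed
  under \<open>star\<close>; solved for all three factors it yields its own transpose. The tensor
  \<open>E\<close> is not cyclically invariant, and this defect makes the adjoint matrix unitary in
  the opposite algebra only after conjugation by a diagonal of powers of q. The conjugated matrix is
  a solution there, which is the origin of the factor q^(j-i) in the unitary antipode.\<close>

lemma complex_alg_simps [simp]:
  "carrier complex_alg = UNIV" "monoid.mult complex_alg = (*)" "one complex_alg = 1"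
  "zero complex_alg = 0" "add complex_alg = (+)" "smult complex_alg = (*)" "star complex_alg = cnj"
  by (simp_all add: complex_alg_def)

lemma cring_complex_alg: "cring complex_alg"
proof (rule cringI)
  show "abelian_group complex_alg"
    by (rule abelian_groupI) (auto intro: exI [of _ "- x" for x :: complex] simp: add_eq_0_iff2)
  show "comm_monoid complex_alg"
    by (rule comm_monoidI) auto
qed (auto simp: algebra_simps)

text \<open>The additive inverse is taken to be \<open>(- 1) \<odot> x\<close>, so every axiom is an
  equation between the given operations or a closure property. The equations have the shape of the
  rules of \<open>pres_eq\<close>, and all algebras below are verified through this rule.\<close>

lemma star_algebraI:
  fixes A :: "('a, 'm) star_alg_scheme" (structure)
  assumes zero: "\<zero> \<in> carrier A" and one: "\<one> \<in> carrier A"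
    and add: "\<And>x y. x \<in> carrier A \<Longrightarrow> y \<in> carrier A \<Longrightarrow> x \<oplus> y \<in> carrier A"
    and mult: "\<And>x y. x \<in> carrier A \<Longrightarrow> y \<in> carrier A \<Longrightarrow> x \<otimes> y \<in> carrier A"
    and smult: "\<And>c x. x \<in> carrier A \<Longrightarrow> c \<odot> x \<in> carrier A"
    and star: "\<And>x. x \<in> carrier A \<Longrightarrow> star A x \<in> carrier A"
    and add_assoc: "\<And>x y z. x \<in> carrier A \<Longrightarrow> y \<in> carrier A \<Longrightarrow> z \<in> carrier A \<Longrightarrow>
          (x \<oplus> y) \<oplus> z = x \<oplus> (y \<oplus> z)"
    and add_comm: "\<And>x y. x \<in> carrier A \<Longrightarrow> y \<in> carrier A \<Longrightarrow> x \<oplus> y = y \<oplus> x"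
    and add_zero: "\<And>x. x \<in> carrier A \<Longrightarrow> \<zero> \<oplus> x = x"
    and add_inv: "\<And>x. x \<in> carrier A \<Longrightarrow> (- 1) \<odot> x \<oplus> x = \<zero>"
    and mult_assoc: "\<And>x y z. x \<in> carrier A \<Longrightarrow> y \<in> carrier A \<Longrightarrow> z \<in> carrier A \<Longrightarrow>
          (x \<otimes> y) \<otimes> z = x \<otimes> (y \<otimes> z)"
    and one_left: "\<And>x. x \<in> carrier A \<Longrightarrow> \<one> \<otimes> x = x"
    and one_right: "\<And>x. x \<in> carrier A \<Longrightarrow> x \<otimes> \<one> = x"
    and distr_left: "\<And>x y z. x \<in> carrier A \<Longrightarrow> y \<in> carrier A \<Longrightarrow> z \<in> carrier A \<Longrightarrow>
          (x \<oplus> y) \<otimes> z = x \<otimes> z \<oplus> y \<otimes> z"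
    and distr_right: "\<And>x y z. x \<in> carrier A \<Longrightarrow> y \<in> carrier A \<Longrightarrow> z \<in> carrier A \<Longrightarrow>
          z \<otimes> (x \<oplus> y) = z \<otimes> x \<oplus> z \<otimes> y"
    and smult_add: "\<And>c x y. x \<in> carrier A \<Longrightarrow> y \<in> carrier A \<Longrightarrow> c \<odot> (x \<oplus> y) = c \<odot> x \<oplus> c \<odot> y"
    and add_smult: "\<And>c d x. x \<in> carrier A \<Longrightarrow> (c + d) \<odot> x = c \<odot> x \<oplus> d \<odot> x"
    and smult_smult: "\<And>c d x. x \<in> carrier A \<Longrightarrow> (c * d) \<odot> x = c \<odot> (d \<odot> x)"
    and smult_one: "\<And>x. x \<in> carrier A \<Longrightarrow> 1 \<odot> x = x"
    and smult_mult_left: "\<And>c x y. x \<in> carrier A \<Longrightarrow> y \<in> carrier A \<Longrightarrow> (c \<odot> x) \<otimes> y = c \<odot> (x \<otimes> y)"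
    and smult_mult_right: "\<And>c x y. x \<in> carrier A \<Longrightarrow> y \<in> carrier A \<Longrightarrow> x \<otimes> (c \<odot> y) = c \<odot> (x \<otimes> y)"
    and star_star: "\<And>x. x \<in> carrier A \<Longrightarrow> star A (star A x) = x"
    and star_add: "\<And>x y. x \<in> carrier A \<Longrightarrow> y \<in> carrier A \<Longrightarrow> star A (x \<oplus> y) = star A x \<oplus> star A y"
    and star_smult: "\<And>c x. x \<in> carrier A \<Longrightarrow> star A (c \<odot> x) = cnj c \<odot> star A x"
    and star_mult: "\<And>x y. x \<in> carrier A \<Longrightarrow> y \<in> carrier A \<Longrightarrow> star A (x \<otimes> y) = star A y \<otimes> star A x"
  shows "star_algebra A"
proof -
  have ab: "abelian_group A"
    by (rule abelian_groupI) (auto simp: zero add add_assoc add_zero intro: add_comm add_inv smult)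
  have "monoid A" by (rule monoidI) (auto simp: assms)
  then have "ring A" by (intro ringI ab) (auto simp: assms)
  moreover have "module complex_alg A"
    by (rule moduleI [OF cring_complex_alg ab]) (auto simp: assms)
  ultimately show ?thesis
    by (intro star_algebra.intro star_algebra_axioms.intro) (auto simp: assms)
qed

context star_algebra begin

lemma scal_closed [simp, intro]: "x \<in> carrier A \<Longrightarrow> c \<odot> x \<in> carrier A"
  using smult_closed by simp

lemma scal_add: "x \<in> carrier A \<Longrightarrow> y \<in> carrier A \<Longrightarrow> c \<odot> (x \<oplus> y) = c \<odot> x \<oplus> c \<odot> y"
  using smult_r_distr by simp

lemma add_scal: "x \<in> carrier A \<Longrightarrow> (c + d) \<odot> x = c \<odot> x \<oplus> d \<odot> x"
  using smult_l_distr [of c d x] by simp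

lemma scal_scal [simp]: "x \<in> carrier A \<Longrightarrow> c \<odot> (d \<odot> x) = (c * d) \<odot> x"
  using smult_assoc1 [of c d x] by simp

lemma one_scal [simp]: "x \<in> carrier A \<Longrightarrow> 1 \<odot> x = x"
  using smult_one [of x] by simp

lemma zero_scal [simp]: "x \<in> carrier A \<Longrightarrow> 0 \<odot> x = \<zero>"
  using smult_l_null [of x] by simp

lemma scal_zero [simp]: "c \<odot> \<zero> = \<zero>"
  using smult_r_null [of c] by simp

lemma uminus_scal: "x \<in> carrier A \<Longrightarrow> \<ominus> x = (- 1) \<odot> x"
  using add_scal [of x "-1" 1] by (simp add: minus_equality)

lemma minus_scal_cancel: "x \<in> carrier A \<Longrightarrow> x \<oplus> (- 1) \<odot> x = \<zero>"
  by (simp add: uminus_scal [symmetric] r_neg)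

lemmas scal_mult = smult_mult_left smult_mult_right

lemma scal_cancel: "x \<in> carrier A \<Longrightarrow> y \<in> carrier A \<Longrightarrow> c \<noteq> 0 \<Longrightarrow> c \<odot> x = c \<odot> y \<Longrightarrow> x = y"
  by (metis one_scal scal_scal left_inverse)

declare star_closed [simp, intro] star_star [simp]

lemma star_one [simp]: "star A \<one> = \<one>"
proof -
  have "star A \<one> = star A \<one> \<otimes> \<one>" by simp
  also have "\<dots> = star A (star A \<one> \<otimes> \<one>)"
    by (simp only: star_mult star_closed one_closed star_star)
  also have "\<dots> = \<one>" by simp
  finally show ?thesis .
qed

lemma star_zero [simp]: "star A \<zero> = \<zero>"
  by (metis star_smult complex_cnj_zero zero_scal one_closed star_closed)

lemma finsum_cl [simp, intro]: "(\<And>i. i \<in> S \<Longrightarrow> f i \<in> carrier A) \<Longrightarrow> finsum A f S \<in> carrier A"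
  by (rule finsum_closed) auto

lemma finsum_scal: "f \<in> S \<rightarrow> carrier A \<Longrightarrow> c \<odot> finsum A f S = finsum A (\<lambda>i. c \<odot> f i) S"
  by (induction S rule: infinite_finite_induct) (auto simp: scal_add Pi_iff)

lemma finsum_star: "f \<in> S \<rightarrow> carrier A \<Longrightarrow> star A (finsum A f S) = finsum A (\<lambda>i. star A (f i)) S"
  by (induction S rule: infinite_finite_induct) (auto simp: star_add Pi_iff)

lemma finsum_mult_right:
  "f \<in> S \<rightarrow> carrier A \<Longrightarrow> a \<in> carrier A \<Longrightarrow> finsum A f S \<otimes> a = finsum A (\<lambda>i. f i \<otimes> a) S"
  by (induction S rule: infinite_finite_induct) (auto simp: l_distr Pi_iff)

lemma finsum_mult_left:
  "f \<in> S \<rightarrow> carrier A \<Longrightarrow> a \<in> carrier A \<Longrightarrow> a \<otimes> finsum A f S = finsum A (\<lambda>i. a \<otimes> f i) S"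
  by (induction S rule: infinite_finite_induct) (auto simp: r_distr Pi_iff)

lemma finsum_swap:
  assumes "finite T" "\<And>i j. i \<in> S \<Longrightarrow> j \<in> T \<Longrightarrow> f i j \<in> carrier A"
  shows "(\<Oplus>i\<in>S. \<Oplus>j\<in>T. f i j) = (\<Oplus>j\<in>T. \<Oplus>i\<in>S. f i j)"
proof (cases "finite S")
  case True
  then show ?thesis using assms(2)
  proof (induction S)
    case (insert i S)
    have "(\<Oplus>i\<in>insert i S. \<Oplus>j\<in>T. f i j) = (\<Oplus>j\<in>T. f i j) \<oplus> (\<Oplus>i\<in>S. \<Oplus>j\<in>T. f i j)"
      using insert by (intro finsum_insert) auto
    also have "\<dots> = (\<Oplus>j\<in>T. f i j) \<oplus> (\<Oplus>j\<in>T. \<Oplus>i\<in>S. f i j)"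
      using insert by simp
    also have "\<dots> = (\<Oplus>j\<in>T. f i j \<oplus> (\<Oplus>i\<in>S. f i j))"
      using insert by (intro finsum_addf [symmetric]) auto
    also have "\<dots> = (\<Oplus>j\<in>T. \<Oplus>i\<in>insert i S. f i j)"
      using insert by (intro finsum_cong' finsum_insert [symmetric]) auto
    finally show ?case .
  qed (simp add: finsum_zero)
qed (simp add: finsum_infinite finsum_zero)

lemma finsum_delta:
  assumes "finite S" "i \<in> S" "\<And>j. j \<in> S \<Longrightarrow> f j \<in> carrier A" "\<And>j. j \<in> S \<Longrightarrow> j \<noteq> i \<Longrightarrow> f j = \<zero>"
  shows "finsum A f S = f i"
proof -
  have "finsum A f S = (\<Oplus>j\<in>S. if i = j then f j else \<zero>)"
    using assms by (intro finsum_cong') auto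
  also have "\<dots> = f i" using assms by (subst finsum_singleton) auto
  finally show ?thesis .
qed

lemma finsum_three:
  assumes "f \<in> {1..3::nat} \<rightarrow> carrier A"
  shows "(\<Oplus>i\<in>{1..3}. f i) = f 1 \<oplus> f 2 \<oplus> f 3"
proof -
  have "{1..3::nat} = {1,2,3}" by auto
  with assms show ?thesis by (simp add: a_assoc Pi_iff)
qed

end

lemma alg_homD:
  assumes "alg_hom A B f"
  shows "x \<in> carrier A \<Longrightarrow> f x \<in> carrier B"
    "x \<in> carrier A \<Longrightarrow> y \<in> carrier A \<Longrightarrow> f (x \<otimes>\<^bsub>A\<^esub> y) = f x \<otimes>\<^bsub>B\<^esub> f y"
    "x \<in> carrier A \<Longrightarrow> y \<in> carrier A \<Longrightarrow> f (x \<oplus>\<^bsub>A\<^esub> y) = f x \<oplus>\<^bsub>B\<^esub> f y"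
    "x \<in> carrier A \<Longrightarrow> f (c \<odot>\<^bsub>A\<^esub> x) = c \<odot>\<^bsub>B\<^esub> f x"
    "f \<one>\<^bsub>A\<^esub> = \<one>\<^bsub>B\<^esub>"
  using assms by (auto simp: alg_hom_def ring_hom_def linear_map_def Pi_iff)

lemma alg_homI:
  assumes "\<And>x. x \<in> carrier A \<Longrightarrow> f x \<in> carrier B"
    "\<And>x y. x \<in> carrier A \<Longrightarrow> y \<in> carrier A \<Longrightarrow> f (x \<otimes>\<^bsub>A\<^esub> y) = f x \<otimes>\<^bsub>B\<^esub> f y"
    "\<And>x y. x \<in> carrier A \<Longrightarrow> y \<in> carrier A \<Longrightarrow> f (x \<oplus>\<^bsub>A\<^esub> y) = f x \<oplus>\<^bsub>B\<^esub> f y"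
    "\<And>c x. x \<in> carrier A \<Longrightarrow> f (c \<odot>\<^bsub>A\<^esub> x) = c \<odot>\<^bsub>B\<^esub> f x"
    "f \<one>\<^bsub>A\<^esub> = \<one>\<^bsub>B\<^esub>"
  shows "alg_hom A B f"
  using assms by (auto simp: alg_hom_def ring_hom_def linear_map_def Pi_iff)

lemma linear_mapI:
  assumes "\<And>x. x \<in> carrier A \<Longrightarrow> f x \<in> carrier B"
    "\<And>x y. x \<in> carrier A \<Longrightarrow> y \<in> carrier A \<Longrightarrow> f (x \<oplus>\<^bsub>A\<^esub> y) = f x \<oplus>\<^bsub>B\<^esub> f y"
    "\<And>c x. x \<in> carrier A \<Longrightarrow> f (c \<odot>\<^bsub>A\<^esub> x) = c \<odot>\<^bsub>B\<^esub> f x"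
  shows "linear_map A B f"
  using assms by (auto simp: linear_map_def Pi_iff)

lemma linear_mapD:
  assumes "linear_map A B f"
  shows "x \<in> carrier A \<Longrightarrow> f x \<in> carrier B"
    "x \<in> carrier A \<Longrightarrow> y \<in> carrier A \<Longrightarrow> f (x \<oplus>\<^bsub>A\<^esub> y) = f x \<oplus>\<^bsub>B\<^esub> f y"
    "x \<in> carrier A \<Longrightarrow> f (c \<odot>\<^bsub>A\<^esub> x) = c \<odot>\<^bsub>B\<^esub> f x"
  using assms by (auto simp: linear_map_def Pi_iff)

lemma alg_hom_linear: "alg_hom A B f \<Longrightarrow> linear_map A B f"
  by (simp add: alg_hom_def)

lemma star_hom_alg: "star_hom A B f \<Longrightarrow> alg_hom A B f"
  by (simp add: star_hom_def)

lemma star_homD: "star_hom A B f \<Longrightarrow> x \<in> carrier A \<Longrightarrow> f (star A x) = star B (f x)"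
  by (simp add: star_hom_def)

lemma linear_map_zero:
  assumes "linear_map A B f" "star_algebra A" "star_algebra B"
  shows "f \<zero>\<^bsub>A\<^esub> = \<zero>\<^bsub>B\<^esub>"
proof -
  interpret A: star_algebra A by fact
  interpret B: star_algebra B by fact
  have "f (0 \<odot>\<^bsub>A\<^esub> \<zero>\<^bsub>A\<^esub>) = 0 \<odot>\<^bsub>B\<^esub> f \<zero>\<^bsub>A\<^esub>" by (rule linear_mapD(3) [OF assms(1)]) simp
  then show ?thesis using linear_mapD(1) [OF assms(1)] by simp
qed

lemma linear_map_finsum:
  assumes "linear_map A B f" "star_algebra A" "star_algebra B" "g \<in> S \<rightarrow> carrier A"
  shows "f (finsum A g S) = finsum B (\<lambda>i. f (g i)) S"
proof -
  interpret A: star_algebra A by fact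
  interpret B: star_algebra B by fact
  show ?thesis using assms(4)
    by (induction S rule: infinite_finite_induct)
      (auto simp: linear_map_zero [OF assms(1-3)] linear_mapD [OF assms(1)] Pi_iff)
qed

lemma linear_map_compose:
  "linear_map A B f \<Longrightarrow> linear_map B C g \<Longrightarrow> linear_map A C (\<lambda>x. g (f x))"
  by (auto simp: linear_map_def Pi_iff)

lemma alg_hom_compose: "alg_hom A B f \<Longrightarrow> alg_hom B C g \<Longrightarrow> alg_hom A C (\<lambda>x. g (f x))"
  by (rule alg_homI) (auto simp: alg_homD)

lemma star_hom_compose: "star_hom A B f \<Longrightarrow> star_hom B C g \<Longrightarrow> star_hom A C (\<lambda>x. g (f x))"
  by (auto simp: star_hom_def alg_homD intro: alg_hom_compose)

lemma star_hom_id: "star_hom A A (\<lambda>x. x)"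
  by (auto simp: star_hom_def intro: alg_homI)

lemma (in star_algebra) alg_hom_restrict:
  "alg_hom A B f \<Longrightarrow> alg_hom A B (restrict f (carrier A))"
  by (intro alg_homI) (auto simp: alg_homD)

lemma (in star_algebra) star_hom_restrict:
  "star_hom A B f \<Longrightarrow> star_hom A B (restrict f (carrier A))"
  by (auto simp: star_hom_def intro: alg_hom_restrict)

lemma star_algebra_complex: "star_algebra complex_alg"
  by (rule star_algebraI) (auto simp: algebra_simps)

lemma opposite_simps [simp]:
  "carrier (opposite A) = carrier A" "x \<otimes>\<^bsub>opposite A\<^esub> y = y \<otimes>\<^bsub>A\<^esub> x" "one (opposite A) = one A"
  "zero (opposite A) = zero A" "add (opposite A) = add A" "smult (opposite A) = smult A"
  "star (opposite A) = star A"
  by (simp_all add: opposite_def)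

lemma finsum_opposite [simp]: "finsum (opposite A) f S = finsum A f S"
  by (simp add: finsum_def finprod_def opposite_def)

lemma star_algebra_opposite:
  assumes "star_algebra A"
  shows "star_algebra (opposite A)"
proof -
  interpret star_algebra A by fact
  show ?thesis
    by (rule star_algebraI)
      (auto simp: a_ac m_assoc l_distr r_distr scal_add add_scal scal_mult
         star_add star_smult star_mult uminus_scal [symmetric] l_neg r_neg)
qed

section \<open>Generated subalgebras and homomorphisms determined on generators\<close>

context star_algebra begin

lemma generated_subset:
  assumes "X \<subseteq> carrier A" "x \<in> generated_alg A X"
  shows "x \<in> carrier A"
  using assms(2) by induction (use assms(1) in auto)

lemma generated_zero: "\<zero> \<in> generated_alg A X"
  using generated_alg.smult [OF generated_alg.one, of A 0 X] by simp

lemma generated_finsum: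
  assumes "X \<subseteq> carrier A" "\<And>i. i \<in> S \<Longrightarrow> f i \<in> generated_alg A X"
  shows "finsum A f S \<in> generated_alg A X"
  using assms(2)
proof (induction S rule: infinite_finite_induct)
  case (insert i S)
  then have "finsum A f (insert i S) = f i \<oplus> finsum A f S"
    by (intro finsum_insert) (auto intro: generated_subset [OF assms(1)])
  with insert show ?case by (auto intro: generated_alg.add)
qed (auto simp: generated_zero)

text \<open>\<open>generated_alg\<close> has no rule for \<open>star\<close>. Since
  \<open>star\<close> reverses products, it suffices that the adjoints of the generators are again
  generated.\<close>

lemma star_algebra_generated:
  assumes "X \<subseteq> carrier A" "star A ` X \<subseteq> generated_alg A X"
  shows "star_algebra (A\<lparr>carrier := generated_alg A X\<rparr>)"
proof -
  have st: "star A x \<in> generated_alg A X" if "x \<in> generated_alg A X" for x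
    using that
  proof induction
    case (incl x)
    then show ?case using assms(2) by auto
  next
    case (mult x y)
    then show ?case
      by (simp add: star_mult generated_subset [OF assms(1)] generated_alg.mult)
  qed (auto simp: star_add star_smult generated_subset [OF assms(1)] intro: generated_alg.intros)
  show ?thesis
    by (rule star_algebraI)
      (use generated_subset [OF assms(1)] in \<open>auto simp: a_ac m_assoc l_distr r_distr scal_add
         add_scal scal_mult generated_zero star_add star_smult star_mult
         uminus_scal [symmetric] l_neg r_neg st intro: generated_alg.intros\<close>)
qed

end

lemma alg_hom_eq_on_generated:
  assumes "star_algebra A" "alg_hom A B f" "alg_hom A B g" "X \<subseteq> carrier A" "\<And>x. x \<in> X \<Longrightarrow> f x = g x"
    and y: "y \<in> generated_alg A X"
  shows "f y = g y"
proof -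
  interpret star_algebra A by fact
  note sub = generated_subset [OF assms(4)]
  show ?thesis using y
    by induction (auto simp: assms(5) sub alg_homD [OF assms(2)] alg_homD [OF assms(3)])
qed

lemma alg_hom_surj:
  assumes "star_algebra A" "alg_hom A B f" "X \<subseteq> carrier A" "Y \<subseteq> f ` carrier A" 
    and y: "y \<in> generated_alg B Y"
  shows "y \<in> f ` carrier A"
proof -
  interpret star_algebra A by fact
  show ?thesis using y
  proof induction
    case one
    show ?case using alg_homD(5) [OF assms(2)] by (metis image_eqI one_closed)
  next
    case (add x y)
    then obtain a b where "a \<in> carrier A" "b \<in> carrier A" "x = f a" "y = f b" by auto
    then show ?case
      by (intro image_eqI [of _ _ "a \<oplus>\<^bsub>A\<^esub> b"]) (auto simp: alg_homD [OF assms(2)])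
  next
    case (mult x y)
    then obtain a b where "a \<in> carrier A" "b \<in> carrier A" "x = f a" "y = f b" by auto
    then show ?case
      by (intro image_eqI [of _ _ "a \<otimes>\<^bsub>A\<^esub> b"]) (auto simp: alg_homD [OF assms(2)])
  next
    case (smult x c)
    then obtain a where "a \<in> carrier A" "x = f a" by auto
    then show ?case
      by (intro image_eqI [of _ _ "c \<odot>\<^bsub>A\<^esub> a"]) (auto simp: alg_homD [OF assms(2)])
  qed (use assms(4) in auto)
qed

section \<open>Star polynomials and their evaluation\<close>

primrec term_eval :: "('a, 'm) star_alg_scheme \<Rightarrow> ('g \<Rightarrow> 'a) \<Rightarrow> 'g star_term \<Rightarrow> 'a" where
  "term_eval A g (Gen x) = g x"
| "term_eval A g One = \<one>\<^bsub>A\<^esub>"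
| "term_eval A g (Add s t) = term_eval A g s \<oplus>\<^bsub>A\<^esub> term_eval A g t"
| "term_eval A g (Mult s t) = term_eval A g s \<otimes>\<^bsub>A\<^esub> term_eval A g t"
| "term_eval A g (Smult c t) = c \<odot>\<^bsub>A\<^esub> term_eval A g t"
| "term_eval A g (Star t) = star A (term_eval A g t)"

lemma (in star_algebra) term_eval_closed:
  "range g \<subseteq> carrier A \<Longrightarrow> term_eval A g t \<in> carrier A"
  by (induction t) auto

lemma star_hom_term_eval:
  assumes "star_algebra A" "star_hom A B f" "range g \<subseteq> carrier A"
  shows "f (term_eval A g t) = term_eval B (\<lambda>x. f (g x)) t"
proof -
  interpret star_algebra A by fact
  note [simp] = term_eval_closed [OF assms(3)] alg_homD [OF star_hom_alg [OF assms(2)]]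
    star_homD [OF assms(2)]
  show ?thesis by (induction t) auto
qed

lemma generated_term_eval:
  assumes "x \<in> generated_alg A (range g)"
  shows "\<exists>t. x = term_eval A g t"
  using assms
proof induction
  case (incl x)
  then show ?case by (metis imageE term_eval.simps(1))
qed (metis term_eval.simps)+

text \<open>The map sends the value of a term in \<open>A\<close> to its value in \<open>B\<close>.
  The premise \<open>eq\<close> makes this independent of the chosen term, and the homomorphism laws
  hold because every operation is a term constructor. Both universal properties, of O(SU_q(3)) and
  of presented algebras, are instances.\<close>

lemma star_hom_from_terms:
  assumes A: "star_algebra A" and B: "star_algebra B"
    and g: "range g \<subseteq> carrier A" and h: "range h \<subseteq> carrier B"
    and surj: "\<And>x. x \<in> carrier A \<Longrightarrow> \<exists>t. x = term_eval A g t"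
    and eq: "\<And>s t. term_eval A g s = term_eval A g t \<Longrightarrow> term_eval B h s = term_eval B h t"
  shows "\<exists>f. star_hom A B f \<and> (\<forall>x. f (g x) = h x)"
proof -
  interpret A: star_algebra A by fact
  interpret B: star_algebra B by fact
  define f where "f x = term_eval B h (SOME t. term_eval A g t = x)" for x
  have f: "f (term_eval A g t) = term_eval B h t" for t
  proof -
    have "term_eval A g (SOME t'. term_eval A g t' = term_eval A g t) = term_eval A g t"
      by (rule someI_ex) blast
    then show ?thesis unfolding f_def by (rule eq)
  qed
  have "star_hom A B f"
    unfolding star_hom_def
  proof (intro conjI alg_homI ballI)
    fix x y c assume "x \<in> carrier A" "y \<in> carrier A"
    then obtain s t where st: "x = term_eval A g s" "y = term_eval A g t" using surj by blast
    show "f x \<in> carrier B" using st f B.term_eval_closed [OF h] by simp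
    show "f (x \<otimes>\<^bsub>A\<^esub> y) = f x \<otimes>\<^bsub>B\<^esub> f y"
      using f [of s] f [of t] f [of "Mult s t"] by (simp add: st)
    show "f (x \<oplus>\<^bsub>A\<^esub> y) = f x \<oplus>\<^bsub>B\<^esub> f y"
      using f [of s] f [of t] f [of "Add s t"] by (simp add: st)
    show "f (c \<odot>\<^bsub>A\<^esub> x) = c \<odot>\<^bsub>B\<^esub> f x"
      using f [of s] f [of "Smult c s"] by (simp add: st)
    show "f (star A x) = star B (f x)"
      using f [of s] f [of "Star s"] by (simp add: st)
  next
    show "f \<one>\<^bsub>A\<^esub> = \<one>\<^bsub>B\<^esub>" using f [of One] by simp
  qed
  moreover have "f (g x) = h x" for x using f [of "Gen x"] by simp
  ultimately show ?thesis by blast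
qed

section \<open>Tensor products\<close>

definition bilinear_map ::
  "('a, 'm) star_alg_scheme \<Rightarrow> ('b, 'n) star_alg_scheme \<Rightarrow> ('c, 'k) star_alg_scheme \<Rightarrow>
   ('a \<Rightarrow> 'b \<Rightarrow> 'c) \<Rightarrow> bool" where
  "bilinear_map A B C g \<longleftrightarrow>
     (\<forall>b\<in>carrier B. linear_map A C (\<lambda>a. g a b)) \<and> (\<forall>a\<in>carrier A. linear_map B C (g a))"

text \<open>\<open>tensor_lift\<close> pins its value down by the images under all linear
  functionals; this condition makes such a value unique.\<close>

definition separated :: "('a, 'm) star_alg_scheme \<Rightarrow> bool" where
  "separated A \<longleftrightarrow>
     (\<forall>x\<in>carrier A. (\<forall>\<phi>. linear_map A complex_alg \<phi> \<longrightarrow> \<phi> x = 0) \<longrightarrow> x = \<zero>\<^bsub>A\<^esub>)"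

lemma bilinear_form_iff: "bilinear_form A B \<beta> \<longleftrightarrow> bilinear_map A B complex_alg \<beta>"
  by (simp add: bilinear_form_def bilinear_map_def)

lemma bilinear_mapI:
  assumes "\<And>a b. a \<in> carrier A \<Longrightarrow> b \<in> carrier B \<Longrightarrow> g a b \<in> carrier C"
    "\<And>a a' b. a \<in> carrier A \<Longrightarrow> a' \<in> carrier A \<Longrightarrow> b \<in> carrier B \<Longrightarrow>
       g (a \<oplus>\<^bsub>A\<^esub> a') b = g a b \<oplus>\<^bsub>C\<^esub> g a' b"
    "\<And>a b b'. a \<in> carrier A \<Longrightarrow> b \<in> carrier B \<Longrightarrow> b' \<in> carrier B \<Longrightarrow>
       g a (b \<oplus>\<^bsub>B\<^esub> b') = g a b \<oplus>\<^bsub>C\<^esub> g a b'"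
    "\<And>c a b. a \<in> carrier A \<Longrightarrow> b \<in> carrier B \<Longrightarrow> g (c \<odot>\<^bsub>A\<^esub> a) b = c \<odot>\<^bsub>C\<^esub> g a b"
    "\<And>c a b. a \<in> carrier A \<Longrightarrow> b \<in> carrier B \<Longrightarrow> g a (c \<odot>\<^bsub>B\<^esub> b) = c \<odot>\<^bsub>C\<^esub> g a b"
  shows "bilinear_map A B C g"
  using assms by (auto simp: bilinear_map_def linear_map_def Pi_iff)

lemma bilinear_mapD:
  assumes "bilinear_map A B C g"
  shows "a \<in> carrier A \<Longrightarrow> b \<in> carrier B \<Longrightarrow> g a b \<in> carrier C"
    "a \<in> carrier A \<Longrightarrow> a' \<in> carrier A \<Longrightarrow> b \<in> carrier B \<Longrightarrow> g (a \<oplus>\<^bsub>A\<^esub> a') b = g a b \<oplus>\<^bsub>C\<^esub> g a' b"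
    "a \<in> carrier A \<Longrightarrow> b \<in> carrier B \<Longrightarrow> b' \<in> carrier B \<Longrightarrow> g a (b \<oplus>\<^bsub>B\<^esub> b') = g a b \<oplus>\<^bsub>C\<^esub> g a b'"
    "a \<in> carrier A \<Longrightarrow> b \<in> carrier B \<Longrightarrow> g (c \<odot>\<^bsub>A\<^esub> a) b = c \<odot>\<^bsub>C\<^esub> g a b"
    "a \<in> carrier A \<Longrightarrow> b \<in> carrier B \<Longrightarrow> g a (c \<odot>\<^bsub>B\<^esub> b) = c \<odot>\<^bsub>C\<^esub> g a b"
  using assms by (auto simp: bilinear_map_def linear_map_def Pi_iff)

lemma bilinear_formI:
  assumes "\<And>a a' b. a \<in> carrier A \<Longrightarrow> a' \<in> carrier A \<Longrightarrow> b \<in> carrier B \<Longrightarrow>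
       \<beta> (a \<oplus>\<^bsub>A\<^esub> a') b = \<beta> a b + \<beta> a' b"
    "\<And>a b b'. a \<in> carrier A \<Longrightarrow> b \<in> carrier B \<Longrightarrow> b' \<in> carrier B \<Longrightarrow>
       \<beta> a (b \<oplus>\<^bsub>B\<^esub> b') = \<beta> a b + \<beta> a b'"
    "\<And>c a b. a \<in> carrier A \<Longrightarrow> b \<in> carrier B \<Longrightarrow> \<beta> (c \<odot>\<^bsub>A\<^esub> a) b = c * \<beta> a b"
    "\<And>c a b. a \<in> carrier A \<Longrightarrow> b \<in> carrier B \<Longrightarrow> \<beta> a (c \<odot>\<^bsub>B\<^esub> b) = c * \<beta> a b"
  shows "bilinear_form A B \<beta>"
  unfolding bilinear_form_iff by (rule bilinear_mapI) (auto simp: assms)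

lemma bilinear_formD:
  assumes "bilinear_form A B \<beta>"
  shows "a \<in> carrier A \<Longrightarrow> a' \<in> carrier A \<Longrightarrow> b \<in> carrier B \<Longrightarrow> \<beta> (a \<oplus>\<^bsub>A\<^esub> a') b = \<beta> a b + \<beta> a' b"
    "a \<in> carrier A \<Longrightarrow> b \<in> carrier B \<Longrightarrow> b' \<in> carrier B \<Longrightarrow> \<beta> a (b \<oplus>\<^bsub>B\<^esub> b') = \<beta> a b + \<beta> a b'"
    "a \<in> carrier A \<Longrightarrow> b \<in> carrier B \<Longrightarrow> \<beta> (c \<odot>\<^bsub>A\<^esub> a) b = c * \<beta> a b"
    "a \<in> carrier A \<Longrightarrow> b \<in> carrier B \<Longrightarrow> \<beta> a (c \<odot>\<^bsub>B\<^esub> b) = c * \<beta> a b"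
  using bilinear_mapD [OF assms [unfolded bilinear_form_iff]] by auto

lemma tensor_alg_simps:
  "one (tensor_alg A B) = pure_tensor A B \<one>\<^bsub>A\<^esub> \<one>\<^bsub>B\<^esub>"
  "zero (tensor_alg A B) = (\<lambda>\<beta>. 0)"
  "s \<oplus>\<^bsub>tensor_alg A B\<^esub> t = (\<lambda>\<beta>. s \<beta> + t \<beta>)"
  "c \<odot>\<^bsub>tensor_alg A B\<^esub> t = (\<lambda>\<beta>. c * t \<beta>)"
  by (simp_all add: tensor_alg_def)

locale star_algebra_pair = A: star_algebra A + B: star_algebra B
  for A :: "('a, 'm) star_alg_scheme" and B :: "('b, 'n) star_alg_scheme"
begin

abbreviation T where "T \<equiv> tensor_alg A B"
abbreviation pure where "pure \<equiv> pure_tensor A B"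

lemma pure_closed [simp, intro]: "a \<in> carrier A \<Longrightarrow> b \<in> carrier B \<Longrightarrow> pure a b \<in> carrier T"
  unfolding tensor_alg_def
  by (auto intro!: exI [of _ 1] exI [of _ "\<lambda>_. a"] exI [of _ "\<lambda>_. b"])

lemma pure_apply: "bilinear_form A B \<beta> \<Longrightarrow> pure a b \<beta> = \<beta> a b"
  by (simp add: pure_tensor_def)

lemma pure_not_bilinear: "\<not> bilinear_form A B \<beta> \<Longrightarrow> pure a b \<beta> = 0"
  by (simp add: pure_tensor_def)

lemma tensor_add_closed:
  assumes "s \<in> carrier T" "t \<in> carrier T"
  shows "s \<oplus>\<^bsub>T\<^esub> t \<in> carrier T"
proof -
  obtain m a b where s: "\<forall>i<(m::nat). a i \<in> carrier A \<and> b i \<in> carrier B"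
    "s = (\<lambda>\<beta>. \<Sum>i<m. pure (a i) (b i) \<beta>)"
    using assms(1) by (auto simp: tensor_alg_def)
  obtain n c d where t: "\<forall>i<(n::nat). c i \<in> carrier A \<and> d i \<in> carrier B"
    "t = (\<lambda>\<beta>. \<Sum>i<n. pure (c i) (d i) \<beta>)"
    using assms(2) by (auto simp: tensor_alg_def)
  define e where "e i = (if i < m then a i else c (i - m))" for i
  define f where "f i = (if i < m then b i else d (i - m))" for i
  have split: "sum g {..<m + n} = (\<Sum>i<m. g i) + (\<Sum>i<n. g (m + i))" for g :: "nat \<Rightarrow> complex"
    by (induction n) (auto simp: algebra_simps)
  have "s \<oplus>\<^bsub>T\<^esub> t = (\<lambda>\<beta>. \<Sum>i<m + n. pure (e i) (f i) \<beta>)"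
    by (simp add: tensor_alg_simps s(2) t(2) split e_def f_def)
  moreover have "\<forall>i<m+n. e i \<in> carrier A \<and> f i \<in> carrier B"
    using s(1) t(1) by (auto simp: e_def f_def)
  ultimately show ?thesis unfolding tensor_alg_def by auto
qed

text \<open>Scalars can be absorbed into one factor and zero is itself pure, so sums of pure tensors
  are the only cases.\<close>

lemma tensor_induct [consumes 1, case_names pure add]:
  assumes t: "t \<in> carrier T"
    and pure: "\<And>a b. a \<in> carrier A \<Longrightarrow> b \<in> carrier B \<Longrightarrow> P (pure a b)"
    and add: "\<And>s t. s \<in> carrier T \<Longrightarrow> t \<in> carrier T \<Longrightarrow> P s \<Longrightarrow> P t \<Longrightarrow> P (s \<oplus>\<^bsub>T\<^esub> t)"
  shows "P t"
proof -
  obtain n a b where ab: "\<forall>i<(n::nat). a i \<in> carrier A \<and> b i \<in> carrier B"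
    and t: "t = (\<lambda>\<beta>. \<Sum>i<n. pure (a i) (b i) \<beta>)"
    using t by (auto simp: tensor_alg_def)
  have "P (\<lambda>\<beta>. \<Sum>i<n. pure (a i) (b i) \<beta>)" using ab
  proof (induction n)
    case 0
    \<comment> \<open>The empty sum counts as a pure tensor, because a bilinear form vanishes at a
      pair of zeros.\<close>
    have "pure \<zero>\<^bsub>A\<^esub> \<zero>\<^bsub>B\<^esub> \<beta> = 0" for \<beta>
      using bilinear_formD(3) [of A B \<beta> "\<zero>\<^bsub>A\<^esub>" "\<zero>\<^bsub>B\<^esub>" 0]
      by (cases "bilinear_form A B \<beta>") (auto simp: pure_apply pure_not_bilinear)
    then have "(\<lambda>\<beta>. 0) = pure \<zero>\<^bsub>A\<^esub> \<zero>\<^bsub>B\<^esub>" by auto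
    with pure show ?case by simp
  next
    case (Suc n)
    have "(\<lambda>\<beta>. \<Sum>i<n. pure (a i) (b i) \<beta>) \<in> carrier T"
      unfolding tensor_alg_def using Suc.prems by (auto intro!: exI [of _ n] exI [of _ a] exI [of _ b])
    with Suc.IH Suc.prems add [of "\<lambda>\<beta>. \<Sum>i<n. pure (a i) (b i) \<beta>" "pure (a n) (b n)"] pure show ?case
      by (simp add: tensor_alg_simps)
  qed
  with t show ?thesis by simp
qed

lemma bilinear_form_cong:
  assumes "\<And>a b. a \<in> carrier A \<Longrightarrow> b \<in> carrier B \<Longrightarrow> \<beta> a b = \<beta>' a b"
  shows "bilinear_form A B \<beta> \<longleftrightarrow> bilinear_form A B \<beta>'"
  unfolding bilinear_form_def linear_map_def using assms by auto

text \<open>A tensor is applied to total functions, whose values off the carriers are arbitrary. As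
  pure tensors look at the carriers only, forms may be rewritten there pointwise.\<close>

lemma tensor_cong:
  assumes "t \<in> carrier T" "\<And>a b. a \<in> carrier A \<Longrightarrow> b \<in> carrier B \<Longrightarrow> \<beta> a b = \<beta>' a b"
  shows "t \<beta> = t \<beta>'"
  using assms(1)
proof (induction rule: tensor_induct)
  case (pure a b)
  then show ?case using bilinear_form_cong [of \<beta> \<beta>'] assms(2)
    by (simp add: pure_tensor_def)
qed (auto simp: tensor_alg_simps)

lemma bilinear_form_add:
  "bilinear_form A B \<beta> \<Longrightarrow> bilinear_form A B \<beta>' \<Longrightarrow> bilinear_form A B (\<lambda>a b. \<beta> a b + \<beta>' a b)"
  by (rule bilinear_formI) (auto simp: bilinear_formD algebra_simps)

lemma bilinear_form_scale:
  "bilinear_form A B \<beta> \<Longrightarrow> bilinear_form A B (\<lambda>a b. c * \<beta> a b)"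
  by (rule bilinear_formI) (auto simp: bilinear_formD algebra_simps)

lemma tensor_form_add:
  assumes "t \<in> carrier T" "bilinear_form A B \<beta>" "bilinear_form A B \<beta>'"
  shows "t (\<lambda>a b. \<beta> a b + \<beta>' a b) = t \<beta> + t \<beta>'"
  using assms(1)
  by (induction rule: tensor_induct)
    (auto simp: pure_apply bilinear_form_add assms(2,3) tensor_alg_simps)

lemma tensor_form_scale:
  assumes "t \<in> carrier T" "bilinear_form A B \<beta>"
  shows "t (\<lambda>a b. c * \<beta> a b) = c * t \<beta>"
  using assms(1)
  by (induction rule: tensor_induct)
    (auto simp: pure_apply bilinear_form_scale assms(2) tensor_alg_simps algebra_simps)

lemma pure_add_left:
  "a \<in> carrier A \<Longrightarrow> a' \<in> carrier A \<Longrightarrow> b \<in> carrier B \<Longrightarrow>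
     pure (a \<oplus>\<^bsub>A\<^esub> a') b = pure a b \<oplus>\<^bsub>T\<^esub> pure a' b"
  by (auto simp: tensor_alg_simps pure_tensor_def bilinear_formD)

lemma pure_add_right:
  "a \<in> carrier A \<Longrightarrow> b \<in> carrier B \<Longrightarrow> b' \<in> carrier B \<Longrightarrow>
     pure a (b \<oplus>\<^bsub>B\<^esub> b') = pure a b \<oplus>\<^bsub>T\<^esub> pure a b'"
  by (auto simp: tensor_alg_simps pure_tensor_def bilinear_formD)

lemma pure_smult_left:
  "a \<in> carrier A \<Longrightarrow> b \<in> carrier B \<Longrightarrow> pure (c \<odot>\<^bsub>A\<^esub> a) b = c \<odot>\<^bsub>T\<^esub> pure a b"
  by (auto simp: tensor_alg_simps pure_tensor_def bilinear_formD)

lemma pure_smult_right: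
  "a \<in> carrier A \<Longrightarrow> b \<in> carrier B \<Longrightarrow> pure a (c \<odot>\<^bsub>B\<^esub> b) = c \<odot>\<^bsub>T\<^esub> pure a b"
  by (auto simp: tensor_alg_simps pure_tensor_def bilinear_formD)

lemma tensor_smult_closed: "t \<in> carrier T \<Longrightarrow> c \<odot>\<^bsub>T\<^esub> t \<in> carrier T"
proof (induction rule: tensor_induct)
  case (pure a b)
  then show ?case by (simp add: pure_smult_left [symmetric])
next
  case (add s t)
  have "c \<odot>\<^bsub>T\<^esub> (s \<oplus>\<^bsub>T\<^esub> t) = c \<odot>\<^bsub>T\<^esub> s \<oplus>\<^bsub>T\<^esub> c \<odot>\<^bsub>T\<^esub> t"
    by (simp add: tensor_alg_simps algebra_simps)
  with add show ?case by (simp add: tensor_add_closed)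
qed

lemma tensor_mult_apply:
  "bilinear_form A B \<beta> \<Longrightarrow> (s \<otimes>\<^bsub>T\<^esub> t) \<beta> = s (\<lambda>a b. t (\<lambda>c d. \<beta> (a \<otimes>\<^bsub>A\<^esub> c) (b \<otimes>\<^bsub>B\<^esub> d)))"
  by (simp add: tensor_alg_def)

lemma tensor_mult_not_bilinear: "\<not> bilinear_form A B \<beta> \<Longrightarrow> (s \<otimes>\<^bsub>T\<^esub> t) \<beta> = 0"
  by (simp add: tensor_alg_def)

lemma bilinear_form_translate:
  "bilinear_form A B \<beta> \<Longrightarrow> a \<in> carrier A \<Longrightarrow> b \<in> carrier B \<Longrightarrow>
     bilinear_form A B (\<lambda>c d. \<beta> (a \<otimes>\<^bsub>A\<^esub> c) (b \<otimes>\<^bsub>B\<^esub> d))"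
  by (rule bilinear_formI) (auto simp: bilinear_formD A.r_distr B.r_distr A.scal_mult B.scal_mult)

text \<open>The product nests one tensor inside the argument of another. The inner evaluation must
  be bilinear again, since otherwise the outer tensor would return its default value 0.\<close>

lemma bilinear_form_mult:
  assumes \<beta>: "bilinear_form A B \<beta>" and t: "t \<in> carrier T"
  shows "bilinear_form A B (\<lambda>a b. t (\<lambda>c d. \<beta> (a \<otimes>\<^bsub>A\<^esub> c) (b \<otimes>\<^bsub>B\<^esub> d)))"
proof -
  note tr = bilinear_form_translate [OF \<beta>]
  show ?thesis
  proof (rule bilinear_formI)
    fix a a' b b' c assume [simp]: "a \<in> carrier A" "a' \<in> carrier A" "b \<in> carrier B" "b' \<in> carrier B"
    show "t (\<lambda>c d. \<beta> ((a \<oplus>\<^bsub>A\<^esub> a') \<otimes>\<^bsub>A\<^esub> c) (b \<otimes>\<^bsub>B\<^esub> d)) =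
          t (\<lambda>c d. \<beta> (a \<otimes>\<^bsub>A\<^esub> c) (b \<otimes>\<^bsub>B\<^esub> d)) + t (\<lambda>c d. \<beta> (a' \<otimes>\<^bsub>A\<^esub> c) (b \<otimes>\<^bsub>B\<^esub> d))"
      by (subst tensor_form_add [symmetric, OF t tr tr])
        (auto intro!: tensor_cong [OF t] simp: A.l_distr bilinear_formD [OF \<beta>])
    show "t (\<lambda>c d. \<beta> (a \<otimes>\<^bsub>A\<^esub> c) ((b \<oplus>\<^bsub>B\<^esub> b') \<otimes>\<^bsub>B\<^esub> d)) =
          t (\<lambda>c d. \<beta> (a \<otimes>\<^bsub>A\<^esub> c) (b \<otimes>\<^bsub>B\<^esub> d)) + t (\<lambda>c d. \<beta> (a \<otimes>\<^bsub>A\<^esub> c) (b' \<otimes>\<^bsub>B\<^esub> d))"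
      by (subst tensor_form_add [symmetric, OF t tr tr])
        (auto intro!: tensor_cong [OF t] simp: B.l_distr bilinear_formD [OF \<beta>])
    show "t (\<lambda>x d. \<beta> ((c \<odot>\<^bsub>A\<^esub> a) \<otimes>\<^bsub>A\<^esub> x) (b \<otimes>\<^bsub>B\<^esub> d)) =
          c * t (\<lambda>c d. \<beta> (a \<otimes>\<^bsub>A\<^esub> c) (b \<otimes>\<^bsub>B\<^esub> d))"
      by (subst tensor_form_scale [symmetric, OF t tr])
        (auto intro!: tensor_cong [OF t] simp: A.scal_mult bilinear_formD [OF \<beta>])
    show "t (\<lambda>x d. \<beta> (a \<otimes>\<^bsub>A\<^esub> x) ((c \<odot>\<^bsub>B\<^esub> b) \<otimes>\<^bsub>B\<^esub> d)) =
          c * t (\<lambda>c d. \<beta> (a \<otimes>\<^bsub>A\<^esub> c) (b \<otimes>\<^bsub>B\<^esub> d))"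
      by (subst tensor_form_scale [symmetric, OF t tr])
        (auto intro!: tensor_cong [OF t] simp: B.scal_mult bilinear_formD [OF \<beta>])
  qed
qed

lemma pure_mult:
  assumes "a \<in> carrier A" "b \<in> carrier B" "c \<in> carrier A" "d \<in> carrier B"
  shows "pure a b \<otimes>\<^bsub>T\<^esub> pure c d = pure (a \<otimes>\<^bsub>A\<^esub> c) (b \<otimes>\<^bsub>B\<^esub> d)"
proof
  fix \<beta>
  show "(pure a b \<otimes>\<^bsub>T\<^esub> pure c d) \<beta> = pure (a \<otimes>\<^bsub>A\<^esub> c) (b \<otimes>\<^bsub>B\<^esub> d) \<beta>"
    using assms
    by (cases "bilinear_form A B \<beta>")
      (auto simp: tensor_mult_apply tensor_mult_not_bilinear pure_apply pure_not_bilinear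
        bilinear_form_mult bilinear_form_translate)
qed

lemma tensor_mult_add_left:
  "(s \<oplus>\<^bsub>T\<^esub> s') \<otimes>\<^bsub>T\<^esub> t = s \<otimes>\<^bsub>T\<^esub> t \<oplus>\<^bsub>T\<^esub> s' \<otimes>\<^bsub>T\<^esub> t"
  by (auto simp: tensor_alg_def)

lemma tensor_mult_smult_left: "(c \<odot>\<^bsub>T\<^esub> s) \<otimes>\<^bsub>T\<^esub> t = c \<odot>\<^bsub>T\<^esub> (s \<otimes>\<^bsub>T\<^esub> t)"
  by (auto simp: tensor_alg_def)

lemma tensor_mult_add_right:
  assumes "s \<in> carrier T" "t \<in> carrier T" "t' \<in> carrier T"
  shows "s \<otimes>\<^bsub>T\<^esub> (t \<oplus>\<^bsub>T\<^esub> t') = s \<otimes>\<^bsub>T\<^esub> t \<oplus>\<^bsub>T\<^esub> s \<otimes>\<^bsub>T\<^esub> t'"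
proof
  fix \<beta>
  show "(s \<otimes>\<^bsub>T\<^esub> (t \<oplus>\<^bsub>T\<^esub> t')) \<beta> = (s \<otimes>\<^bsub>T\<^esub> t \<oplus>\<^bsub>T\<^esub> s \<otimes>\<^bsub>T\<^esub> t') \<beta>"
    using tensor_form_add [OF assms(1) bilinear_form_mult bilinear_form_mult, OF _ assms(2) _ assms(3)]
    by (cases "bilinear_form A B \<beta>")
      (simp_all add: tensor_mult_apply tensor_mult_not_bilinear tensor_alg_simps)
qed

lemma tensor_mult_smult_right:
  assumes "s \<in> carrier T" "t \<in> carrier T"
  shows "s \<otimes>\<^bsub>T\<^esub> (c \<odot>\<^bsub>T\<^esub> t) = c \<odot>\<^bsub>T\<^esub> (s \<otimes>\<^bsub>T\<^esub> t)"
proof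
  fix \<beta>
  show "(s \<otimes>\<^bsub>T\<^esub> (c \<odot>\<^bsub>T\<^esub> t)) \<beta> = (c \<odot>\<^bsub>T\<^esub> (s \<otimes>\<^bsub>T\<^esub> t)) \<beta>"
    using tensor_form_scale [OF assms(1) bilinear_form_mult, OF _ assms(2)]
    by (cases "bilinear_form A B \<beta>")
      (simp_all add: tensor_mult_apply tensor_mult_not_bilinear tensor_alg_simps)
qed

lemma tensor_mult_closed:
  assumes "s \<in> carrier T" "t \<in> carrier T"
  shows "s \<otimes>\<^bsub>T\<^esub> t \<in> carrier T"
  using assms(1)
proof (induction rule: tensor_induct)
  case (pure a b)
  show ?case using assms(2)
    by (induction rule: tensor_induct)
      (simp_all add: pure_mult pure tensor_mult_add_right tensor_add_closed)
qed (simp add: tensor_mult_add_left tensor_add_closed)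

lemma bilinear_form_star:
  "bilinear_form A B \<beta> \<Longrightarrow> bilinear_form A B (\<lambda>a b. cnj (\<beta> (star A a) (star B b)))"
  by (rule bilinear_formI) (auto simp: bilinear_formD A.star_add B.star_add A.star_smult B.star_smult)

lemma pure_star:
  "a \<in> carrier A \<Longrightarrow> b \<in> carrier B \<Longrightarrow> star T (pure a b) = pure (star A a) (star B b)"
  by (auto simp: tensor_alg_def pure_tensor_def bilinear_form_star)

lemma tensor_star_add: "star T (s \<oplus>\<^bsub>T\<^esub> t) = star T s \<oplus>\<^bsub>T\<^esub> star T t"
  by (auto simp: tensor_alg_def)

lemma tensor_star_smult: "star T (c \<odot>\<^bsub>T\<^esub> t) = cnj c \<odot>\<^bsub>T\<^esub> star T t"
  by (auto simp: tensor_alg_def)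

lemma tensor_star_closed: "t \<in> carrier T \<Longrightarrow> star T t \<in> carrier T"
  by (induction rule: tensor_induct) (simp_all add: pure_star tensor_star_add tensor_add_closed)

text \<open>Additivity in each argument reduces every law to pure tensors, where it is the law in
  \<open>A\<close> and in \<open>B\<close>; associativity takes an induction in all three
  arguments.\<close>

lemma star_algebra_tensor: "star_algebra T"
proof -
  note cl = tensor_mult_closed tensor_add_closed tensor_smult_closed tensor_star_closed
  note pw = tensor_alg_simps algebra_simps
  have one: "\<one>\<^bsub>T\<^esub> = pure \<one>\<^bsub>A\<^esub> \<one>\<^bsub>B\<^esub>" by (simp add: tensor_alg_simps)
  have assoc: "(s \<otimes>\<^bsub>T\<^esub> t) \<otimes>\<^bsub>T\<^esub> r = s \<otimes>\<^bsub>T\<^esub> (t \<otimes>\<^bsub>T\<^esub> r)"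
    if s: "s \<in> carrier T" and t: "t \<in> carrier T" and r: "r \<in> carrier T" for s t r
    using s
  proof (induction rule: tensor_induct)
    case (pure a b)
    note ab = pure
    show ?case using t
    proof (induction rule: tensor_induct)
      case (pure c d)
      note cd = pure
      show ?case using r
        by (induction rule: tensor_induct)
          (simp_all add: pure_mult ab cd A.m_assoc B.m_assoc tensor_mult_add_right cl)
    qed (simp add: ab tensor_mult_add_left tensor_mult_add_right cl r)
  qed (simp add: tensor_mult_add_left cl r t)
  have stm: "star T (s \<otimes>\<^bsub>T\<^esub> t) = star T t \<otimes>\<^bsub>T\<^esub> star T s"
    if s: "s \<in> carrier T" and t: "t \<in> carrier T" for s t
    using s
  proof (induction rule: tensor_induct)
    case (pure a b)
    note ab = pure
    show ?case using t
      by (induction rule: tensor_induct)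
        (simp_all add: pure_mult pure_star ab A.star_mult B.star_mult tensor_mult_add_right
          tensor_mult_add_left tensor_star_add cl)
  qed (simp add: tensor_mult_add_left tensor_mult_add_right tensor_star_add cl t)
  have stst: "star T (star T t) = t" if "t \<in> carrier T" for t
    using that by (induction rule: tensor_induct) (simp_all add: pure_star tensor_star_add cl)
  have ol: "\<one>\<^bsub>T\<^esub> \<otimes>\<^bsub>T\<^esub> t = t" if "t \<in> carrier T" for t
    using that by (induction rule: tensor_induct)
      (simp_all add: one pure_mult tensor_mult_add_right cl)
  have or: "t \<otimes>\<^bsub>T\<^esub> \<one>\<^bsub>T\<^esub> = t" if "t \<in> carrier T" for t
    using that by (induction rule: tensor_induct)
      (simp_all add: one pure_mult tensor_mult_add_left cl)
  have zero: "\<zero>\<^bsub>T\<^esub> \<in> carrier T"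
    using tensor_smult_closed [of "pure \<one>\<^bsub>A\<^esub> \<one>\<^bsub>B\<^esub>" 0] by (simp add: tensor_alg_simps)
  show ?thesis
    by (rule star_algebraI)
      (simp_all add: zero one cl assoc stm stst ol [unfolded one] or [unfolded one]
        tensor_mult_add_left tensor_mult_add_right tensor_mult_smult_left tensor_mult_smult_right
        tensor_star_add tensor_star_smult, simp_all add: pw)
qed

sublocale T: star_algebra T by (rule star_algebra_tensor)

text \<open>Immediate from the realisation inside a dual: evaluation at any \<open>\<beta>\<close>
  is a linear functional.\<close>

lemma separated_tensor: "separated T"
  unfolding separated_def
proof (intro ballI impI)
  fix t assume t: "t \<in> carrier T" and h: "\<forall>\<phi>. linear_map T complex_alg \<phi> \<longrightarrow> \<phi> t = 0"
  have "t \<beta> = 0" for \<beta>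
    using h [rule_format, of "\<lambda>t. t \<beta>"] by (simp add: linear_mapI tensor_alg_simps)
  then show "t = \<zero>\<^bsub>T\<^esub>" by (auto simp: tensor_alg_simps)
qed

lemma tensor_alg_homI:
  assumes "star_algebra C" "linear_map T C f" "f (pure \<one>\<^bsub>A\<^esub> \<one>\<^bsub>B\<^esub>) = \<one>\<^bsub>C\<^esub>"
    and pm: "\<And>a b c d. a \<in> carrier A \<Longrightarrow> b \<in> carrier B \<Longrightarrow> c \<in> carrier A \<Longrightarrow> d \<in> carrier B \<Longrightarrow>
      f (pure (a \<otimes>\<^bsub>A\<^esub> c) (b \<otimes>\<^bsub>B\<^esub> d)) = f (pure a b) \<otimes>\<^bsub>C\<^esub> f (pure c d)"
  shows "alg_hom T C f"
proof -
  interpret C: star_algebra C by fact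
  note lin = linear_mapD [OF assms(2)]
  have "f (s \<otimes>\<^bsub>T\<^esub> t) = f s \<otimes>\<^bsub>C\<^esub> f t" if s: "s \<in> carrier T" and t: "t \<in> carrier T" for s t
    using s
  proof (induction rule: tensor_induct)
    case (pure a b)
    note ab = pure
    show ?case using t
      by (induction rule: tensor_induct)
        (simp_all add: pure_mult ab pm tensor_mult_add_right lin C.r_distr)
  qed (simp add: tensor_mult_add_left lin C.l_distr t)
  then show ?thesis
    by (intro alg_homI) (simp_all add: lin assms(3) tensor_alg_simps(1))
qed

lemma tensor_star_homI:
  assumes "star_algebra C" "alg_hom T C f"
    and st: "\<And>a b. a \<in> carrier A \<Longrightarrow> b \<in> carrier B \<Longrightarrow>
      f (pure (star A a) (star B b)) = star C (f (pure a b))"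
  shows "star_hom T C f"
proof -
  interpret C: star_algebra C by fact
  have "f (star T t) = star C (f t)" if "t \<in> carrier T" for t
    using that
    by (induction rule: tensor_induct)
      (simp_all add: pure_star st tensor_star_add alg_homD [OF assms(2)] C.star_add)
  with assms(2) show ?thesis by (simp add: star_hom_def)
qed

lemma tensor_lift_eqI:
  assumes "star_algebra C" "separated C" "y \<in> carrier C"
    "\<And>\<phi>. linear_map C complex_alg \<phi> \<Longrightarrow> \<phi> y = t (\<lambda>a b. \<phi> (g a b))"
  shows "tensor_lift C g t = y"
  unfolding tensor_lift_def
proof (rule the_equality)
  interpret C: star_algebra C by fact
  fix z assume z: "z \<in> carrier C \<and> (\<forall>\<phi>. linear_map C complex_alg \<phi> \<longrightarrow> \<phi> z = t (\<lambda>a b. \<phi> (g a b)))"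
  have "\<phi> (z \<oplus>\<^bsub>C\<^esub> (- 1) \<odot>\<^bsub>C\<^esub> y) = 0" if "linear_map C complex_alg \<phi>" for \<phi>
    using that z assms by (simp add: linear_mapD [OF that])
  with assms(2) z assms(3) have "z \<oplus>\<^bsub>C\<^esub> (- 1) \<odot>\<^bsub>C\<^esub> y = \<zero>\<^bsub>C\<^esub>"
    by (simp add: separated_def)
  with z assms(3) show "z = y"
    by (metis C.add.inv_equality C.minus_minus C.scal_closed C.uminus_scal)
qed (use assms in auto)

lemma bilinear_form_compose:
  "bilinear_map A B C g \<Longrightarrow> linear_map C complex_alg \<phi> \<Longrightarrow> bilinear_form A B (\<lambda>a b. \<phi> (g a b))"
  by (rule bilinear_formI) (simp_all add: bilinear_mapD linear_mapD)

text \<open>Separation allows at most one value for the description in \<open>tensor_lift\<close>;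
  existence is by induction, with \<open>g a b\<close> as the value at a pure tensor and sums as
  values at sums. Linearity follows because the describing equations are linear in the
  tensor.\<close>

lemma tensor_lift_props:
  assumes C: "star_algebra C" "separated C" and g: "bilinear_map A B C g"
  shows tensor_lift_pure: "a \<in> carrier A \<Longrightarrow> b \<in> carrier B \<Longrightarrow> tensor_lift C g (pure a b) = g a b"
    and tensor_lift_linear: "linear_map T C (tensor_lift C g)"
proof -
  interpret C: star_algebra C by fact
  note eqI = tensor_lift_eqI [OF C]
  show "tensor_lift C g (pure a b) = g a b" if "a \<in> carrier A" "b \<in> carrier B" for a b
    by (rule eqI) (simp_all add: bilinear_mapD(1) [OF g] that pure_apply bilinear_form_compose [OF g])
  have ex: "tensor_lift C g t \<in> carrier C \<and>
    (\<forall>\<phi>. linear_map C complex_alg \<phi> \<longrightarrow> \<phi> (tensor_lift C g t) = t (\<lambda>a b. \<phi> (g a b)))"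
    if "t \<in> carrier T" for t
  proof -
    have "\<exists>y\<in>carrier C. \<forall>\<phi>. linear_map C complex_alg \<phi> \<longrightarrow> \<phi> y = t (\<lambda>a b. \<phi> (g a b))"
      using that
    proof (induction rule: tensor_induct)
      case (pure a b)
      then show ?case
        by (intro bexI [of _ "g a b"])
          (simp_all add: bilinear_mapD(1) [OF g] pure_apply bilinear_form_compose [OF g])
    next
      case (add s t)
      then obtain y z where "y \<in> carrier C" "z \<in> carrier C"
        "\<forall>\<phi>. linear_map C complex_alg \<phi> \<longrightarrow> \<phi> y = s (\<lambda>a b. \<phi> (g a b))"
        "\<forall>\<phi>. linear_map C complex_alg \<phi> \<longrightarrow> \<phi> z = t (\<lambda>a b. \<phi> (g a b))" by blast
      then show ?case
        by (intro bexI [of _ "y \<oplus>\<^bsub>C\<^esub> z"]) (simp_all add: linear_mapD tensor_alg_simps)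
    qed
    then obtain y where y: "y \<in> carrier C"
      "\<And>\<phi>. linear_map C complex_alg \<phi> \<Longrightarrow> \<phi> y = t (\<lambda>a b. \<phi> (g a b))" by blast
    then show ?thesis using eqI [of y t g] by simp
  qed
  show "linear_map T C (tensor_lift C g)"
  proof (rule linear_mapI)
    fix s t c assume st: "s \<in> carrier T" "t \<in> carrier T"
    show "tensor_lift C g t \<in> carrier C" using ex st by blast
    show "tensor_lift C g (s \<oplus>\<^bsub>T\<^esub> t) = tensor_lift C g s \<oplus>\<^bsub>C\<^esub> tensor_lift C g t"
      by (rule eqI) (use ex [OF st(1)] ex [OF st(2)] in \<open>simp_all add: linear_mapD tensor_alg_simps\<close>)
    show "tensor_lift C g (c \<odot>\<^bsub>T\<^esub> s) = c \<odot>\<^bsub>C\<^esub> tensor_lift C g s"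
      by (rule eqI) (use ex [OF st(1)] in \<open>simp_all add: linear_mapD tensor_alg_simps\<close>)
  qed
qed

lemma bilinear_mult:
  assumes "star_algebra C" "linear_map A C f" "linear_map B C g"
  shows "bilinear_map A B C (\<lambda>a b. f a \<otimes>\<^bsub>C\<^esub> g b)"
proof -
  interpret C: star_algebra C by fact
  show ?thesis
    by (rule bilinear_mapI)
      (simp_all add: linear_mapD [OF assms(2)] linear_mapD [OF assms(3)] C.l_distr C.r_distr C.scal_mult)
qed

text \<open>Universal property of the tensor product of algebras: homomorphisms with commuting
  images combine into one. It proves the associator multiplicative, and its star version gives
  representations of tensor products.\<close>

lemma tensor_lift_alg_hom:
  assumes C: "star_algebra C" "separated C" and f: "alg_hom A C f" and g: "alg_hom B C g"
    and comm: "\<And>a b. a \<in> carrier A \<Longrightarrow> b \<in> carrier B \<Longrightarrow> f a \<otimes>\<^bsub>C\<^esub> g b = g b \<otimes>\<^bsub>C\<^esub> f a"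
  shows "alg_hom T C (tensor_lift C (\<lambda>a b. f a \<otimes>\<^bsub>C\<^esub> g b))"
proof -
  interpret C: star_algebra C by fact
  note lp = tensor_lift_props [OF C bilinear_mult [OF C(1) alg_hom_linear [OF f] alg_hom_linear [OF g]]]
  note fg = alg_homD [OF f] alg_homD [OF g]
  show ?thesis
  proof (rule tensor_alg_homI [OF C(1) lp(2)])
    fix a b c d
    assume [simp]: "a \<in> carrier A" "b \<in> carrier B" "c \<in> carrier A" "d \<in> carrier B"
    have "(f a \<otimes>\<^bsub>C\<^esub> f c) \<otimes>\<^bsub>C\<^esub> (g b \<otimes>\<^bsub>C\<^esub> g d) = f a \<otimes>\<^bsub>C\<^esub> (f c \<otimes>\<^bsub>C\<^esub> g b) \<otimes>\<^bsub>C\<^esub> g d"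
      by (simp add: C.m_assoc fg)
    also have "\<dots> = (f a \<otimes>\<^bsub>C\<^esub> g b) \<otimes>\<^bsub>C\<^esub> (f c \<otimes>\<^bsub>C\<^esub> g d)"
      using comm [of c b] by (simp add: C.m_assoc fg)
    finally show "tensor_lift C (\<lambda>a b. f a \<otimes>\<^bsub>C\<^esub> g b) (pure (a \<otimes>\<^bsub>A\<^esub> c) (b \<otimes>\<^bsub>B\<^esub> d)) =
      tensor_lift C (\<lambda>a b. f a \<otimes>\<^bsub>C\<^esub> g b) (pure a b) \<otimes>\<^bsub>C\<^esub> tensor_lift C (\<lambda>a b. f a \<otimes>\<^bsub>C\<^esub> g b) (pure c d)"
      by (simp add: lp(1) fg)
  qed (simp add: lp(1) fg)
qed

lemma tensor_lift_star_hom: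
  assumes C: "star_algebra C" "separated C" and f: "star_hom A C f" and g: "star_hom B C g"
    and comm: "\<And>a b. a \<in> carrier A \<Longrightarrow> b \<in> carrier B \<Longrightarrow> f a \<otimes>\<^bsub>C\<^esub> g b = g b \<otimes>\<^bsub>C\<^esub> f a"
  shows "star_hom T C (tensor_lift C (\<lambda>a b. f a \<otimes>\<^bsub>C\<^esub> g b))"
proof -
  interpret C: star_algebra C by fact
  note fa = star_hom_alg [OF f] and ga = star_hom_alg [OF g]
  note lp = tensor_lift_props [OF C bilinear_mult [OF C(1) alg_hom_linear [OF fa] alg_hom_linear [OF ga]]]
  note fg = alg_homD [OF fa] alg_homD [OF ga]
  show ?thesis
  proof (rule tensor_star_homI [OF C(1) tensor_lift_alg_hom [OF C fa ga comm]])
    fix a b assume ab: "a \<in> carrier A" "b \<in> carrier B"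
    \<comment> \<open>Adjoints reverse the two factors, so commutation is needed at the starred
      elements as well.\<close>
    then have "f (star A a) \<otimes>\<^bsub>C\<^esub> g (star B b) = star C (g b) \<otimes>\<^bsub>C\<^esub> star C (f a)"
      using comm [of "star A a" "star B b"] by (simp add: star_homD [OF f] star_homD [OF g])
    also have "\<dots> = star C (f a \<otimes>\<^bsub>C\<^esub> g b)" using ab by (simp add: C.star_mult fg)
    finally show "tensor_lift C (\<lambda>a b. f a \<otimes>\<^bsub>C\<^esub> g b) (pure (star A a) (star B b)) =
        star C (tensor_lift C (\<lambda>a b. f a \<otimes>\<^bsub>C\<^esub> g b) (pure a b))"
      using ab by (simp add: lp(1))
  qed
qed

end

section \<open>Maps between tensor products and the associator\<close>

lemma tensor_map_props:
  assumes "star_algebra A" "star_algebra B" "star_algebra C" "star_algebra D"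
    and f: "linear_map A C f" and g: "linear_map B D g"
  shows tensor_map_pure: "a \<in> carrier A \<Longrightarrow> b \<in> carrier B \<Longrightarrow>
      tensor_map C D f g (pure_tensor A B a b) = pure_tensor C D (f a) (g b)"
    and tensor_map_linear: "linear_map (tensor_alg A B) (tensor_alg C D) (tensor_map C D f g)"
proof -
  interpret AB: star_algebra_pair A B by (intro star_algebra_pair.intro assms)
  interpret CD: star_algebra_pair C D by (intro star_algebra_pair.intro assms)
  note fg = linear_mapD [OF f] linear_mapD [OF g]
  have bil: "bilinear_form A B (\<lambda>a b. \<beta> (f a) (g b))" if "bilinear_form C D \<beta>" for \<beta>
    by (rule bilinear_formI) (simp_all add: fg bilinear_formD [OF that])
  show p: "tensor_map C D f g (pure_tensor A B a b) = pure_tensor C D (f a) (g b)"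
    if "a \<in> carrier A" "b \<in> carrier B" for a b
    by (auto simp: tensor_map_def pure_tensor_def bil)
  have add: "tensor_map C D f g (s \<oplus>\<^bsub>tensor_alg A B\<^esub> t) =
      tensor_map C D f g s \<oplus>\<^bsub>tensor_alg C D\<^esub> tensor_map C D f g t" for s t
    by (auto simp: tensor_map_def tensor_alg_simps)
  have "tensor_map C D f g t \<in> carrier (tensor_alg C D)" if "t \<in> carrier (tensor_alg A B)" for t
    using that by (induction rule: AB.tensor_induct) (simp_all add: p add fg)
  then show "linear_map (tensor_alg A B) (tensor_alg C D) (tensor_map C D f g)"
    by (intro linear_mapI add) (auto simp: tensor_map_def tensor_alg_simps)
qed

lemma tensor_map_alg_hom:
  assumes s: "star_algebra A" "star_algebra B" "star_algebra C" "star_algebra D"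
    and f: "alg_hom A C f" and g: "alg_hom B D g"
  shows "alg_hom (tensor_alg A B) (tensor_alg C D) (tensor_map C D f g)"
proof -
  interpret AB: star_algebra_pair A B by (intro star_algebra_pair.intro assms)
  interpret CD: star_algebra_pair C D by (intro star_algebra_pair.intro assms)
  note tm = tensor_map_props [OF s alg_hom_linear [OF f] alg_hom_linear [OF g]]
  show ?thesis
    by (rule AB.tensor_alg_homI [OF CD.star_algebra_tensor tm(2)])
      (simp_all add: tm(1) alg_homD [OF f] alg_homD [OF g] tensor_alg_simps(1) CD.pure_mult)
qed

lemma tensor_map_star_hom:
  assumes s: "star_algebra A" "star_algebra B" "star_algebra C" "star_algebra D"
    and f: "star_hom A C f" and g: "star_hom B D g"
  shows "star_hom (tensor_alg A B) (tensor_alg C D) (tensor_map C D f g)"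
proof -
  interpret AB: star_algebra_pair A B by (intro star_algebra_pair.intro assms)
  interpret CD: star_algebra_pair C D by (intro star_algebra_pair.intro assms)
  note fa = star_hom_alg [OF f] and ga = star_hom_alg [OF g]
  note tm = tensor_map_props [OF s alg_hom_linear [OF fa] alg_hom_linear [OF ga]]
  show ?thesis
    by (rule AB.tensor_star_homI [OF CD.star_algebra_tensor tensor_map_alg_hom [OF s fa ga]])
      (simp_all add: tm(1) star_homD [OF f] star_homD [OF g] CD.pure_star alg_homD [OF fa] alg_homD [OF ga])
qed

lemma tensor_assoc_props:
  assumes "star_algebra A" "star_algebra B" "star_algebra C"
  shows tensor_assoc_pure: "a \<in> carrier A \<Longrightarrow> b \<in> carrier B \<Longrightarrow> c \<in> carrier C \<Longrightarrow>
      tensor_assoc A B C (pure_tensor (tensor_alg A B) C (pure_tensor A B a b) c) =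
      pure_tensor A (tensor_alg B C) a (pure_tensor B C b c)"
    and tensor_assoc_alg_hom: "alg_hom (tensor_alg (tensor_alg A B) C) (tensor_alg A (tensor_alg B C))
      (tensor_assoc A B C)"
proof -
  interpret AB: star_algebra_pair A B by (intro star_algebra_pair.intro assms)
  interpret BC: star_algebra_pair B C by (intro star_algebra_pair.intro assms)
  interpret AB_C: star_algebra_pair "tensor_alg A B" C
    by (intro star_algebra_pair.intro assms AB.star_algebra_tensor)
  interpret A_BC: star_algebra_pair A "tensor_alg B C"
    by (intro star_algebra_pair.intro assms BC.star_algebra_tensor)
  have b1: "bilinear_form A B (\<lambda>a b. \<beta> a (BC.pure b c))"
    if "bilinear_form A BC.T \<beta>" "c \<in> carrier C" for \<beta> c
    by (rule bilinear_formI)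
      (simp_all add: that(2) bilinear_formD [OF that(1)] BC.pure_add_left BC.pure_smult_left)
  have b2: "bilinear_form AB.T C (\<lambda>s c. s (\<lambda>a b. \<beta> a (BC.pure b c)))"
    if \<beta>: "bilinear_form A BC.T \<beta>" for \<beta>
  proof (rule bilinear_formI)
    fix s s' c c' z
    assume [simp]: "s \<in> carrier AB.T" "s' \<in> carrier AB.T" "c \<in> carrier C" "c' \<in> carrier C"
    show "s (\<lambda>a b. \<beta> a (BC.pure b (c \<oplus>\<^bsub>C\<^esub> c'))) =
        s (\<lambda>a b. \<beta> a (BC.pure b c)) + s (\<lambda>a b. \<beta> a (BC.pure b c'))"
      unfolding AB.tensor_form_add [OF \<open>s \<in> carrier AB.T\<close> b1 [OF \<beta> \<open>c \<in> carrier C\<close>]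
          b1 [OF \<beta> \<open>c' \<in> carrier C\<close>], symmetric]
      by (rule AB.tensor_cong) (simp_all add: BC.pure_add_right bilinear_formD(2) [OF \<beta>])
    show "s (\<lambda>a b. \<beta> a (BC.pure b (z \<odot>\<^bsub>C\<^esub> c))) = z * s (\<lambda>a b. \<beta> a (BC.pure b c))"
      unfolding AB.tensor_form_scale [OF \<open>s \<in> carrier AB.T\<close> b1 [OF \<beta> \<open>c \<in> carrier C\<close>], symmetric]
      by (rule AB.tensor_cong) (simp_all add: BC.pure_smult_right bilinear_formD(4) [OF \<beta>])
  qed (simp_all add: tensor_alg_simps)
  show pp: "tensor_assoc A B C (AB_C.pure (AB.pure a b) c) = A_BC.pure a (BC.pure b c)"
    if "a \<in> carrier A" "b \<in> carrier B" "c \<in> carrier C" for a b c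
  proof
    fix \<beta>
    show "tensor_assoc A B C (AB_C.pure (AB.pure a b) c) \<beta> = A_BC.pure a (BC.pure b c) \<beta>"
      by (cases "bilinear_form A BC.T \<beta>")
        (simp_all add: tensor_assoc_def AB_C.pure_apply [OF b2] AB.pure_apply [OF b1] A_BC.pure_apply
          A_BC.pure_not_bilinear that)
  qed
  \<comment> \<open>The explicit formula of the associator is awkward to multiply. It is therefore
    identified with the lift of two commuting embeddings, of \<open>A \<otimes> B\<close> by
    \<open>i12\<close> and of \<open>C\<close> by \<open>i3\<close>, which is multiplicative by
    construction.\<close>
  define i12 where "i12 = tensor_map A BC.T (\<lambda>a. a) (\<lambda>b. BC.pure b \<one>\<^bsub>C\<^esub>)"
  define i3 where "i3 = (\<lambda>c. A_BC.pure \<one>\<^bsub>A\<^esub> (BC.pure \<one>\<^bsub>B\<^esub> c))"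
  have hb: "alg_hom B BC.T (\<lambda>b. BC.pure b \<one>\<^bsub>C\<^esub>)"
    by (rule alg_homI) (simp_all add: BC.pure_mult BC.pure_add_left BC.pure_smult_left tensor_alg_simps(1))
  note i12h = tensor_map_alg_hom [OF assms(1,2,1) BC.star_algebra_tensor star_hom_alg [OF star_hom_id] hb, folded i12_def]
  note i12p = tensor_map_pure [OF assms(1,2,1) BC.star_algebra_tensor alg_hom_linear [OF star_hom_alg [OF star_hom_id]] alg_hom_linear [OF hb], folded i12_def]
  have i3h: "alg_hom C A_BC.T i3"
    unfolding i3_def
    by (rule alg_homI) (simp_all add: BC.pure_mult A_BC.pure_mult BC.pure_add_right A_BC.pure_add_right
        BC.pure_smult_right A_BC.pure_smult_right tensor_alg_simps(1))
  have comm: "i12 s \<otimes>\<^bsub>A_BC.T\<^esub> i3 c = i3 c \<otimes>\<^bsub>A_BC.T\<^esub> i12 s" if "s \<in> carrier AB.T" "c \<in> carrier C" for s c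
    using that(1)
    by (induction rule: AB.tensor_induct)
      (use that(2) in \<open>simp_all add: i12p i3_def A_BC.pure_mult BC.pure_mult
         alg_homD [OF i12h] A_BC.T.l_distr A_BC.T.r_distr\<close>)
  note L = AB_C.tensor_lift_alg_hom [OF A_BC.star_algebra_tensor A_BC.separated_tensor i12h i3h comm]
  note Lp = AB_C.tensor_lift_pure [OF A_BC.star_algebra_tensor A_BC.separated_tensor
      AB_C.bilinear_mult [OF A_BC.star_algebra_tensor alg_hom_linear [OF i12h] alg_hom_linear [OF i3h]]]
  let ?L = "tensor_lift A_BC.T (\<lambda>s c. i12 s \<otimes>\<^bsub>A_BC.T\<^esub> i3 c)"
  have add: "tensor_assoc A B C (t \<oplus>\<^bsub>AB_C.T\<^esub> t') =
      tensor_assoc A B C t \<oplus>\<^bsub>A_BC.T\<^esub> tensor_assoc A B C t'" for t t'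
    by (auto simp: tensor_assoc_def tensor_alg_simps)
  have e1: "tensor_assoc A B C (AB_C.pure s c) = i12 s \<otimes>\<^bsub>A_BC.T\<^esub> i3 c"
    if "s \<in> carrier AB.T" "c \<in> carrier C" for s c
    using that(1)
    by (induction rule: AB.tensor_induct)
      (use that(2) in \<open>simp_all add: pp i12p i3_def A_BC.pure_mult BC.pure_mult
         alg_homD [OF i12h] A_BC.T.l_distr AB_C.pure_add_left add\<close>)
  have eq: "tensor_assoc A B C t = ?L t" if "t \<in> carrier AB_C.T" for t
    using that
    by (induction rule: AB_C.tensor_induct) (simp_all add: e1 Lp add alg_homD [OF L])
  show "alg_hom AB_C.T A_BC.T (tensor_assoc A B C)"
    by (rule alg_homI) (simp_all add: eq alg_homD [OF L])
qed

section \<open>Consequences of the \<open>SU\<^sub>q(3)\<close>-relations\<close>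

declare One_nat_def [simp del]

lemma foldSetD_cong:
  fixes D :: "'a set"
  assumes "(S, x) \<in> foldSetD D f e" "\<And>i. i \<in> S \<Longrightarrow> f i = g i"
  shows "(S, x) \<in> foldSetD D g e"
  using assms
proof induction
  case (insertI i S x)
  then show ?case using foldSetD.insertI [of i S g x D e] by auto
qed (rule foldSetD.emptyI)

text \<open>Unlike \<open>finsum_cong'\<close> this has no closedness premise, so the simplifier can rewrite under sums.\<close>

lemma finsum_scong:
  assumes "S = T" "\<And>i. i \<in> T =simp=> f i = g i"
  shows "finsum G f S = finsum G g T"
proof -
  have eq: "f i = g i" if "i \<in> T" for i using assms(2) that by (simp add: simp_implies_def)
  have "foldSetD (carrier G) (\<lambda>x y. f x \<oplus>\<^bsub>G\<^esub> y) \<zero>\<^bsub>G\<^esub> `` {T} = foldSetD (carrier G) (\<lambda>x y. g x \<oplus>\<^bsub>G\<^esub> y) \<zero>\<^bsub>G\<^esub> `` {T}"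
    by (auto intro: foldSetD_cong simp: eq)
  then have "foldD (carrier G) (\<lambda>x y. f x \<oplus>\<^bsub>G\<^esub> y) \<zero>\<^bsub>G\<^esub> T = foldD (carrier G) (\<lambda>x y. g x \<oplus>\<^bsub>G\<^esub> y) \<zero>\<^bsub>G\<^esub> T"
    by (simp add: foldD_def set_eq_iff)
  then show ?thesis by (simp add: assms(1) finsum_def finprod_def o_def)
qed

context star_algebra begin

lemmas finsum_expand = finsum_scal finsum_star finsum_mult_left finsum_mult_right Pi_iff
  scal_mult m_assoc star_smult star_mult

end

lemma is_unitary_matrixD:
  assumes "is_unitary_matrix A a" "i \<in> {1..3}" "j \<in> {1..3}"
  shows "(\<Oplus>\<^bsub>A\<^esub>k\<in>{1..3}. a i k \<otimes>\<^bsub>A\<^esub> star A (a j k)) = (if i = j then \<one>\<^bsub>A\<^esub> else \<zero>\<^bsub>A\<^esub>)"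
    "(\<Oplus>\<^bsub>A\<^esub>k\<in>{1..3}. star A (a k i) \<otimes>\<^bsub>A\<^esub> a k j) = (if i = j then \<one>\<^bsub>A\<^esub> else \<zero>\<^bsub>A\<^esub>)"
  using assms by (auto simp: is_unitary_matrix_def)

lemma star_hom_SUq3_sums:
  fixes A :: "('a, 'm) star_alg_scheme"
  assumes A: "star_algebra A" and B: "star_algebra B" and f: "star_hom A B f"
    and ca: "\<forall>i\<in>{1..3}. \<forall>j\<in>{1..3}. a i j \<in> carrier A"
  shows "i \<in> {1..3} \<Longrightarrow> j \<in> {1..3} \<Longrightarrow> f (\<Oplus>\<^bsub>A\<^esub>k\<in>{1..3}. a i k \<otimes>\<^bsub>A\<^esub> star A (a j k)) =
      (\<Oplus>\<^bsub>B\<^esub>k\<in>{1..3}. f (a i k) \<otimes>\<^bsub>B\<^esub> star B (f (a j k)))"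
    and "i \<in> {1..3} \<Longrightarrow> j \<in> {1..3} \<Longrightarrow> f (\<Oplus>\<^bsub>A\<^esub>k\<in>{1..3}. star A (a k i) \<otimes>\<^bsub>A\<^esub> a k j) =
      (\<Oplus>\<^bsub>B\<^esub>k\<in>{1..3}. star B (f (a k i)) \<otimes>\<^bsub>B\<^esub> f (a k j))"
    and "j1 \<in> {1..3} \<Longrightarrow> j2 \<in> {1..3} \<Longrightarrow> j3 \<in> {1..3} \<Longrightarrow>
      f (\<Oplus>\<^bsub>A\<^esub>i1\<in>{1..3}. \<Oplus>\<^bsub>A\<^esub>i2\<in>{1..3}. \<Oplus>\<^bsub>A\<^esub>i3\<in>{1..3}. E_tensor q i1 i2 i3 \<odot>\<^bsub>A\<^esub>
        (a j1 i1 \<otimes>\<^bsub>A\<^esub> a j2 i2 \<otimes>\<^bsub>A\<^esub> a j3 i3)) =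
      (\<Oplus>\<^bsub>B\<^esub>i1\<in>{1..3}. \<Oplus>\<^bsub>B\<^esub>i2\<in>{1..3}. \<Oplus>\<^bsub>B\<^esub>i3\<in>{1..3}. E_tensor q i1 i2 i3 \<odot>\<^bsub>B\<^esub>
        (f (a j1 i1) \<otimes>\<^bsub>B\<^esub> f (a j2 i2) \<otimes>\<^bsub>B\<^esub> f (a j3 i3)))"
proof -
  interpret A: star_algebra A by fact
  interpret B: star_algebra B by fact
  note fa = star_hom_alg [OF f]
  note h = alg_homD [OF fa] star_homD [OF f]
  have fs: "f (finsum A g S) = finsum B (\<lambda>i. f (g i)) S" if "g \<in> S \<rightarrow> carrier A"
    for g :: "nat \<Rightarrow> 'a" and S
    using linear_map_finsum [OF alg_hom_linear [OF fa] A B that] .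
  assume "i \<in> {1..3}" "j \<in> {1..3}"
  then show "f (\<Oplus>\<^bsub>A\<^esub>k\<in>{1..3}. a i k \<otimes>\<^bsub>A\<^esub> star A (a j k)) =
      (\<Oplus>\<^bsub>B\<^esub>k\<in>{1..3}. f (a i k) \<otimes>\<^bsub>B\<^esub> star B (f (a j k)))"
    and "f (\<Oplus>\<^bsub>A\<^esub>k\<in>{1..3}. star A (a k i) \<otimes>\<^bsub>A\<^esub> a k j) =
      (\<Oplus>\<^bsub>B\<^esub>k\<in>{1..3}. star B (f (a k i)) \<otimes>\<^bsub>B\<^esub> f (a k j))"
    by (simp_all add: fs ca h Pi_iff cong: finsum_scong)
next
  interpret A: star_algebra A by fact
  interpret B: star_algebra B by fact
  note fa = star_hom_alg [OF f]
  note h = alg_homD [OF fa]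
  have fs: "f (finsum A g S) = finsum B (\<lambda>i. f (g i)) S" if "g \<in> S \<rightarrow> carrier A"
    for g :: "nat \<Rightarrow> 'a" and S
    using linear_map_finsum [OF alg_hom_linear [OF fa] A B that] .
  assume "j1 \<in> {1..3}" "j2 \<in> {1..3}" "j3 \<in> {1..3}"
  then show "f (\<Oplus>\<^bsub>A\<^esub>i1\<in>{1..3}. \<Oplus>\<^bsub>A\<^esub>i2\<in>{1..3}. \<Oplus>\<^bsub>A\<^esub>i3\<in>{1..3}. E_tensor q i1 i2 i3 \<odot>\<^bsub>A\<^esub>
        (a j1 i1 \<otimes>\<^bsub>A\<^esub> a j2 i2 \<otimes>\<^bsub>A\<^esub> a j3 i3)) =
      (\<Oplus>\<^bsub>B\<^esub>i1\<in>{1..3}. \<Oplus>\<^bsub>B\<^esub>i2\<in>{1..3}. \<Oplus>\<^bsub>B\<^esub>i3\<in>{1..3}. E_tensor q i1 i2 i3 \<odot>\<^bsub>B\<^esub>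
        (f (a j1 i1) \<otimes>\<^bsub>B\<^esub> f (a j2 i2) \<otimes>\<^bsub>B\<^esub> f (a j3 i3)))"
    by (simp add: fs ca h Pi_iff cong: finsum_scong)
qed

text \<open>Relations can be tested along a jointly injective family of homomorphisms. For
  O(SU_q(3)) these are the evaluations at all representations, where the relations hold by the
  choice of the index set.\<close>

lemma SUq3_relations_jointly:
  assumes A: "star_algebra A" and B: "star_algebra B"
    and ca: "\<And>i j. i \<in> {1..3} \<Longrightarrow> j \<in> {1..3} \<Longrightarrow> a i j \<in> carrier A"
    and f: "\<And>f. f \<in> F \<Longrightarrow> star_hom A B f"
    and inj: "\<And>x y. x \<in> carrier A \<Longrightarrow> y \<in> carrier A \<Longrightarrow> (\<And>f. f \<in> F \<Longrightarrow> f x = f y) \<Longrightarrow> x = y"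
    and rel: "\<And>f. f \<in> F \<Longrightarrow> SUq3_relations q B (\<lambda>i j. f (a i j))"
  shows "SUq3_relations q A a"
proof -
  interpret A: star_algebra A by fact
  interpret B: star_algebra B by fact
  have "\<forall>i\<in>{1..3}. \<forall>j\<in>{1..3}. a i j \<in> carrier A" using ca by blast
  note sums = star_hom_SUq3_sums [OF A B f this]
  have fu: "f (if i = j then \<one>\<^bsub>A\<^esub> else \<zero>\<^bsub>A\<^esub>) = (if i = j then \<one>\<^bsub>B\<^esub> else \<zero>\<^bsub>B\<^esub>)" if "f \<in> F" for f and i j :: nat
    using alg_homD(5) [OF star_hom_alg [OF f [OF that]]]
      linear_map_zero [OF alg_hom_linear [OF star_hom_alg [OF f [OF that]]] A B] by simp
  have u: "is_unitary_matrix B (\<lambda>i j. f (a i j))" if "f \<in> F" for f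
    using rel [OF that] by (simp add: SUq3_relations_def)
  have "is_unitary_matrix A a"
    unfolding is_unitary_matrix_def
  proof (intro ballI conjI)
    fix i j :: nat assume ij: "i \<in> {1..3}" "j \<in> {1..3}"
    show "(\<Oplus>\<^bsub>A\<^esub>k\<in>{1..3}. a i k \<otimes>\<^bsub>A\<^esub> star A (a j k)) = (if i = j then \<one>\<^bsub>A\<^esub> else \<zero>\<^bsub>A\<^esub>)"
    proof (rule inj)
      fix g assume g: "g \<in> F"
      show "g (\<Oplus>\<^bsub>A\<^esub>k\<in>{1..3}. a i k \<otimes>\<^bsub>A\<^esub> star A (a j k)) = g (if i = j then \<one>\<^bsub>A\<^esub> else \<zero>\<^bsub>A\<^esub>)"
        unfolding fu [OF g] sums(1) [OF g ij] is_unitary_matrixD(1) [OF u [OF g] ij] ..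
    qed (use ij ca in simp_all)
    show "(\<Oplus>\<^bsub>A\<^esub>k\<in>{1..3}. star A (a k i) \<otimes>\<^bsub>A\<^esub> a k j) = (if i = j then \<one>\<^bsub>A\<^esub> else \<zero>\<^bsub>A\<^esub>)"
    proof (rule inj)
      fix g assume g: "g \<in> F"
      show "g (\<Oplus>\<^bsub>A\<^esub>k\<in>{1..3}. star A (a k i) \<otimes>\<^bsub>A\<^esub> a k j) = g (if i = j then \<one>\<^bsub>A\<^esub> else \<zero>\<^bsub>A\<^esub>)"
        unfolding fu [OF g] sums(2) [OF g ij] is_unitary_matrixD(2) [OF u [OF g] ij] ..
    qed (use ij ca in simp_all)
  qed
  moreover have "(\<Oplus>\<^bsub>A\<^esub>i1\<in>{1..3}. \<Oplus>\<^bsub>A\<^esub>i2\<in>{1..3}. \<Oplus>\<^bsub>A\<^esub>i3\<in>{1..3}. E_tensor q i1 i2 i3 \<odot>\<^bsub>A\<^esub>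
        (a j1 i1 \<otimes>\<^bsub>A\<^esub> a j2 i2 \<otimes>\<^bsub>A\<^esub> a j3 i3)) = E_tensor q j1 j2 j3 \<odot>\<^bsub>A\<^esub> \<one>\<^bsub>A\<^esub>"
    if j: "j1 \<in> {1..3}" "j2 \<in> {1..3}" "j3 \<in> {1..3}" for j1 j2 j3
  proof (rule inj)
    fix g assume g: "g \<in> F"
    note h = alg_homD [OF star_hom_alg [OF f [OF g]]]
    show "g (\<Oplus>\<^bsub>A\<^esub>i1\<in>{1..3}. \<Oplus>\<^bsub>A\<^esub>i2\<in>{1..3}. \<Oplus>\<^bsub>A\<^esub>i3\<in>{1..3}. E_tensor q i1 i2 i3 \<odot>\<^bsub>A\<^esub>
        (a j1 i1 \<otimes>\<^bsub>A\<^esub> a j2 i2 \<otimes>\<^bsub>A\<^esub> a j3 i3)) = g (E_tensor q j1 j2 j3 \<odot>\<^bsub>A\<^esub> \<one>\<^bsub>A\<^esub>)"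
      unfolding sums(3) [OF g j] using rel [OF g] j by (simp add: SUq3_relations_def h)
  qed (use ca j in simp_all)
  ultimately show ?thesis
    unfolding SUq3_relations_def using ca by (intro conjI ballI) blast+
qed

lemma SUq3_relations_hom:
  assumes A: "star_algebra A" and B: "star_algebra B" and f: "star_hom A B f"
    and a: "SUq3_relations q A a"
  shows "SUq3_relations q B (\<lambda>i j. f (a i j))"
proof -
  interpret A: star_algebra A by fact
  note fa = star_hom_alg [OF f]
  note h = alg_homD [OF fa] linear_map_zero [OF alg_hom_linear [OF fa] A B]
  have ca: "a i j \<in> carrier A" if "i \<in> {1..3}" "j \<in> {1..3}" for i j
    using a that by (auto simp: SUq3_relations_def)
  have u: "is_unitary_matrix A a" using a by (simp add: SUq3_relations_def)
  have "\<forall>i\<in>{1..3}. \<forall>j\<in>{1..3}. a i j \<in> carrier A" using ca by blast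
  note sums = star_hom_SUq3_sums [OF A B f this, symmetric]
  have U: "is_unitary_matrix B (\<lambda>i j. f (a i j))"
    unfolding is_unitary_matrix_def
  proof (intro ballI conjI)
    fix i j :: nat assume ij: "i \<in> {1..3}" "j \<in> {1..3}"
    show "(\<Oplus>\<^bsub>B\<^esub>k\<in>{1..3}. f (a i k) \<otimes>\<^bsub>B\<^esub> star B (f (a j k))) = (if i = j then \<one>\<^bsub>B\<^esub> else \<zero>\<^bsub>B\<^esub>)"
      unfolding sums(1) [OF ij] is_unitary_matrixD(1) [OF u ij] by (simp add: h)
    show "(\<Oplus>\<^bsub>B\<^esub>k\<in>{1..3}. star B (f (a k i)) \<otimes>\<^bsub>B\<^esub> f (a k j)) = (if i = j then \<one>\<^bsub>B\<^esub> else \<zero>\<^bsub>B\<^esub>)"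
      unfolding sums(2) [OF ij] is_unitary_matrixD(2) [OF u ij] by (simp add: h)
  qed
  have E: "(\<Oplus>\<^bsub>B\<^esub>i1\<in>{1..3}. \<Oplus>\<^bsub>B\<^esub>i2\<in>{1..3}. \<Oplus>\<^bsub>B\<^esub>i3\<in>{1..3}. E_tensor q i1 i2 i3 \<odot>\<^bsub>B\<^esub>
        (f (a j1 i1) \<otimes>\<^bsub>B\<^esub> f (a j2 i2) \<otimes>\<^bsub>B\<^esub> f (a j3 i3))) = E_tensor q j1 j2 j3 \<odot>\<^bsub>B\<^esub> \<one>\<^bsub>B\<^esub>"
    if j: "j1 \<in> {1..3}" "j2 \<in> {1..3}" "j3 \<in> {1..3}" for j1 j2 j3
    unfolding sums(3) [OF j] using a j by (simp add: SUq3_relations_def h)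
  show ?thesis
    unfolding SUq3_relations_def
  proof (intro conjI ballI)
    fix i j :: nat assume "i \<in> {1..3}" "j \<in> {1..3}"
    then show "f (a i j) \<in> carrier B" by (intro h(1) ca)
  qed (fact U, rule E)
qed

lemma SUq3_relations_cong:
  assumes "\<And>i j. i \<in> {1..3} \<Longrightarrow> j \<in> {1..3} \<Longrightarrow> a i j = b i j"
  shows "SUq3_relations q A a \<longleftrightarrow> SUq3_relations q A b"
  unfolding SUq3_relations_def is_unitary_matrix_def
  by (simp add: assms del: atLeastAtMost_iff cong: finsum_scong)

section \<open>Symmetries of the tensor \<open>E\<close>\<close>

lemma E_tensor_values:
  "E_tensor q 1 2 3 = 1" "E_tensor q 1 3 2 = - q" "E_tensor q 2 1 3 = - q"
  "E_tensor q 2 3 1 = q\<^sup>2" "E_tensor q 3 1 2 = q\<^sup>2" "E_tensor q 3 2 1 = - (q ^ 3)"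
  by (simp_all add: E_tensor_def inversions3_def)

lemma E_tensor_eq_0:
  "E_tensor q i i j = 0" "E_tensor q i j i = 0" "E_tensor q j i i = 0"
  by (simp_all add: E_tensor_def)

lemma cnj_E_tensor [simp]: "cnj (E_tensor q i j k) = E_tensor q i j k"
  by (simp add: E_tensor_def)

text \<open>Moving an index from the last to the first place of \<open>E\<close> costs \<open>q\<^bsup>2k-4\<^esup>\<close>; this weight is the
  modular factor in the two twisted unitarity relations below.\<close>

definition weight :: "real \<Rightarrow> nat \<Rightarrow> complex" where
  "weight q k = complex_of_real q powi (2 * int k - 4)"

lemma in_three: "i \<in> {1..3::nat} \<longleftrightarrow> i = 1 \<or> i = 2 \<or> i = 3" by auto

lemma weight_nonzero: "q \<noteq> 0 \<Longrightarrow> weight q k \<noteq> 0"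
  by (simp add: weight_def)

text \<open>For distinct indices, moving k from the last place to the first creates k - 1 inversions
  with smaller indices and removes 3 - k with larger ones. The net change 2k - 4 is even, so the
  sign of -q disappears.\<close>

lemma E_tensor_cyclic:
  assumes "q \<noteq> 0" "i \<in> {1..3}" "j \<in> {1..3}" "k \<in> {1..3}"
  shows "E_tensor q k i j = weight q k * E_tensor q i j k"
proof -
  have w: "weight q 1 = inverse (q\<^sup>2)" "weight q 2 = 1" "weight q 3 = q\<^sup>2"
    by (simp_all add: weight_def power_int_def power_inverse)
  show ?thesis
    using assms unfolding in_three
    by (elim disjE) (simp_all only: E_tensor_values E_tensor_eq_0 w, simp_all add: power2_eq_square power3_eq_cube field_simps)
qed

text \<open>With the two other indices fixed in increasing order, \<open>E\<close> becomes a nonzero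
  multiple of a delta in the free place. Contracting a minor identity with this pair isolates a
  single starred entry.\<close>

lemma E_tensor_complement:
  assumes "q \<noteq> 0" "j \<in> {1..3}"
  obtains m n where "m \<in> {1..3}" "n \<in> {1..3}" "E_tensor q m n j \<noteq> 0" "E_tensor q j m n \<noteq> 0"
    "\<And>k. k \<in> {1..3} \<Longrightarrow> k \<noteq> j \<Longrightarrow> E_tensor q m n k = 0"
    "\<And>k. k \<in> {1..3} \<Longrightarrow> k \<noteq> j \<Longrightarrow> E_tensor q k m n = 0"
proof -
  consider "j = 1" | "j = 2" | "j = 3" using assms(2) by fastforce
  then show ?thesis
  proof cases
    case 1
    show ?thesis
      by (rule that [of 2 3]) (use 1 assms(1) in \<open>auto simp: E_tensor_def in_three\<close>)
  next
    case 2
    show ?thesis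
      by (rule that [of 1 3]) (use 2 assms(1) in \<open>auto simp: E_tensor_def in_three\<close>)
  next
    case 3
    show ?thesis
      by (rule that [of 1 2]) (use 3 assms(1) in \<open>auto simp: E_tensor_def in_three\<close>)
  qed
qed

section \<open>Cofactor formulas and twisted unitarity\<close>

locale SUq3_matrix = star_algebra A for A :: "('a, 'm) star_alg_scheme" (structure) +
  fixes q :: real and a :: "nat \<Rightarrow> nat \<Rightarrow> 'a"
  assumes q_pos: "0 < q" and rel: "SUq3_relations q A a"
begin

lemma q_nz: "q \<noteq> 0" using q_pos by simp

lemma entry [simp]: "i \<in> {1..3} \<Longrightarrow> j \<in> {1..3} \<Longrightarrow> a i j \<in> carrier A"
  using rel by (auto simp: SUq3_relations_def)

lemma unitary: "is_unitary_matrix A a"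
  using rel by (simp add: SUq3_relations_def)

lemmas row_unitary = is_unitary_matrixD(1) [OF unitary]
lemmas col_unitary = is_unitary_matrixD(2) [OF unitary]

lemma E_rel:
  "j1 \<in> {1..3} \<Longrightarrow> j2 \<in> {1..3} \<Longrightarrow> j3 \<in> {1..3} \<Longrightarrow>
   (\<Oplus>i1\<in>{1..3}. \<Oplus>i2\<in>{1..3}. \<Oplus>i3\<in>{1..3}. E_tensor q i1 i2 i3 \<odot> (a j1 i1 \<otimes> a j2 i2 \<otimes> a j3 i3)) =
   E_tensor q j1 j2 j3 \<odot> \<one>"
  using rel by (auto simp: SUq3_relations_def)

text \<open>Multiplication by the adjoint matrix from the left and summation over rows leaves
  \<open>F k\<close>, by unitarity of the columns.\<close>

lemma solve_left:
  assumes F: "\<And>i. i \<in> {1..3} \<Longrightarrow> F i \<in> carrier A"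
    and eq: "\<And>j. j \<in> {1..3} \<Longrightarrow> (\<Oplus>i\<in>{1..3}. a j i \<otimes> F i) = G j"
    and k: "k \<in> {1..3}"
  shows "F k = (\<Oplus>j\<in>{1..3}. star A (a j k) \<otimes> G j)"
proof -
  have "(\<Oplus>j\<in>{1..3}. star A (a j k) \<otimes> G j) = (\<Oplus>j\<in>{1..3}. \<Oplus>i\<in>{1..3}. star A (a j k) \<otimes> a j i \<otimes> F i)"
  proof (rule finsum_cong')
    fix j :: nat assume j: "j \<in> {1..3}"
    show "star A (a j k) \<otimes> G j = (\<Oplus>i\<in>{1..3}. star A (a j k) \<otimes> a j i \<otimes> F i)"
      unfolding eq [OF j, symmetric]
      using j k F by (subst finsum_mult_left) (auto intro!: finsum_cong' simp: m_assoc)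
  qed (use F k in auto)
  also have "\<dots> = (\<Oplus>i\<in>{1..3}. \<Oplus>j\<in>{1..3}. star A (a j k) \<otimes> a j i \<otimes> F i)"
    using F k by (intro finsum_swap) auto
  also have "\<dots> = (\<Oplus>i\<in>{1..3}. (\<Oplus>j\<in>{1..3}. star A (a j k) \<otimes> a j i) \<otimes> F i)"
    using F k by (simp add: finsum_expand cong: finsum_scong)
  also have "\<dots> = (\<Oplus>i\<in>{1..3}. if k = i then F i else \<zero>)"
    using F k by (intro finsum_cong' HOL.refl) (auto simp: col_unitary simp del: atLeastAtMost_iff)
  also have "\<dots> = F k" using F k by (subst finsum_singleton) auto
  finally show ?thesis by simp
qed

text \<open>Mirror image of \<open>solve_left\<close>: the adjoint matrix is applied from the right
  and unitarity of the rows is used.\<close>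

lemma solve_right:
  assumes F: "\<And>i. i \<in> {1..3} \<Longrightarrow> F i \<in> carrier A"
    and eq: "\<And>j. j \<in> {1..3} \<Longrightarrow> (\<Oplus>i\<in>{1..3}. F i \<otimes> a i j) = G j"
    and k: "k \<in> {1..3}"
  shows "F k = (\<Oplus>j\<in>{1..3}. G j \<otimes> star A (a k j))"
proof -
  have "(\<Oplus>j\<in>{1..3}. G j \<otimes> star A (a k j)) = (\<Oplus>j\<in>{1..3}. \<Oplus>i\<in>{1..3}. F i \<otimes> (a i j \<otimes> star A (a k j)))"
  proof (rule finsum_cong')
    fix j :: nat assume j: "j \<in> {1..3}"
    show "G j \<otimes> star A (a k j) = (\<Oplus>i\<in>{1..3}. F i \<otimes> (a i j \<otimes> star A (a k j)))"
      unfolding eq [OF j, symmetric]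
      using j k F by (subst finsum_mult_right) (auto intro!: finsum_cong' simp: m_assoc)
  qed (use F k in auto)
  also have "\<dots> = (\<Oplus>i\<in>{1..3}. \<Oplus>j\<in>{1..3}. F i \<otimes> (a i j \<otimes> star A (a k j)))"
    using F k by (intro finsum_swap) auto
  also have "\<dots> = (\<Oplus>i\<in>{1..3}. F i \<otimes> (\<Oplus>j\<in>{1..3}. a i j \<otimes> star A (a k j)))"
    using F k by (simp add: finsum_expand cong: finsum_scong)
  also have "\<dots> = (\<Oplus>i\<in>{1..3}. if k = i then F i else \<zero>)"
    using F k by (intro finsum_cong' HOL.refl) (auto simp: row_unitary simp del: atLeastAtMost_iff)
  also have "\<dots> = F k" using F k by (subst finsum_singleton) auto
  finally show ?thesis by simp
qed

text \<open>Quantum cofactor formula. The determinant relation is a linear system for the part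
  without its first factor; solving it trades that factor for a starred entry on the other
  side.\<close>

lemma minor_left:
  assumes k: "k \<in> {1..3}" and j: "j2 \<in> {1..3}" "j3 \<in> {1..3}"
  shows "(\<Oplus>i2\<in>{1..3}. \<Oplus>i3\<in>{1..3}. E_tensor q k i2 i3 \<odot> (a j2 i2 \<otimes> a j3 i3)) =
         (\<Oplus>j1\<in>{1..3}. E_tensor q j1 j2 j3 \<odot> star A (a j1 k))"
proof -
  have "(\<Oplus>i2\<in>{1..3}. \<Oplus>i3\<in>{1..3}. E_tensor q k i2 i3 \<odot> (a j2 i2 \<otimes> a j3 i3)) =
      (\<Oplus>j1\<in>{1..3}. star A (a j1 k) \<otimes> (E_tensor q j1 j2 j3 \<odot> \<one>))"
  proof (rule solve_left [OF _ _ k])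
    fix j1 :: nat assume j1: "j1 \<in> {1..3}"
    have "(\<Oplus>i\<in>{1..3}. a j1 i \<otimes> (\<Oplus>i2\<in>{1..3}. \<Oplus>i3\<in>{1..3}. E_tensor q i i2 i3 \<odot> (a j2 i2 \<otimes> a j3 i3))) =
      (\<Oplus>i1\<in>{1..3}. \<Oplus>i2\<in>{1..3}. \<Oplus>i3\<in>{1..3}. E_tensor q i1 i2 i3 \<odot> (a j1 i1 \<otimes> a j2 i2 \<otimes> a j3 i3))"
      using j1 j by (simp add: finsum_expand cong: finsum_scong)
    then show "(\<Oplus>i\<in>{1..3}. a j1 i \<otimes> (\<Oplus>i2\<in>{1..3}. \<Oplus>i3\<in>{1..3}. E_tensor q i i2 i3 \<odot> (a j2 i2 \<otimes> a j3 i3))) =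
        E_tensor q j1 j2 j3 \<odot> \<one>"
      using E_rel j1 j by simp
  qed (use j in simp)
  also have "\<dots> = (\<Oplus>j1\<in>{1..3}. E_tensor q j1 j2 j3 \<odot> star A (a j1 k))"
    using k by (simp add: scal_mult cong: finsum_scong)
  finally show ?thesis .
qed

text \<open>The three factors of the determinant relation are moved across one after the other, so
  that a number appears as a nested sum of starred entries. The adjoint of that identity is the
  determinant relation with rows and columns exchanged.\<close>

lemma transposed_E_nested:
  assumes k: "k1 \<in> {1..3}" "k2 \<in> {1..3}" "k3 \<in> {1..3}"
  shows "(\<Oplus>j3\<in>{1..3}. (\<Oplus>j2\<in>{1..3}. (\<Oplus>j1\<in>{1..3}. E_tensor q j1 j2 j3 \<odot> a j1 k1) \<otimes> a j2 k2) \<otimes> a j3 k3) =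
         E_tensor q k1 k2 k3 \<odot> \<one>"
proof -
  \<comment> \<open>The first factor has already been moved in \<open>minor_left\<close>; here the
    second follows, with the nesting chosen so that \<open>solve_left\<close> applies again.\<close>
  have s2: "(\<Oplus>i3\<in>{1..3}. E_tensor q k1 k2 i3 \<odot> a j3 i3) =
      (\<Oplus>j2\<in>{1..3}. star A (a j2 k2) \<otimes> (\<Oplus>j1\<in>{1..3}. E_tensor q j1 j2 j3 \<odot> star A (a j1 k1)))"
    if j3: "j3 \<in> {1..3}" for j3
  proof (rule solve_left [OF _ _ k(2)])
    fix j2 :: nat assume j2: "j2 \<in> {1..3}"
    have "(\<Oplus>i\<in>{1..3}. a j2 i \<otimes> (\<Oplus>i3\<in>{1..3}. E_tensor q k1 i i3 \<odot> a j3 i3)) =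
        (\<Oplus>i2\<in>{1..3}. \<Oplus>i3\<in>{1..3}. E_tensor q k1 i2 i3 \<odot> (a j2 i2 \<otimes> a j3 i3))"
      using j2 j3 by (simp add: finsum_expand cong: finsum_scong)
    then show "(\<Oplus>i\<in>{1..3}. a j2 i \<otimes> (\<Oplus>i3\<in>{1..3}. E_tensor q k1 i i3 \<odot> a j3 i3)) =
        (\<Oplus>j1\<in>{1..3}. E_tensor q j1 j2 j3 \<odot> star A (a j1 k1))"
      using minor_left k(1) j2 j3 by simp
  qed (use j3 in simp)
  have s3: "E_tensor q k1 k2 k3 \<odot> \<one> = (\<Oplus>j3\<in>{1..3}. star A (a j3 k3) \<otimes>
      (\<Oplus>j2\<in>{1..3}. star A (a j2 k2) \<otimes> (\<Oplus>j1\<in>{1..3}. E_tensor q j1 j2 j3 \<odot> star A (a j1 k1))))"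
  proof (rule solve_left [OF _ _ k(3)])
    fix j3 :: nat assume j3: "j3 \<in> {1..3}"
    have "(\<Oplus>i\<in>{1..3}. a j3 i \<otimes> (E_tensor q k1 k2 i \<odot> \<one>)) = (\<Oplus>i3\<in>{1..3}. E_tensor q k1 k2 i3 \<odot> a j3 i3)"
      using j3 by (simp add: scal_mult cong: finsum_scong)
    then show "(\<Oplus>i\<in>{1..3}. a j3 i \<otimes> (E_tensor q k1 k2 i \<odot> \<one>)) =
      (\<Oplus>j2\<in>{1..3}. star A (a j2 k2) \<otimes> (\<Oplus>j1\<in>{1..3}. E_tensor q j1 j2 j3 \<odot> star A (a j1 k1)))"
      using s2 [OF j3] by simp
  qed auto
  \<comment> \<open>Taking adjoints restores the order 1, 2, 3 of the factors and keeps the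
    coefficients, as \<open>E\<close> is real.\<close>
  have "star A (E_tensor q k1 k2 k3 \<odot> \<one>) =
    (\<Oplus>j3\<in>{1..3}. (\<Oplus>j2\<in>{1..3}. (\<Oplus>j1\<in>{1..3}. E_tensor q j1 j2 j3 \<odot> a j1 k1) \<otimes> a j2 k2) \<otimes> a j3 k3)"
    unfolding s3 using k by (simp add: finsum_expand cong: finsum_scong)
  then show ?thesis by (simp add: star_smult)
qed

text \<open>Second cofactor formula, from the transposed relation: now only the last factor is moved
  across, to the right.\<close>

lemma minor_right:
  assumes m: "m \<in> {1..3}" and k: "k1 \<in> {1..3}" "k2 \<in> {1..3}"
  shows "(\<Oplus>j2\<in>{1..3}. (\<Oplus>j1\<in>{1..3}. E_tensor q j1 j2 m \<odot> a j1 k1) \<otimes> a j2 k2) =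
         (\<Oplus>k3\<in>{1..3}. E_tensor q k1 k2 k3 \<odot> star A (a m k3))"
proof -
  have "(\<Oplus>j2\<in>{1..3}. (\<Oplus>j1\<in>{1..3}. E_tensor q j1 j2 m \<odot> a j1 k1) \<otimes> a j2 k2) =
      (\<Oplus>k3\<in>{1..3}. (E_tensor q k1 k2 k3 \<odot> \<one>) \<otimes> star A (a m k3))"
    using k by (intro solve_right [OF _ _ m] transposed_E_nested) simp_all
  also have "\<dots> = (\<Oplus>k3\<in>{1..3}. E_tensor q k1 k2 k3 \<odot> star A (a m k3))"
    using m by (simp add: scal_mult cong: finsum_scong)
  finally show ?thesis .
qed

lemma transposed_E_rel:
  assumes k: "k1 \<in> {1..3}" "k2 \<in> {1..3}" "k3 \<in> {1..3}"
  shows "(\<Oplus>j1\<in>{1..3}. \<Oplus>j2\<in>{1..3}. \<Oplus>j3\<in>{1..3}. E_tensor q j1 j2 j3 \<odot> (a j1 k1 \<otimes> a j2 k2 \<otimes> a j3 k3)) =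
         E_tensor q k1 k2 k3 \<odot> \<one>"
proof -
  have "E_tensor q k1 k2 k3 \<odot> \<one> =
    (\<Oplus>j3\<in>{1..3}. \<Oplus>j2\<in>{1..3}. \<Oplus>j1\<in>{1..3}. E_tensor q j1 j2 j3 \<odot> (a j1 k1 \<otimes> a j2 k2 \<otimes> a j3 k3))"
    unfolding transposed_E_nested [OF k, symmetric] using k by (simp add: finsum_expand cong: finsum_scong)
  also have "\<dots> = (\<Oplus>j3\<in>{1..3}. \<Oplus>j1\<in>{1..3}. \<Oplus>j2\<in>{1..3}. E_tensor q j1 j2 j3 \<odot> (a j1 k1 \<otimes> a j2 k2 \<otimes> a j3 k3))"
    using k by (intro finsum_scong [unfolded simp_implies_def] HOL.refl finsum_swap finite_atLeastAtMost) simp_all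
  also have "\<dots> = (\<Oplus>j1\<in>{1..3}. \<Oplus>j3\<in>{1..3}. \<Oplus>j2\<in>{1..3}. E_tensor q j1 j2 j3 \<odot> (a j1 k1 \<otimes> a j2 k2 \<otimes> a j3 k3))"
    using k by (intro finsum_swap finite_atLeastAtMost) simp_all
  also have "\<dots> = (\<Oplus>j1\<in>{1..3}. \<Oplus>j2\<in>{1..3}. \<Oplus>j3\<in>{1..3}. E_tensor q j1 j2 j3 \<odot> (a j1 k1 \<otimes> a j2 k2 \<otimes> a j3 k3))"
    using k by (intro finsum_scong [unfolded simp_implies_def] HOL.refl finsum_swap finite_atLeastAtMost) simp_all
  finally show ?thesis by simp
qed

text \<open>By \<open>minor_right\<close> the starred entry is a minor whose row index k stands last
  in \<open>E\<close>. The weight moves k to the first place, where the transposed determinant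
  relation sums everything up.\<close>

lemma twisted_unitary_col:
  assumes i: "i \<in> {1..3}" and j: "j \<in> {1..3}"
  shows "(\<Oplus>k\<in>{1..3}. weight q k \<odot> (a k i \<otimes> star A (a k j))) = (if i = j then weight q j \<odot> \<one> else \<zero>)"
proof -
  obtain m n where m: "m \<in> {1..3}" and n: "n \<in> {1..3}" and nz: "E_tensor q m n j \<noteq> 0"
    and z: "\<And>k. k \<in> {1..3} \<Longrightarrow> k \<noteq> j \<Longrightarrow> E_tensor q m n k = 0"
    and z': "\<And>k. k \<in> {1..3} \<Longrightarrow> k \<noteq> j \<Longrightarrow> E_tensor q k m n = 0"
    using E_tensor_complement [OF q_nz j] by metis
  have st: "E_tensor q m n j \<odot> star A (a k j) =
      (\<Oplus>j2\<in>{1..3}. (\<Oplus>j1\<in>{1..3}. E_tensor q j1 j2 k \<odot> a j1 m) \<otimes> a j2 n)"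
    if k: "k \<in> {1..3}" for k
    unfolding minor_right [OF k m n] using j k z
    by (intro finsum_delta [symmetric]) auto
  have cyc: "weight q k * E_tensor q x y k = E_tensor q k x y"
    if "k \<in> {1..3}" "x \<in> {1..3}" "y \<in> {1..3}" for k x y
    using E_tensor_cyclic [OF q_nz that(2,3,1)] by simp
  have "E_tensor q m n j \<odot> (\<Oplus>k\<in>{1..3}. weight q k \<odot> (a k i \<otimes> star A (a k j))) =
      (\<Oplus>k\<in>{1..3}. weight q k \<odot> (a k i \<otimes> (E_tensor q m n j \<odot> star A (a k j))))"
    using i j by (simp add: finsum_expand mult.commute cong: finsum_scong)
  also have "\<dots> = (\<Oplus>k\<in>{1..3}. \<Oplus>j2\<in>{1..3}. \<Oplus>j1\<in>{1..3}. E_tensor q k j1 j2 \<odot> (a k i \<otimes> a j1 m \<otimes> a j2 n))"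
    using i m n by (simp add: finsum_expand st cyc cong: finsum_scong)
  also have "\<dots> = (\<Oplus>k\<in>{1..3}. \<Oplus>j1\<in>{1..3}. \<Oplus>j2\<in>{1..3}. E_tensor q k j1 j2 \<odot> (a k i \<otimes> a j1 m \<otimes> a j2 n))"
    using i m n by (intro finsum_scong [unfolded simp_implies_def] HOL.refl finsum_swap finite_atLeastAtMost) simp_all
  also have "\<dots> = E_tensor q i m n \<odot> \<one>"
    by (rule transposed_E_rel [OF i m n])
  also have "\<dots> = E_tensor q m n j \<odot> (if i = j then weight q j \<odot> \<one> else \<zero>)"
    using z' [OF i] E_tensor_cyclic [OF q_nz m n j] by (auto simp: mult.commute)
  finally show ?thesis
    by (rule scal_cancel [OF _ _ nz, rotated 2]) (use i j in auto)
qed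

text \<open>Here the starred entry comes from \<open>minor_left\<close>, with its column index k in
  the first place of \<open>E\<close>. The inverse weight moves k to the last place and the original
  determinant relation applies.\<close>

lemma twisted_unitary_row:
  assumes i: "i \<in> {1..3}" and j: "j \<in> {1..3}"
  shows "(\<Oplus>k\<in>{1..3}. inverse (weight q k) \<odot> (star A (a j k) \<otimes> a i k)) =
    (if i = j then inverse (weight q j) \<odot> \<one> else \<zero>)"
proof -
  obtain m n where m: "m \<in> {1..3}" and n: "n \<in> {1..3}" and nz: "E_tensor q j m n \<noteq> 0"
    and z: "\<And>k. k \<in> {1..3} \<Longrightarrow> k \<noteq> j \<Longrightarrow> E_tensor q m n k = 0"
    and z': "\<And>k. k \<in> {1..3} \<Longrightarrow> k \<noteq> j \<Longrightarrow> E_tensor q k m n = 0"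
    using E_tensor_complement [OF q_nz j] by metis
  have cyc: "inverse (weight q k) * E_tensor q k x y = E_tensor q x y k"
    if "k \<in> {1..3}" "x \<in> {1..3}" "y \<in> {1..3}" for k x y
    using E_tensor_cyclic [OF q_nz that(2,3,1)] weight_nonzero [OF q_nz] by simp
  have st: "E_tensor q j m n \<odot> star A (a j k) =
      (\<Oplus>i2\<in>{1..3}. \<Oplus>i3\<in>{1..3}. E_tensor q k i2 i3 \<odot> (a m i2 \<otimes> a n i3))"
    if k: "k \<in> {1..3}" for k
    unfolding minor_left [OF k m n] using j k z'
    by (intro finsum_delta [symmetric]) auto
  have "E_tensor q j m n \<odot> (\<Oplus>k\<in>{1..3}. inverse (weight q k) \<odot> (star A (a j k) \<otimes> a i k)) =
      (\<Oplus>k\<in>{1..3}. inverse (weight q k) \<odot> ((E_tensor q j m n \<odot> star A (a j k)) \<otimes> a i k))"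
    using i j by (simp add: finsum_expand mult.commute cong: finsum_scong)
  also have "\<dots> = (\<Oplus>k\<in>{1..3}. \<Oplus>i2\<in>{1..3}. \<Oplus>i3\<in>{1..3}. E_tensor q i2 i3 k \<odot> (a m i2 \<otimes> a n i3 \<otimes> a i k))"
    using i m n by (simp add: finsum_expand st cyc cong: finsum_scong)
  also have "\<dots> = (\<Oplus>i2\<in>{1..3}. \<Oplus>k\<in>{1..3}. \<Oplus>i3\<in>{1..3}. E_tensor q i2 i3 k \<odot> (a m i2 \<otimes> a n i3 \<otimes> a i k))"
    using i m n by (intro finsum_swap finite_atLeastAtMost) simp_all
  also have "\<dots> = (\<Oplus>i2\<in>{1..3}. \<Oplus>i3\<in>{1..3}. \<Oplus>k\<in>{1..3}. E_tensor q i2 i3 k \<odot> (a m i2 \<otimes> a n i3 \<otimes> a i k))"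
    using i m n by (intro finsum_scong [unfolded simp_implies_def] HOL.refl finsum_swap finite_atLeastAtMost) simp_all
  also have "\<dots> = E_tensor q m n i \<odot> \<one>"
    by (rule E_rel [OF m n i])
  also have "\<dots> = E_tensor q j m n \<odot> (if i = j then inverse (weight q j) \<odot> \<one> else \<zero>)"
    using z [OF i] cyc [OF j m n] by (auto simp: mult.commute)
  finally show ?thesis
    by (rule scal_cancel [OF _ _ nz, rotated 2]) (use i j in auto)
qed

text \<open>The two complementary rows in \<open>minor_left\<close> leave one starred entry, which
  is thus a quadratic polynomial in the entries. This makes the algebra generated without
  \<open>star\<close> a star algebra.\<close>

lemma star_entry_generated:
  assumes j: "j \<in> {1..3}" and k: "k \<in> {1..3}"
  shows "star A (a j k) \<in> generated_alg A {a i j |i j. i \<in> {1..3} \<and> j \<in> {1..3}}" (is "_ \<in> generated_alg A ?X")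
proof -
  obtain m n where m: "m \<in> {1..3}" and n: "n \<in> {1..3}" and nz: "E_tensor q j m n \<noteq> 0"
    and z': "\<And>k. k \<in> {1..3} \<Longrightarrow> k \<noteq> j \<Longrightarrow> E_tensor q k m n = 0"
    using E_tensor_complement [OF q_nz j] by metis
  have X: "?X \<subseteq> carrier A" by auto
  have "E_tensor q j m n \<odot> star A (a j k) =
      (\<Oplus>i2\<in>{1..3}. \<Oplus>i3\<in>{1..3}. E_tensor q k i2 i3 \<odot> (a m i2 \<otimes> a n i3))"
    unfolding minor_left [OF k m n] using j k z'
    by (intro finsum_delta [symmetric]) auto
  also have "\<dots> \<in> generated_alg A ?X"
    using m n by (intro generated_finsum X generated_alg.smult generated_alg.mult generated_alg.incl) blast+
  finally have "inverse (E_tensor q j m n) \<odot> (E_tensor q j m n \<odot> star A (a j k)) \<in> generated_alg A ?X"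
    by (rule generated_alg.smult)
  with nz j k show ?thesis by simp
qed

end

text \<open>The entries are the images of \<open>a\<^sub>i\<^sub>j\<close> under the unitary antipode.\<close>

lemma SUq3_relations_opposite:
  fixes A :: "('a, 'm) star_alg_scheme" (structure)
  assumes "SUq3_matrix A q a"
  shows "SUq3_relations q (opposite A)
    (\<lambda>i j. (complex_of_real q powi (int j - int i)) \<odot>\<^bsub>A\<^esub> star A (a j i))" (is "SUq3_relations q _ ?b")
proof -
  interpret SUq3_matrix A q a by fact
  let ?p = "\<lambda>n::int. complex_of_real q powi n"
  have padd: "?p m * ?p n = ?p (m + n)" for m n using q_nz by (simp add: power_int_add)
  \<comment> \<open>The exponents are split so that the part containing the summation index k is the
    weight of the twisted unitarity relation. The other part leaves the sum, and for i = j it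
    cancels the weight on the right-hand side.\<close>
  have pw: "?p (int k - int i) * ?p (int k - int j) = ?p (4 - int i - int j) * weight q k" for i j k
    by (simp add: padd weight_def algebra_simps)
  have pw': "?p (int i - int k) * ?p (int j - int k) = ?p (int i + int j - 4) * inverse (weight q k)" for i j k
    by (simp add: padd weight_def power_int_minus [symmetric] algebra_simps)
  have cp: "cnj (?p n) = ?p n" for n by (cases n rule: int_cases2) (simp_all add: power_int_minus)
  have u: "is_unitary_matrix (opposite A) ?b"
    unfolding is_unitary_matrix_def
  proof (intro ballI conjI)
    fix i j :: nat assume ij: "i \<in> {1..3}" "j \<in> {1..3}"
    have "(\<Oplus>k\<in>{1..3}. star A (?b j k) \<otimes> ?b i k) =
        (\<Oplus>k\<in>{1..3}. ?p (4 - int i - int j) \<odot> (weight q k \<odot> (a k j \<otimes> star A (a k i))))"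
      using ij by (simp add: star_smult cp scal_mult pw cong: finsum_scong)
    also have "\<dots> = ?p (4 - int i - int j) \<odot> (\<Oplus>k\<in>{1..3}. weight q k \<odot> (a k j \<otimes> star A (a k i)))"
      using ij by (intro finsum_scal [symmetric]) auto
    also have "\<dots> = (if i = j then \<one> else \<zero>)"
      unfolding twisted_unitary_col [OF ij(2,1)] using q_nz by (auto simp: weight_def padd)
    finally show "(\<Oplus>\<^bsub>opposite A\<^esub>k\<in>{1..3}. ?b i k \<otimes>\<^bsub>opposite A\<^esub> star (opposite A) (?b j k)) =
        (if i = j then \<one>\<^bsub>opposite A\<^esub> else \<zero>\<^bsub>opposite A\<^esub>)" by simp
    have "(\<Oplus>k\<in>{1..3}. ?b k j \<otimes> star A (?b k i)) =
        (\<Oplus>k\<in>{1..3}. ?p (int i + int j - 4) \<odot> (inverse (weight q k) \<odot> (star A (a j k) \<otimes> a i k)))"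
      using ij by (simp add: star_smult cp scal_mult pw' cong: finsum_scong)
    also have "\<dots> = ?p (int i + int j - 4) \<odot> (\<Oplus>k\<in>{1..3}. inverse (weight q k) \<odot> (star A (a j k) \<otimes> a i k))"
      using ij by (intro finsum_scal [symmetric]) auto
    also have "\<dots> = (if i = j then \<one> else \<zero>)"
      unfolding twisted_unitary_row [OF ij] using q_nz
      by (auto simp: weight_def padd power_int_minus [symmetric])
    finally show "(\<Oplus>\<^bsub>opposite A\<^esub>k\<in>{1..3}. star (opposite A) (?b k i) \<otimes>\<^bsub>opposite A\<^esub> ?b k j) =
        (if i = j then \<one>\<^bsub>opposite A\<^esub> else \<zero>\<^bsub>opposite A\<^esub>)" by simp
  qed
  have E: "(\<Oplus>i1\<in>{1..3}. \<Oplus>i2\<in>{1..3}. \<Oplus>i3\<in>{1..3}. E_tensor q i1 i2 i3 \<odot>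
      (?b j3 i3 \<otimes> (?b j2 i2 \<otimes> ?b j1 i1))) = E_tensor q j1 j2 j3 \<odot> \<one>"
    if j: "j1 \<in> {1..3}" "j2 \<in> {1..3}" "j3 \<in> {1..3}" for j1 j2 j3
  proof -
    let ?c = "?p (6 - int j1 - int j2 - int j3)"
    \<comment> \<open>Distinct indices sum to 6, so the total power of q is independent of the
      summation; for all other triples both sides contain the factor \<open>E = 0\<close>.\<close>
    have c: "E_tensor q i1 i2 i3 * (?p (int i1 - int j1) * (?p (int i2 - int j2) * ?p (int i3 - int j3))) =
        ?c * E_tensor q i1 i2 i3"
      if "i1 \<in> {1..3}" "i2 \<in> {1..3}" "i3 \<in> {1..3}" for i1 i2 i3
    proof (cases "distinct [i1, i2, i3]")
      case True
      with that have "int i1 + int i2 + int i3 = 6" by (auto simp: in_three)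
      then have e: "(int i1 - int j1) + ((int i2 - int j2) + (int i3 - int j3)) = 6 - int j1 - int j2 - int j3"
        by simp
      show ?thesis unfolding padd e by (rule mult.commute)
    qed (auto simp: E_tensor_def)
    \<comment> \<open>Products in the opposite algebra read backwards, so up to a power of q this is
      the adjoint of the transposed determinant relation.\<close>
    have "(\<Oplus>i1\<in>{1..3}. \<Oplus>i2\<in>{1..3}. \<Oplus>i3\<in>{1..3}. E_tensor q i1 i2 i3 \<odot> (?b j3 i3 \<otimes> (?b j2 i2 \<otimes> ?b j1 i1))) =
      ?c \<odot> star A (\<Oplus>i1\<in>{1..3}. \<Oplus>i2\<in>{1..3}. \<Oplus>i3\<in>{1..3}. E_tensor q i1 i2 i3 \<odot> (a i1 j1 \<otimes> a i2 j2 \<otimes> a i3 j3))"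
      using j by (simp add: finsum_expand c mult.assoc cong: finsum_scong)
    also have "\<dots> = ?c \<odot> (E_tensor q j1 j2 j3 \<odot> \<one>)"
      by (simp add: transposed_E_rel [OF j] star_smult)
    also have "\<dots> = E_tensor q j1 j2 j3 \<odot> \<one>"
    \<comment> \<open>The remaining power of q is 1 exactly in the case where \<open>E\<close> can
      be nonzero.\<close>
    proof (cases "distinct [j1, j2, j3]")
      case True
      with j have "int j1 + int j2 + int j3 = 6" by (auto simp: in_three)
      then have "6 - int j1 - int j2 - int j3 = 0" by simp
      then show ?thesis by simp
    qed (auto simp: E_tensor_def)
    finally show ?thesis .
  qed
  show ?thesis
    unfolding SUq3_relations_def
    by (intro conjI ballI u) (use E in auto)
qed

section \<open>Products of solutions and diagonal solutions\<close>

context star_algebra begin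

lemma finsum_prod:
  assumes "finite S" "finite T" "\<And>i j. i \<in> S \<Longrightarrow> j \<in> T \<Longrightarrow> f i j \<in> carrier A"
  shows "(\<Oplus>i\<in>S. \<Oplus>j\<in>T. f i j) = (\<Oplus>p\<in>S \<times> T. f (fst p) (snd p))"
  using assms(1,3)
proof (induction S)
  case (insert i S)
  have "(\<Oplus>p\<in>insert i S \<times> T. f (fst p) (snd p)) = (\<Oplus>p\<in>Pair i ` T \<union> S \<times> T. f (fst p) (snd p))"
    by (rule arg_cong [of _ _ "finsum A _"]) auto
  also have "\<dots> = (\<Oplus>p\<in>Pair i ` T. f (fst p) (snd p)) \<oplus> (\<Oplus>p\<in>S \<times> T. f (fst p) (snd p))"
    using insert assms(2) by (intro finsum_Un_disjoint) auto
  also have "(\<Oplus>p\<in>Pair i ` T. f (fst p) (snd p)) = (\<Oplus>j\<in>T. f i j)"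
    using insert by (subst finsum_reindex) (auto simp: inj_on_def)
  finally show ?case
    using insert by (subst finsum_insert) auto
qed simp

lemma eq_of_add_zero:
  "x \<in> carrier A \<Longrightarrow> y \<in> carrier A \<Longrightarrow> x \<oplus> (- c) \<odot> y = \<zero> \<Longrightarrow> x = c \<odot> y"
  by (metis (no_types) add.inv_equality minus_minus mult_minus1 scal_closed scal_scal uminus_scal)

lemma finsum_triple:
  assumes "finite S" "\<And>i j k. i \<in> S \<Longrightarrow> j \<in> S \<Longrightarrow> k \<in> S \<Longrightarrow> f i j k \<in> carrier A"
  shows "(\<Oplus>i\<in>S. \<Oplus>j\<in>S. \<Oplus>k\<in>S. f i j k) =
         (\<Oplus>p\<in>S \<times> S \<times> S. f (fst p) (fst (snd p)) (snd (snd p)))"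
proof -
  have "(\<Oplus>i\<in>S. \<Oplus>j\<in>S. \<Oplus>k\<in>S. f i j k) = (\<Oplus>i\<in>S. \<Oplus>p\<in>S \<times> S. f i (fst p) (snd p))"
    using assms by (intro finsum_scong [unfolded simp_implies_def] HOL.refl finsum_prod) auto
  also have "\<dots> = (\<Oplus>p\<in>S \<times> S \<times> S. f (fst p) (fst (snd p)) (snd (snd p)))"
    using assms by (intro finsum_prod) auto
  finally show ?thesis .
qed

end

text \<open>The determinant relation says that \<open>E\<close> is a vector fixed by the third
  tensor power of the matrix. If the entries of \<open>b\<close> can be moved past those of
  \<open>a\<close>, the third power of the product factors and fixes \<open>E\<close> too. With the
  matrices \<open>a \<otimes> 1\<close> and \<open>1 \<otimes> a\<close> this becomes the
  coproduct.\<close>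

lemma SUq3_relations_mult:
  fixes A :: "('a, 'm) star_alg_scheme" (structure)
  assumes a: "SUq3_matrix A q a" and b: "SUq3_matrix A q b"
    and comm: "\<And>i j k l. i \<in> {1..3} \<Longrightarrow> j \<in> {1..3} \<Longrightarrow> k \<in> {1..3} \<Longrightarrow> l \<in> {1..3} \<Longrightarrow>
      b i j \<otimes> a k l = a k l \<otimes> b i j"
  shows "SUq3_relations q A (\<lambda>i j. \<Oplus>k\<in>{1..3}. a i k \<otimes> b k j)"
proof -
  interpret a: SUq3_matrix A q a by fact
  interpret b: SUq3_matrix A q b by fact
  let ?I = "{1..3::nat}"
  define c where "c i j = (\<Oplus>k\<in>?I. a i k \<otimes> b k j)" for i j
  have cc: "c i j \<in> carrier A" if "i \<in> ?I" "j \<in> ?I" for i j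
    using that by (simp add: c_def)
  have U: "is_unitary_matrix A c"
    unfolding is_unitary_matrix_def
  proof (intro ballI conjI)
    fix i j :: nat assume i: "i \<in> ?I" and j: "j \<in> ?I"
    \<comment> \<open>In a b (star b) (star a) the inner unitarity relation of b collapses first,
      then that of a; the entries keep their order throughout. The column relation below works in
      the same way.\<close>
    have "(\<Oplus>k\<in>?I. c i k \<otimes> star A (c j k)) =
        (\<Oplus>k\<in>?I. \<Oplus>l\<in>?I. \<Oplus>m\<in>?I. a i l \<otimes> b l k \<otimes> (star A (b m k) \<otimes> star A (a j m)))"
    proof (rule finsum_scong [OF HOL.refl], unfold simp_implies_def)
      fix k assume k: "k \<in> ?I"
      have s: "star A (c j k) = (\<Oplus>m\<in>?I. star A (b m k) \<otimes> star A (a j m))"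
        using j k by (simp add: c_def a.finsum_star a.star_mult Pi_iff cong: finsum_scong)
      have "c i k \<otimes> star A (c j k) = (\<Oplus>l\<in>?I. a i l \<otimes> b l k \<otimes> star A (c j k))"
        using i j k cc by (subst c_def, subst a.finsum_mult_right) (auto simp: Pi_iff)
      also have "\<dots> = (\<Oplus>l\<in>?I. \<Oplus>m\<in>?I. a i l \<otimes> b l k \<otimes> (star A (b m k) \<otimes> star A (a j m)))"
        using i j k by (simp add: s a.finsum_mult_left Pi_iff cong: finsum_scong)
      finally show "c i k \<otimes> star A (c j k) =
        (\<Oplus>l\<in>?I. \<Oplus>m\<in>?I. a i l \<otimes> b l k \<otimes> (star A (b m k) \<otimes> star A (a j m)))" .
    qed
    also have "\<dots> = (\<Oplus>l\<in>?I. \<Oplus>k\<in>?I. \<Oplus>m\<in>?I. a i l \<otimes> b l k \<otimes> (star A (b m k) \<otimes> star A (a j m)))"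
      using i j by (intro a.finsum_swap finite_atLeastAtMost) simp_all
    also have "\<dots> = (\<Oplus>l\<in>?I. \<Oplus>m\<in>?I. \<Oplus>k\<in>?I. a i l \<otimes> b l k \<otimes> (star A (b m k) \<otimes> star A (a j m)))"
      using i j by (intro finsum_scong [unfolded simp_implies_def] HOL.refl a.finsum_swap finite_atLeastAtMost) simp_all
    also have "\<dots> = (\<Oplus>l\<in>?I. \<Oplus>m\<in>?I. a i l \<otimes> (\<Oplus>k\<in>?I. b l k \<otimes> star A (b m k)) \<otimes> star A (a j m))"
      using i j by (simp add: a.finsum_expand cong: finsum_scong)
    also have "\<dots> = (\<Oplus>l\<in>?I. \<Oplus>m\<in>?I. if m = l then a i l \<otimes> star A (a j l) else \<zero>)"
      using i j by (simp add: b.row_unitary del: atLeastAtMost_iff cong: finsum_scong)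
        (intro finsum_scong [unfolded simp_implies_def] HOL.refl, auto)
    also have "\<dots> = (\<Oplus>l\<in>?I. a i l \<otimes> star A (a j l))"
    proof (rule finsum_scong [OF HOL.refl], unfold simp_implies_def)
      fix l assume "l \<in> ?I"
      then show "(\<Oplus>m\<in>?I. if m = l then a i l \<otimes> star A (a j l) else \<zero>) = a i l \<otimes> star A (a j l)"
        using i j by (subst a.finsum_delta [of _ l]) auto
    qed
    also have "\<dots> = (if i = j then \<one> else \<zero>)" by (rule a.row_unitary [OF i j])
    finally show "(\<Oplus>k\<in>?I. c i k \<otimes> star A (c j k)) = (if i = j then \<one> else \<zero>)" .
    have "(\<Oplus>k\<in>?I. star A (c k i) \<otimes> c k j) =
        (\<Oplus>k\<in>?I. \<Oplus>l\<in>?I. \<Oplus>m\<in>?I. star A (b l i) \<otimes> star A (a k l) \<otimes> (a k m \<otimes> b m j))"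
    proof (rule finsum_scong [OF HOL.refl], unfold simp_implies_def)
      fix k assume k: "k \<in> ?I"
      have s: "star A (c k i) = (\<Oplus>l\<in>?I. star A (b l i) \<otimes> star A (a k l))"
        using i k by (simp add: c_def a.finsum_star a.star_mult Pi_iff cong: finsum_scong)
      have "star A (c k i) \<otimes> c k j = (\<Oplus>l\<in>?I. star A (b l i) \<otimes> star A (a k l) \<otimes> c k j)"
        unfolding s using i j k cc by (subst a.finsum_mult_right) (auto simp: Pi_iff)
      also have "\<dots> = (\<Oplus>l\<in>?I. \<Oplus>m\<in>?I. star A (b l i) \<otimes> star A (a k l) \<otimes> (a k m \<otimes> b m j))"
        using i j k by (simp add: c_def a.finsum_mult_left Pi_iff cong: finsum_scong)
      finally show "star A (c k i) \<otimes> c k j =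
        (\<Oplus>l\<in>?I. \<Oplus>m\<in>?I. star A (b l i) \<otimes> star A (a k l) \<otimes> (a k m \<otimes> b m j))" .
    qed
    also have "\<dots> = (\<Oplus>l\<in>?I. \<Oplus>k\<in>?I. \<Oplus>m\<in>?I. star A (b l i) \<otimes> star A (a k l) \<otimes> (a k m \<otimes> b m j))"
      using i j by (intro a.finsum_swap finite_atLeastAtMost) simp_all
    also have "\<dots> = (\<Oplus>l\<in>?I. \<Oplus>m\<in>?I. \<Oplus>k\<in>?I. star A (b l i) \<otimes> star A (a k l) \<otimes> (a k m \<otimes> b m j))"
      using i j by (intro finsum_scong [unfolded simp_implies_def] HOL.refl a.finsum_swap finite_atLeastAtMost) simp_all
    also have "\<dots> = (\<Oplus>l\<in>?I. \<Oplus>m\<in>?I. star A (b l i) \<otimes> (\<Oplus>k\<in>?I. star A (a k l) \<otimes> a k m) \<otimes> b m j)"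
      using i j by (simp add: a.finsum_expand cong: finsum_scong)
    also have "\<dots> = (\<Oplus>l\<in>?I. \<Oplus>m\<in>?I. if m = l then star A (b l i) \<otimes> b l j else \<zero>)"
      using i j by (simp add: a.col_unitary del: atLeastAtMost_iff cong: finsum_scong)
        (intro finsum_scong [unfolded simp_implies_def] HOL.refl, auto)
    also have "\<dots> = (\<Oplus>l\<in>?I. star A (b l i) \<otimes> b l j)"
    proof (rule finsum_scong [OF HOL.refl], unfold simp_implies_def)
      fix l assume "l \<in> ?I"
      then show "(\<Oplus>m\<in>?I. if m = l then star A (b l i) \<otimes> b l j else \<zero>) = star A (b l i) \<otimes> b l j"
        using i j by (subst a.finsum_delta [of _ l]) auto
    qed
    also have "\<dots> = (if i = j then \<one> else \<zero>)" by (rule b.col_unitary [OF i j])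
    finally show "(\<Oplus>k\<in>?I. star A (c k i) \<otimes> c k j) = (if i = j then \<one> else \<zero>)" .
  qed
  have E: "(\<Oplus>i1\<in>?I. \<Oplus>i2\<in>?I. \<Oplus>i3\<in>?I. E_tensor q i1 i2 i3 \<odot> (c j1 i1 \<otimes> c j2 i2 \<otimes> c j3 i3)) =
      E_tensor q j1 j2 j3 \<odot> \<one>"
    if j: "j1 \<in> ?I" "j2 \<in> ?I" "j3 \<in> ?I" for j1 j2 j3
  proof -
    \<comment> \<open>Triples become single indices, so that \<open>a3\<close> and \<open>b3\<close>
      act as matrices on triples and the calculation is: product matrix applied to \<open>E\<close>
      equals \<open>a3\<close> applied to \<open>b3\<close> applied to \<open>E\<close>.\<close>
    let ?S = "?I \<times> ?I \<times> ?I"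
    define E' where "E' p = E_tensor q (fst p) (fst (snd p)) (snd (snd p))" for p
    define a3 where "a3 l = a j1 (fst l) \<otimes> a j2 (fst (snd l)) \<otimes> a j3 (snd (snd l))" for l
    define b3 where "b3 l p = b (fst l) (fst p) \<otimes> b (fst (snd l)) (fst (snd p)) \<otimes> b (snd (snd l)) (snd (snd p))" for l p
    have cl: "l \<in> ?S \<Longrightarrow> a3 l \<in> carrier A" "l \<in> ?S \<Longrightarrow> p \<in> ?S \<Longrightarrow> b3 l p \<in> carrier A" for l p
      using j by (auto simp: a3_def b3_def)
    have ccc: "c j1 i1 \<otimes> c j2 i2 \<otimes> c j3 i3 = (\<Oplus>l\<in>?S. a3 l \<otimes> b3 l (i1, i2, i3))"
      if i: "i1 \<in> ?I" "i2 \<in> ?I" "i3 \<in> ?I" for i1 i2 i3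
    proof -
      \<comment> \<open>Commutation is used here only: all entries of \<open>b\<close> are collected
        to the right of the entries of \<open>a\<close>.\<close>
      have re: "a j1 l1 \<otimes> b l1 i1 \<otimes> (a j2 l2 \<otimes> b l2 i2) \<otimes> (a j3 l3 \<otimes> b l3 i3) =
        a3 (l1, l2, l3) \<otimes> b3 (l1, l2, l3) (i1, i2, i3)" if l: "l1 \<in> ?I" "l2 \<in> ?I" "l3 \<in> ?I" for l1 l2 l3
      proof -
        have c': "b x y \<otimes> (a z w \<otimes> r) = a z w \<otimes> (b x y \<otimes> r)"
          if "x \<in> ?I" "y \<in> ?I" "z \<in> ?I" "w \<in> ?I" "r \<in> carrier A" for x y z w r
          using that comm [of x y z w] by (simp add: a.m_assoc [symmetric])
        show ?thesis
          using i j l by (simp add: a3_def b3_def a.m_assoc comm c')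
      qed
      have "c j1 i1 \<otimes> c j2 i2 \<otimes> c j3 i3 =
          (\<Oplus>l1\<in>?I. a j1 l1 \<otimes> b l1 i1 \<otimes> c j2 i2 \<otimes> c j3 i3)"
        using i j cc by (subst c_def) (simp add: a.finsum_mult_right Pi_iff cong: finsum_scong)
      also have "\<dots> = (\<Oplus>l1\<in>?I. \<Oplus>l2\<in>?I. a j1 l1 \<otimes> b l1 i1 \<otimes> (a j2 l2 \<otimes> b l2 i2) \<otimes> c j3 i3)"
        using i j cc by (subst (1) c_def) (simp add: a.finsum_mult_right a.finsum_mult_left Pi_iff cong: finsum_scong)
      also have "\<dots> = (\<Oplus>l1\<in>?I. \<Oplus>l2\<in>?I. \<Oplus>l3\<in>?I.
          a j1 l1 \<otimes> b l1 i1 \<otimes> (a j2 l2 \<otimes> b l2 i2) \<otimes> (a j3 l3 \<otimes> b l3 i3))"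
        using i j by (simp add: c_def a.finsum_mult_left Pi_iff cong: finsum_scong)
      also have "\<dots> = (\<Oplus>l1\<in>?I. \<Oplus>l2\<in>?I. \<Oplus>l3\<in>?I. a3 (l1, l2, l3) \<otimes> b3 (l1, l2, l3) (i1, i2, i3))"
        by (intro finsum_scong [unfolded simp_implies_def] HOL.refl re)
      also have "\<dots> = (\<Oplus>l\<in>?S. a3 l \<otimes> b3 l (i1, i2, i3))"
        using i by (subst a.finsum_triple) (auto intro!: a.m_closed cl)
      finally show ?thesis .
    qed
    have "(\<Oplus>i1\<in>?I. \<Oplus>i2\<in>?I. \<Oplus>i3\<in>?I. E_tensor q i1 i2 i3 \<odot> (c j1 i1 \<otimes> c j2 i2 \<otimes> c j3 i3)) =
        (\<Oplus>i1\<in>?I. \<Oplus>i2\<in>?I. \<Oplus>i3\<in>?I. E' (i1, i2, i3) \<odot> (\<Oplus>l\<in>?S. a3 l \<otimes> b3 l (i1, i2, i3)))"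
      by (simp add: ccc E'_def del: atLeastAtMost_iff cong: finsum_scong)
    also have "\<dots> = (\<Oplus>p\<in>?S. E' p \<odot> (\<Oplus>l\<in>?S. a3 l \<otimes> b3 l p))"
      by (subst a.finsum_triple) (auto intro!: a.scal_closed a.finsum_cl a.m_closed cl)
    also have "\<dots> = (\<Oplus>p\<in>?S. \<Oplus>l\<in>?S. a3 l \<otimes> (E' p \<odot> b3 l p))"
      by (intro finsum_scong [unfolded simp_implies_def] HOL.refl)
        (subst a.finsum_scal, auto intro!: a.m_closed finsum_scong [unfolded simp_implies_def] simp: cl a.scal_mult)
    also have "\<dots> = (\<Oplus>l\<in>?S. \<Oplus>p\<in>?S. a3 l \<otimes> (E' p \<odot> b3 l p))"
      by (intro a.finsum_swap finite_SigmaI finite_atLeastAtMost a.m_closed a.scal_closed cl)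
    also have "\<dots> = (\<Oplus>l\<in>?S. a3 l \<otimes> (\<Oplus>p\<in>?S. E' p \<odot> b3 l p))"
      by (intro finsum_scong [unfolded simp_implies_def] HOL.refl)
        (subst a.finsum_mult_left, auto intro!: a.scal_closed cl)
    also have "\<dots> = (\<Oplus>l\<in>?S. E' l \<odot> a3 l)"
    proof (rule finsum_scong [OF HOL.refl], unfold simp_implies_def)
      fix l assume l: "l \<in> ?S"
      then have l': "fst l \<in> ?I" "fst (snd l) \<in> ?I" "snd (snd l) \<in> ?I" by auto
      have "(\<Oplus>p\<in>?S. E' p \<odot> b3 l p) = E' l \<odot> \<one>"
        unfolding E'_def b3_def
        by (subst b.E_rel [OF l', symmetric], subst a.finsum_triple) (use l' in auto)
      then show "a3 l \<otimes> (\<Oplus>p\<in>?S. E' p \<odot> b3 l p) = E' l \<odot> a3 l"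
        using cl(1) [OF l] by (simp add: a.scal_mult)
    qed
    also have "\<dots> = (\<Oplus>i1\<in>?I. \<Oplus>i2\<in>?I. \<Oplus>i3\<in>?I. E_tensor q i1 i2 i3 \<odot> (a j1 i1 \<otimes> a j2 i2 \<otimes> a j3 i3))"
      using j by (subst a.finsum_triple) (auto simp: E'_def a3_def)
    also have "\<dots> = E_tensor q j1 j2 j3 \<odot> \<one>" by (rule a.E_rel [OF j])
    finally show ?thesis .
  qed
  have "SUq3_relations q A c"
    unfolding SUq3_relations_def
  proof (intro conjI ballI)
    fix i j assume "i \<in> ?I" "j \<in> ?I" then show "c i j \<in> carrier A" by (rule cc)
  qed (fact U, rule E)
  then show ?thesis unfolding c_def .
qed

lemma SUq3_relations_diag:
  fixes A :: "('a, 'm) star_alg_scheme" (structure)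
  assumes "star_algebra A" and d: "\<And>i. i \<in> {1..3} \<Longrightarrow> d i \<in> carrier A"
    and u: "\<And>i. i \<in> {1..3} \<Longrightarrow> d i \<otimes> star A (d i) = \<one>" "\<And>i. i \<in> {1..3} \<Longrightarrow> star A (d i) \<otimes> d i = \<one>"
    and det: "\<And>i j k. i \<in> {1..3} \<Longrightarrow> j \<in> {1..3} \<Longrightarrow> k \<in> {1..3} \<Longrightarrow> distinct [i, j, k] \<Longrightarrow> d i \<otimes> d j \<otimes> d k = \<one>"
  shows "SUq3_relations q A (\<lambda>i j. if i = j then d i else \<zero>)"
proof -
  interpret star_algebra A by fact
  let ?I = "{1..3::nat}"
  let ?a = "\<lambda>i j. if i = j then d i else \<zero>"
  have U: "is_unitary_matrix A ?a"
    unfolding is_unitary_matrix_def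
  proof (intro ballI conjI)
    fix i j :: nat assume i: "i \<in> ?I" and j: "j \<in> ?I"
    show "(\<Oplus>k\<in>?I. ?a i k \<otimes> star A (?a j k)) = (if i = j then \<one> else \<zero>)"
      by (subst finsum_delta [of _ i]) (use i j d u in \<open>auto simp del: atLeastAtMost_iff\<close>)
    show "(\<Oplus>k\<in>?I. star A (?a k i) \<otimes> ?a k j) = (if i = j then \<one> else \<zero>)"
      by (subst finsum_delta [of _ i]) (use i j d u in \<open>auto simp del: atLeastAtMost_iff\<close>)
  qed
  have E: "(\<Oplus>i1\<in>?I. \<Oplus>i2\<in>?I. \<Oplus>i3\<in>?I. E_tensor q i1 i2 i3 \<odot> (?a j1 i1 \<otimes> ?a j2 i2 \<otimes> ?a j3 i3)) =
      E_tensor q j1 j2 j3 \<odot> \<one>"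
    if j: "j1 \<in> ?I" "j2 \<in> ?I" "j3 \<in> ?I" for j1 j2 j3
  proof -
    let ?t = "\<lambda>p. E_tensor q (fst p) (fst (snd p)) (snd (snd p)) \<odot>
        (?a j1 (fst p) \<otimes> ?a j2 (fst (snd p)) \<otimes> ?a j3 (snd (snd p)))"
    have "(\<Oplus>i1\<in>?I. \<Oplus>i2\<in>?I. \<Oplus>i3\<in>?I. E_tensor q i1 i2 i3 \<odot> (?a j1 i1 \<otimes> ?a j2 i2 \<otimes> ?a j3 i3)) =
        (\<Oplus>p\<in>?I \<times> ?I \<times> ?I. ?t p)"
      using j d by (intro finsum_triple) auto
    also have "\<dots> = ?t (j1, j2, j3)"
      by (rule finsum_delta) (use j d in \<open>auto simp del: atLeastAtMost_iff\<close>)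
    also have "\<dots> = E_tensor q j1 j2 j3 \<odot> \<one>"
      using det [OF j] j d by (cases "distinct [j1, j2, j3]") (auto simp: E_tensor_def)
    finally show ?thesis .
  qed
  show ?thesis
    unfolding SUq3_relations_def
  proof (intro conjI ballI)
    fix i j assume "i \<in> ?I" "j \<in> ?I" then show "?a i j \<in> carrier A" using d by simp
  qed (fact U, rule E)
qed

section \<open>Block diagonal solutions and the relations of U_q(2)\<close>

definition Uq2_triple :: "real \<Rightarrow> ('a, 'm) star_alg_scheme \<Rightarrow> 'a \<Rightarrow> 'a \<Rightarrow> 'a \<Rightarrow> bool" where
  "Uq2_triple q A u \<alpha> \<gamma> \<longleftrightarrow> u \<in> carrier A \<and> \<alpha> \<in> carrier A \<and> \<gamma> \<in> carrier A \<and>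
     u \<otimes>\<^bsub>A\<^esub> star A u = \<one>\<^bsub>A\<^esub> \<and> star A u \<otimes>\<^bsub>A\<^esub> u = \<one>\<^bsub>A\<^esub> \<and>
     u \<otimes>\<^bsub>A\<^esub> \<alpha> = \<alpha> \<otimes>\<^bsub>A\<^esub> u \<and> u \<otimes>\<^bsub>A\<^esub> \<gamma> = \<gamma> \<otimes>\<^bsub>A\<^esub> u \<and>
     \<alpha> \<otimes>\<^bsub>A\<^esub> \<gamma> = complex_of_real q \<odot>\<^bsub>A\<^esub> (\<gamma> \<otimes>\<^bsub>A\<^esub> \<alpha>) \<and>
     \<gamma> \<otimes>\<^bsub>A\<^esub> star A \<gamma> = star A \<gamma> \<otimes>\<^bsub>A\<^esub> \<gamma> \<and>
     \<alpha> \<otimes>\<^bsub>A\<^esub> star A \<gamma> = complex_of_real q \<odot>\<^bsub>A\<^esub> (star A \<gamma> \<otimes>\<^bsub>A\<^esub> \<alpha>) \<and>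
     star A \<alpha> \<otimes>\<^bsub>A\<^esub> \<alpha> \<oplus>\<^bsub>A\<^esub> \<gamma> \<otimes>\<^bsub>A\<^esub> star A \<gamma> = \<one>\<^bsub>A\<^esub> \<and>
     \<alpha> \<otimes>\<^bsub>A\<^esub> star A \<alpha> \<oplus>\<^bsub>A\<^esub> (complex_of_real q)\<^sup>2 \<odot>\<^bsub>A\<^esub> (\<gamma> \<otimes>\<^bsub>A\<^esub> star A \<gamma>) = \<one>\<^bsub>A\<^esub>"

definition v_matrix :: "real \<Rightarrow> ('a, 'm) star_alg_scheme \<Rightarrow> 'a \<Rightarrow> 'a \<Rightarrow> 'a \<Rightarrow> nat \<Rightarrow> nat \<Rightarrow> 'a" where
  "v_matrix q A u \<alpha> \<gamma> i j =
     (if (i, j) = (1, 1) then u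
      else if (i, j) = (2, 2) then \<alpha>
      else if (i, j) = (2, 3) then (- complex_of_real q) \<odot>\<^bsub>A\<^esub> (star A \<gamma> \<otimes>\<^bsub>A\<^esub> star A u)
      else if (i, j) = (3, 2) then \<gamma>
      else if (i, j) = (3, 3) then star A \<alpha> \<otimes>\<^bsub>A\<^esub> star A u
      else \<zero>\<^bsub>A\<^esub>)"

lemma v_matrix_values:
  "v_matrix q A u \<alpha> \<gamma> 1 1 = u" "v_matrix q A u \<alpha> \<gamma> 1 2 = \<zero>\<^bsub>A\<^esub>" "v_matrix q A u \<alpha> \<gamma> 1 3 = \<zero>\<^bsub>A\<^esub>"
  "v_matrix q A u \<alpha> \<gamma> 2 1 = \<zero>\<^bsub>A\<^esub>" "v_matrix q A u \<alpha> \<gamma> 2 2 = \<alpha>"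
  "v_matrix q A u \<alpha> \<gamma> 2 3 = (- complex_of_real q) \<odot>\<^bsub>A\<^esub> (star A \<gamma> \<otimes>\<^bsub>A\<^esub> star A u)"
  "v_matrix q A u \<alpha> \<gamma> 3 1 = \<zero>\<^bsub>A\<^esub>" "v_matrix q A u \<alpha> \<gamma> 3 2 = \<gamma>"
  "v_matrix q A u \<alpha> \<gamma> 3 3 = star A \<alpha> \<otimes>\<^bsub>A\<^esub> star A u"
  by (simp_all add: v_matrix_def)

definition block_matrix :: "('a, 'm) star_alg_scheme \<Rightarrow> (nat \<Rightarrow> nat \<Rightarrow> 'a) \<Rightarrow> bool" where
  "block_matrix A a \<longleftrightarrow> a 1 2 = \<zero>\<^bsub>A\<^esub> \<and> a 1 3 = \<zero>\<^bsub>A\<^esub> \<and> a 2 1 = \<zero>\<^bsub>A\<^esub> \<and> a 3 1 = \<zero>\<^bsub>A\<^esub>"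

lemma (in star_algebra) unitary_cancel:
  assumes "u \<in> carrier A" "star A u \<otimes> u = \<one>" "x \<in> carrier A" "u \<otimes> x = y"
  shows "x = star A u \<otimes> y"
  using assms by (simp add: m_assoc [symmetric] flip: assms(4))

lemma (in star_algebra) unitary_cancel_right:
  assumes "u \<in> carrier A" "u \<otimes> star A u = \<one>" "x \<in> carrier A" "x \<otimes> u = y"
  shows "x = y \<otimes> star A u"
  using assms by (simp add: m_assoc flip: assms(4))

text \<open>Conjugate \<open>u \<otimes> x = x \<otimes> u\<close> by \<open>star A u\<close>. In a
  \<open>Uq2_triple\<close> centrality of u is stated for \<alpha> and \<gamma> alone; this extends
  it to their adjoints and hence to all words.\<close>

lemma (in star_algebra) unitary_commutes:
  assumes [simp]: "u \<in> carrier A" "x \<in> carrier A"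
    and uu: "u \<otimes> star A u = \<one>" "star A u \<otimes> u = \<one>" and ux: "u \<otimes> x = x \<otimes> u"
  shows "star A u \<otimes> x = x \<otimes> star A u" "u \<otimes> star A x = star A x \<otimes> u"
proof -
  have "star A u \<otimes> x = star A u \<otimes> (x \<otimes> u) \<otimes> star A u" by (simp add: m_assoc uu)
  also have "\<dots> = star A u \<otimes> (u \<otimes> x) \<otimes> star A u" by (simp only: ux)
  also have "\<dots> = x \<otimes> star A u" by (simp add: m_assoc [symmetric] uu)
  finally show s: "star A u \<otimes> x = x \<otimes> star A u" .
  show "u \<otimes> star A x = star A x \<otimes> u"
    using arg_cong [OF s, of "star A"] by (simp add: star_mult)
qed

text \<open>The minors on columns 1 and 3 reduce to one product each. Read with their two rows in
  either order, they give the third column with \<open>star A u\<close> on the left and on the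
  right, hence both the shape of that column and the centrality of u. Unitarity of rows and columns
  supplies the other relations.\<close>

lemma Uq2_triple_of_block_matrix:
  fixes A :: "('a, 'm) star_alg_scheme" (structure)
  assumes "SUq3_matrix A q a" and b: "block_matrix A a"
  shows "Uq2_triple q A (a 1 1) (a 2 2) (a 3 2)"
    and "\<And>i j. i \<in> {1..3} \<Longrightarrow> j \<in> {1..3} \<Longrightarrow> a i j = v_matrix q A (a 1 1) (a 2 2) (a 3 2) i j"
proof -
  interpret SUq3_matrix A q a by fact
  have z: "a 1 2 = \<zero>" "a 1 3 = \<zero>" "a 2 1 = \<zero>" "a 3 1 = \<zero>"
    using b by (simp_all add: block_matrix_def)
  have I: "1 \<in> {1..3::nat}" "2 \<in> {1..3::nat}" "3 \<in> {1..3::nat}" by auto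
  note Ev = E_tensor_values E_tensor_eq_0
  define u where "u = a 1 1"
  define \<alpha> where "\<alpha> = a 2 2"
  define \<gamma> where "\<gamma> = a 3 2"
  have cl [simp]: "u \<in> carrier A" "\<alpha> \<in> carrier A" "\<gamma> \<in> carrier A" "a 2 3 \<in> carrier A" "a 3 3 \<in> carrier A"
    by (simp_all add: u_def \<alpha>_def \<gamma>_def)
  note defs = u_def [symmetric] \<alpha>_def [symmetric] \<gamma>_def [symmetric]
  have uu: "u \<otimes> star A u = \<one>" "star A u \<otimes> u = \<one>"
    using row_unitary [OF I(1) I(1)] col_unitary [OF I(1) I(1)]
    by (simp_all add: finsum_three Pi_iff z defs)
  have q0: "complex_of_real q \<noteq> 0" using q_nz by simp
  \<comment> \<open>For the row pairs (1,3), (3,1), (1,2), (2,1) one of the two products in the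
    minor contains an entry outside the blocks and vanishes.\<close>
  have d1: "u \<otimes> a 3 3 = star A \<alpha>"
    using minor_left [OF I(2) I(1) I(3)] scal_cancel [of "u \<otimes> a 3 3" "star A \<alpha>" "- complex_of_real q"] q0
    by (simp add: finsum_three Pi_iff z defs Ev)
  have d2: "a 3 3 \<otimes> u = star A \<alpha>"
    using minor_left [OF I(2) I(3) I(1)] scal_cancel [of "a 3 3 \<otimes> u" "star A \<alpha>" "(complex_of_real q)\<^sup>2"] q0
    by (simp add: finsum_three Pi_iff z defs Ev)
  have d3: "u \<otimes> a 2 3 = (- complex_of_real q) \<odot> star A \<gamma>"
    using minor_left [OF I(2) I(1) I(2)] scal_cancel [of "u \<otimes> a 2 3" "(- complex_of_real q) \<odot> star A \<gamma>" "- complex_of_real q"] q0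
    by (simp add: finsum_three Pi_iff z defs Ev power2_eq_square)
  have d4: "a 2 3 \<otimes> u = (- complex_of_real q) \<odot> star A \<gamma>"
    using minor_left [OF I(2) I(2) I(1)] scal_cancel [of "a 2 3 \<otimes> u" "(- complex_of_real q) \<odot> star A \<gamma>" "(complex_of_real q)\<^sup>2"] q0
    by (simp add: finsum_three Pi_iff z defs Ev power2_eq_square power3_eq_cube)
  have a33: "a 3 3 = star A u \<otimes> star A \<alpha>" "a 3 3 = star A \<alpha> \<otimes> star A u"
    using unitary_cancel [OF _ uu(2) _ d1] unitary_cancel_right [OF _ uu(1) _ d2] by simp_all
  have a23: "a 2 3 = (- complex_of_real q) \<odot> (star A u \<otimes> star A \<gamma>)" "a 2 3 = (- complex_of_real q) \<odot> (star A \<gamma> \<otimes> star A u)"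
    using unitary_cancel [OF _ uu(2) _ d3] unitary_cancel_right [OF _ uu(1) _ d4] by (simp_all add: scal_mult)
  have "star A (star A u \<otimes> star A \<alpha>) = star A (star A \<alpha> \<otimes> star A u)" using a33 by simp
  then have ua: "u \<otimes> \<alpha> = \<alpha> \<otimes> u" by (simp add: star_mult)
  have ug': "star A u \<otimes> star A \<gamma> = star A \<gamma> \<otimes> star A u"
    using scal_cancel [of "star A u \<otimes> star A \<gamma>" "star A \<gamma> \<otimes> star A u" "- complex_of_real q"] a23 q0 by simp
  then have "star A (star A u \<otimes> star A \<gamma>) = star A (star A \<gamma> \<otimes> star A u)" by simp
  then have ug: "u \<otimes> \<gamma> = \<gamma> \<otimes> u" by (simp add: star_mult)
  have usu: "u \<otimes> (star A u \<otimes> x) = x" "star A u \<otimes> (u \<otimes> x) = x" if "x \<in> carrier A" for x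
    using that uu by (simp_all add: m_assoc [symmetric])
  have c22: "star A \<alpha> \<otimes> \<alpha> \<oplus> star A \<gamma> \<otimes> \<gamma> = \<one>"
    using col_unitary [OF I(2) I(2)] by (simp add: finsum_three Pi_iff z defs)
  have r33: "\<gamma> \<otimes> star A \<gamma> \<oplus> star A \<alpha> \<otimes> \<alpha> = \<one>"
    using row_unitary [OF I(3) I(3)]
    by (simp add: finsum_three Pi_iff z defs) (simp add: a33(2) star_mult m_assoc usu)
  \<comment> \<open>Unitarity of row 3 and of column 2 share the summand
    \<open>star A \<alpha> \<otimes> \<alpha>\<close>; cancelling it leaves normality of
    \<gamma>.\<close>
  have gg: "\<gamma> \<otimes> star A \<gamma> = star A \<gamma> \<otimes> \<gamma>"
  proof -
    have "\<gamma> \<otimes> star A \<gamma> \<oplus> star A \<alpha> \<otimes> \<alpha> = star A \<gamma> \<otimes> \<gamma> \<oplus> star A \<alpha> \<otimes> \<alpha>"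
      using r33 c22 by (simp add: a_comm)
    then show ?thesis by (subst (asm) add.right_cancel) simp_all
  qed
  have r22: "\<alpha> \<otimes> star A \<alpha> \<oplus> (complex_of_real q)\<^sup>2 \<odot> (\<gamma> \<otimes> star A \<gamma>) = \<one>"
    using row_unitary [OF I(2) I(2)]
    by (simp add: finsum_three Pi_iff z defs) (simp add: a23(2) star_mult star_smult scal_mult m_assoc usu gg power2_eq_square)
  have ag': "\<alpha> \<otimes> star A \<gamma> \<oplus> (- 1) \<odot> (complex_of_real q \<odot> (star A \<gamma> \<otimes> \<alpha>)) = \<zero>"
    using row_unitary [OF I(2) I(3)]
    by (simp add: finsum_three Pi_iff z defs) (simp add: a33(2) a23(2) star_mult scal_mult m_assoc usu)
  have ag: "\<alpha> \<otimes> star A \<gamma> = complex_of_real q \<odot> (star A \<gamma> \<otimes> \<alpha>)"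
    by (rule eq_of_add_zero) (use ag' in simp_all)
  \<comment> \<open>Orthogonality of columns 2 and 3 carries a factor \<open>star A u\<close> on the
    right. Multiplying by u removes it, and the adjoint of the result is the relation between
    \<alpha> and \<gamma>.\<close>
  have "star A \<gamma> \<otimes> star A \<alpha> \<otimes> star A u \<oplus> (- complex_of_real q) \<odot> (star A \<alpha> \<otimes> star A \<gamma> \<otimes> star A u) = \<zero>"
    using col_unitary [OF I(2) I(3)]
    by (simp add: finsum_three Pi_iff z defs) (simp add: a33(2) a23(2) scal_mult m_assoc a_comm)
  then have "star A \<gamma> \<otimes> star A \<alpha> \<otimes> star A u = complex_of_real q \<odot> (star A \<alpha> \<otimes> star A \<gamma> \<otimes> star A u)"
    by (intro eq_of_add_zero) simp_all
  then have "star A \<gamma> \<otimes> star A \<alpha> \<otimes> star A u \<otimes> u =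
      complex_of_real q \<odot> (star A \<alpha> \<otimes> star A \<gamma> \<otimes> star A u) \<otimes> u" by simp
  then have "star A \<gamma> \<otimes> star A \<alpha> = complex_of_real q \<odot> (star A \<alpha> \<otimes> star A \<gamma>)"
    by (simp add: scal_mult m_assoc uu)
  then have "star A (star A \<gamma> \<otimes> star A \<alpha>) = star A (complex_of_real q \<odot> (star A \<alpha> \<otimes> star A \<gamma>))"
    by simp
  then have ag2: "\<alpha> \<otimes> \<gamma> = complex_of_real q \<odot> (\<gamma> \<otimes> \<alpha>)"
    by (simp add: star_mult star_smult)
  have "star A \<alpha> \<otimes> \<alpha> \<oplus> \<gamma> \<otimes> star A \<gamma> = \<one>" using c22 gg by simp
  then show "Uq2_triple q A (a 1 1) (a 2 2) (a 3 2)"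
    unfolding defs Uq2_triple_def using uu ua ug ag ag2 gg r22 by simp
  show "a i j = v_matrix q A (a 1 1) (a 2 2) (a 3 2) i j" if "i \<in> {1..3}" "j \<in> {1..3}" for i j
    using that unfolding in_three defs
    by (elim disjE) (simp_all only: v_matrix_values z defs a33(2) a23(2))
qed

lemma SUq3_relations_v_matrix:
  fixes A :: "('a, 'm) star_alg_scheme" (structure)
  assumes "star_algebra A" and t: "Uq2_triple q A u \<alpha> \<gamma>"
  shows "SUq3_relations q A (v_matrix q A u \<alpha> \<gamma>)"
proof -
  interpret star_algebra A by fact
  let ?I = "{1..3::nat}"
  let ?v = "v_matrix q A u \<alpha> \<gamma>"
  let ?q = "complex_of_real q"
  have cl [simp]: "u \<in> carrier A" "\<alpha> \<in> carrier A" "\<gamma> \<in> carrier A"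
    and uu: "u \<otimes> star A u = \<one>" "star A u \<otimes> u = \<one>"
    and ua: "u \<otimes> \<alpha> = \<alpha> \<otimes> u" and ug: "u \<otimes> \<gamma> = \<gamma> \<otimes> u"
    and ag: "\<alpha> \<otimes> \<gamma> = ?q \<odot> (\<gamma> \<otimes> \<alpha>)"
    and gg: "\<gamma> \<otimes> star A \<gamma> = star A \<gamma> \<otimes> \<gamma>"
    and ag': "\<alpha> \<otimes> star A \<gamma> = ?q \<odot> (star A \<gamma> \<otimes> \<alpha>)"
    and r1: "star A \<alpha> \<otimes> \<alpha> \<oplus> \<gamma> \<otimes> star A \<gamma> = \<one>"
    and r2: "\<alpha> \<otimes> star A \<alpha> \<oplus> ?q\<^sup>2 \<odot> (\<gamma> \<otimes> star A \<gamma>) = \<one>"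
    using t unfolding Uq2_triple_def by blast+
  have vc [simp]: "?v i j \<in> carrier A" for i j by (simp add: v_matrix_def)
  note swap = unitary_commutes(1) [OF cl(1) _ uu] and swap' = unitary_commutes(2) [OF cl(1) _ uu]
  \<comment> \<open>Rules for a normal form of words: u and its adjoint travel to the front, where
    they can cancel.\<close>
  have su: "\<alpha> \<otimes> u = u \<otimes> \<alpha>" "\<gamma> \<otimes> u = u \<otimes> \<gamma>" "star A \<alpha> \<otimes> u = u \<otimes> star A \<alpha>" "star A \<gamma> \<otimes> u = u \<otimes> star A \<gamma>"
    "\<alpha> \<otimes> star A u = star A u \<otimes> \<alpha>" "\<gamma> \<otimes> star A u = star A u \<otimes> \<gamma>"
    "star A \<alpha> \<otimes> star A u = star A u \<otimes> star A \<alpha>" "star A \<gamma> \<otimes> star A u = star A u \<otimes> star A \<gamma>"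
    using swap' [of \<alpha>] swap' [of \<gamma>] swap [of \<alpha>] swap [of \<gamma>] swap [of "star A \<alpha>"] swap [of "star A \<gamma>"] ua ug
    by simp_all
  have su': "x \<otimes> (u \<otimes> y) = u \<otimes> (x \<otimes> y)" if "x \<otimes> u = u \<otimes> x" "x \<in> carrier A" "y \<in> carrier A" for x y
    using that by (simp add: m_assoc [symmetric])
  have su'': "x \<otimes> (star A u \<otimes> y) = star A u \<otimes> (x \<otimes> y)"
    if "x \<otimes> star A u = star A u \<otimes> x" "x \<in> carrier A" "y \<in> carrier A" for x y
    using that by (simp add: m_assoc [symmetric])
  note sus = su' [OF su(1)] su' [OF su(2)] su' [OF su(3)] su' [OF su(4)]
    su'' [OF su(5)] su'' [OF su(6)] su'' [OF su(7)] su'' [OF su(8)]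
  have usu: "u \<otimes> (star A u \<otimes> x) = x" "star A u \<otimes> (u \<otimes> x) = x" if "x \<in> carrier A" for x
    using that uu by (simp_all add: m_assoc [symmetric])
  have sag: "star A \<gamma> \<otimes> star A \<alpha> = ?q \<odot> (star A \<alpha> \<otimes> star A \<gamma>)"
    using arg_cong [OF ag, of "star A"] by (simp add: star_mult star_smult)
  have sag': "\<gamma> \<otimes> star A \<alpha> = ?q \<odot> (star A \<alpha> \<otimes> \<gamma>)"
    using arg_cong [OF ag', of "star A"] by (simp add: star_mult star_smult)
  have canc: "c \<odot> x \<oplus> (d \<odot> x) = (c + d) \<odot> x" if "x \<in> carrier A" for x c d
    using that by (simp add: add_scal)
  have r1': "star A \<alpha> \<otimes> \<alpha> \<oplus> star A \<gamma> \<otimes> \<gamma> = \<one>" "star A \<gamma> \<otimes> \<gamma> \<oplus> star A \<alpha> \<otimes> \<alpha> = \<one>"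
    and r2': "\<alpha> \<otimes> star A \<alpha> \<oplus> ?q\<^sup>2 \<odot> (star A \<gamma> \<otimes> \<gamma>) = \<one>" "?q\<^sup>2 \<odot> (star A \<gamma> \<otimes> \<gamma>) \<oplus> \<alpha> \<otimes> star A \<alpha> = \<one>"
    using r1 r2 by (simp_all add: gg a_comm)
  note norm = uu su sus usu scal_mult m_assoc star_mult star_smult ag ag' sag sag' gg canc
    r1' r2' [unfolded power2_eq_square]
  have U: "is_unitary_matrix A ?v"
    unfolding is_unitary_matrix_def
  proof (intro ballI conjI)
    fix i j :: nat assume ij: "i \<in> ?I" "j \<in> ?I"
    show "(\<Oplus>k\<in>?I. ?v i k \<otimes> star A (?v j k)) = (if i = j then \<one> else \<zero>)"
      using ij unfolding in_three
      by (subst finsum_three, simp add: Pi_iff) (elim disjE; simp add: v_matrix_values norm)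
    show "(\<Oplus>k\<in>?I. star A (?v k i) \<otimes> ?v k j) = (if i = j then \<one> else \<zero>)"
      using ij unfolding in_three
      by (subst finsum_three, simp add: Pi_iff) (elim disjE; simp add: v_matrix_values norm)
  qed
  have D22: "\<alpha> \<otimes> ?v 2 3 \<oplus> (- ?q) \<odot> (?v 2 3 \<otimes> \<alpha>) = \<zero>"
    and D33: "\<gamma> \<otimes> ?v 3 3 \<oplus> (- ?q) \<odot> (?v 3 3 \<otimes> \<gamma>) = \<zero>"
    by (simp_all add: v_matrix_values norm)
  have "\<alpha> \<otimes> ?v 3 3 \<oplus> (- ?q) \<odot> (?v 2 3 \<otimes> \<gamma>) = star A u \<otimes> (\<alpha> \<otimes> star A \<alpha> \<oplus> ?q\<^sup>2 \<odot> (star A \<gamma> \<otimes> \<gamma>))"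
    by (subst r_distr) (simp_all add: v_matrix_values su sus m_assoc scal_mult power2_eq_square)
  then have D23: "\<alpha> \<otimes> ?v 3 3 \<oplus> (- ?q) \<odot> (?v 2 3 \<otimes> \<gamma>) = star A u"
    by (simp add: r2')
  have "\<gamma> \<otimes> ?v 2 3 \<oplus> (- ?q) \<odot> (?v 3 3 \<otimes> \<alpha>) = (- ?q) \<odot> (star A u \<otimes> (star A \<gamma> \<otimes> \<gamma> \<oplus> star A \<alpha> \<otimes> \<alpha>))"
    by (subst r_distr) (simp_all add: scal_add v_matrix_values su sus gg m_assoc scal_mult)
  then have D32: "\<gamma> \<otimes> ?v 2 3 \<oplus> (- ?q) \<odot> (?v 3 3 \<otimes> \<alpha>) = (- ?q) \<odot> star A u"
    by (simp add: r1')
  \<comment> \<open>The quantum minor of rows x, y in columns 2 and 3. Its value on the lower block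
    is \<open>star A u\<close>, the inverse of the entry in the upper block, which is how the
    determinant becomes 1.\<close>
  define D where "D x y = ?v x 2 \<otimes> ?v y 3 \<oplus> (- ?q) \<odot> (?v x 3 \<otimes> ?v y 2)" for x y
  have D: "D 2 2 = \<zero>" "D 3 3 = \<zero>" "D 2 3 = star A u" "D 3 2 = (- ?q) \<odot> star A u"
    "D 1 x = \<zero>" "D x 1 = \<zero>" for x
    using D22 D33 D23 D32 by (simp_all add: D_def v_matrix_values)
  have uv: "?v x y \<otimes> u = u \<otimes> ?v x y" for x y
    by (simp add: v_matrix_def su sus m_assoc scal_mult uu usu)
  have v1: "?v 1 y = (if y = 1 then u else \<zero>)" "?v x 1 = (if x = 1 then u else \<zero>)" for x y
    by (simp_all add: v_matrix_def)
  have Dc [simp]: "D x y \<in> carrier A" for x y by (simp add: D_def)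
  have E: "(\<Oplus>i1\<in>?I. \<Oplus>i2\<in>?I. \<Oplus>i3\<in>?I. E_tensor q i1 i2 i3 \<odot> (?v j1 i1 \<otimes> ?v j2 i2 \<otimes> ?v j3 i3)) =
      E_tensor q j1 j2 j3 \<odot> \<one>"
    if j: "j1 \<in> ?I" "j2 \<in> ?I" "j3 \<in> ?I" for j1 j2 j3
  proof -
    \<comment> \<open>Laplace expansion along column 1. Its only nonzero entry is u, which commutes
      with every entry of the matrix and so can be pulled to the front.\<close>
    have "(\<Oplus>i1\<in>?I. \<Oplus>i2\<in>?I. \<Oplus>i3\<in>?I. E_tensor q i1 i2 i3 \<odot> (?v j1 i1 \<otimes> ?v j2 i2 \<otimes> ?v j3 i3)) =
       ?v j1 1 \<otimes> D j2 j3 \<oplus> (- ?q) \<odot> (?v j2 1 \<otimes> D j1 j3) \<oplus> ?q\<^sup>2 \<odot> (?v j3 1 \<otimes> D j1 j2)"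
    proof -
      have "?v j3 1 \<otimes> x = x \<otimes> ?v j3 1" if "x = ?v j1 k \<otimes> ?v j2 l" for x k l
        using that by (auto simp: v1 m_assoc uv su' [OF uv])
      have m: "?v j1 k \<otimes> ?v j2 1 \<otimes> ?v j3 l = ?v j2 1 \<otimes> (?v j1 k \<otimes> ?v j3 l)"
        "?v j1 k \<otimes> ?v j2 l \<otimes> ?v j3 1 = ?v j3 1 \<otimes> (?v j1 k \<otimes> ?v j2 l)" for k l
        by (auto simp: v1 m_assoc uv su' [OF uv])
      show ?thesis
        by (simp add: finsum_three Pi_iff E_tensor_values E_tensor_eq_0 D_def m r_distr scal_mult scal_add)
          (simp add: m_assoc a_ac power2_eq_square power3_eq_cube)
    qed
    also have "\<dots> = E_tensor q j1 j2 j3 \<odot> \<one>"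
      using j unfolding in_three
      by (elim disjE; simp only: E_tensor_values E_tensor_eq_0 v1 D; simp add: uu scal_mult power2_eq_square power3_eq_cube)
    finally show ?thesis .
  qed
  show ?thesis
    unfolding SUq3_relations_def
  proof (intro conjI ballI)
    fix i j show "?v i j \<in> carrier A" by (rule vc)
  qed (fact U, rule E)
qed

section \<open>Hopf algebras generated by a matrix\<close>

lemma make_hopf_simps [simp]:
  "carrier (make_hopf A D e S) = carrier A" "monoid.mult (make_hopf A D e S) = monoid.mult A"
  "one (make_hopf A D e S) = one A" "zero (make_hopf A D e S) = zero A"
  "add (make_hopf A D e S) = add A" "smult (make_hopf A D e S) = smult A"
  "star (make_hopf A D e S) = star A" "comult (make_hopf A D e S) = D"
  "counit (make_hopf A D e S) = e" "antipode (make_hopf A D e S) = S"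
  by (simp_all add: make_hopf_def)

lemma make_hopf_linear_map [simp]:
  "linear_map (make_hopf A D e S) B = linear_map A B" "linear_map B (make_hopf A D e S) = linear_map B A"
  by (simp_all add: linear_map_def fun_eq_iff)

lemma make_hopf_alg_hom [simp]:
  "alg_hom (make_hopf A D e S) B = alg_hom A B" "alg_hom B (make_hopf A D e S) = alg_hom B A"
  by (simp_all add: alg_hom_def ring_hom_def fun_eq_iff)

lemma make_hopf_star_hom [simp]:
  "star_hom (make_hopf A D e S) B = star_hom A B" "star_hom B (make_hopf A D e S) = star_hom B A"
  by (simp_all add: star_hom_def fun_eq_iff)

lemma make_hopf_bilinear_form [simp]:
  "bilinear_form (make_hopf A D e S) B = bilinear_form A B" "bilinear_form B (make_hopf A D e S) = bilinear_form B A"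
  by (simp_all add: bilinear_form_def fun_eq_iff)

lemma make_hopf_pure_tensor [simp]:
  "pure_tensor (make_hopf A D e S) B = pure_tensor A B" "pure_tensor B (make_hopf A D e S) = pure_tensor B A"
  by (simp_all add: pure_tensor_def fun_eq_iff)

lemma make_hopf_tensor_alg [simp]:
  "tensor_alg (make_hopf A D e S) B = tensor_alg A B" "tensor_alg B (make_hopf A D e S) = tensor_alg B A"
  by (simp_all add: tensor_alg_def cong: if_cong)

lemma make_hopf_tensor_maps [simp]:
  "tensor_map (make_hopf A D e S) B = tensor_map A B" "tensor_map B (make_hopf A D e S) = tensor_map B A"
  "tensor_lift (make_hopf A D e S) = tensor_lift A"
  "tensor_assoc (make_hopf A D e S) (make_hopf A D e S) (make_hopf A D e S) = tensor_assoc A A A"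
  by (simp_all add: tensor_map_def tensor_lift_def tensor_assoc_def fun_eq_iff)

lemma make_hopf_matrix_map [simp]:
  "is_matrix_star_map (make_hopf A D e S) B = is_matrix_star_map A B"
  "is_matrix_star_map B (make_hopf A D e S) = is_matrix_star_map B A"
  by (simp_all add: is_matrix_star_map_def fun_eq_iff)

lemma make_hopf_homogeneous [simp]: "homogeneous (make_hopf A D e S) X = homogeneous A X"
proof -
  have "(x, d) \<in> homogeneous (make_hopf A D e S) X \<longleftrightarrow> (x, d) \<in> homogeneous A X" for x d
  proof
    assume "(x, d) \<in> homogeneous (make_hopf A D e S) X"
    then show "(x, d) \<in> homogeneous A X"
      by induction (use homogeneous.intros [where A = A and X = X] in simp_all)
  next
    assume "(x, d) \<in> homogeneous A X"
    then show "(x, d) \<in> homogeneous (make_hopf A D e S) X"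
      by induction (use homogeneous.intros [where A = "make_hopf A D e S" and X = X] in simp_all)
  qed
  then show ?thesis by auto
qed

lemma star_algebra_make_hopf: "star_algebra A \<Longrightarrow> star_algebra (make_hopf A D e S)"
proof -
  assume "star_algebra A"
  then interpret star_algebra A .
  show ?thesis
    by (rule star_algebraI)
      (auto simp: a_ac m_assoc l_distr r_distr scal_add add_scal scal_mult
         star_add star_smult star_mult uminus_scal [symmetric] l_neg r_neg)
qed

lemma (in star_algebra_pair) tensor_finsum:
  assumes "g \<in> S \<rightarrow> carrier A" "b \<in> carrier B"
  shows "pure (finsum A g S) b = finsum T (\<lambda>i. pure (g i) b) S"
  by (rule linear_map_finsum [OF _ A.star_algebra_axioms T.star_algebra_axioms assms(1)])
    (simp add: linear_mapI pure_add_left pure_smult_left assms(2))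

lemma (in star_algebra_pair) tensor_finsum_right:
  assumes "g \<in> S \<rightarrow> carrier B" "a \<in> carrier A"
  shows "pure a (finsum B g S) = finsum T (\<lambda>i. pure a (g i)) S"
  by (rule linear_map_finsum [OF _ B.star_algebra_axioms T.star_algebra_axioms assms(1)])
    (simp add: linear_mapI pure_add_right pure_smult_right assms(2))

lemma (in star_algebra_pair) bilinear_scal_left:
  "linear_map A complex_alg \<phi> \<Longrightarrow> bilinear_map A B B (\<lambda>a b. \<phi> a \<odot>\<^bsub>B\<^esub> b)"
  by (rule bilinear_mapI) (simp_all add: linear_mapD B.add_scal B.scal_add mult.commute)

lemma (in star_algebra_pair) bilinear_scal_right:
  "linear_map B complex_alg \<phi> \<Longrightarrow> bilinear_map A B A (\<lambda>a b. \<phi> b \<odot>\<^bsub>A\<^esub> a)"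
  by (rule bilinear_mapI) (simp_all add: linear_mapD A.add_scal A.scal_add mult.commute)

lemma (in star_algebra_pair) tensor_lift_scal_left:
  assumes "separated B" and f: "alg_hom A complex_alg f"
  shows "alg_hom T B (tensor_lift B (\<lambda>a b. f a \<odot>\<^bsub>B\<^esub> b))"
proof (rule tensor_alg_homI [OF B.star_algebra_axioms])
  note bil = bilinear_scal_left [OF alg_hom_linear [OF f]]
  note lp = tensor_lift_props [OF B.star_algebra_axioms assms(1) bil]
  show "linear_map T B (tensor_lift B (\<lambda>a b. f a \<odot>\<^bsub>B\<^esub> b))" by (rule lp(2))
qed (simp_all add: tensor_lift_pure [OF B.star_algebra_axioms assms(1) bilinear_scal_left [OF alg_hom_linear [OF f]]]
    alg_homD [OF f] B.scal_mult mult.commute)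

lemma (in star_algebra_pair) tensor_lift_scal_right:
  assumes "separated A" and f: "alg_hom B complex_alg f"
  shows "alg_hom T A (tensor_lift A (\<lambda>a b. f b \<odot>\<^bsub>A\<^esub> a))"
proof (rule tensor_alg_homI [OF A.star_algebra_axioms])
  note bil = bilinear_scal_right [OF alg_hom_linear [OF f]]
  note lp = tensor_lift_props [OF A.star_algebra_axioms assms(1) bil]
  show "linear_map T A (tensor_lift A (\<lambda>a b. f b \<odot>\<^bsub>A\<^esub> a))" by (rule lp(2))
qed (simp_all add: tensor_lift_pure [OF A.star_algebra_axioms assms(1) bilinear_scal_right [OF alg_hom_linear [OF f]]]
    alg_homD [OF f] A.scal_mult mult.commute)

section \<open>Bialgebra structure determined on matrix entries\<close>

definition entries :: "(nat \<Rightarrow> nat \<Rightarrow> 'a) \<Rightarrow> 'a set" where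
  "entries a = {a i j |i j. i \<in> {1..3} \<and> j \<in> {1..3}}"

definition matrix_comult :: "('a, 'm) star_alg_scheme \<Rightarrow> (nat \<Rightarrow> nat \<Rightarrow> 'a) \<Rightarrow> nat \<Rightarrow> nat \<Rightarrow> ('a, 'a) tensor" where
  "matrix_comult A a i j = (\<Oplus>\<^bsub>tensor_alg A A\<^esub>k\<in>{1..3}. pure_tensor A A (a i k) (a k j))"

text \<open>\<open>gen\<close> lets identities between algebra maps be checked on entries, and
  \<open>sep\<close> gives \<open>tensor_lift\<close> into \<open>A\<close> its intended
  values.\<close>

locale matrix_generated = SUq3_matrix A q a
  for A :: "'a star_alg" (structure) and q and a :: "nat \<Rightarrow> nat \<Rightarrow> 'a" +
  assumes gen: "carrier A = generated_alg A (entries a)" and sep: "separated A"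
begin

sublocale AA: star_algebra_pair A A ..

abbreviation "AT \<equiv> tensor_alg A A"

lemma entries_subset: "entries a \<subseteq> carrier A"
  by (auto simp: entries_def)

lemma alg_hom_ext:
  assumes "alg_hom A B f" "alg_hom A B g"
    "\<And>i j. i \<in> {1..3} \<Longrightarrow> j \<in> {1..3} \<Longrightarrow> f (a i j) = g (a i j)" "x \<in> carrier A"
  shows "f x = g x"
proof (rule alg_hom_eq_on_generated [OF star_algebra_axioms assms(1,2) entries_subset])
  fix y assume "y \<in> entries a"
  then show "f y = g y" using assms(3) by (auto simp: entries_def)
qed (use assms(4) gen in simp)

lemma matrix_star_map_unique:
  assumes "star_hom A B f" "\<And>i j. i \<in> {1..3} \<Longrightarrow> j \<in> {1..3} \<Longrightarrow> f (a i j) = b i j"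
  shows "\<exists>!f. is_matrix_star_map A B a b f"
proof (rule ex1I)
  show "is_matrix_star_map A B a b (restrict f (carrier A))"
    using assms star_hom_restrict [OF assms(1)] by (auto simp: is_matrix_star_map_def)
  fix g assume g: "is_matrix_star_map A B a b g"
  show "g = restrict f (carrier A)"
  proof (rule extensionalityI [of _ "carrier A"])
    fix x assume "x \<in> carrier A"
    then show "g x = restrict f (carrier A) x"
      using g assms alg_hom_ext [of B g f x] by (simp add: is_matrix_star_map_def star_hom_alg)
  qed (use g in \<open>simp_all add: is_matrix_star_map_def\<close>)
qed

lemma matrix_star_map:
  assumes "star_hom A B f" "\<And>i j. i \<in> {1..3} \<Longrightarrow> j \<in> {1..3} \<Longrightarrow> f (a i j) = b i j"
  shows "star_hom A B (matrix_star_map A B a b)"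
    "i \<in> {1..3} \<Longrightarrow> j \<in> {1..3} \<Longrightarrow> matrix_star_map A B a b (a i j) = b i j"
proof -
  have "is_matrix_star_map A B a b (matrix_star_map A B a b)"
    unfolding matrix_star_map_def by (rule theI' [OF matrix_star_map_unique [OF assms]])
  then show "star_hom A B (matrix_star_map A B a b)"
    "i \<in> {1..3} \<Longrightarrow> j \<in> {1..3} \<Longrightarrow> matrix_star_map A B a b (a i j) = b i j"
    by (simp_all add: is_matrix_star_map_def)
qed

lemma matrix_alg_map:
  assumes f: "alg_hom A B f" "\<And>i j. i \<in> {1..3} \<Longrightarrow> j \<in> {1..3} \<Longrightarrow> f (a i j) = b i j"
  shows "alg_hom A B (matrix_alg_map A B a b)"
    "i \<in> {1..3} \<Longrightarrow> j \<in> {1..3} \<Longrightarrow> matrix_alg_map A B a b (a i j) = b i j"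
proof -
  let ?P = "\<lambda>f. f \<in> extensional (carrier A) \<and> alg_hom A B f \<and> (\<forall>i\<in>{1..3}. \<forall>j\<in>{1..3}. f (a i j) = b i j)"
  have "\<exists>!f. ?P f"
  proof (rule ex1I)
    show "?P (restrict f (carrier A))"
      using f alg_hom_restrict [OF f(1)] by auto
    fix g assume g: "?P g"
    show "g = restrict f (carrier A)"
    proof (rule extensionalityI [of _ "carrier A"])
      fix x assume "x \<in> carrier A"
      then show "g x = restrict f (carrier A) x"
        using g f alg_hom_ext [of B g f x] by simp
    qed (use g in simp_all)
  qed
  from theI' [OF this] show "alg_hom A B (matrix_alg_map A B a b)"
    "i \<in> {1..3} \<Longrightarrow> j \<in> {1..3} \<Longrightarrow> matrix_alg_map A B a b (a i j) = b i j"
    by (simp_all add: matrix_alg_map_def)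
qed

end

locale matrix_bialgebra = matrix_generated A q a
  for A :: "'a star_alg" (structure) and q a +
  fixes D :: "'a \<Rightarrow> ('a, 'a) tensor" and e :: "'a \<Rightarrow> complex"
  assumes D_hom: "star_hom A (tensor_alg A A) D"
    and D_entry: "\<And>i j. i \<in> {1..3} \<Longrightarrow> j \<in> {1..3} \<Longrightarrow> D (a i j) = matrix_comult A a i j"
    and e_hom: "star_hom A complex_alg e"
    and e_entry: "\<And>i j. i \<in> {1..3} \<Longrightarrow> j \<in> {1..3} \<Longrightarrow> e (a i j) = (if i = j then 1 else 0)"
begin

lemmas D_alg = star_hom_alg [OF D_hom] and e_alg = star_hom_alg [OF e_hom]

lemma lift_D_entry:
  assumes "star_algebra B" "linear_map AT B f" "i \<in> {1..3}" "j \<in> {1..3}"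
  shows "f (D (a i j)) = (\<Oplus>\<^bsub>B\<^esub>k\<in>{1..3}. f (AA.pure (a i k) (a k j)))"
  unfolding D_entry [OF assms(3,4)] matrix_comult_def
  by (rule linear_map_finsum [OF assms(2) AA.star_algebra_tensor assms(1)]) (use assms(3,4) in auto)

lemma coassociative:
  assumes "x \<in> carrier A"
  shows "tensor_assoc A A A (tensor_map AT A D (\<lambda>a. a) (D x)) = tensor_map A AT (\<lambda>a. a) D (D x)"
proof -
  interpret T_A: star_algebra_pair AT A
    by (intro star_algebra_pair.intro AA.star_algebra_tensor star_algebra_axioms)
  interpret A_T: star_algebra_pair A AT
    by (intro star_algebra_pair.intro AA.star_algebra_tensor star_algebra_axioms)
  note id = star_hom_alg [OF star_hom_id [of A]]
  note sA = star_algebra_axioms and sT = AA.star_algebra_tensor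
  note m1 = tensor_map_alg_hom [OF sA sA sT sA D_alg id]
  note m2 = tensor_map_alg_hom [OF sA sA sA sT id D_alg]
  note as = tensor_assoc_alg_hom [OF sA sA sA]
  show ?thesis
  proof (rule alg_hom_ext [OF _ _ _ assms])
    show "alg_hom A A_T.T (\<lambda>x. tensor_assoc A A A (tensor_map AT A D (\<lambda>a. a) (D x)))"
      by (rule alg_hom_compose [OF alg_hom_compose [OF D_alg m1] as])
    show "alg_hom A A_T.T (\<lambda>x. tensor_map A AT (\<lambda>a. a) D (D x))"
      by (rule alg_hom_compose [OF D_alg m2])
    fix i j :: nat assume ij: "i \<in> {1..3}" "j \<in> {1..3}"
    note lin1 = alg_hom_linear [OF alg_hom_compose [OF m1 as]]
    have p1: "tensor_assoc A A A (tensor_map AT A D (\<lambda>a. a) (AA.pure (a i k) (a k j))) =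
        (\<Oplus>\<^bsub>A_T.T\<^esub>l\<in>{1..3}. A_T.pure (a i l) (AA.pure (a l k) (a k j)))" if k: "k \<in> {1..3}" for k
    proof -
      have "tensor_map AT A D (\<lambda>a. a) (AA.pure (a i k) (a k j)) = T_A.pure (D (a i k)) (a k j)"
        using ij k by (subst tensor_map_pure [OF sA sA sT sA alg_hom_linear [OF D_alg] alg_hom_linear [OF id]]) auto
      also have "\<dots> = (\<Oplus>\<^bsub>T_A.T\<^esub>l\<in>{1..3}. T_A.pure (AA.pure (a i l) (a l k)) (a k j))"
        unfolding D_entry [OF ij(1) k] matrix_comult_def
        using ij k by (subst T_A.tensor_finsum) auto
      finally have "tensor_assoc A A A (tensor_map AT A D (\<lambda>a. a) (AA.pure (a i k) (a k j))) =
          (\<Oplus>\<^bsub>A_T.T\<^esub>l\<in>{1..3}. tensor_assoc A A A (T_A.pure (AA.pure (a i l) (a l k)) (a k j)))"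
        using ij k
        by (simp only:) (subst linear_map_finsum [OF alg_hom_linear [OF as] T_A.star_algebra_tensor A_T.star_algebra_tensor], auto)
      also have "\<dots> = (\<Oplus>\<^bsub>A_T.T\<^esub>l\<in>{1..3}. A_T.pure (a i l) (AA.pure (a l k) (a k j)))"
        using ij k by (intro finsum_scong [unfolded simp_implies_def] HOL.refl tensor_assoc_pure [OF sA sA sA]) auto
      finally show ?thesis .
    qed
    have p2: "tensor_map A AT (\<lambda>a. a) D (AA.pure (a i k) (a k j)) =
        (\<Oplus>\<^bsub>A_T.T\<^esub>l\<in>{1..3}. A_T.pure (a i k) (AA.pure (a k l) (a l j)))" if k: "k \<in> {1..3}" for k
      using ij k
      by (subst tensor_map_pure [OF sA sA sA sT alg_hom_linear [OF id] alg_hom_linear [OF D_alg]])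
        (auto simp: D_entry matrix_comult_def intro!: A_T.tensor_finsum_right)
    have "tensor_assoc A A A (tensor_map AT A D (\<lambda>a. a) (D (a i j))) =
        (\<Oplus>\<^bsub>A_T.T\<^esub>k\<in>{1..3}. \<Oplus>\<^bsub>A_T.T\<^esub>l\<in>{1..3}. A_T.pure (a i l) (AA.pure (a l k) (a k j)))"
      using ij by (subst lift_D_entry [OF A_T.star_algebra_tensor lin1])
        (auto intro!: finsum_scong [unfolded simp_implies_def] p1)
    \<comment> \<open>Both sides are the same double sum over the intermediate indices; only the
      order of summation differs.\<close>
    also have "\<dots> = (\<Oplus>\<^bsub>A_T.T\<^esub>l\<in>{1..3}. \<Oplus>\<^bsub>A_T.T\<^esub>k\<in>{1..3}. A_T.pure (a i l) (AA.pure (a l k) (a k j)))"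
      using ij by (intro A_T.T.finsum_swap) auto
    also have "\<dots> = tensor_map A AT (\<lambda>a. a) D (D (a i j))"
      using ij by (subst lift_D_entry [OF A_T.star_algebra_tensor alg_hom_linear [OF m2]])
        (auto intro!: finsum_scong [unfolded simp_implies_def] p2 [symmetric])
    finally show "tensor_assoc A A A (tensor_map AT A D (\<lambda>a. a) (D (a i j))) =
      tensor_map A AT (\<lambda>a. a) D (D (a i j))" .
  qed
qed

text \<open>Slicing the coproduct with a diagonal character leaves one term and rescales row i by
  \<open>l i\<close>. The trivial character gives the counit law, and other characters enter the
  antipode.\<close>

lemma scale_left:
  assumes f: "alg_hom A complex_alg f"
    and fa: "\<And>i j. i \<in> {1..3} \<Longrightarrow> j \<in> {1..3} \<Longrightarrow> f (a i j) = (if i = j then l i else 0)"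
  shows "alg_hom A A (\<lambda>x. tensor_lift A (\<lambda>a b. f a \<odot> b) (D x))"
    "i \<in> {1..3} \<Longrightarrow> j \<in> {1..3} \<Longrightarrow> tensor_lift A (\<lambda>a b. f a \<odot> b) (D (a i j)) = l i \<odot> a i j"
proof -
  note h = AA.tensor_lift_scal_left [OF sep f]
  note p = AA.tensor_lift_pure [OF star_algebra_axioms sep AA.bilinear_scal_left [OF alg_hom_linear [OF f]]]
  show "alg_hom A A (\<lambda>x. tensor_lift A (\<lambda>a b. f a \<odot> b) (D x))"
    by (rule alg_hom_compose [OF D_alg h])
  assume ij: "i \<in> {1..3}" "j \<in> {1..3}"
  have "tensor_lift A (\<lambda>a b. f a \<odot> b) (D (a i j)) = (\<Oplus>k\<in>{1..3}. f (a i k) \<odot> a k j)"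
    using ij by (subst lift_D_entry [OF star_algebra_axioms alg_hom_linear [OF h]])
      (auto intro!: finsum_scong [unfolded simp_implies_def] p)
  also have "\<dots> = f (a i i) \<odot> a i j"
    by (rule finsum_delta) (use ij fa in auto)
  finally show "tensor_lift A (\<lambda>a b. f a \<odot> b) (D (a i j)) = l i \<odot> a i j" using ij fa by simp
qed

lemma scale_right:
  assumes f: "alg_hom A complex_alg f"
    and fa: "\<And>i j. i \<in> {1..3} \<Longrightarrow> j \<in> {1..3} \<Longrightarrow> f (a i j) = (if i = j then l i else 0)"
  shows "alg_hom A A (\<lambda>x. tensor_lift A (\<lambda>a b. f b \<odot> a) (D x))"
    "i \<in> {1..3} \<Longrightarrow> j \<in> {1..3} \<Longrightarrow> tensor_lift A (\<lambda>a b. f b \<odot> a) (D (a i j)) = l j \<odot> a i j"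
proof -
  note h = AA.tensor_lift_scal_right [OF sep f]
  note p = AA.tensor_lift_pure [OF star_algebra_axioms sep AA.bilinear_scal_right [OF alg_hom_linear [OF f]]]
  show "alg_hom A A (\<lambda>x. tensor_lift A (\<lambda>a b. f b \<odot> a) (D x))"
    by (rule alg_hom_compose [OF D_alg h])
  assume ij: "i \<in> {1..3}" "j \<in> {1..3}"
  have "tensor_lift A (\<lambda>a b. f b \<odot> a) (D (a i j)) = (\<Oplus>k\<in>{1..3}. f (a k j) \<odot> a i k)"
    using ij by (subst lift_D_entry [OF star_algebra_axioms alg_hom_linear [OF h]])
      (auto intro!: finsum_scong [unfolded simp_implies_def] p)
  also have "\<dots> = f (a j j) \<odot> a i j"
    by (rule finsum_delta) (use ij fa in auto)
  finally show "tensor_lift A (\<lambda>a b. f b \<odot> a) (D (a i j)) = l j \<odot> a i j" using ij fa by simp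
qed

lemma counit_laws:
  assumes "x \<in> carrier A"
  shows "tensor_lift A (\<lambda>a b. e a \<odot> b) (D x) = x" "tensor_lift A (\<lambda>a b. e b \<odot> a) (D x) = x"
proof -
  note id = star_hom_alg [OF star_hom_id [of A]]
  \<comment> \<open>The counit is the diagonal character with all values 1, for which both
    rescalings are the identity.\<close>
  have e1: "e (a i j) = (if i = j then (\<lambda>_. 1) i else 0)" if "i \<in> {1..3}" "j \<in> {1..3}" for i j
    using e_entry [OF that] by simp
  show "tensor_lift A (\<lambda>a b. e a \<odot> b) (D x) = x"
  proof (rule alg_hom_ext [OF scale_left(1) [OF e_alg e1] id _ assms])
    fix i j :: nat assume ij: "i \<in> {1..3}" "j \<in> {1..3}"
    then show "tensor_lift A (\<lambda>a b. e a \<odot> b) (D (a i j)) = a i j"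
      using scale_left(2) [OF e_alg e1 ij] by simp
  qed assumption
  show "tensor_lift A (\<lambda>a b. e b \<odot> a) (D x) = x"
  proof (rule alg_hom_ext [OF scale_right(1) [OF e_alg e1] id _ assms])
    fix i j :: nat assume ij: "i \<in> {1..3}" "j \<in> {1..3}"
    then show "tensor_lift A (\<lambda>a b. e b \<odot> a) (D (a i j)) = a i j"
      using scale_right(2) [OF e_alg e1 ij] by simp
  qed assumption
qed

end

locale matrix_hopf_algebra = matrix_bialgebra A q a D e
  for A :: "'a star_alg" (structure) and q a D e +
  fixes S :: "'a \<Rightarrow> 'a"
  assumes S_hom: "alg_hom A (opposite A) S"
    and S_entry: "\<And>i j. i \<in> {1..3} \<Longrightarrow> j \<in> {1..3} \<Longrightarrow> S (a i j) = star A (a j i)"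
begin

abbreviation "H \<equiv> make_hopf A D e S"

lemma S_linear: "linear_map A A S"
  using alg_hom_linear [OF S_hom] by (simp add: linear_map_def)

lemma S_mult: "x \<in> carrier A \<Longrightarrow> y \<in> carrier A \<Longrightarrow> S (x \<otimes> y) = S y \<otimes> S x"
  using alg_homD(2) [OF S_hom] by simp

lemma S_closed [simp]: "x \<in> carrier A \<Longrightarrow> S x \<in> carrier A"
  using linear_mapD(1) [OF S_linear] .

lemma S_one: "S \<one> = \<one>"
  using alg_homD(5) [OF S_hom] by simp

text \<open>Both antipode identities say that a linear map \<open>m\<close> on \<open>A \<otimes> A\<close> satisfies
  \<open>m (\<Delta> x) = \<epsilon> x\<close>; the set of such \<open>x\<close> is a subalgebra because \<open>m (s t)\<close> only depends on
  \<open>m s\<close> (respectively \<open>m t\<close>).\<close>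

lemma antipode_left_law:
  assumes "x \<in> carrier A"
  shows "tensor_lift A (\<lambda>a b. S a \<otimes> b) (D x) = e x \<odot> \<one>"
proof -
  let ?m = "tensor_lift A (\<lambda>a b. S a \<otimes> b)"
  note id = alg_hom_linear [OF star_hom_alg [OF star_hom_id [of A]]]
  note bil = AA.bilinear_mult [OF star_algebra_axioms S_linear id]
  note p = AA.tensor_lift_pure [OF star_algebra_axioms sep bil]
  note lin = AA.tensor_lift_linear [OF star_algebra_axioms sep bil]
  note l = linear_mapD [OF lin]
  \<comment> \<open>As \<open>S\<close> is antimultiplicative, the new factor \<open>S c\<close>
    comes out on the far left and d on the far right, with the value at s enclosed between
    them.\<close>
  have m1: "?m (s \<otimes>\<^bsub>AT\<^esub> AA.pure c d) = S c \<otimes> ?m s \<otimes> d"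
    if "s \<in> carrier AT" "c \<in> carrier A" "d \<in> carrier A" for s c d
    using that(1)
    by (induction rule: AA.tensor_induct)
      (use that(2,3) in \<open>simp_all add: p l AA.pure_mult S_mult m_assoc AA.tensor_mult_add_left l_distr r_distr\<close>)
  \<comment> \<open>A scalar value at s can be taken out from between \<open>S c\<close> and d, so
    multiplication by s acts on the value at t as that scalar.\<close>
  have m2: "?m (s \<otimes>\<^bsub>AT\<^esub> t) = z \<odot> ?m t"
    if "t \<in> carrier AT" "s \<in> carrier AT" "?m s = z \<odot> \<one>" for s t z
    using that(1)
    by (induction rule: AA.tensor_induct)
      (use that(2,3) in \<open>simp_all add: m1 p l scal_mult AA.T.r_distr scal_add\<close>)
  note Dl = alg_homD [OF D_alg] and el = alg_homD [OF e_alg, simplified]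
  have "x \<in> generated_alg A (entries a)" using assms gen by simp
  then show ?thesis
  proof induction
    case (incl x)
    then obtain i j where ij: "i \<in> {1..3}" "j \<in> {1..3}" "x = a i j" by (auto simp: entries_def)
    have "?m (D (a i j)) = (\<Oplus>k\<in>{1..3}. star A (a k i) \<otimes> a k j)"
      using ij by (subst lift_D_entry [OF star_algebra_axioms lin])
        (auto intro!: finsum_scong [unfolded simp_implies_def] simp: p S_entry simp del: atLeastAtMost_iff)
    then show ?case using ij by (simp add: col_unitary e_entry del: atLeastAtMost_iff)
  next
    case one
    show ?case by (simp add: Dl el tensor_alg_simps p S_one)
  next
    case (add x y)
    then show ?case by (simp add: gen [symmetric] Dl el l add_scal)
  next
    case (mult x y)
    then show ?case using m2 [of "D y" "D x" "e x"] by (simp add: gen [symmetric] Dl el)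
  next
    case (smult x c)
    then show ?case by (simp add: gen [symmetric] Dl el l)
  qed
qed

lemma antipode_right_law:
  assumes "x \<in> carrier A"
  shows "tensor_lift A (\<lambda>a b. a \<otimes> S b) (D x) = e x \<odot> \<one>"
proof -
  let ?m = "tensor_lift A (\<lambda>a b. a \<otimes> S b)"
  note id = alg_hom_linear [OF star_hom_alg [OF star_hom_id [of A]]]
  note bil = AA.bilinear_mult [OF star_algebra_axioms id S_linear]
  note p = AA.tensor_lift_pure [OF star_algebra_axioms sep bil]
  note lin = AA.tensor_lift_linear [OF star_algebra_axioms sep bil]
  note l = linear_mapD [OF lin]
  \<comment> \<open>Mirror image: multiplication from the left now encloses the value between c and
    \<open>S d\<close>.\<close>
  have m1: "?m (AA.pure c d \<otimes>\<^bsub>AT\<^esub> s) = c \<otimes> ?m s \<otimes> S d"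
    if "s \<in> carrier AT" "c \<in> carrier A" "d \<in> carrier A" for s c d
    using that(1)
    by (induction rule: AA.tensor_induct)
      (use that(2,3) in \<open>simp_all add: p l AA.pure_mult S_mult m_assoc AA.T.r_distr l_distr r_distr\<close>)
  have m2: "?m (t \<otimes>\<^bsub>AT\<^esub> s) = z \<odot> ?m t"
    if "t \<in> carrier AT" "s \<in> carrier AT" "?m s = z \<odot> \<one>" for s t z
    using that(1)
    by (induction rule: AA.tensor_induct)
      (use that(2,3) in \<open>simp_all add: m1 p l scal_mult AA.T.l_distr scal_add\<close>)
  note Dl = alg_homD [OF D_alg] and el = alg_homD [OF e_alg, simplified]
  have "x \<in> generated_alg A (entries a)" using assms gen by simp
  then show ?thesis
  proof induction
    case (incl x)
    then obtain i j where ij: "i \<in> {1..3}" "j \<in> {1..3}" "x = a i j" by (auto simp: entries_def)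
    have "?m (D (a i j)) = (\<Oplus>k\<in>{1..3}. a i k \<otimes> star A (a j k))"
      using ij by (subst lift_D_entry [OF star_algebra_axioms lin])
        (auto intro!: finsum_scong [unfolded simp_implies_def] simp: p S_entry simp del: atLeastAtMost_iff)
    then show ?case using ij by (simp add: row_unitary e_entry del: atLeastAtMost_iff)
  next
    case one
    show ?case by (simp add: Dl el tensor_alg_simps p S_one)
  next
    case (add x y)
    then show ?case by (simp add: gen [symmetric] Dl el l add_scal)
  next
    case (mult x y)
    then show ?case using m2 [of "D x" "D y" "e y"] by (simp add: gen [symmetric] Dl el mult.commute)
  next
    case (smult x c)
    then show ?case by (simp add: gen [symmetric] Dl el l)
  qed
qed

lemma hopf_star_algebra_H: "hopf_star_algebra H"
proof (intro hopf_star_algebra.intro hopf_star_algebra_axioms.intro)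
  show "star_algebra H" by (rule star_algebra_make_hopf) (rule star_algebra_axioms)
qed (simp_all add: D_hom e_hom S_linear coassociative counit_laws antipode_left_law antipode_right_law)

end

text \<open>The antipode is the unitary antipode \<open>R\<close> preceded by the rescaling \<open>a\<^sub>i\<^sub>j \<mapsto> q\<^bsup>i-j\<^esup> a\<^sub>i\<^sub>j\<close>, which
  is convolution with characters of the diagonal torus at points that need not be unimodular.\<close>

lemma (in matrix_bialgebra) antipode_exists:
  assumes char: "\<And>x y. x \<noteq> 0 \<Longrightarrow> y \<noteq> 0 \<Longrightarrow> \<exists>f. alg_hom A complex_alg f \<and> (\<forall>i\<in>{1..3}. \<forall>j\<in>{1..3}.
      f (a i j) = (if i \<noteq> j then 0 else if i = 1 then x else if i = 2 then y else inverse (x * y)))"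
    and R: "alg_hom A (opposite A) R" "\<And>i j. i \<in> {1..3} \<Longrightarrow> j \<in> {1..3} \<Longrightarrow>
      R (a i j) = (complex_of_real q powi (int j - int i)) \<odot> star A (a j i)"
  shows "\<exists>S. alg_hom A (opposite A) S \<and> (\<forall>i\<in>{1..3}. \<forall>j\<in>{1..3}. S (a i j) = star A (a j i))"
proof -
  let ?q = "complex_of_real q"
  have q0: "?q \<noteq> 0" using q_nz by simp
  \<comment> \<open>These are q^(i-2) for rows and q^(2-j) for columns. Each triple of values has
    product 1, so it is a point of the torus, and together they cancel the factor q^(j-i) of
    \<open>R\<close>.\<close>
  let ?l = "\<lambda>i. if i = 1 then inverse ?q else if i = 2 then 1 else ?q"
  let ?m = "\<lambda>i. if i = 1 then ?q else if i = 2 then 1 else inverse ?q"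
  obtain f where f: "alg_hom A complex_alg f"
    and f': "\<And>i j. i \<in> {1..3} \<Longrightarrow> j \<in> {1..3} \<Longrightarrow> f (a i j) = (if i = j then ?l i else 0)"
    using char [of "inverse ?q" 1] q0 by auto
  obtain g where g: "alg_hom A complex_alg g"
    and g': "\<And>i j. i \<in> {1..3} \<Longrightarrow> j \<in> {1..3} \<Longrightarrow> g (a i j) = (if i = j then ?m i else 0)"
    using char [of ?q 1] q0 by auto
  define F where "F x = tensor_lift A (\<lambda>a b. f a \<odot> b) (D x)" for x
  define G where "G x = tensor_lift A (\<lambda>a b. g b \<odot> a) (D x)" for x
  have F: "alg_hom A A F" "\<And>i j. i \<in> {1..3} \<Longrightarrow> j \<in> {1..3} \<Longrightarrow> F (a i j) = ?l i \<odot> a i j"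
    unfolding F_def by (rule scale_left [OF f f']; assumption)+
  have G: "alg_hom A A G" "\<And>i j. i \<in> {1..3} \<Longrightarrow> j \<in> {1..3} \<Longrightarrow> G (a i j) = ?m j \<odot> a i j"
    unfolding G_def by (rule scale_right [OF g g']; assumption)+
  have w: "?l i * (?m j * ?q powi (int j - int i)) = 1" if "i \<in> {1..3}" "j \<in> {1..3}" for i j
    using that q0 unfolding in_three by (elim disjE) (simp_all add: power_int_def power2_eq_square field_simps)
  have "R (G (F (a i j))) = star A (a j i)" if "i \<in> {1..3}" "j \<in> {1..3}" for i j
    using that w [OF that]
    by (simp add: F(2) G(2) R(2) alg_homD(4) [OF G(1)] alg_homD(4) [OF R(1)] mult.assoc del: atLeastAtMost_iff)
  moreover have "alg_hom A (opposite A) (\<lambda>x. R (G (F x)))"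
    by (rule alg_hom_compose [OF alg_hom_compose [OF F(1) G(1)] R(1)])
  ultimately show ?thesis by (intro exI [of _ "\<lambda>x. R (G (F x))"]) auto
qed

text \<open>Compatibility with coproduct, counit and antipode each equates two algebra maps, into
  the opposite algebra for the antipode, so the entries decide. Surjectivity holds because the image
  contains the entries of \<open>b\<close>.\<close>

lemma matrix_hopf_hom:
  assumes "matrix_hopf_algebra A q a D e S" "matrix_hopf_algebra B q b D' e' S'"
    and f: "star_hom A B f" and fa: "\<And>i j. i \<in> {1..3} \<Longrightarrow> j \<in> {1..3} \<Longrightarrow> f (a i j) = b i j"
  shows "hopf_star_epi (make_hopf A D e S) (make_hopf B D' e' S') f"
proof -
  interpret A: matrix_hopf_algebra A q a D e S by fact
  interpret B: matrix_hopf_algebra B q b D' e' S' by fact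
  note fh = star_hom_alg [OF f]
  note sA = A.star_algebra_axioms and sB = B.star_algebra_axioms
  note ff = tensor_map_alg_hom [OF sA sA sB sB fh fh]
  note ffp = tensor_map_pure [OF sA sA sB sB alg_hom_linear [OF fh] alg_hom_linear [OF fh]]
  have c: "D' (f x) = tensor_map B B f f (D x)" if "x \<in> carrier A" for x
  proof (rule A.alg_hom_ext [OF alg_hom_compose [OF fh B.D_alg] alg_hom_compose [OF A.D_alg ff] _ that])
    fix i j :: nat assume ij: "i \<in> {1..3}" "j \<in> {1..3}"
    show "D' (f (a i j)) = tensor_map B B f f (D (a i j))"
      using ij by (subst A.lift_D_entry [OF B.AA.star_algebra_tensor alg_hom_linear [OF ff]])
        (auto simp: fa B.D_entry matrix_comult_def ffp simp del: atLeastAtMost_iff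
          intro!: finsum_scong [unfolded simp_implies_def])
  qed
  have e: "e' (f x) = e x" if "x \<in> carrier A" for x
    by (rule A.alg_hom_ext [OF alg_hom_compose [OF fh B.e_alg] A.e_alg _ that])
      (simp add: fa A.e_entry B.e_entry del: atLeastAtMost_iff)
  have fo: "alg_hom (opposite A) (opposite B) f"
    using fh by (auto simp: alg_hom_def ring_hom_def linear_map_def)
  have s: "S' (f x) = f (S x)" if "x \<in> carrier A" for x
    by (rule A.alg_hom_ext [OF alg_hom_compose [OF fh B.S_hom] alg_hom_compose [OF A.S_hom fo] _ that])
      (simp add: fa A.S_entry B.S_entry star_homD [OF f] del: atLeastAtMost_iff)
  have "carrier B \<subseteq> f ` carrier A"
  proof
    fix y assume "y \<in> carrier B"
    then have "y \<in> generated_alg B (entries b)" using B.gen by simp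
    moreover have "entries b \<subseteq> f ` carrier A"
    proof
      fix z assume "z \<in> entries b"
      then obtain i j where ij: "i \<in> {1..3}" "j \<in> {1..3}" "z = b i j" by (auto simp: entries_def)
      then show "z \<in> f ` carrier A" by (intro image_eqI [of _ _ "a i j"]) (simp_all add: fa)
    qed
    ultimately show "y \<in> f ` carrier A" using alg_hom_surj [OF sA fh A.entries_subset] by blast
  qed
  then have "f ` carrier A = carrier B" using alg_homD(1) [OF fh] by blast
  then show ?thesis
    by (simp add: hopf_star_epi_def hopf_star_hom_def A.hopf_star_algebra_H B.hopf_star_algebra_H f c e s)
qed

section \<open>The torus\<close>

lemma laurent_induct [case_names single add]:
  fixes p :: "'k \<Rightarrow>\<^sub>0 'b::comm_monoid_add"
  assumes single: "\<And>d c. P (Poly_Mapping.single d c)" and add: "\<And>p q. P p \<Longrightarrow> P q \<Longrightarrow> P (p + q)"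
  shows "P p"
proof -
  let ?s = "\<lambda>K. \<Sum>d\<in>K. Poly_Mapping.single d (Poly_Mapping.lookup p d)"
  have "p = ?s (Poly_Mapping.keys p)"
    by (rule poly_mapping_eqI)
      (auto simp: lookup_sum lookup_single when_def sum.delta in_keys_iff)
  moreover have "P (?s K)" if "finite K" for K
    using that
  proof (induction K)
    case empty
    show ?case using single [of undefined 0] by simp
  next
    case (insert d K)
    then show ?case by (simp add: add single)
  qed
  ultimately show ?thesis by (metis finite_keys)
qed

text \<open>Scalars act as constant polynomials, so the module laws become laws of the commutative
  ring of Laurent polynomials.\<close>

lemma torus_simps [simp]:
  "carrier torus_alg = UNIV" "monoid.mult torus_alg = (*)" "one torus_alg = 1"
  "zero torus_alg = 0" "add torus_alg = (+)"
  "smult torus_alg = (\<lambda>c p. Poly_Mapping.single 0 c * p)"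
  by (simp_all add: torus_alg_def mult_map_scale_conv_mult fun_eq_iff)

lemma inj_uminus_pair: "inj (uminus :: int \<times> int \<Rightarrow> int \<times> int)"
  by (auto simp: inj_def)

lemma lookup_star_torus:
  "Poly_Mapping.lookup (star torus_alg p) d = cnj (Poly_Mapping.lookup p (- d))"
  by (simp add: torus_alg_def Poly_Mapping.map_key.rep_eq [OF inj_uminus_pair] Poly_Mapping.map.rep_eq when_def)

lemma star_torus_single: "star torus_alg (Poly_Mapping.single d c) = Poly_Mapping.single (- d) (cnj c)"
proof (rule poly_mapping_eqI)
  fix d'
  have "d = - d' \<longleftrightarrow> - d = d'" by (metis add.inverse_inverse)
  then show "Poly_Mapping.lookup (star torus_alg (Poly_Mapping.single d c)) d' =
      Poly_Mapping.lookup (Poly_Mapping.single (- d) (cnj c)) d'"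
    by (simp add: lookup_star_torus lookup_single when_def)
qed

lemma star_torus_add: "star torus_alg (p + q) = star torus_alg p + star torus_alg q"
  by (rule poly_mapping_eqI) (simp add: lookup_star_torus lookup_add)

lemma star_torus_mult: "star torus_alg (p * q) = star torus_alg q * star torus_alg p"
proof (induction p rule: laurent_induct)
  case (single d c)
  show ?case
    by (induction q rule: laurent_induct)
      (simp_all add: mult_single star_torus_single star_torus_add algebra_simps)
qed (simp add: star_torus_add algebra_simps)

lemma star_algebra_torus: "star_algebra torus_alg"
proof -
  have "star torus_alg (star torus_alg p) = p" for p
    by (rule poly_mapping_eqI) (simp add: lookup_star_torus)
  moreover have "Poly_Mapping.single 0 (- 1) * p + p = 0" for p :: laurent2
    by (simp add: single_uminus)
  moreover have "Poly_Mapping.single 0 (c + d) * p = Poly_Mapping.single 0 c * p + Poly_Mapping.single 0 d * p"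
    for c d and p :: laurent2
    by (simp add: single_add ring_distribs)
  moreover have "Poly_Mapping.single 0 (c * d) * p = Poly_Mapping.single 0 c * (Poly_Mapping.single 0 d * p)"
    for c d and p :: laurent2
    by (simp add: mult_single mult.assoc [symmetric])
  ultimately show ?thesis
    by (intro star_algebraI)
      (simp_all add: algebra_simps star_torus_add star_torus_mult star_torus_single)
qed

lemma lookup_torus_smult:
  "Poly_Mapping.lookup (Poly_Mapping.single 0 c * p) d = c * Poly_Mapping.lookup p d" for p :: laurent2
  by (simp add: mult_map_scale_conv_mult [symmetric] Poly_Mapping.map.rep_eq when_def)

lemma linear_map_lookup: "linear_map torus_alg complex_alg (\<lambda>p. Poly_Mapping.lookup p d)"
  by (rule linear_mapI) (simp_all add: lookup_add lookup_torus_smult)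

lemma separated_torus: "separated torus_alg"
  unfolding separated_def
proof (intro ballI impI)
  fix p assume "\<forall>\<phi>. linear_map torus_alg complex_alg \<phi> \<longrightarrow> \<phi> p = 0"
  then have "Poly_Mapping.lookup p d = 0" for d using linear_map_lookup by blast
  then show "p = \<zero>\<^bsub>torus_alg\<^esub>" by (simp add: poly_mapping_eqI)
qed

text \<open>The linear extension of \<open>F\<close> from basis elements. It serves for maps out of
  Laurent polynomials and for combinations of the spanning monomials of O(U_q(2)).\<close>

definition lin_comb :: "('c, 'm) star_alg_scheme \<Rightarrow> ('k \<Rightarrow> 'c) \<Rightarrow> ('k \<Rightarrow>\<^sub>0 complex) \<Rightarrow> 'c" where
  "lin_comb C F p = (\<Oplus>\<^bsub>C\<^esub>d\<in>Poly_Mapping.keys p. Poly_Mapping.lookup p d \<odot>\<^bsub>C\<^esub> F d)"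

context star_algebra begin

context
  fixes F :: "'k \<Rightarrow> 'a"
  assumes F_closed [simp]: "\<And>d. F d \<in> carrier A"
begin

lemma lin_comb_superset:
  assumes "finite K" "Poly_Mapping.keys p \<subseteq> K"
  shows "lin_comb A F p = (\<Oplus>d\<in>K. Poly_Mapping.lookup p d \<odot> F d)"
proof -
  have "(\<Oplus>d\<in>K. Poly_Mapping.lookup p d \<odot> F d) =
      (\<Oplus>d\<in>Poly_Mapping.keys p \<union> (K - Poly_Mapping.keys p). Poly_Mapping.lookup p d \<odot> F d)"
    using assms by (intro arg_cong [of _ _ "finsum A _"]) auto
  also have "\<dots> = lin_comb A F p \<oplus> (\<Oplus>d\<in>K - Poly_Mapping.keys p. Poly_Mapping.lookup p d \<odot> F d)"
    unfolding lin_comb_def using assms by (intro finsum_Un_disjoint) auto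
  also have "(\<Oplus>d\<in>K - Poly_Mapping.keys p. Poly_Mapping.lookup p d \<odot> F d) = (\<Oplus>d\<in>K - Poly_Mapping.keys p. \<zero>)"
    by (intro finsum_scong [unfolded simp_implies_def] HOL.refl) (simp add: in_keys_iff)
  finally show ?thesis by (simp add: finsum_zero lin_comb_def)
qed

lemma lin_comb_closed [simp]: "lin_comb A F p \<in> carrier A"
  by (simp add: lin_comb_def)

lemma lin_comb_single: "lin_comb A F (Poly_Mapping.single d c) = c \<odot> F d"
proof -
  have "lin_comb A F (Poly_Mapping.single d c) = (\<Oplus>d'\<in>{d}. Poly_Mapping.lookup (Poly_Mapping.single d c) d' \<odot> F d')"
    by (rule lin_comb_superset) auto
  then show ?thesis by simp
qed

lemma lin_comb_add: "lin_comb A F (p + q) = lin_comb A F p \<oplus> lin_comb A F q"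
proof -
  let ?K = "Poly_Mapping.keys p \<union> Poly_Mapping.keys q"
  have "lin_comb A F (p + q) = (\<Oplus>d\<in>?K. Poly_Mapping.lookup p d \<odot> F d \<oplus> Poly_Mapping.lookup q d \<odot> F d)"
    by (subst lin_comb_superset [of ?K]) (auto simp: lookup_add add_scal Poly_Mapping.keys_add)
  also have "\<dots> = lin_comb A F p \<oplus> lin_comb A F q"
    by (simp add: lin_comb_superset [of ?K] finsum_addf)
  finally show ?thesis .
qed

end

context
  fixes F :: "int \<times> int \<Rightarrow> 'a"
  assumes F_closed [simp]: "\<And>d. F d \<in> carrier A" and F_zero: "F 0 = \<one>"
    and F_add: "\<And>d d'. F (d + d') = F d \<otimes> F d'"
begin

lemma lin_comb_mult: "lin_comb A F (p * q) = lin_comb A F p \<otimes> lin_comb A F q"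
proof (induction p rule: laurent_induct)
  case (single d c)
  show ?case
    by (induction q rule: laurent_induct)
      (simp_all add: mult_single lin_comb_single F_add scal_mult ring_distribs lin_comb_add r_distr scal_add mult.commute [of c])
qed (simp add: lin_comb_add l_distr ring_distribs)

lemma laurent_alg_hom: "alg_hom torus_alg A (lin_comb A F)"
proof (rule alg_homI)
  show "lin_comb A F \<one>\<^bsub>torus_alg\<^esub> = \<one>"
    using lin_comb_single [of F 0 1] by (simp add: F_zero)
qed (simp_all add: lin_comb_mult lin_comb_add lin_comb_single F_zero scal_mult)

lemma laurent_star_hom:
  assumes "\<And>d. star A (F d) = F (- d)"
  shows "star_hom torus_alg A (lin_comb A F)"
proof -
  have "lin_comb A F (star torus_alg p) = star A (lin_comb A F p)" for p
    by (induction p rule: laurent_induct)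
      (simp_all add: star_torus_single star_torus_add lin_comb_single lin_comb_add star_add star_smult assms)
  then show ?thesis by (simp add: star_hom_def laurent_alg_hom)
qed

end

end

lemma finsum_complex: "finsum complex_alg f S = sum f S"
proof -
  interpret star_algebra complex_alg by (rule star_algebra_complex)
  show ?thesis by (induction S rule: infinite_finite_induct) auto
qed

section \<open>Characters of the torus\<close>

definition torus_char :: "complex \<Rightarrow> complex \<Rightarrow> int \<times> int \<Rightarrow> complex" where
  "torus_char x y d = x powi fst d * y powi snd d"

lemma torus_char_props:
  assumes "x \<noteq> 0" "y \<noteq> 0"
  shows "torus_char x y 0 = 1" "torus_char x y (d + d') = torus_char x y d * torus_char x y d'"
  using assms by (simp_all add: torus_char_def power_int_add mult_ac)

lemma torus_char_alg_hom:
  "x \<noteq> 0 \<Longrightarrow> y \<noteq> 0 \<Longrightarrow> alg_hom torus_alg complex_alg (lin_comb complex_alg (torus_char x y))"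
  by (rule star_algebra.laurent_alg_hom [OF star_algebra_complex]) (simp_all add: torus_char_props)

lemma unimodular_cnj: "cmod x = 1 \<Longrightarrow> cnj x = inverse x"
  by (metis complex_norm_square inverse_unique mult.commute of_real_1 one_power2 power_one)

lemma torus_char_star_hom:
  assumes "cmod x = 1" "cmod y = 1"
  shows "star_hom torus_alg complex_alg (lin_comb complex_alg (torus_char x y))"
proof -
  have nz: "x \<noteq> 0" "y \<noteq> 0" using assms by auto
  have c: "cnj z powi n = z powi (- n)" if "cmod z = 1" for z n
    by (cases n rule: int_cases2) (simp_all add: unimodular_cnj [OF that] power_int_minus power_inverse)
  show ?thesis
    by (rule star_algebra.laurent_star_hom [OF star_algebra_complex])
      (simp_all add: torus_char_props nz, simp add: torus_char_def c assms)
qed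

text \<open>The degree assigned to a column is the exponent of the corresponding diagonal entry;
  this is the link between degrees and the torus coaction.\<close>

lemma diag_T2_eq: "diag_T2 = (\<lambda>i j. if i = j then U_monom (column_degree i) else \<zero>\<^bsub>torus_alg\<^esub>)"
  by (auto simp: diag_T2_def column_degree_def U_monom_def star_torus_single mult_single fun_eq_iff Let_def)

lemma lin_comb_U [simp]: 
  assumes "star_algebra C" "\<And>d. F d \<in> carrier C" "F 0 = \<one>\<^bsub>C\<^esub>" "\<And>d d'. F (d + d') = F d \<otimes>\<^bsub>C\<^esub> F d'"
  shows "lin_comb C F (U_monom d) = F d" "lin_comb C F 0 = \<zero>\<^bsub>C\<^esub>"
proof -
  interpret star_algebra C by fact
  show "lin_comb C F (U_monom d) = F d"
    unfolding U_monom_def using assms by (subst lin_comb_single) auto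
  show "lin_comb C F 0 = \<zero>\<^bsub>C\<^esub>" by (simp add: lin_comb_def)
qed

lemma U_monom_add: "U_monom (d + d') = U_monom d * U_monom d'" and U_monom_0: "U_monom 0 = 1"
  by (simp_all add: U_monom_def mult_single)

lemma SUq3_matrix_torus:
  assumes "0 < q"
  shows "SUq3_matrix torus_alg q diag_T2"
proof (intro SUq3_matrix.intro SUq3_matrix_axioms.intro star_algebra_torus assms)
  show "SUq3_relations q torus_alg diag_T2"
    unfolding diag_T2_eq
  proof (rule SUq3_relations_diag [OF star_algebra_torus])
    fix i j k :: nat assume "i \<in> {1..3}" "j \<in> {1..3}" "k \<in> {1..3}" "distinct [i, j, k]"
    then show "U_monom (column_degree i) \<otimes>\<^bsub>torus_alg\<^esub> U_monom (column_degree j) \<otimes>\<^bsub>torus_alg\<^esub>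
        U_monom (column_degree k) = \<one>\<^bsub>torus_alg\<^esub>"
      unfolding in_three by (elim disjE) (simp_all add: U_monom_def mult_single column_degree_def zero_prod_def [symmetric])
  qed (simp_all add: U_monom_def star_torus_single mult_single)
qed

lemma torus_generated: "carrier torus_alg = generated_alg torus_alg (entries diag_T2)" (is "_ = ?G")
proof -
  interpret star_algebra torus_alg by (rule star_algebra_torus)
  have g: "U_monom (column_degree i) \<in> ?G" if "i \<in> {1..3}" for i
    using that by (intro generated_alg.incl) (auto simp: entries_def diag_T2_eq)
  have mult: "U_monom (d + d') \<in> ?G" if "U_monom d \<in> ?G" "U_monom d' \<in> ?G" for d d'
    using generated_alg.mult [OF that] by (simp add: U_monom_add)
  have one: "U_monom 0 \<in> ?G" using generated_alg.one [of torus_alg] by (simp add: U_monom_0)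
  have pow: "U_monom (int n * fst d, int n * snd d) \<in> ?G" if "U_monom d \<in> ?G" for d n
  proof (induction n)
    case (Suc n)
    have "(int (Suc n) * fst d, int (Suc n) * snd d) = d + (int n * fst d, int n * snd d)"
      by (cases d) (simp add: algebra_simps)
    then show ?case using mult [OF that Suc] by simp
  qed (use one in \<open>simp add: zero_prod_def\<close>)
  have mon: "U_monom d \<in> ?G" for d
  proof (cases d)
    case (Pair m n)
    \<comment> \<open>Negative exponents are available only through the third diagonal entry, of
      degree (-1,-1). Its k-th power, with k large enough, leaves nonnegative exponents m + k and n
      + k for the first two.\<close>
    define k where "k = nat (\<bar>m\<bar> + \<bar>n\<bar>)"
    have "U_monom (int k * (- 1), int k * (- 1)) \<in> ?G" "U_monom (m + int k, 0) \<in> ?G" "U_monom (0, n + int k) \<in> ?G"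
      using pow [OF g [of 3], of k] pow [OF g [of 1], of "nat (m + int k)"] pow [OF g [of 2], of "nat (n + int k)"]
      using abs_ge_zero [of m] abs_ge_zero [of n] abs_ge_minus_self [of m] abs_ge_minus_self [of n]
      by (simp_all add: column_degree_def k_def)
    from mult [OF mult [OF this(1,2)] this(3)] show ?thesis by (simp add: Pair)
  qed
  have "p \<in> ?G" for p
  proof (induction p rule: laurent_induct)
    case (single d c)
    have "c \<odot>\<^bsub>torus_alg\<^esub> U_monom d \<in> ?G" by (rule generated_alg.smult [OF mon])
    then show ?case by (simp add: U_monom_def mult_single)
  next
    case (add p q)
    then show ?case using generated_alg.add [of p torus_alg _ q] by simp
  qed
  then show ?thesis by auto
qed

definition torus_comult :: "laurent2 \<Rightarrow> (laurent2, laurent2) tensor" where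
  "torus_comult = lin_comb (tensor_alg torus_alg torus_alg) (\<lambda>d. pure_tensor torus_alg torus_alg (U_monom d) (U_monom d))"

definition torus_counit :: "laurent2 \<Rightarrow> complex" where
  "torus_counit = lin_comb complex_alg (\<lambda>d. 1)"

definition torus_antipode :: "laurent2 \<Rightarrow> laurent2" where
  "torus_antipode = Poly_Mapping.map_key uminus"

lemma O_T2_eq: "O_T2 = make_hopf torus_alg torus_comult torus_counit torus_antipode"
  by (simp add: O_T2_def torus_comult_def torus_counit_def torus_antipode_def lin_comb_def fun_eq_iff finsum_complex)

text \<open>The torus enters as a diagonal solution of the same relations, so that maps onto it fall
  under \<open>matrix_hopf_hom\<close>.\<close>

lemma matrix_hopf_torus:
  assumes "0 < q"
  shows "matrix_hopf_algebra torus_alg q diag_T2 torus_comult torus_counit torus_antipode"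
proof -
  interpret SUq3_matrix torus_alg q diag_T2 by (rule SUq3_matrix_torus [OF assms])
  interpret TT: star_algebra_pair torus_alg torus_alg ..
  let ?F = "\<lambda>d. TT.pure (U_monom d) (U_monom d)"
  have F: "?F d \<in> carrier TT.T" "?F 0 = \<one>\<^bsub>TT.T\<^esub>" "?F (d + d') = ?F d \<otimes>\<^bsub>TT.T\<^esub> ?F d'" for d d'
    by (simp_all add: tensor_alg_simps U_monom_0 U_monom_add TT.pure_mult)
  have c: "torus_comult (U_monom d) = ?F d" "torus_comult 0 = \<zero>\<^bsub>TT.T\<^esub>" for d
    unfolding torus_comult_def using F by (auto intro!: lin_comb_U [OF TT.star_algebra_tensor])
  have e: "torus_counit (U_monom d) = 1" "torus_counit 0 = 0" for d
    unfolding torus_counit_def by (simp_all add: lin_comb_U [OF star_algebra_complex])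
  have s1: "torus_antipode (Poly_Mapping.single d z) = Poly_Mapping.single (- d) z" for d z
    unfolding torus_antipode_def using map_key_single [OF inj_uminus_pair, of "- d" z] by simp
  have s2: "torus_antipode (p + p') = torus_antipode p + torus_antipode p'" for p p'
    unfolding torus_antipode_def by (rule map_key_plus [OF inj_uminus_pair])
  have s3: "torus_antipode (p * p') = torus_antipode p * torus_antipode p'" for p p'
  proof (induction p rule: laurent_induct)
    case (single d z)
    show ?case
      by (induction p' rule: laurent_induct) (simp_all add: mult_single s1 s2 ring_distribs)
  qed (simp add: s2 ring_distribs)
  have zero: "TT.pure 0 x = \<zero>\<^bsub>TT.T\<^esub>" "TT.pure x 0 = \<zero>\<^bsub>TT.T\<^esub>" for x
    using TT.pure_smult_left [of 0 x 0] TT.pure_smult_right [of x 0 0] by simp_all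
  show ?thesis
  proof unfold_locales
    show "carrier torus_alg = generated_alg torus_alg (entries diag_T2)" by (rule torus_generated)
    show "separated torus_alg" by (rule separated_torus)
    show "star_hom torus_alg TT.T torus_comult"
      unfolding torus_comult_def
      by (rule star_algebra.laurent_star_hom [OF TT.star_algebra_tensor F])
        (simp add: TT.pure_star, simp add: U_monom_def star_torus_single)
    show "star_hom torus_alg complex_alg torus_counit"
      unfolding torus_counit_def
      by (rule star_algebra.laurent_star_hom [OF star_algebra_complex]) simp_all
    show "alg_hom torus_alg (opposite torus_alg) torus_antipode"
    proof (rule alg_homI)
      show "torus_antipode \<one>\<^bsub>torus_alg\<^esub> = \<one>\<^bsub>opposite torus_alg\<^esub>"
        using s1 [of 0 1] by simp
    qed (simp_all add: s2 s3 s1 mult.commute)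
    fix i j :: nat assume ij: "i \<in> {1..3}" "j \<in> {1..3}"
    show "torus_counit (diag_T2 i j) = (if i = j then 1 else 0)"
      by (simp add: diag_T2_eq e)
    show "torus_antipode (diag_T2 i j) = star torus_alg (diag_T2 j i)"
      using s1 [of 0 0] star_torus_single [of 0 0] by (simp add: diag_T2_eq U_monom_def s1 star_torus_single)
    have "matrix_comult torus_alg diag_T2 i j = TT.pure (diag_T2 i i) (diag_T2 i j)"
      unfolding matrix_comult_def
      by (rule TT.T.finsum_delta) (use ij in \<open>auto simp: diag_T2_eq zero\<close>)
    then show "torus_comult (diag_T2 i j) = matrix_comult torus_alg diag_T2 i j"
      by (auto simp: diag_T2_eq c zero)
  qed
qed

section \<open>Representations on \<open>\<ell>\<^sup>2\<close>\<close>

text \<open>Estimates use the squared norm, for which rows of a double series simply add up; square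
  roots appear only in the translation to \<open>l2_norm\<close>.\<close>

definition sqnorm :: "(nat \<Rightarrow> complex) \<Rightarrow> real" where
  "sqnorm x = suminf (\<lambda>n. (cmod (x n))\<^sup>2)"

lemma l2_norm_sqnorm: "l2_norm x = sqrt (sqnorm x)"
  by (simp add: l2_norm_def sqnorm_def)

lemma l2I: "summable (\<lambda>n. (cmod (x n))\<^sup>2) \<Longrightarrow> x \<in> l2"
  and l2D: "x \<in> l2 \<Longrightarrow> summable (\<lambda>n. (cmod (x n))\<^sup>2)"
  by (simp_all add: l2_def)

lemma sqnorm_nonneg: "x \<in> l2 \<Longrightarrow> 0 \<le> sqnorm x"
  unfolding sqnorm_def by (intro suminf_nonneg l2D) simp_all

lemma norm_add_sq_le: "(cmod (a + b))\<^sup>2 \<le> 2 * (cmod a)\<^sup>2 + 2 * (cmod b)\<^sup>2"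
proof -
  have "(cmod (a + b))\<^sup>2 \<le> (cmod a + cmod b)\<^sup>2" by (intro power_mono norm_triangle_ineq) simp
  also have "\<dots> \<le> 2 * (cmod a)\<^sup>2 + 2 * (cmod b)\<^sup>2"
    using sum_squares_bound [of "cmod a" "cmod b"] by (simp add: power2_sum)
  finally show ?thesis .
qed

lemma l2_add [simp]:
  assumes "x \<in> l2" "y \<in> l2"
  shows "(\<lambda>n. x n + y n) \<in> l2" and sqnorm_add_le: "sqnorm (\<lambda>n. x n + y n) \<le> 2 * sqnorm x + 2 * sqnorm y"
proof -
  have s: "summable (\<lambda>n. 2 * (cmod (x n))\<^sup>2 + 2 * (cmod (y n))\<^sup>2)"
    by (intro summable_add summable_mult l2D assms)
  have s': "summable (\<lambda>n. (cmod (x n + y n))\<^sup>2)"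
    by (rule summable_comparison_test' [OF s, of 0]) (simp add: norm_add_sq_le)
  then show "(\<lambda>n. x n + y n) \<in> l2" by (rule l2I)
  have "sqnorm (\<lambda>n. x n + y n) \<le> suminf (\<lambda>n. 2 * (cmod (x n))\<^sup>2 + 2 * (cmod (y n))\<^sup>2)"
    unfolding sqnorm_def by (intro suminf_le s s' norm_add_sq_le)
  also have "\<dots> = 2 * sqnorm x + 2 * sqnorm y"
    unfolding sqnorm_def using assms by (simp add: suminf_add [symmetric] suminf_mult summable_mult l2D)
  finally show "sqnorm (\<lambda>n. x n + y n) \<le> 2 * sqnorm x + 2 * sqnorm y" .
qed

lemma l2_scale [simp]:
  assumes "x \<in> l2"
  shows "(\<lambda>n. c * x n) \<in> l2" and sqnorm_scale: "sqnorm (\<lambda>n. c * x n) = (cmod c)\<^sup>2 * sqnorm x"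
  using l2D [OF assms]
  by (auto intro!: l2I simp: norm_mult power_mult_distrib summable_mult sqnorm_def suminf_mult)

lemma l2_zero [simp]: "(\<lambda>n. 0) \<in> l2" and sqnorm_zero [simp]: "sqnorm (\<lambda>n. 0) = 0"
  by (simp_all add: l2_def sqnorm_def)

lemma l2_cnj [simp]: "x \<in> l2 \<Longrightarrow> (\<lambda>n. cnj (x n)) \<in> l2" and sqnorm_cnj: "sqnorm (\<lambda>n. cnj (x n)) = sqnorm x"
  by (simp_all add: l2_def sqnorm_def)

lemma l2_dominated:
  assumes "x \<in> l2" "\<And>n. cmod (y n) \<le> cmod (x n)"
  shows "y \<in> l2" and sqnorm_mono: "sqnorm y \<le> sqnorm x"
proof -
  have s: "summable (\<lambda>n. (cmod (y n))\<^sup>2)"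
    by (rule summable_comparison_test' [OF l2D [OF assms(1)], of 0]) (simp add: assms(2) power_mono)
  then show "y \<in> l2" by (rule l2I)
  show "sqnorm y \<le> sqnorm x"
    unfolding sqnorm_def by (intro suminf_le s l2D assms(1)) (simp add: assms(2) power_mono)
qed

lemma finite_support_l2:
  assumes "\<And>n. n \<ge> N \<Longrightarrow> x n = 0"
  shows "x \<in> l2" and "sqnorm x = (\<Sum>n<N. (cmod (x n))\<^sup>2)"
proof -
  have s: "(\<lambda>n. (cmod (x n))\<^sup>2) sums (\<Sum>n<N. (cmod (x n))\<^sup>2)"
    by (rule sums_finite) (auto simp: assms not_less)
  then show "x \<in> l2" by (auto intro: l2I sums_summable)
  show "sqnorm x = (\<Sum>n<N. (cmod (x n))\<^sup>2)" using s by (simp add: sqnorm_def sums_iff)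
qed

definition unit :: "nat \<Rightarrow> nat \<Rightarrow> complex" where
  "unit k = (\<lambda>n. if n = k then 1 else 0)"

lemma unit_l2 [simp]: "unit k \<in> l2"
  by (rule finite_support_l2 [of "Suc k"]) (simp add: unit_def)

lemma l2_inner_abs_summable:
  assumes "x \<in> l2" "y \<in> l2"
  shows "summable (\<lambda>n. cmod (x n * cnj (y n)))"
proof (rule summable_comparison_test' [of "\<lambda>n. (cmod (x n))\<^sup>2 + (cmod (y n))\<^sup>2" 0])
  show "summable (\<lambda>n. (cmod (x n))\<^sup>2 + (cmod (y n))\<^sup>2)"
    by (intro summable_add l2D assms)
  show "norm (cmod (x n * cnj (y n))) \<le> (cmod (x n))\<^sup>2 + (cmod (y n))\<^sup>2" for n
  proof -
    have "0 \<le> cmod (x n) * cmod (y n)" by simp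
    moreover have "norm (cmod (x n * cnj (y n))) = cmod (x n) * cmod (y n)" by (simp add: norm_mult)
    ultimately show ?thesis
      using sum_squares_bound [of "cmod (x n)" "cmod (y n)"] by linarith
  qed
qed

lemma l2_inner_summable: "x \<in> l2 \<Longrightarrow> y \<in> l2 \<Longrightarrow> summable (\<lambda>n. x n * cnj (y n))"
  by (rule summable_norm_cancel) (rule l2_inner_abs_summable)

lemma l2_inner_add: "x \<in> l2 \<Longrightarrow> x' \<in> l2 \<Longrightarrow> y \<in> l2 \<Longrightarrow>
    l2_inner (\<lambda>n. x n + x' n) y = l2_inner x y + l2_inner x' y"
  by (simp add: l2_inner_def distrib_right l2_inner_summable suminf_add ring_distribs)

lemma l2_inner_scale: "x \<in> l2 \<Longrightarrow> y \<in> l2 \<Longrightarrow> l2_inner (\<lambda>n. c * x n) y = c * l2_inner x y"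
  by (simp add: l2_inner_def mult.assoc l2_inner_summable suminf_mult)

lemma l2_inner_cnj:
  assumes "x \<in> l2" "y \<in> l2"
  shows "l2_inner y x = cnj (l2_inner x y)"
proof -
  have "(\<lambda>n. x n * cnj (y n)) sums l2_inner x y"
    unfolding l2_inner_def using assms by (intro summable_sums l2_inner_summable)
  then have "(\<lambda>n. cnj (x n * cnj (y n))) sums cnj (l2_inner x y)" by (rule sums_cnj [THEN iffD2])
  then show ?thesis by (simp add: l2_inner_def sums_iff mult.commute)
qed

lemma l2_inner_conjugate:
  assumes "x \<in> l2" "y \<in> l2"
  shows "l2_inner (\<lambda>n. cnj (x n)) (\<lambda>n. cnj (y n)) = cnj (l2_inner x y)"
  using l2_inner_cnj [OF assms] by (simp add: l2_inner_def mult.commute)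

lemma l2_inner_unit_right: "l2_inner x (unit k) = x k"
proof -
  have "(\<lambda>n. x n * cnj (unit k n)) = (\<lambda>n. if n = k then x n else 0)"
    by (auto simp: unit_def)
  then show ?thesis
    using sums_single [of k x] by (simp add: l2_inner_def sums_iff eq_commute)
qed

lemma l2_inner_unit_left: "y \<in> l2 \<Longrightarrow> l2_inner (unit k) y = cnj (y k)"
  using l2_inner_cnj [of y "unit k"] l2_inner_unit_right by simp

text \<open>The inequality between arithmetic and geometric mean with a weight s, summed termwise.
  The freedom in s is what yields Cauchy-Schwarz and the bound of the adjoint.\<close>

lemma l2_inner_bound:
  assumes "x \<in> l2" "y \<in> l2" "0 < s"
  shows "cmod (l2_inner x y) \<le> (s * sqnorm x + sqnorm y / s) / 2"
proof -
  have le: "cmod (x n * cnj (y n)) \<le> s / 2 * (cmod (x n))\<^sup>2 + 1 / (2 * s) * (cmod (y n))\<^sup>2" for n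
  proof -
    have "0 \<le> (s * cmod (x n) - cmod (y n))\<^sup>2 / (2 * s)" using assms(3) by simp
    also have "\<dots> = s / 2 * (cmod (x n))\<^sup>2 + 1 / (2 * s) * (cmod (y n))\<^sup>2 - cmod (x n) * cmod (y n)"
      using assms(3) by (simp add: power2_diff field_simps power2_eq_square)
    finally show ?thesis by (simp add: norm_mult)
  qed
  have s: "summable (\<lambda>n. s / 2 * (cmod (x n))\<^sup>2 + 1 / (2 * s) * (cmod (y n))\<^sup>2)"
    by (intro summable_add summable_mult l2D assms)
  have "cmod (l2_inner x y) \<le> suminf (\<lambda>n. cmod (x n * cnj (y n)))"
    unfolding l2_inner_def by (intro summable_norm l2_inner_abs_summable assms)
  also have "\<dots> \<le> suminf (\<lambda>n. s / 2 * (cmod (x n))\<^sup>2 + 1 / (2 * s) * (cmod (y n))\<^sup>2)"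
    by (intro suminf_le le s l2_inner_abs_summable assms)
  also have "\<dots> = s / 2 * sqnorm x + 1 / (2 * s) * sqnorm y"
    unfolding sqnorm_def
    by (subst suminf_add [symmetric], (intro summable_mult l2D assms)+)
      (simp only: suminf_mult [OF l2D [OF assms(1)]] suminf_mult [OF l2D [OF assms(2)]])
  finally show ?thesis using assms(3) by (simp add: field_simps)
qed

lemma Cauchy_Schwarz_l2:
  assumes "x \<in> l2" "y \<in> l2"
  shows "(cmod (l2_inner x y))\<^sup>2 \<le> sqnorm x * sqnorm y"
proof (cases "l2_inner x y = 0")
  case True
  then show ?thesis using sqnorm_nonneg assms by simp
next
  case False
  let ?c = "cmod (l2_inner x y)"
  have c: "?c > 0" using False by simp
  have y: "sqnorm y \<ge> 0" by (rule sqnorm_nonneg [OF assms(2)])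
  show ?thesis
  proof (cases "sqnorm x = 0")
    case True
    \<comment> \<open>If x has norm zero, s can be taken as large as desired; this value makes the
      bound strictly smaller than \<open>?c\<close>, a contradiction.\<close>
    have "0 < (sqnorm y + 1) / ?c" using c y by simp
    from l2_inner_bound [OF assms this] have "?c \<le> sqnorm y / ((sqnorm y + 1) / ?c) / 2"
      by (simp add: True)
    also have "\<dots> = ?c * (sqnorm y / (2 * (sqnorm y + 1)))" using c y by (simp add: field_simps)
    also have "\<dots> < ?c * 1" using c y by (intro mult_strict_left_mono) (simp_all add: divide_simps)
    also have "\<dots> = ?c" by simp
    finally show ?thesis by simp
  next
    case False
    then have x: "sqnorm x > 0" using sqnorm_nonneg [OF assms(1)] by simp
    \<comment> \<open>With this weight the first summand of the bound is half of \<open>?c\<close>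
      and can be subtracted.\<close>
    then have "0 < ?c / sqnorm x" using c by simp
    from l2_inner_bound [OF assms this] show ?thesis
      using x c by (simp add: field_simps power2_eq_square)
  qed
qed

section \<open>Bounded operators, matrix coefficients and adjoints\<close>

lemma bounded_l2_opsI:
  assumes "T \<in> extensional l2" "\<And>x. x \<in> l2 \<Longrightarrow> T x \<in> l2"
    "\<And>x y. x \<in> l2 \<Longrightarrow> y \<in> l2 \<Longrightarrow> T (\<lambda>n. x n + y n) = (\<lambda>n. T x n + T y n)"
    "\<And>c x. x \<in> l2 \<Longrightarrow> T (\<lambda>n. c * x n) = (\<lambda>n. c * T x n)"
    "\<And>x. x \<in> l2 \<Longrightarrow> sqnorm (T x) \<le> K * sqnorm x"
  shows "T \<in> bounded_l2_ops"
proof -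
  have "l2_norm (T x) \<le> sqrt \<bar>K\<bar> * l2_norm x" if "x \<in> l2" for x
  proof -
    have "sqnorm (T x) \<le> \<bar>K\<bar> * sqnorm x"
      using assms(5) [OF that] mult_right_mono [OF abs_ge_self [of K] sqnorm_nonneg [OF that]] by simp
    then show ?thesis by (simp add: l2_norm_sqnorm real_sqrt_mult [symmetric])
  qed
  then show ?thesis using assms(1-4) by (auto simp: bounded_l2_ops_def PiE_def Pi_iff)
qed

lemma bounded_l2_opsD:
  assumes "T \<in> bounded_l2_ops"
  shows "T \<in> extensional l2" "\<And>x. x \<in> l2 \<Longrightarrow> T x \<in> l2"
    "\<And>x y. x \<in> l2 \<Longrightarrow> y \<in> l2 \<Longrightarrow> T (\<lambda>n. x n + y n) = (\<lambda>n. T x n + T y n)"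
    "\<And>c x. x \<in> l2 \<Longrightarrow> T (\<lambda>n. c * x n) = (\<lambda>n. c * T x n)"
  using assms by (auto simp: bounded_l2_ops_def PiE_def Pi_iff)

lemma bounded_l2_ops_bound:
  assumes "T \<in> bounded_l2_ops"
  obtains K where "0 < K" "\<And>x. x \<in> l2 \<Longrightarrow> sqnorm (T x) \<le> K * sqnorm x"
proof -
  obtain K where K: "\<And>x. x \<in> l2 \<Longrightarrow> l2_norm (T x) \<le> K * l2_norm x"
    using assms unfolding bounded_l2_ops_def by blast
  show ?thesis
  \<comment> \<open>The given K may have any sign; the shifted square is positive and still bounds
    the squared norm.\<close>
  proof (rule that [of "K\<^sup>2 + 1"])
    fix x assume x: "x \<in> l2"
    have "(sqrt (sqnorm (T x)))\<^sup>2 \<le> (K * sqrt (sqnorm x))\<^sup>2"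
      using K [OF x] sqnorm_nonneg [OF bounded_l2_opsD(2) [OF assms x]]
      by (intro power_mono) (simp_all add: l2_norm_sqnorm)
    then show "sqnorm (T x) \<le> (K\<^sup>2 + 1) * sqnorm x"
      using sqnorm_nonneg [OF x] sqnorm_nonneg [OF bounded_l2_opsD(2) [OF assms x]]
      by (simp add: power_mult_distrib algebra_simps)
  qed (simp add: add_nonneg_pos)
qed

lemma bounded_l2_ops_ext:
  assumes "S \<in> bounded_l2_ops" "T \<in> bounded_l2_ops" "\<And>x. x \<in> l2 \<Longrightarrow> S x = T x"
  shows "S = T"
  using assms by (intro extensionalityI [of S l2 T] bounded_l2_opsD)

definition truncation :: "nat \<Rightarrow> (nat \<Rightarrow> complex) \<Rightarrow> nat \<Rightarrow> complex" where
  "truncation N x n = (if n < N then x n else 0)"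

lemma truncation_l2 [simp]: "truncation N x \<in> l2"
  by (rule finite_support_l2 [of N]) (simp add: truncation_def)

lemma truncation_Suc: "truncation (Suc N) x = (\<lambda>n. truncation N x n + x N * unit N n)"
proof
  fix n
  show "truncation (Suc N) x n = truncation N x n + x N * unit N n"
    by (cases n N rule: linorder_cases) (simp_all add: truncation_def unit_def)
qed

lemma sqnorm_tail:
  assumes "x \<in> l2"
  shows "(\<lambda>N. sqnorm (\<lambda>n. x n - truncation N x n)) \<longlonglongrightarrow> 0"
proof -
  have "sqnorm (\<lambda>n. x n - truncation N x n) = suminf (\<lambda>n. (cmod (x (n + N)))\<^sup>2)" for N
  proof -
    let ?f = "\<lambda>n. (cmod (x n - truncation N x n))\<^sup>2"
    have s: "summable ?f"
      by (rule summable_comparison_test' [OF l2D [OF assms], of 0]) (simp add: truncation_def)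
    have "suminf ?f = suminf (\<lambda>n. ?f (n + N)) + sum ?f {..<N}" by (rule suminf_split_initial_segment [OF s])
    then show ?thesis by (simp add: sqnorm_def truncation_def)
  qed
  moreover have "suminf (\<lambda>n. (cmod (x (n + N)))\<^sup>2) = sqnorm x - (\<Sum>n<N. (cmod (x n))\<^sup>2)" for N
    unfolding sqnorm_def by (rule suminf_minus_initial_segment [OF l2D [OF assms]])
  moreover have "(\<lambda>N. sqnorm x - (\<Sum>n<N. (cmod (x n))\<^sup>2)) \<longlonglongrightarrow> sqnorm x - sqnorm x"
    unfolding sqnorm_def by (intro tendsto_diff tendsto_const summable_LIMSEQ l2D assms)
  ultimately show ?thesis by simp
qed

lemma bounded_truncation_inner:
  assumes T: "T \<in> bounded_l2_ops" and y: "y \<in> l2"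
  shows "l2_inner (T (truncation N x)) y = (\<Sum>n<N. x n * l2_inner (T (unit n)) y)"
proof (induction N)
  case 0
  have z: "truncation 0 x = (\<lambda>n. 0 * unit 0 n)" by (simp add: truncation_def fun_eq_iff)
  show ?case
    unfolding z by (subst bounded_l2_opsD(4) [OF T]) (simp_all add: l2_inner_def)
next
  case (Suc N)
  show ?case
    unfolding truncation_Suc
    by (simp add: bounded_l2_opsD(2-4) [OF T] l2_inner_add l2_inner_scale y Suc)
qed

text \<open>Truncations of x converge to x in norm and T is bounded, so the finite expansions of the
  inner product converge. In particular a bounded operator is determined by its matrix
  coefficients.\<close>

lemma bounded_inner_expansion:
  assumes T: "T \<in> bounded_l2_ops" and x: "x \<in> l2" and y: "y \<in> l2"
  shows "(\<lambda>n. x n * l2_inner (T (unit n)) y) sums l2_inner (T x) y"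
proof -
  obtain K where K: "0 < K" "\<And>x. x \<in> l2 \<Longrightarrow> sqnorm (T x) \<le> K * sqnorm x"
    using bounded_l2_ops_bound [OF T] by blast
  have tail: "(\<lambda>n. x n - truncation N x n) \<in> l2" for N
    using x by (rule l2_dominated) (simp add: truncation_def)
  have "(\<lambda>N. l2_inner (T (truncation N x)) y) \<longlonglongrightarrow> l2_inner (T x) y"
  proof (rule LIM_zero_cancel, rule tendsto_norm_zero_cancel, rule tendsto_0_le [where K = 1])
    show "(\<lambda>N. sqrt (K * sqnorm (\<lambda>n. x n - truncation N x n) * sqnorm y)) \<longlonglongrightarrow> 0"
      using sqnorm_tail [OF x] by (auto intro!: tendsto_eq_intros)
    have "cmod (l2_inner (T (truncation N x)) y - l2_inner (T x) y) \<le>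
        sqrt (K * sqnorm (\<lambda>n. x n - truncation N x n) * sqnorm y)" for N
    proof -
      let ?d = "\<lambda>n. x n - truncation N x n"
      have "T x = T (\<lambda>n. truncation N x n + ?d n)" by simp
      also have "\<dots> = (\<lambda>n. T (truncation N x) n + T ?d n)"
        by (rule bounded_l2_opsD(3) [OF T truncation_l2 tail])
      finally have "l2_inner (T x) y = l2_inner (T (truncation N x)) y + l2_inner (T ?d) y"
        using bounded_l2_opsD(2) [OF T] tail y by (simp add: l2_inner_add)
      then have "cmod (l2_inner (T (truncation N x)) y - l2_inner (T x) y) = cmod (l2_inner (T ?d) y)"
        by (simp add: norm_minus_commute)
      also have "\<dots> \<le> sqrt (sqnorm (T ?d) * sqnorm y)"
        by (intro real_le_rsqrt Cauchy_Schwarz_l2 bounded_l2_opsD(2) [OF T] tail y)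
      also have "\<dots> \<le> sqrt (K * sqnorm ?d * sqnorm y)"
        by (intro real_sqrt_le_mono mult_right_mono K(2) tail sqnorm_nonneg y)
      finally show ?thesis .
    qed
    then show "\<forall>\<^sub>F N in sequentially. norm (norm (l2_inner (T (truncation N x)) y - l2_inner (T x) y)) \<le>
        norm (sqrt (K * sqnorm (\<lambda>n. x n - truncation N x n) * sqnorm y)) * 1"
      by (intro always_eventually allI) (smt (verit) norm_ge_zero real_norm_def)
  qed
  then show ?thesis by (simp add: sums_def bounded_truncation_inner [OF T y])
qed

lemma bounded_l2_ops_eqI:
  assumes "S \<in> bounded_l2_ops" "T \<in> bounded_l2_ops" "\<And>m n. S (unit m) n = T (unit m) n"
  shows "S = T"
proof (rule bounded_l2_ops_ext [OF assms(1,2)])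
  fix x assume x: "x \<in> l2"
  have eq: "S (unit m) = T (unit m)" for m using assms(3) by auto
  show "S x = T x"
  proof
    fix k
    show "S x k = T x k"
      using bounded_inner_expansion [OF assms(1) x unit_l2, of k]
        bounded_inner_expansion [OF assms(2) x unit_l2, of k]
      by (simp add: l2_inner_unit_right eq sums_iff)
  qed
qed

text \<open>The adjoint is obtained from its matrix coefficients; boundedness follows by testing
  against truncations of the candidate itself.\<close>

lemma adjoint_exists:
  assumes T: "T \<in> bounded_l2_ops"
  shows "\<exists>S\<in>bounded_l2_ops. \<forall>x\<in>l2. \<forall>y\<in>l2. l2_inner (T x) y = l2_inner x (S y)"
proof -
  define S where "S = (\<lambda>y\<in>l2. \<lambda>n. cnj (l2_inner (T (unit n)) y))"
  note TD = bounded_l2_opsD [OF T]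
  obtain K where K: "0 < K" "\<And>x. x \<in> l2 \<Longrightarrow> sqnorm (T x) \<le> K * sqnorm x"
    using bounded_l2_ops_bound [OF T] by blast
  have S: "S y n = cnj (l2_inner (T (unit n)) y)" if "y \<in> l2" for y n
    using that by (simp add: S_def)
  have part: "(\<Sum>n<N. (cmod (S y n))\<^sup>2) \<le> K * sqnorm y" if y: "y \<in> l2" for y N
  proof -
    let ?z = "truncation N (S y)"
    let ?r = "\<Sum>n<N. (cmod (S y n))\<^sup>2"
    have nz: "sqnorm ?z = ?r"
      by (subst finite_support_l2 [of N]) (simp_all add: truncation_def)
    have "l2_inner (T ?z) y = (\<Sum>n<N. S y n * cnj (S y n))"
      by (simp add: bounded_truncation_inner [OF T y] S [OF y])
    then have "cmod (l2_inner (T ?z) y) = ?r"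
      by (simp only: complex_norm_square [symmetric] of_real_sum [symmetric] norm_of_real) (simp add: sum_nonneg)
    \<comment> \<open>The weight 1 / K makes the first summand at most half of \<open>?r\<close>, as
      T enlarges squared norms by at most K; the remaining half gives the estimate.\<close>
    then have "?r \<le> (1 / K * sqnorm (T ?z) + sqnorm y / (1 / K)) / 2"
      using l2_inner_bound [of "T ?z" y "1 / K"] TD(2) y K(1) by simp
    also have "\<dots> \<le> (?r + K * sqnorm y) / 2"
      using K(2) [of ?z] K(1) by (simp add: nz field_simps)
    finally show ?thesis by simp
  qed
  have Sl2: "S y \<in> l2" if "y \<in> l2" for y
    by (rule l2I, rule bounded_imp_summable [of _ "K * sqnorm y"])
      (use part [OF that, of "Suc n" for n] in \<open>simp_all add: lessThan_Suc_atMost\<close>)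
  have "S \<in> bounded_l2_ops"
  proof (rule bounded_l2_opsI [of _ K])
    fix x y c assume x: "x \<in> l2" and y: "y \<in> l2"
    show "S x \<in> l2" by (rule Sl2 [OF x])
    have sw: "cnj (l2_inner (T (unit n)) y) = l2_inner y (T (unit n))" if "y \<in> l2" for y n
      using l2_inner_cnj [of "T (unit n)" y] that TD(2) by simp
    show "S (\<lambda>n. x n + y n) = (\<lambda>n. S x n + S y n)"
      using x y by (auto simp: S sw l2_inner_add TD(2))
    show "S (\<lambda>n. c * x n) = (\<lambda>n. c * S x n)"
      using x by (auto simp: S sw l2_inner_scale TD(2))
    show "sqnorm (S x) \<le> K * sqnorm x"
      unfolding sqnorm_def by (rule suminf_le_const [OF l2D [OF Sl2 [OF x]]]) (use part [OF x] in \<open>simp add: sqnorm_def\<close>)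
  qed (simp add: S_def)
  moreover have "l2_inner (T x) y = l2_inner x (S y)" if "x \<in> l2" "y \<in> l2" for x y
    using bounded_inner_expansion [OF T that] that by (simp add: l2_inner_def [of x] S sums_iff)
  ultimately show ?thesis by blast
qed

lemma adjoint_unique:
  assumes "S \<in> bounded_l2_ops" "S' \<in> bounded_l2_ops"
    "\<And>x y. x \<in> l2 \<Longrightarrow> y \<in> l2 \<Longrightarrow> l2_inner x (S y) = l2_inner x (S' y)"
  shows "S = S'"
proof (rule bounded_l2_ops_ext [OF assms(1,2)])
  fix y assume y: "y \<in> l2"
  show "S y = S' y"
  proof
    fix n
    show "S y n = S' y n"
      using assms(3) [of "unit n" y] y bounded_l2_opsD(2) [OF assms(1) y] bounded_l2_opsD(2) [OF assms(2) y]
      by (simp add: l2_inner_unit_left)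
  qed
qed

lemma l2_adjoint_eqI:
  assumes "S \<in> bounded_l2_ops" "\<And>x y. x \<in> l2 \<Longrightarrow> y \<in> l2 \<Longrightarrow> l2_inner (T x) y = l2_inner x (S y)"
  shows "l2_adjoint T = S"
  unfolding l2_adjoint_def
proof (rule the_equality)
  show "S \<in> bounded_l2_ops \<and> (\<forall>x\<in>l2. \<forall>y\<in>l2. l2_inner (T x) y = l2_inner x (S y))"
    using assms by simp
  fix S' assume S': "S' \<in> bounded_l2_ops \<and> (\<forall>x\<in>l2. \<forall>y\<in>l2. l2_inner (T x) y = l2_inner x (S' y))"
  show "S' = S"
  proof (rule adjoint_unique)
    fix x y assume "x \<in> l2" "y \<in> l2"
    then show "l2_inner x (S' y) = l2_inner x (S y)" using S' assms(2) by metis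
  qed (use S' assms(1) in blast)+
qed

lemma l2_adjoint:
  assumes "T \<in> bounded_l2_ops"
  shows l2_adjoint_closed [simp]: "l2_adjoint T \<in> bounded_l2_ops"
    and l2_adjoint_inner: "x \<in> l2 \<Longrightarrow> y \<in> l2 \<Longrightarrow> l2_inner (T x) y = l2_inner x (l2_adjoint T y)"
proof -
  obtain S where S: "S \<in> bounded_l2_ops" "\<And>x y. x \<in> l2 \<Longrightarrow> y \<in> l2 \<Longrightarrow> l2_inner (T x) y = l2_inner x (S y)"
    using adjoint_exists [OF assms] by blast
  then have "l2_adjoint T = S" by (rule l2_adjoint_eqI)
  with S show "l2_adjoint T \<in> bounded_l2_ops"
    "x \<in> l2 \<Longrightarrow> y \<in> l2 \<Longrightarrow> l2_inner (T x) y = l2_inner x (l2_adjoint T y)" by simp_all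
qed

section \<open>The star algebra of bounded operators\<close>

lemma B_l2_simps [simp]:
  "carrier B_l2 = bounded_l2_ops" "\<zero>\<^bsub>B_l2\<^esub> = (\<lambda>x\<in>l2. (\<lambda>n. 0))" "\<one>\<^bsub>B_l2\<^esub> = (\<lambda>x\<in>l2. x)"
  "star B_l2 = l2_adjoint"
  "S \<otimes>\<^bsub>B_l2\<^esub> T = (\<lambda>x\<in>l2. S (T x))" "S \<oplus>\<^bsub>B_l2\<^esub> T = (\<lambda>x\<in>l2. (\<lambda>n. S x n + T x n))"
  "c \<odot>\<^bsub>B_l2\<^esub> T = (\<lambda>x\<in>l2. (\<lambda>n. c * T x n))"
  by (simp_all add: B_l2_def)

lemma bounded_ops_closed:
  shows bounded_zero: "(\<lambda>x\<in>l2. (\<lambda>n. 0)) \<in> bounded_l2_ops"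
    and bounded_id: "(\<lambda>x\<in>l2. x) \<in> bounded_l2_ops"
    and bounded_compose: "S \<in> bounded_l2_ops \<Longrightarrow> T \<in> bounded_l2_ops \<Longrightarrow> (\<lambda>x\<in>l2. S (T x)) \<in> bounded_l2_ops"
    and bounded_add: "S \<in> bounded_l2_ops \<Longrightarrow> T \<in> bounded_l2_ops \<Longrightarrow> (\<lambda>x\<in>l2. (\<lambda>n. S x n + T x n)) \<in> bounded_l2_ops"
    and bounded_scale: "T \<in> bounded_l2_ops \<Longrightarrow> (\<lambda>x\<in>l2. (\<lambda>n. c * T x n)) \<in> bounded_l2_ops"
proof -
  show "(\<lambda>x\<in>l2. (\<lambda>n. 0)) \<in> bounded_l2_ops"
    by (rule bounded_l2_opsI [of _ 0]) simp_all
  show "(\<lambda>x\<in>l2. x) \<in> bounded_l2_ops"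
    by (rule bounded_l2_opsI [of _ 1]) simp_all
  assume T: "T \<in> bounded_l2_ops"
  obtain L where L: "0 < L" "\<And>x. x \<in> l2 \<Longrightarrow> sqnorm (T x) \<le> L * sqnorm x"
    using bounded_l2_ops_bound [OF T] by blast
  note TD = bounded_l2_opsD(2-4) [OF T]
  show "(\<lambda>x\<in>l2. (\<lambda>n. c * T x n)) \<in> bounded_l2_ops"
  proof (rule bounded_l2_opsI [of _ "(cmod c)\<^sup>2 * L"])
    fix x assume "x \<in> l2"
    then show "sqnorm ((\<lambda>x\<in>l2. (\<lambda>n. c * T x n)) x) \<le> (cmod c)\<^sup>2 * L * sqnorm x"
      using L(2) [of x] by (simp add: sqnorm_scale TD mult.assoc mult_left_mono)
  qed (simp_all add: TD algebra_simps)
  assume S: "S \<in> bounded_l2_ops"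
  obtain K where K: "0 < K" "\<And>x. x \<in> l2 \<Longrightarrow> sqnorm (S x) \<le> K * sqnorm x"
    using bounded_l2_ops_bound [OF S] by blast
  note SD = bounded_l2_opsD(2-4) [OF S]
  show "(\<lambda>x\<in>l2. S (T x)) \<in> bounded_l2_ops"
  proof (rule bounded_l2_opsI [of _ "K * L"])
    fix x assume "x \<in> l2"
    then have "sqnorm (S (T x)) \<le> K * sqnorm (T x)" "K * sqnorm (T x) \<le> K * (L * sqnorm x)"
      using K L(2) [of x] by (simp_all add: TD)
    then show "sqnorm ((\<lambda>x\<in>l2. S (T x)) x) \<le> K * L * sqnorm x"
      using \<open>x \<in> l2\<close> by simp
  qed (simp_all add: TD SD)
  show "(\<lambda>x\<in>l2. (\<lambda>n. S x n + T x n)) \<in> bounded_l2_ops"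
  proof (rule bounded_l2_opsI [of _ "2 * K + 2 * L"])
    fix x assume "x \<in> l2"
    then have "sqnorm (\<lambda>n. S x n + T x n) \<le> 2 * sqnorm (S x) + 2 * sqnorm (T x)"
      by (intro sqnorm_add_le SD(1) TD(1))
    also have "\<dots> \<le> 2 * (K * sqnorm x) + 2 * (L * sqnorm x)"
      using K(2) L(2) \<open>x \<in> l2\<close> by (intro add_mono mult_left_mono) simp_all
    also have "\<dots> = (2 * K + 2 * L) * sqnorm x" by (simp add: ring_distribs)
    finally show "sqnorm ((\<lambda>x\<in>l2. (\<lambda>n. S x n + T x n)) x) \<le> (2 * K + 2 * L) * sqnorm x"
      using \<open>x \<in> l2\<close> by simp
  qed (simp_all add: TD SD algebra_simps)
qed

lemma star_algebra_B_l2: "star_algebra B_l2"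
proof (rule star_algebraI)
  note cl = bounded_ops_closed
  fix S T R :: l2_op and c d :: complex
  assume "S \<in> carrier B_l2" and "T \<in> carrier B_l2" and "R \<in> carrier B_l2"
  then have S: "S \<in> bounded_l2_ops" and T: "T \<in> bounded_l2_ops" and R: "R \<in> bounded_l2_ops" by simp_all
  note D = bounded_l2_opsD(2-4) [OF S] bounded_l2_opsD(2-4) [OF T] bounded_l2_opsD(2-4) [OF R]
  note adj = l2_adjoint_inner [OF S] l2_adjoint_inner [OF T]
    bounded_l2_opsD(2) [OF l2_adjoint_closed [OF S]] bounded_l2_opsD(2) [OF l2_adjoint_closed [OF T]]
  show "\<one>\<^bsub>B_l2\<^esub> \<otimes>\<^bsub>B_l2\<^esub> S = S" "S \<otimes>\<^bsub>B_l2\<^esub> \<one>\<^bsub>B_l2\<^esub> = S" "\<zero>\<^bsub>B_l2\<^esub> \<oplus>\<^bsub>B_l2\<^esub> S = S" "1 \<odot>\<^bsub>B_l2\<^esub> S = S"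
    unfolding B_l2_simps by (rule bounded_l2_ops_ext, (rule cl S)+, simp add: D)+
  show "star B_l2 (star B_l2 S) = S"
    unfolding B_l2_simps
  proof (rule l2_adjoint_eqI [OF S])
    fix x y assume "x \<in> l2" "y \<in> l2"
    then show "l2_inner (l2_adjoint S x) y = l2_inner x (S y)"
      using l2_inner_cnj [of y "l2_adjoint S x"] l2_inner_cnj [of "S y" x] by (simp add: adj D)
  qed
  show "star B_l2 (S \<oplus>\<^bsub>B_l2\<^esub> T) = star B_l2 S \<oplus>\<^bsub>B_l2\<^esub> star B_l2 T"
    unfolding B_l2_simps
  proof (rule l2_adjoint_eqI [OF cl(4)])
    fix x y assume xy: "x \<in> l2" "y \<in> l2"
    then show "l2_inner ((\<lambda>x\<in>l2. \<lambda>n. S x n + T x n) x) y = l2_inner x ((\<lambda>x\<in>l2. \<lambda>n. l2_adjoint S x n + l2_adjoint T x n) y)"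
      using l2_inner_cnj [of "\<lambda>n. l2_adjoint S y n + l2_adjoint T y n" x]
        l2_inner_cnj [of "l2_adjoint S y" x] l2_inner_cnj [of "l2_adjoint T y" x]
      by (simp add: l2_inner_add D adj)
  qed (simp_all add: S T)
  show "star B_l2 (c \<odot>\<^bsub>B_l2\<^esub> S) = cnj c \<odot>\<^bsub>B_l2\<^esub> star B_l2 S"
    unfolding B_l2_simps
  proof (rule l2_adjoint_eqI [OF cl(5)])
    fix x y assume xy: "x \<in> l2" "y \<in> l2"
    then show "l2_inner ((\<lambda>x\<in>l2. \<lambda>n. c * S x n) x) y = l2_inner x ((\<lambda>x\<in>l2. \<lambda>n. cnj c * l2_adjoint S x n) y)"
      using l2_inner_cnj [of "\<lambda>n. cnj c * l2_adjoint S y n" x] l2_inner_cnj [of "l2_adjoint S y" x]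
      by (simp add: l2_inner_scale D adj)
  qed (simp_all add: S)
  show "star B_l2 (S \<otimes>\<^bsub>B_l2\<^esub> T) = star B_l2 T \<otimes>\<^bsub>B_l2\<^esub> star B_l2 S"
    unfolding B_l2_simps
    by (rule l2_adjoint_eqI [OF cl(3)]) (simp_all add: S T D adj)
qed (simp_all add: bounded_ops_closed bounded_l2_opsD algebra_simps cong: restrict_cong)

lemma linear_map_coefficient: "linear_map B_l2 complex_alg (\<lambda>T. T (unit m) n)"
  by (rule linear_mapI) simp_all

lemma separated_B_l2: "separated B_l2"
  unfolding separated_def
proof (intro ballI impI)
  fix T assume T: "T \<in> carrier B_l2" and h: "\<forall>\<phi>. linear_map B_l2 complex_alg \<phi> \<longrightarrow> \<phi> T = 0"
  have "T (unit m) n = 0" for m n using h linear_map_coefficient by blast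
  with T show "T = \<zero>\<^bsub>B_l2\<^esub>"
    by (intro bounded_l2_ops_eqI) (simp_all add: bounded_zero)
qed

section \<open>Double series and amplification of operators\<close>

lemma summable_iff_rows:
  fixes f :: "nat \<Rightarrow> real"
  assumes f: "\<And>n. 0 \<le> f n" and p: "bij (p :: nat \<times> nat \<Rightarrow> nat)"
  shows "summable f \<longleftrightarrow> (\<forall>n. summable (\<lambda>m. f (p (n, m)))) \<and> summable (\<lambda>n. suminf (\<lambda>m. f (p (n, m))))"
proof -
  have inner: "infsum (\<lambda>m. f (p (n, m))) UNIV = suminf (\<lambda>m. f (p (n, m)))" if "summable (\<lambda>m. f (p (n, m)))" for n
    using that f by (metis has_sum_imp_sums has_sum_infsum summable_on_UNIV_nonneg_real_iff sums_unique)
  have "summable f \<longleftrightarrow> (\<lambda>z. f (p z)) summable_on UNIV"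
    using f p summable_on_reindex_bij_betw [of p UNIV UNIV f] by (simp add: summable_on_UNIV_nonneg_real_iff)
  also have "\<dots> \<longleftrightarrow> (\<lambda>z. f (p z)) abs_summable_on Sigma UNIV (\<lambda>_. UNIV)"
    using f by simp
  also have "\<dots> \<longleftrightarrow> (\<forall>n. (\<lambda>m. f (p (n, m))) summable_on UNIV) \<and>
      (\<lambda>n. infsum (\<lambda>m. f (p (n, m))) UNIV) summable_on UNIV"
    unfolding abs_summable_on_Sigma_iff using f by (simp add: infsum_nonneg)
  also have "\<dots> \<longleftrightarrow> (\<forall>n. summable (\<lambda>m. f (p (n, m)))) \<and> summable (\<lambda>n. infsum (\<lambda>m. f (p (n, m))) UNIV)"
    using f by (simp add: summable_on_UNIV_nonneg_real_iff infsum_nonneg)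
  also have "\<dots> \<longleftrightarrow> (\<forall>n. summable (\<lambda>m. f (p (n, m)))) \<and> summable (\<lambda>n. suminf (\<lambda>m. f (p (n, m))))"
    using inner by (auto cong: conj_cong)
  finally show ?thesis .
qed

text \<open>Fubini along the bijection \<open>p\<close>. Squared norms and inner products are split
  into rows with it, so that an operator acting on each row separately can be controlled.\<close>

lemma suminf_rows:
  fixes f :: "nat \<Rightarrow> 'b::banach"
  assumes f: "summable (\<lambda>n. norm (f n))" and p: "bij (p :: nat \<times> nat \<Rightarrow> nat)"
  shows "(\<lambda>n. suminf (\<lambda>m. f (p (n, m)))) sums suminf f"
proof -
  have rows: "\<forall>n. summable (\<lambda>m. norm (f (p (n, m))))" "summable (\<lambda>n. suminf (\<lambda>m. norm (f (p (n, m)))))"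
    using summable_iff_rows [of "\<lambda>n. norm (f n)", OF _ p] f by simp_all
  have inf: "infsum g UNIV = suminf g" if "summable (\<lambda>n. norm (g n))" for g :: "nat \<Rightarrow> 'b"
    using norm_summable_imp_has_sum [OF that summable_sums [OF summable_norm_cancel [OF that]]] by (rule infsumI)
  have so: "f summable_on UNIV" by (rule norm_summable_imp_summable_on [OF f])
  then have so': "(\<lambda>z. f (p z)) summable_on Sigma UNIV (\<lambda>_. UNIV)"
    using summable_on_reindex_bij_betw [of p UNIV UNIV f] p by simp
  have eq: "infsum (\<lambda>n. suminf (\<lambda>m. f (p (n, m)))) UNIV = suminf f"
  proof -
    have "infsum (\<lambda>n. suminf (\<lambda>m. f (p (n, m)))) UNIV = infsum (\<lambda>n. infsum (\<lambda>m. f (p (n, m))) UNIV) UNIV"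
      using rows by (simp add: inf)
    also have "\<dots> = infsum (\<lambda>z. f (p z)) (Sigma UNIV (\<lambda>_. UNIV))"
      by (rule infsum_Sigma_banach [OF so'])
    also have "\<dots> = infsum f UNIV"
      using infsum_reindex_bij_betw [of p UNIV UNIV f] p by simp
    finally show ?thesis by (simp add: inf f)
  qed
  have "summable (\<lambda>n. norm (suminf (\<lambda>m. f (p (n, m)))))"
    by (rule summable_comparison_test' [OF rows(2), of 0]) (use rows(1) in \<open>simp add: summable_norm\<close>)
  then show ?thesis
    using eq inf [of "\<lambda>n. suminf (\<lambda>m. f (p (n, m)))"] by (simp add: summable_norm_cancel summable_sums sums_iff)
qed

text \<open>With \<open>\<ell>\<^sup>2(\<nat>)\<close> identified with \<open>\<ell>\<^sup>2(\<nat> \<times> \<nat>)\<close> along a bijection \<open>p\<close>, the operator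
  \<open>amplify p T\<close> is \<open>1 \<otimes> T\<close>.\<close>

definition amplify :: "(nat \<times> nat \<Rightarrow> nat) \<Rightarrow> l2_op \<Rightarrow> l2_op" where
  "amplify p T = (\<lambda>x\<in>l2. \<lambda>k. T (\<lambda>i. x (p (fst (inv_into UNIV p k), i))) (snd (inv_into UNIV p k)))"

context
  fixes p :: "nat \<times> nat \<Rightarrow> nat"
  assumes p: "bij p"
begin

lemma inv_p [simp]: "inv_into UNIV p (p z) = z"
  using p by (simp add: bij_is_inj)

lemma p_eq_iff [simp]: "p z = p z' \<longleftrightarrow> z = z'"
  using p by (simp add: bij_is_inj inj_eq)

lemma ext_p: "(\<And>n m. f (p (n, m)) = g (p (n, m))) \<Longrightarrow> f = g"
  using p by (metis bij_is_surj ext surj_f_inv_f surj_pair)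

lemma amplify_apply: "x \<in> l2 \<Longrightarrow> amplify p T x (p (n, m)) = T (\<lambda>i. x (p (n, i))) m"
  by (simp add: amplify_def)

lemma l2_rows_iff:
  "x \<in> l2 \<longleftrightarrow> (\<forall>n. (\<lambda>i. x (p (n, i))) \<in> l2) \<and> summable (\<lambda>n. sqnorm (\<lambda>i. x (p (n, i))))"
  unfolding l2_def sqnorm_def mem_Collect_eq by (rule summable_iff_rows) (simp_all add: p)

lemma l2_row: "x \<in> l2 \<Longrightarrow> (\<lambda>i. x (p (n, i))) \<in> l2"
  using l2_rows_iff by blast

lemma sqnorm_rows: "x \<in> l2 \<Longrightarrow> (\<lambda>n. sqnorm (\<lambda>i. x (p (n, i)))) sums sqnorm x"
  unfolding sqnorm_def by (rule suminf_rows [OF _ p]) (simp add: l2D)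

lemma l2_inner_rows:
  "x \<in> l2 \<Longrightarrow> y \<in> l2 \<Longrightarrow> (\<lambda>n. l2_inner (\<lambda>i. x (p (n, i))) (\<lambda>i. y (p (n, i)))) sums l2_inner x y"
  unfolding l2_inner_def by (rule suminf_rows [OF _ p]) (simp add: l2_inner_abs_summable del: norm_mult)

lemma amplify_bounded:
  assumes T: "T \<in> bounded_l2_ops"
  shows "amplify p T \<in> bounded_l2_ops"
proof -
  note TD = bounded_l2_opsD(2-4) [OF T]
  obtain K where K: "0 < K" "\<And>x. x \<in> l2 \<Longrightarrow> sqnorm (T x) \<le> K * sqnorm x"
    using bounded_l2_ops_bound [OF T] by blast
  have row: "(\<lambda>i. amplify p T x (p (n, i))) = T (\<lambda>i. x (p (n, i)))" if "x \<in> l2" for x n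
    using that by (simp add: amplify_apply)
  have le: "sqnorm (T (\<lambda>i. x (p (n, i)))) \<le> K * sqnorm (\<lambda>i. x (p (n, i)))" if "x \<in> l2" for x n
    by (rule K(2) [OF l2_row [OF that]])
  have s: "summable (\<lambda>n. K * sqnorm (\<lambda>i. x (p (n, i))))" if "x \<in> l2" for x
    using that l2_rows_iff by (intro summable_mult) blast
  have s': "summable (\<lambda>n. sqnorm (T (\<lambda>i. x (p (n, i)))))" if "x \<in> l2" for x
    by (rule summable_comparison_test' [OF s [OF that], of 0])
      (simp add: sqnorm_nonneg TD(1) l2_row that le)
  have cl: "amplify p T x \<in> l2" if "x \<in> l2" for x
    using that s' by (subst l2_rows_iff) (simp add: row TD(1) l2_row)
  show ?thesis
  proof (rule bounded_l2_opsI [of _ K])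
    fix x y c assume x: "x \<in> l2" and y: "y \<in> l2"
    show "amplify p T x \<in> l2" by (rule cl [OF x])
    show "amplify p T (\<lambda>n. x n + y n) = (\<lambda>n. amplify p T x n + amplify p T y n)"
      by (rule ext_p) (simp add: amplify_apply x y TD l2_row)
    show "amplify p T (\<lambda>n. c * x n) = (\<lambda>n. c * amplify p T x n)"
      by (rule ext_p) (simp add: amplify_apply x TD l2_row)
    have "sqnorm (amplify p T x) = suminf (\<lambda>n. sqnorm (T (\<lambda>i. x (p (n, i)))))"
      using sqnorm_rows [OF cl [OF x]] by (simp add: row x sums_iff)
    also have "\<dots> \<le> suminf (\<lambda>n. K * sqnorm (\<lambda>i. x (p (n, i))))"
      by (intro suminf_le s s' x le)
    also have "\<dots> = K * sqnorm x"
      using sqnorm_rows [OF x] by (simp add: suminf_mult sums_iff)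
    finally show "sqnorm (amplify p T x) \<le> K * sqnorm x" .
  qed (simp add: amplify_def)
qed

lemma amplify_star_hom: "star_hom B_l2 B_l2 (amplify p)"
  unfolding star_hom_def
proof (intro conjI ballI alg_homI)
  fix S T :: l2_op and c assume "S \<in> carrier B_l2" and "T \<in> carrier B_l2"
  then have S: "S \<in> bounded_l2_ops" and T: "T \<in> bounded_l2_ops" by simp_all
  note D = bounded_l2_opsD(2-4) [OF S] bounded_l2_opsD(2-4) [OF T]
    bounded_l2_opsD(2) [OF amplify_bounded [OF S]] bounded_l2_opsD(2) [OF amplify_bounded [OF T]]
  note cl = bounded_ops_closed amplify_bounded S T
  show "amplify p S \<in> carrier B_l2" by (simp add: cl)
  show "amplify p (S \<otimes>\<^bsub>B_l2\<^esub> T) = amplify p S \<otimes>\<^bsub>B_l2\<^esub> amplify p T"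
    unfolding B_l2_simps
    by (rule bounded_l2_ops_ext, (intro cl)+, rule ext_p) (simp add: amplify_apply D l2_row)
  show "amplify p (S \<oplus>\<^bsub>B_l2\<^esub> T) = amplify p S \<oplus>\<^bsub>B_l2\<^esub> amplify p T"
    unfolding B_l2_simps
    by (rule bounded_l2_ops_ext, (intro cl)+, rule ext_p) (simp add: amplify_apply D l2_row)
  show "amplify p (c \<odot>\<^bsub>B_l2\<^esub> S) = c \<odot>\<^bsub>B_l2\<^esub> amplify p S"
    unfolding B_l2_simps
    by (rule bounded_l2_ops_ext, (intro cl)+, rule ext_p) (simp add: amplify_apply D l2_row)
  show "amplify p (star B_l2 S) = star B_l2 (amplify p S)"
    unfolding B_l2_simps
  proof (rule l2_adjoint_eqI [symmetric])
    show a: "amplify p (l2_adjoint S) \<in> bounded_l2_ops" by (intro cl l2_adjoint_closed)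
    fix x y assume x: "x \<in> l2" and y: "y \<in> l2"
    have "(\<lambda>n. l2_inner (\<lambda>i. amplify p S x (p (n, i))) (\<lambda>i. y (p (n, i)))) sums l2_inner (amplify p S x) y"
      by (intro l2_inner_rows D x y)
    moreover have "(\<lambda>n. l2_inner (\<lambda>i. x (p (n, i))) (\<lambda>i. amplify p (l2_adjoint S) y (p (n, i)))) sums
        l2_inner x (amplify p (l2_adjoint S) y)"
      by (intro l2_inner_rows bounded_l2_opsD(2) [OF a] x y)
    ultimately show "l2_inner (amplify p S x) y = l2_inner x (amplify p (l2_adjoint S) y)"
      by (simp add: amplify_apply x y l2_adjoint_inner [OF S] l2_row sums_iff)
  qed
next
  show "amplify p \<one>\<^bsub>B_l2\<^esub> = \<one>\<^bsub>B_l2\<^esub>"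
    unfolding B_l2_simps
    by (rule bounded_l2_ops_ext, (intro amplify_bounded bounded_id)+, rule ext_p) (simp add: amplify_apply l2_row)
qed

lemma amplify_unit:
  "amplify p T (unit (p (n, m))) (p (n', m')) = (if n = n' then T (unit m) m' else T (\<lambda>i. 0) m')"
proof -
  have "(\<lambda>i. unit (p (n, m)) (p (n', i))) = (if n = n' then unit m else (\<lambda>i. 0))"
    by (auto simp: unit_def fun_eq_iff)
  then show ?thesis by (simp add: amplify_apply)
qed

end

lemma bounded_at_zero: "T \<in> bounded_l2_ops \<Longrightarrow> T (\<lambda>i. 0) = (\<lambda>i. 0)"
  using bounded_l2_opsD(4) [of T "\<lambda>i. 0" 0] by simp

text \<open>The pairing is swapped, so that rows are indexed by the second coordinate and the
  operator acts on the first.\<close>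

abbreviation amplify_left :: "l2_op \<Rightarrow> l2_op" where
  "amplify_left \<equiv> amplify (\<lambda>z. prod_encode (snd z, fst z))"

abbreviation amplify_right :: "l2_op \<Rightarrow> l2_op" where
  "amplify_right \<equiv> amplify prod_encode"

lemma bij_prod_encode_swap: "bij (\<lambda>z. prod_encode (snd z, fst z))"
proof -
  have "bij (prod_encode \<circ> (\<lambda>z. (snd z, fst z)))"
    using bij_comp [OF bij_swap bij_prod_encode] by (simp add: prod.swap_def [abs_def])
  then show ?thesis by (simp add: o_def)
qed

text \<open>In either order the result has the coefficients of the tensor product of S and T. Since
  coefficients determine bounded operators, the two amplifications commute.\<close>

lemma amplify_coefficients:
  assumes S: "S \<in> bounded_l2_ops" and T: "T \<in> bounded_l2_ops"
  shows "amplify_left S (amplify_right T (unit (prod_encode (i, j)))) (prod_encode (m, n)) = S (unit i) m * T (unit j) n"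
    and "amplify_right T (amplify_left S (unit (prod_encode (i, j)))) (prod_encode (m, n)) = S (unit i) m * T (unit j) n"
proof -
  let ?l = "\<lambda>z. prod_encode (snd z, fst z)"
  note L = amplify_unit [OF bij_prod_encode_swap, of _ j i n, simplified]
  have r: "amplify_right T (unit (prod_encode (i, j))) (prod_encode (i', n)) = T (unit j) n * unit i i'" for i'
    using amplify_unit [OF bij_prod_encode, of T i j i' n]
    by (auto simp: unit_def bounded_at_zero [OF T])
  have l: "amplify_left S (unit (prod_encode (i, j))) (prod_encode (m, j')) = S (unit i) m * unit j j'" for j'
    using amplify_unit [OF bij_prod_encode_swap, of S j i j' m]
    by (auto simp: unit_def bounded_at_zero [OF S])
  have "amplify_right T (unit (prod_encode (i, j))) \<in> l2" "amplify_left S (unit (prod_encode (i, j))) \<in> l2"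
    using bounded_l2_opsD(2) amplify_bounded bij_prod_encode bij_prod_encode_swap S T by simp_all
  then show "amplify_left S (amplify_right T (unit (prod_encode (i, j)))) (prod_encode (m, n)) = S (unit i) m * T (unit j) n"
    "amplify_right T (amplify_left S (unit (prod_encode (i, j)))) (prod_encode (m, n)) = S (unit i) m * T (unit j) n"
    using amplify_apply [OF bij_prod_encode_swap, of "amplify_right T (unit (prod_encode (i, j)))" S n m]
      amplify_apply [OF bij_prod_encode, of "amplify_left S (unit (prod_encode (i, j)))" T m n]
    by (simp_all add: r l bounded_l2_opsD(4) [OF S unit_l2] bounded_l2_opsD(4) [OF T unit_l2])
qed

lemma amplify_commute:
  assumes S: "S \<in> bounded_l2_ops" and T: "T \<in> bounded_l2_ops"
  shows "amplify_left S \<otimes>\<^bsub>B_l2\<^esub> amplify_right T = amplify_right T \<otimes>\<^bsub>B_l2\<^esub> amplify_left S"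
  unfolding B_l2_simps
proof (rule bounded_l2_ops_eqI)
  fix k l
  obtain i j m n where "k = prod_encode (i, j)" "l = prod_encode (m, n)"
    using prod_decode_inverse by (metis surj_pair)
  then show "(\<lambda>x\<in>l2. amplify_left S (amplify_right T x)) (unit k) l =
    (\<lambda>x\<in>l2. amplify_right T (amplify_left S x)) (unit k) l"
    by (simp add: amplify_coefficients [OF S T])
qed (intro bounded_compose amplify_bounded bij_prod_encode bij_prod_encode_swap S T)+

text \<open>Transposition \<open>T \<mapsto> J T\<^sup>* J\<close>, with \<open>J\<close> the complex conjugation of \<open>\<ell>\<^sup>2\<close>.\<close>

definition l2_transpose :: "l2_op \<Rightarrow> l2_op" where
  "l2_transpose T = (\<lambda>x\<in>l2. \<lambda>n. cnj (l2_adjoint T (\<lambda>i. cnj (x i)) n))"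

lemma l2_transpose_coefficient:
  assumes T: "T \<in> bounded_l2_ops"
  shows "l2_transpose T (unit m) n = T (unit n) m"
proof -
  have u: "(\<lambda>i. cnj (unit k i)) = unit k" for k by (auto simp: unit_def)
  have "l2_adjoint T (unit m) n = cnj (l2_inner (unit n) (l2_adjoint T (unit m)))"
    by (subst l2_inner_unit_left) (simp_all add: bounded_l2_opsD(2) [OF l2_adjoint_closed [OF T]])
  also have "l2_inner (unit n) (l2_adjoint T (unit m)) = T (unit n) m"
    by (simp add: l2_adjoint_inner [OF T, symmetric] l2_inner_unit_right)
  finally show ?thesis by (simp add: l2_transpose_def u)
qed

lemma l2_transpose_bounded:
  assumes T: "T \<in> bounded_l2_ops"
  shows "l2_transpose T \<in> bounded_l2_ops"
proof -
  note a = l2_adjoint_closed [OF T]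
  note D = bounded_l2_opsD(2-4) [OF a]
  obtain K where K: "0 < K" "\<And>x. x \<in> l2 \<Longrightarrow> sqnorm (l2_adjoint T x) \<le> K * sqnorm x"
    using bounded_l2_ops_bound [OF a] by blast
  show ?thesis
  proof (rule bounded_l2_opsI [of _ K])
    fix x assume x: "x \<in> l2"
    show "sqnorm (l2_transpose T x) \<le> K * sqnorm x"
      using K(2) [of "\<lambda>i. cnj (x i)"] x by (simp add: l2_transpose_def sqnorm_cnj)
  qed (simp_all add: l2_transpose_def D)
qed

text \<open>The adjoint and the conjugation by J are both conjugate linear, but only the adjoint
  reverses products. Their composite is linear and antimultiplicative, hence a homomorphism on the
  opposite algebra.\<close>

lemma l2_transpose_star_hom: "star_hom (opposite B_l2) B_l2 l2_transpose"
  unfolding star_hom_def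
proof (intro conjI ballI alg_homI)
  interpret star_algebra B_l2 by (rule star_algebra_B_l2)
  fix S T :: l2_op and c assume "S \<in> carrier (opposite B_l2)" and "T \<in> carrier (opposite B_l2)"
  then have S: "S \<in> bounded_l2_ops" and T: "T \<in> bounded_l2_ops" by simp_all
  note cl = bounded_ops_closed l2_transpose_bounded l2_adjoint_closed S T
  note co = l2_transpose_coefficient
  note aD = bounded_l2_opsD(2-4) [OF l2_adjoint_closed [OF S]] bounded_l2_opsD(2-4) [OF l2_adjoint_closed [OF T]]
  show "l2_transpose S \<in> carrier B_l2" by (simp add: cl)
  show "l2_transpose (S \<otimes>\<^bsub>opposite B_l2\<^esub> T) = l2_transpose S \<otimes>\<^bsub>B_l2\<^esub> l2_transpose T"
  proof -
    have "l2_adjoint (T \<otimes>\<^bsub>B_l2\<^esub> S) = l2_adjoint S \<otimes>\<^bsub>B_l2\<^esub> l2_adjoint T"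
      using star_mult [of T S] S T by simp
    then show ?thesis by (simp add: l2_transpose_def aD fun_eq_iff restrict_def)
  qed
  show "l2_transpose (S \<oplus>\<^bsub>opposite B_l2\<^esub> T) = l2_transpose S \<oplus>\<^bsub>B_l2\<^esub> l2_transpose T"
    unfolding opposite_simps B_l2_simps
    by (rule bounded_l2_ops_eqI) (simp_all add: co cl)
  show "l2_transpose (c \<odot>\<^bsub>opposite B_l2\<^esub> S) = c \<odot>\<^bsub>B_l2\<^esub> l2_transpose S"
    unfolding opposite_simps B_l2_simps
    by (rule bounded_l2_ops_eqI) (simp_all add: co cl)
  show "l2_transpose (star (opposite B_l2) S) = star B_l2 (l2_transpose S)"
    unfolding opposite_simps B_l2_simps
  proof (rule l2_adjoint_eqI [symmetric])
    show "l2_transpose (l2_adjoint S) \<in> bounded_l2_ops" by (intro cl)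
    fix x y assume x: "x \<in> l2" and y: "y \<in> l2"
    have ss: "l2_adjoint (l2_adjoint S) = S" using star_star [of S] S by simp
    have "l2_inner (l2_transpose S x) y = cnj (l2_inner (l2_adjoint S (\<lambda>i. cnj (x i))) (\<lambda>i. cnj (y i)))"
      using x y l2_inner_conjugate [of "l2_adjoint S (\<lambda>i. cnj (x i))" "\<lambda>i. cnj (y i)"]
      by (simp add: l2_transpose_def aD)
    also have "\<dots> = cnj (l2_inner (\<lambda>i. cnj (x i)) (S (\<lambda>i. cnj (y i))))"
      using x y l2_adjoint_inner [OF l2_adjoint_closed [OF S], of "\<lambda>i. cnj (x i)" "\<lambda>i. cnj (y i)"] by (simp add: ss)
    also have "\<dots> = l2_inner x (l2_transpose (l2_adjoint S) y)"
      using x y l2_inner_conjugate [of "\<lambda>i. cnj (x i)" "S (\<lambda>i. cnj (y i))"]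
      by (simp add: l2_transpose_def ss bounded_l2_opsD(2) [OF S])
    finally show "l2_inner (l2_transpose S x) y = l2_inner x (l2_transpose (l2_adjoint S) y)" .
  qed
next
  show "l2_transpose \<one>\<^bsub>opposite B_l2\<^esub> = \<one>\<^bsub>B_l2\<^esub>"
    unfolding opposite_simps B_l2_simps
    by (rule bounded_l2_ops_eqI) (simp_all add: l2_transpose_coefficient l2_transpose_bounded bounded_id, simp add: unit_def)
qed

section \<open>Residual algebras\<close>

definition residual :: "('a, 'm) star_alg_scheme \<Rightarrow> bool" where
  "residual A \<longleftrightarrow> (\<forall>x\<in>carrier A. x \<noteq> \<zero>\<^bsub>A\<^esub> \<longrightarrow> (\<exists>\<phi>. star_hom A B_l2 \<phi> \<and> \<phi> x \<noteq> \<zero>\<^bsub>B_l2\<^esub>))"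

lemma residual_coefficient:
  assumes "residual A" "x \<in> carrier A" "x \<noteq> \<zero>\<^bsub>A\<^esub>"
  obtains \<phi> m n where "star_hom A B_l2 \<phi>" "\<phi> x (unit m) n \<noteq> 0"
proof -
  obtain \<phi> where \<phi>: "star_hom A B_l2 \<phi>" "\<phi> x \<noteq> \<zero>\<^bsub>B_l2\<^esub>"
    using assms by (auto simp: residual_def)
  moreover have "\<phi> x \<in> bounded_l2_ops" using alg_homD(1) [OF star_hom_alg [OF \<phi>(1)] assms(2)] by simp
  ultimately have "\<exists>m n. \<phi> x (unit m) n \<noteq> 0"
    using bounded_l2_ops_eqI [of "\<phi> x" "\<zero>\<^bsub>B_l2\<^esub>"] bounded_zero by auto
  with \<phi> that show ?thesis by blast
qed

lemma residual_separated:
  assumes "residual A"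
  shows "separated A"
  unfolding separated_def
proof (intro ballI impI)
  fix x assume x: "x \<in> carrier A" and h: "\<forall>\<phi>. linear_map A complex_alg \<phi> \<longrightarrow> \<phi> x = 0"
  show "x = \<zero>\<^bsub>A\<^esub>"
  proof (rule ccontr)
    assume "x \<noteq> \<zero>\<^bsub>A\<^esub>"
    then obtain \<phi> m n where \<phi>: "star_hom A B_l2 \<phi>" "\<phi> x (unit m) n \<noteq> 0"
      using residual_coefficient [OF assms x] by blast
    have "linear_map A complex_alg (\<lambda>x. \<phi> x (unit m) n)"
      by (rule linear_map_compose [OF alg_hom_linear [OF star_hom_alg [OF \<phi>(1)]] linear_map_coefficient])
    with h \<phi>(2) show False by blast
  qed
qed

lemma residual_opposite:
  assumes "residual A"
  shows "residual (opposite A)"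
  unfolding residual_def
proof (intro ballI impI)
  fix x assume x: "x \<in> carrier (opposite A)" "x \<noteq> \<zero>\<^bsub>opposite A\<^esub>"
  then obtain \<phi> m n where \<phi>: "star_hom A B_l2 \<phi>" "\<phi> x (unit m) n \<noteq> 0"
    using residual_coefficient [OF assms, of x] by (metis opposite_simps(1,4))
  have "star_hom (opposite A) (opposite B_l2) \<phi>"
    using \<phi>(1) by (auto simp: star_hom_def alg_hom_def ring_hom_def linear_map_def)
  then have h: "star_hom (opposite A) B_l2 (\<lambda>x. l2_transpose (\<phi> x))"
    by (rule star_hom_compose [OF _ l2_transpose_star_hom])
  have "\<phi> x \<in> bounded_l2_ops" using alg_homD(1) [OF star_hom_alg [OF \<phi>(1)]] x by simp
  then have "l2_transpose (\<phi> x) (unit n) m \<noteq> 0" using \<phi>(2) by (simp add: l2_transpose_coefficient)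
  then have "l2_transpose (\<phi> x) \<noteq> \<zero>\<^bsub>B_l2\<^esub>" by auto
  with h show "\<exists>\<phi>. star_hom (opposite A) B_l2 \<phi> \<and> \<phi> x \<noteq> \<zero>\<^bsub>B_l2\<^esub>" by blast
qed

text \<open>Induction on the number of summands. A functional not vanishing on the last second
  factor turns the hypothesis into an equation that expresses the last first factor by the others;
  the last summand is then absorbed into them. The sets of functionals need not be linear spaces,
  which suits matrix coefficients.\<close>

lemma (in star_algebra_pair) tensor_separated_by_products:
  assumes A: "\<And>a. a \<in> carrier A \<Longrightarrow> a \<noteq> \<zero>\<^bsub>A\<^esub> \<Longrightarrow> \<exists>\<phi>\<in>\<Phi>. \<phi> a \<noteq> 0"
    and B: "\<And>b. b \<in> carrier B \<Longrightarrow> b \<noteq> \<zero>\<^bsub>B\<^esub> \<Longrightarrow> \<exists>\<psi>\<in>\<Psi>. \<psi> b \<noteq> 0"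
    and \<Phi>: "\<And>\<phi>. \<phi> \<in> \<Phi> \<Longrightarrow> linear_map A complex_alg \<phi>"
    and \<Psi>: "\<And>\<psi>. \<psi> \<in> \<Psi> \<Longrightarrow> linear_map B complex_alg \<psi>"
    and t: "t \<in> carrier T" and h: "\<And>\<phi> \<psi>. \<phi> \<in> \<Phi> \<Longrightarrow> \<psi> \<in> \<Psi> \<Longrightarrow> t (\<lambda>a b. \<phi> a * \<psi> b) = 0"
  shows "t = \<zero>\<^bsub>T\<^esub>"
proof -
  have bil: "bilinear_form A B (\<lambda>a b. \<phi> a * \<psi> b)" if "\<phi> \<in> \<Phi>" "\<psi> \<in> \<Psi>" for \<phi> \<psi>
    using linear_mapD [OF \<Phi> [OF that(1)]] linear_mapD [OF \<Psi> [OF that(2)]]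
    by (intro bilinear_formI) (simp_all add: algebra_simps)
  have main: "(\<Oplus>\<^bsub>T\<^esub>i\<in>{..<n}. pure (a i) (b i)) = \<zero>\<^bsub>T\<^esub>"
    if "\<forall>i<n. a i \<in> carrier A \<and> b i \<in> carrier B"
      "\<forall>\<phi>\<in>\<Phi>. \<forall>\<psi>\<in>\<Psi>. (\<Sum>i<n. \<phi> (a i) * \<psi> (b i)) = 0" for n :: nat and a b
    using that
  proof (induction n arbitrary: b)
    case (Suc n)
    have ab: "a i \<in> carrier A" "b i \<in> carrier B" if "i < Suc n" for i using Suc.prems(1) that by auto
    have split: "(\<Oplus>\<^bsub>T\<^esub>i\<in>{..<Suc n}. pure (a i) (c i)) = pure (a n) (c n) \<oplus>\<^bsub>T\<^esub> (\<Oplus>\<^bsub>T\<^esub>i\<in>{..<n}. pure (a i) (c i))"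
      if "\<And>i. i < Suc n \<Longrightarrow> c i \<in> carrier B" for c
      unfolding lessThan_Suc using that ab by (intro T.finsum_insert) auto
    show ?case
    proof (cases "b n = \<zero>\<^bsub>B\<^esub>")
      case True
      have "pure (a n) (b n) = \<zero>\<^bsub>T\<^esub>"
        using pure_smult_right [of "a n" "b n" 0] ab by (simp add: True)
      moreover have "(\<Oplus>\<^bsub>T\<^esub>i\<in>{..<n}. pure (a i) (b i)) = \<zero>\<^bsub>T\<^esub>"
      proof (rule Suc.IH)
        have "\<psi> (b n) = 0" if "\<psi> \<in> \<Psi>" for \<psi>
          using linear_map_zero [OF \<Psi> [OF that] B.star_algebra_axioms star_algebra_complex] by (simp add: True)
        then show "\<forall>\<phi>\<in>\<Phi>. \<forall>\<psi>\<in>\<Psi>. (\<Sum>i<n. \<phi> (a i) * \<psi> (b i)) = 0" using Suc.prems(2) by force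
      qed (use Suc.prems(1) in auto)
      ultimately show ?thesis using split [of b] ab by simp
    next
      case False
      then obtain \<psi> where \<psi>: "\<psi> \<in> \<Psi>" "\<psi> (b n) \<noteq> 0" using B ab by blast
      \<comment> \<open>Coefficients obtained by solving the vanishing sum, evaluated with \<psi>,
        for the last first factor.\<close>
      define z where "z i = - \<psi> (b i) / \<psi> (b n)" for i
      have an: "a n = (\<Oplus>\<^bsub>A\<^esub>i\<in>{..<n}. z i \<odot>\<^bsub>A\<^esub> a i)" (is "_ = ?s")
      proof -
        have s: "?s \<in> carrier A" using ab by auto
        have "\<phi> (a n \<oplus>\<^bsub>A\<^esub> (- 1) \<odot>\<^bsub>A\<^esub> ?s) = 0" if \<phi>: "\<phi> \<in> \<Phi>" for \<phi>
        proof -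
          note l = linear_mapD [OF \<Phi> [OF \<phi>]]
          have "\<phi> ?s = (\<Sum>i<n. z i * \<phi> (a i))"
            using ab by (subst linear_map_finsum [OF \<Phi> [OF \<phi>] A.star_algebra_axioms star_algebra_complex])
              (auto simp: finsum_complex l intro!: sum.cong)
          moreover have "(\<Sum>i<n. \<phi> (a i) * \<psi> (b i)) + \<phi> (a n) * \<psi> (b n) = 0"
            using Suc.prems(2) \<phi> \<psi>(1) by simp
          moreover have "\<psi> (b n) * (\<Sum>i<n. z i * \<phi> (a i)) = - (\<Sum>i<n. \<phi> (a i) * \<psi> (b i))"
            using \<psi>(2) by (simp add: z_def sum_distrib_left sum_negf [symmetric] mult_ac)
          ultimately have "\<psi> (b n) * \<phi> ?s = \<psi> (b n) * \<phi> (a n)"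
            by (simp add: algebra_simps add_eq_0_iff)
          with \<psi>(2) have "\<phi> ?s = \<phi> (a n)" by simp
          then show ?thesis using s ab by (simp add: l)
        qed
        then have "\<forall>\<phi>\<in>\<Phi>. \<phi> (a n \<oplus>\<^bsub>A\<^esub> (- 1) \<odot>\<^bsub>A\<^esub> ?s) = 0" by blast
        then have "a n \<oplus>\<^bsub>A\<^esub> (- 1) \<odot>\<^bsub>A\<^esub> ?s = \<zero>\<^bsub>A\<^esub>" 
        proof (rule contrapos_pp)
          assume "a n \<oplus>\<^bsub>A\<^esub> (- 1) \<odot>\<^bsub>A\<^esub> ?s \<noteq> \<zero>\<^bsub>A\<^esub>"
          moreover have "a n \<oplus>\<^bsub>A\<^esub> (- 1) \<odot>\<^bsub>A\<^esub> ?s \<in> carrier A" using s ab by simp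
          ultimately have "\<exists>\<phi>\<in>\<Phi>. \<phi> (a n \<oplus>\<^bsub>A\<^esub> (- 1) \<odot>\<^bsub>A\<^esub> ?s) \<noteq> 0" by (intro A)
          then show "\<not> (\<forall>\<phi>\<in>\<Phi>. \<phi> (a n \<oplus>\<^bsub>A\<^esub> (- 1) \<odot>\<^bsub>A\<^esub> ?s) = 0)" by blast
        qed
        then have "a n = 1 \<odot>\<^bsub>A\<^esub> ?s" using s ab by (intro A.eq_of_add_zero) auto
        with s show ?thesis by simp
      qed
      \<comment> \<open>Substituting the combination for \<open>a n\<close> and moving its scalars
        to the second leg adds this multiple of \<open>b n\<close> to each
        \<open>b i\<close>.\<close>
      define b' where "b' i = b i \<oplus>\<^bsub>B\<^esub> z i \<odot>\<^bsub>B\<^esub> b n" for i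
      have b': "b' i \<in> carrier B" if "i < n" for i using ab that by (simp add: b'_def)
      have "pure (a n) (b n) = (\<Oplus>\<^bsub>T\<^esub>i\<in>{..<n}. pure (z i \<odot>\<^bsub>A\<^esub> a i) (b n))"
        unfolding an using ab by (subst tensor_finsum) auto
      also have "\<dots> = (\<Oplus>\<^bsub>T\<^esub>i\<in>{..<n}. pure (a i) (z i \<odot>\<^bsub>B\<^esub> b n))"
        using ab by (intro finsum_scong [unfolded simp_implies_def] HOL.refl) (simp add: pure_smult_left pure_smult_right)
      finally have "(\<Oplus>\<^bsub>T\<^esub>i\<in>{..<Suc n}. pure (a i) (b i)) =
          (\<Oplus>\<^bsub>T\<^esub>i\<in>{..<n}. pure (a i) (z i \<odot>\<^bsub>B\<^esub> b n)) \<oplus>\<^bsub>T\<^esub> (\<Oplus>\<^bsub>T\<^esub>i\<in>{..<n}. pure (a i) (b i))"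
        using split [of b] ab by simp
      also have "\<dots> = (\<Oplus>\<^bsub>T\<^esub>i\<in>{..<n}. pure (a i) (z i \<odot>\<^bsub>B\<^esub> b n) \<oplus>\<^bsub>T\<^esub> pure (a i) (b i))"
        using ab by (intro T.finsum_addf [symmetric]) auto
      also have "\<dots> = (\<Oplus>\<^bsub>T\<^esub>i\<in>{..<n}. pure (a i) (b' i))"
        using ab by (intro finsum_scong [unfolded simp_implies_def] HOL.refl)
          (simp add: b'_def pure_add_right T.a_comm)
      also have "\<dots> = \<zero>\<^bsub>T\<^esub>"
      proof (rule Suc.IH)
        show "\<forall>\<phi>\<in>\<Phi>. \<forall>\<psi>'\<in>\<Psi>. (\<Sum>i<n. \<phi> (a i) * \<psi>' (b' i)) = 0"
        proof (intro ballI)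
          fix \<phi> \<psi>' assume \<phi>: "\<phi> \<in> \<Phi>" and \<psi>': "\<psi>' \<in> \<Psi>"
          have s0: "(\<Sum>i<n. \<phi> (a i) * \<psi>' (b i)) + \<phi> (a n) * \<psi>' (b n) = 0"
            using bspec [OF bspec [OF Suc.prems(2) \<phi>] \<psi>'] by simp
          have "\<phi> (a n) = (\<Sum>i<n. z i * \<phi> (a i))"
            by (subst an, subst linear_map_finsum [OF \<Phi> [OF \<phi>] A.star_algebra_axioms star_algebra_complex])
              (use ab in \<open>auto simp: finsum_complex linear_mapD [OF \<Phi> [OF \<phi>]] intro!: sum.cong\<close>)
          moreover have "(\<Sum>i<n. \<phi> (a i) * \<psi>' (b' i)) =
              (\<Sum>i<n. \<phi> (a i) * \<psi>' (b i)) + (\<Sum>i<n. z i * \<phi> (a i)) * \<psi>' (b n)"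
            unfolding sum_distrib_right sum.distrib [symmetric]
            using ab by (intro sum.cong) (auto simp: b'_def linear_mapD [OF \<Psi> [OF \<psi>']] algebra_simps)
          ultimately show "(\<Sum>i<n. \<phi> (a i) * \<psi>' (b' i)) = 0"
            by (simp only: s0 flip: \<open>\<phi> (a n) = (\<Sum>i<n. z i * \<phi> (a i))\<close>)
        qed
      qed (use b' ab in auto)
      finally show ?thesis .
    qed
  qed simp
  obtain n a b where ab: "\<forall>i<(n::nat). a i \<in> carrier A \<and> b i \<in> carrier B"
    and t': "t = (\<lambda>\<beta>. \<Sum>i<n. pure (a i) (b i) \<beta>)"
    using t by (auto simp: tensor_alg_def)
  have fs: "(\<Oplus>\<^bsub>T\<^esub>i\<in>{..<m}. pure (a i) (b i)) = (\<lambda>\<beta>. \<Sum>i<m. pure (a i) (b i) \<beta>)" if "m \<le> n" for m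
    using that
  proof (induction m)
    case (Suc m)
    have "(\<Oplus>\<^bsub>T\<^esub>i\<in>{..<Suc m}. pure (a i) (b i)) = pure (a m) (b m) \<oplus>\<^bsub>T\<^esub> (\<Oplus>\<^bsub>T\<^esub>i\<in>{..<m}. pure (a i) (b i))"
      unfolding lessThan_Suc using ab Suc.prems by (intro T.finsum_insert) auto
    with Suc show ?case by (simp add: tensor_alg_simps add.commute)
  qed (simp add: tensor_alg_simps)
  have "(\<Oplus>\<^bsub>T\<^esub>i\<in>{..<n}. pure (a i) (b i)) = \<zero>\<^bsub>T\<^esub>"
    by (rule main [OF ab]) (use h bil in \<open>auto simp: t' pure_apply\<close>)
  then show ?thesis by (simp add: fs t')
qed

text \<open>Products of matrix coefficients separate tensors, and each such product is a matrix
  coefficient of a single representation: the two amplified representations commute and combine into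
  one of the tensor product.\<close>

lemma residual_tensor:
  assumes sA: "star_algebra A" and sB: "star_algebra B" and A: "residual A" and B: "residual B"
  shows "residual (tensor_alg A B)"
  unfolding residual_def
proof (intro ballI impI)
  interpret star_algebra_pair A B by (intro star_algebra_pair.intro sA sB)
  fix t assume t: "t \<in> carrier T" "t \<noteq> \<zero>\<^bsub>T\<^esub>"
  define \<Phi> where "\<Phi> = {\<lambda>x. \<phi> x (unit m) n |\<phi> m n. star_hom A B_l2 \<phi>}"
  define \<Psi> where "\<Psi> = {\<lambda>x. \<phi> x (unit m) n |\<phi> m n. star_hom B B_l2 \<phi>}"
  have lin: "linear_map X complex_alg (\<lambda>x. \<phi> x (unit m) n)" if "star_hom X B_l2 \<phi>"
    for X :: "('x, 'y) star_alg_scheme" and \<phi> m n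
    by (rule linear_map_compose [OF alg_hom_linear [OF star_hom_alg [OF that]] linear_map_coefficient])
  have "\<exists>\<phi>\<in>\<Phi>. \<exists>\<psi>\<in>\<Psi>. t (\<lambda>a b. \<phi> a * \<psi> b) \<noteq> 0"
  proof (rule ccontr)
    assume "\<not> ?thesis"
    then have "t = \<zero>\<^bsub>T\<^esub>"
    proof (intro tensor_separated_by_products [OF _ _ _ _ t(1), of \<Phi> \<Psi>])
      show "\<exists>\<phi>\<in>\<Phi>. \<phi> a \<noteq> 0" if a: "a \<in> carrier A" "a \<noteq> \<zero>\<^bsub>A\<^esub>" for a
      proof -
        obtain \<phi> m n where "star_hom A B_l2 \<phi>" "\<phi> a (unit m) n \<noteq> 0"
          using residual_coefficient [OF A a] .
        then show ?thesis by (intro bexI [of _ "\<lambda>x. \<phi> x (unit m) n"]) (auto simp: \<Phi>_def)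
      qed
      show "\<exists>\<phi>\<in>\<Psi>. \<phi> a \<noteq> 0" if a: "a \<in> carrier B" "a \<noteq> \<zero>\<^bsub>B\<^esub>" for a
      proof -
        obtain \<phi> m n where "star_hom B B_l2 \<phi>" "\<phi> a (unit m) n \<noteq> 0"
          using residual_coefficient [OF B a] .
        then show ?thesis by (intro bexI [of _ "\<lambda>x. \<phi> x (unit m) n"]) (auto simp: \<Psi>_def)
      qed
      show "linear_map A complex_alg \<phi>" if "\<phi> \<in> \<Phi>" for \<phi>
        using that lin unfolding \<Phi>_def by blast
      show "linear_map B complex_alg \<psi>" if "\<psi> \<in> \<Psi>" for \<psi>
        using that lin unfolding \<Psi>_def by blast
    qed blast
    with t(2) show False by blast
  qed
  then obtain \<phi> i m \<psi> j n where \<phi>: "star_hom A B_l2 \<phi>" and \<psi>: "star_hom B B_l2 \<psi>"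
    and nz: "t (\<lambda>a b. \<phi> a (unit i) m * \<psi> b (unit j) n) \<noteq> 0"
    unfolding \<Phi>_def \<Psi>_def by blast
  define F where "F a = amplify_left (\<phi> a)" for a
  define G where "G b = amplify_right (\<psi> b)" for b
  have F: "star_hom A B_l2 F" and G: "star_hom B B_l2 G"
    unfolding F_def G_def
    by (rule star_hom_compose [OF \<phi> amplify_star_hom [OF bij_prod_encode_swap]],
        rule star_hom_compose [OF \<psi> amplify_star_hom [OF bij_prod_encode]])
  have bd: "a \<in> carrier A \<Longrightarrow> \<phi> a \<in> bounded_l2_ops" "b \<in> carrier B \<Longrightarrow> \<psi> b \<in> bounded_l2_ops" for a b
    using alg_homD(1) [OF star_hom_alg [OF \<phi>]] alg_homD(1) [OF star_hom_alg [OF \<psi>]] by simp_all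
  have comm: "F a \<otimes>\<^bsub>B_l2\<^esub> G b = G b \<otimes>\<^bsub>B_l2\<^esub> F a" if "a \<in> carrier A" "b \<in> carrier B" for a b
    unfolding F_def G_def by (intro amplify_commute bd that)
  define L where "L = tensor_lift B_l2 (\<lambda>a b. F a \<otimes>\<^bsub>B_l2\<^esub> G b)"
  have L: "star_hom T B_l2 L"
    unfolding L_def by (rule tensor_lift_star_hom [OF star_algebra_B_l2 separated_B_l2 F G comm])
  note Lp = tensor_lift_pure [OF star_algebra_B_l2 separated_B_l2
      bilinear_mult [OF star_algebra_B_l2 alg_hom_linear [OF star_hom_alg [OF F]] alg_hom_linear [OF star_hom_alg [OF G]]], folded L_def]
  have bil: "bilinear_form A B (\<lambda>a b. \<phi> a (unit i) m * \<psi> b (unit j) n)"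
    using linear_mapD [OF lin [OF \<phi>]] linear_mapD [OF lin [OF \<psi>]]
    by (intro bilinear_formI) (simp_all add: algebra_simps)
  have "L s (unit (prod_encode (i, j))) (prod_encode (m, n)) = s (\<lambda>a b. \<phi> a (unit i) m * \<psi> b (unit j) n)"
    if "s \<in> carrier T" for s
    using that
  proof (induction rule: tensor_induct)
    case (pure a b)
    then show ?case
      unfolding Lp [OF pure] pure_apply [OF bil] using amplify_coefficients(1) [OF bd(1) [OF pure(1)] bd(2) [OF pure(2)]]
      by (simp add: F_def G_def)
  next
    case (add s s')
    then show ?case
      unfolding alg_homD(3) [OF star_hom_alg [OF L] add(1,2)] by (simp add: tensor_alg_simps)
  qed
  with nz t(1) have "L t (unit (prod_encode (i, j))) (prod_encode (m, n)) \<noteq> 0" by simp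
  then have "L t \<noteq> \<zero>\<^bsub>B_l2\<^esub>" by auto
  with L show "\<exists>\<phi>. star_hom T B_l2 \<phi> \<and> \<phi> t \<noteq> \<zero>\<^bsub>B_l2\<^esub>" by blast
qed

section \<open>The universal property of \<open>\<O>(SU\<^sub>q(3))\<close>\<close>

text \<open>Dedekind's argument. Evaluating the relation at \<open>f x y\<close> and subtracting
  \<open>\<chi> k y\<close> times the relation at x eliminates the character k; a y that
  distinguishes i from k then forces the coefficient of i to vanish.\<close>

lemma characters_independent:
  fixes \<chi> :: "'i \<Rightarrow> 'm \<Rightarrow> complex"
  assumes "finite I"
    and closed: "\<And>x y. x \<in> M \<Longrightarrow> y \<in> M \<Longrightarrow> f x y \<in> M"
    and mult: "\<And>i x y. i \<in> I \<Longrightarrow> x \<in> M \<Longrightarrow> y \<in> M \<Longrightarrow> \<chi> i (f x y) = \<chi> i x * \<chi> i y"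
    and nz: "\<And>i. i \<in> I \<Longrightarrow> \<exists>x\<in>M. \<chi> i x \<noteq> 0"
    and inj: "\<And>i j. i \<in> I \<Longrightarrow> j \<in> I \<Longrightarrow> i \<noteq> j \<Longrightarrow> \<exists>x\<in>M. \<chi> i x \<noteq> \<chi> j x"
    and zero: "\<And>x. x \<in> M \<Longrightarrow> (\<Sum>i\<in>I. c i * \<chi> i x) = 0"
  shows "\<forall>i\<in>I. c i = 0"
  using assms(1) mult nz inj zero
proof (induction I arbitrary: c)
  case (insert k I)
  have "c i = 0" if i: "i \<in> I" for i
  proof -
    obtain y where y: "y \<in> M" "\<chi> i y \<noteq> \<chi> k y"
      using insert.prems(3) [of i k] insert.hyps i by auto
    have "\<forall>i\<in>I. c i * (\<chi> i y - \<chi> k y) = 0"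
    proof (rule insert.IH)
      fix x assume x: "x \<in> M"
      have "(\<Sum>i\<in>insert k I. c i * \<chi> i (f x y)) = 0" "(\<Sum>i\<in>insert k I. c i * \<chi> i x) = 0"
        using insert.prems(4) closed x y(1) by blast+
      then have "c k * (\<chi> k x * \<chi> k y) + (\<Sum>i\<in>I. c i * (\<chi> i x * \<chi> i y)) = 0"
        "c k * \<chi> k x + (\<Sum>i\<in>I. c i * \<chi> i x) = 0"
        using insert.hyps insert.prems(1) x y(1) by simp_all
      moreover have "(\<Sum>i\<in>I. c i * (\<chi> i y - \<chi> k y) * \<chi> i x) =
          (\<Sum>i\<in>I. c i * (\<chi> i x * \<chi> i y)) - (\<Sum>i\<in>I. c i * \<chi> i x) * \<chi> k y"
        by (simp only: sum_distrib_right sum_subtractf [symmetric]) (simp add: algebra_simps)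
      ultimately show "(\<Sum>i\<in>I. c i * (\<chi> i y - \<chi> k y) * \<chi> i x) = 0"
        unfolding add_eq_0_iff by simp
    qed (use insert.prems in blast)+
    with i y(2) show "c i = 0" by auto
  qed
  moreover have "c k = 0"
  proof -
    obtain x where "x \<in> M" "\<chi> k x \<noteq> 0" using insert.prems(2) by auto
    then show ?thesis using insert.prems(4) [of x] insert.hyps calculation by simp
  qed
  ultimately show ?case by blast
qed simp

lemma unimodular_power_neq_1:
  assumes "(n::int) \<noteq> 0"
  obtains x where "cmod x = 1" "x powi n \<noteq> 1"
proof
  \<comment> \<open>Its power with exponent |n| is -1, which is also its own inverse, so the sign of
    n is harmless.\<close>
  let ?x = "cis (pi / n)"
  show "cmod ?x = 1" by simp
  have "?x ^ nat \<bar>n\<bar> = cis (pi * sgn n)"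
    using assms by (simp add: DeMoivre abs_sgn [of n] mult_sgn_abs) (auto simp: sgn_if)
  then have "?x ^ nat \<bar>n\<bar> = - 1" using assms by (auto simp: sgn_if complex_eq_iff)
  moreover have "?x powi n = ?x ^ nat \<bar>n\<bar> \<or> ?x powi n = inverse (?x ^ nat \<bar>n\<bar>)"
    by (cases "n \<ge> 0") (simp_all only: power_int_def power_inverse, simp_all)
  ultimately show "?x powi n \<noteq> 1" by auto
qed

lemma torus_chars_distinct:
  assumes "d \<noteq> d'"
  shows "\<exists>x y. cmod x = 1 \<and> cmod y = 1 \<and> torus_char x y d \<noteq> torus_char x y d'"
proof -
  have neq: "x powi m \<noteq> x powi m'" if "cmod x = 1" "x powi (m - m') \<noteq> 1" for x :: complex and m m'
  proof -
    have "x \<noteq> 0" using that(1) by auto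
    then have "x powi (m - m') = x powi m / x powi m'" by (simp add: power_int_diff)
    with that(2) \<open>x \<noteq> 0\<close> show ?thesis by auto
  qed
  consider "fst d \<noteq> fst d'" | "snd d \<noteq> snd d'" using assms by (auto simp: prod_eq_iff)
  then show ?thesis
  proof cases
    case 1
    then obtain x where "cmod x = 1" "x powi (fst d - fst d') \<noteq> 1"
      using unimodular_power_neq_1 [of "fst d - fst d'"] by auto
    then show ?thesis by (intro exI [of _ x] exI [of _ 1]) (simp add: torus_char_def neq)
  next
    case 2
    then obtain x where "cmod x = 1" "x powi (snd d - snd d') \<noteq> 1"
      using unimodular_power_neq_1 [of "snd d - snd d'"] by auto
    then show ?thesis by (intro exI [of _ 1] exI [of _ x]) (simp add: torus_char_def neq)
  qed
qed

lemma star_hom_scalars: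
  assumes "star_algebra B"
  shows "star_hom complex_alg B (\<lambda>c. c \<odot>\<^bsub>B\<^esub> \<one>\<^bsub>B\<^esub>)"
proof -
  interpret star_algebra B by fact
  show ?thesis by (auto simp: star_hom_def add_scal scal_mult star_smult mult.commute intro!: alg_homI)
qed

text \<open>Unimodular points give star characters, which act on l2 as scalars. These points form a
  semigroup on which different monomials are different characters, so a polynomial vanishing at all
  of them is zero.\<close>

lemma residual_torus: "residual torus_alg"
  unfolding residual_def
proof (intro ballI impI)
  fix p assume p: "p \<noteq> \<zero>\<^bsub>torus_alg\<^esub>"
  let ?T = "{z. cmod (fst z) = 1 \<and> cmod (snd z) = 1}"
  have "\<exists>z\<in>?T. lin_comb complex_alg (torus_char (fst z) (snd z)) p \<noteq> 0"
  proof (rule ccontr)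
    assume none: "\<not> ?thesis"
    have "\<forall>d\<in>Poly_Mapping.keys p. Poly_Mapping.lookup p d = 0"
    proof (rule characters_independent [where M = ?T and f = "\<lambda>z w. (fst z * fst w, snd z * snd w)"
        and \<chi> = "\<lambda>d z. torus_char (fst z) (snd z) d"])
      fix d d' :: "int \<times> int" assume "d \<noteq> d'"
      then show "\<exists>z\<in>?T. torus_char (fst z) (snd z) d \<noteq> torus_char (fst z) (snd z) d'"
      proof -
        obtain x y where "cmod x = 1" "cmod y = 1" "torus_char x y d \<noteq> torus_char x y d'"
          using torus_chars_distinct [OF \<open>d \<noteq> d'\<close>] by blast
        then show ?thesis by (intro bexI [of _ "(x, y)"]) simp_all
      qed
    next
      fix z assume "z \<in> ?T"
      then have "lin_comb complex_alg (torus_char (fst z) (snd z)) p = 0" using none by blast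
      then show "(\<Sum>d\<in>Poly_Mapping.keys p. Poly_Mapping.lookup p d * torus_char (fst z) (snd z) d) = 0"
        by (simp add: lin_comb_def finsum_complex)
    next
      fix d show "\<exists>z\<in>?T. torus_char (fst z) (snd z) d \<noteq> 0"
        by (intro bexI [of _ "(1, 1)"]) (simp_all add: torus_char_def)
    qed (auto simp: norm_mult torus_char_def power_int_mult_distrib)
    then have "p = 0" by (intro poly_mapping_eqI) (auto simp: in_keys_iff)
    with p show False by simp
  qed
  then obtain x y where xy: "cmod x = 1" "cmod y = 1" "lin_comb complex_alg (torus_char x y) p \<noteq> 0"
    by auto
  interpret star_algebra B_l2 by (rule star_algebra_B_l2)
  have "star_hom torus_alg B_l2 (\<lambda>p. lin_comb complex_alg (torus_char x y) p \<odot>\<^bsub>B_l2\<^esub> \<one>\<^bsub>B_l2\<^esub>)"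
    by (rule star_hom_compose [OF torus_char_star_hom [OF xy(1,2)] star_hom_scalars [OF star_algebra_B_l2]])
  moreover have "lin_comb complex_alg (torus_char x y) p \<odot>\<^bsub>B_l2\<^esub> \<one>\<^bsub>B_l2\<^esub> \<noteq> \<zero>\<^bsub>B_l2\<^esub>"
  proof
    assume "lin_comb complex_alg (torus_char x y) p \<odot>\<^bsub>B_l2\<^esub> \<one>\<^bsub>B_l2\<^esub> = \<zero>\<^bsub>B_l2\<^esub>"
    then have "(lin_comb complex_alg (torus_char x y) p \<odot>\<^bsub>B_l2\<^esub> \<one>\<^bsub>B_l2\<^esub>) (unit 0) 0 = \<zero>\<^bsub>B_l2\<^esub> (unit 0) 0"
      by simp
    moreover have "unit 0 0 = 1" by (simp add: unit_def)
    ultimately show False using xy(3) by simp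
  qed
  ultimately show "\<exists>\<phi>. star_hom torus_alg B_l2 \<phi> \<and> \<phi> p \<noteq> \<zero>\<^bsub>B_l2\<^esub>" by blast
qed

section \<open>The concrete algebra generated by the fundamental matrix\<close>

lemma generated_alg_carrier_update [simp]: "generated_alg (A\<lparr>carrier := c\<rparr>) X = generated_alg A X"
proof (intro Set.set_eqI iffI)
  fix x assume "x \<in> generated_alg (A\<lparr>carrier := c\<rparr>) X"
  then show "x \<in> generated_alg A X"
    by induction (use generated_alg.intros [where A = A and X = X] in simp_all)
next
  fix x assume "x \<in> generated_alg A X"
  then show "x \<in> generated_alg (A\<lparr>carrier := c\<rparr>) X"
    by induction (use generated_alg.intros [where A = "A\<lparr>carrier := c\<rparr>" and X = X] in simp_all)
qed

lemma generated_alg_mono: "x \<in> generated_alg A X \<Longrightarrow> X \<subseteq> Y \<Longrightarrow> x \<in> generated_alg A Y"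
  by (induction rule: generated_alg.induct) (auto intro: generated_alg.intros)

text \<open>The generated subalgebra depends on the operations of its ambient algebra rather than on
  its carrier. The carrier may therefore be enlarged to all families of bounded operators, where
  every axiom holds pointwise.\<close>

definition full_product :: "'r set \<Rightarrow> ('r \<Rightarrow> l2_op) star_alg" where
  "full_product R = (B_l2_product R)\<lparr>carrier := R \<rightarrow>\<^sub>E bounded_l2_ops\<rparr>"

lemma full_product_simps [simp]:
  "carrier (full_product R) = R \<rightarrow>\<^sub>E bounded_l2_ops"
  "x \<otimes>\<^bsub>full_product R\<^esub> y = (\<lambda>r\<in>R. x r \<otimes>\<^bsub>B_l2\<^esub> y r)"
  "x \<oplus>\<^bsub>full_product R\<^esub> y = (\<lambda>r\<in>R. x r \<oplus>\<^bsub>B_l2\<^esub> y r)"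
  "c \<odot>\<^bsub>full_product R\<^esub> x = (\<lambda>r\<in>R. c \<odot>\<^bsub>B_l2\<^esub> x r)"
  "\<one>\<^bsub>full_product R\<^esub> = (\<lambda>r\<in>R. \<one>\<^bsub>B_l2\<^esub>)" "\<zero>\<^bsub>full_product R\<^esub> = (\<lambda>r\<in>R. \<zero>\<^bsub>B_l2\<^esub>)"
  "star (full_product R) x = (\<lambda>r\<in>R. star B_l2 (x r))"
  by (simp_all add: full_product_def B_l2_product_def)

lemma star_algebra_full_product: "star_algebra (full_product R)"
proof -
  interpret B: star_algebra B_l2 by (rule star_algebra_B_l2)
  have car: "bounded_l2_ops = carrier B_l2" by simp
  have c: "r \<in> R \<Longrightarrow> x \<in> R \<rightarrow>\<^sub>E carrier B_l2 \<Longrightarrow> x r \<in> carrier B_l2" for x r by auto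
  have re: "(\<lambda>r\<in>R. x r) = x" if "x \<in> R \<rightarrow>\<^sub>E carrier B_l2" for x
    using that by (simp add: PiE_def extensional_restrict)
  show ?thesis
    by (rule star_algebraI)
      (simp_all add: car c re Pi_iff B.a_ac B.m_assoc B.l_distr B.r_distr B.scal_add B.add_scal B.scal_mult
         B.star_add B.star_smult B.star_mult B.uminus_scal [symmetric] B.l_neg B.r_neg
         del: B_l2_simps cong: restrict_cong)
qed

lemma evaluation_star_hom: "r \<in> R \<Longrightarrow> star_hom (full_product R) B_l2 (\<lambda>x. x r)"
  unfolding star_hom_def by (intro conjI alg_homI ballI) (auto simp del: B_l2_simps(2-) simp: PiE_iff)

definition SUq3_alg :: "real \<Rightarrow> SUq3_elem star_alg" where
  "SUq3_alg q = (full_product (SUq3_reps q))\<lparr>carrier :=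
     generated_alg (full_product (SUq3_reps q)) (entries (u_SUq3 q))\<rparr>"

lemma O_SUq3_eq: "O_SUq3 q = matrix_hopf (SUq3_alg q) (u_SUq3 q)"
  by (simp add: O_SUq3_def SUq3_alg_def C_SUq3_def universal_cstar_def full_product_def entries_def)

lemma u_SUq3_apply: "r \<in> SUq3_reps q \<Longrightarrow> u_SUq3 q i j r = r (i, j)"
  by (simp add: u_SUq3_def universal_gen_def)

lemma SUq3_reps_rel: "r \<in> SUq3_reps q \<Longrightarrow> SUq3_relations q B_l2 (\<lambda>i j. r (i, j))"
  by (simp add: SUq3_reps_def curry_def)

lemma u_SUq3_full: "i \<in> {1..3} \<Longrightarrow> j \<in> {1..3} \<Longrightarrow> u_SUq3 q i j \<in> carrier (full_product (SUq3_reps q))"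
  using SUq3_reps_rel by (auto simp: u_SUq3_def universal_gen_def SUq3_relations_def)

lemma SUq3_matrix_full:
  assumes "0 < q"
  shows "SUq3_matrix (full_product (SUq3_reps q)) q (u_SUq3 q)"
proof (intro SUq3_matrix.intro SUq3_matrix_axioms.intro star_algebra_full_product assms)
  let ?R = "SUq3_reps q"
  show "SUq3_relations q (full_product ?R) (u_SUq3 q)"
  proof (rule SUq3_relations_jointly [OF star_algebra_full_product star_algebra_B_l2 u_SUq3_full,
      where F = "(\<lambda>r x. x r) ` ?R"])
    fix x y assume "x \<in> carrier (full_product ?R)" "y \<in> carrier (full_product ?R)"
      "\<And>f. f \<in> (\<lambda>r x. x r) ` ?R \<Longrightarrow> f x = f y"
    then show "x = y" by (intro extensionalityI [of x ?R y]) (auto simp: PiE_def)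
  next
    fix f assume "f \<in> (\<lambda>r (x :: SUq3_elem). x r) ` ?R"
    then obtain r where r: "r \<in> ?R" "f = (\<lambda>x. x r)" by auto
    then show "star_hom (full_product ?R) B_l2 f" by (simp add: evaluation_star_hom)
    show "SUq3_relations q B_l2 (\<lambda>i j. f (u_SUq3 q i j))"
      using SUq3_reps_rel [OF r(1)] by (simp add: r(2) u_SUq3_apply [OF r(1)])
  qed
qed

lemma star_algebra_SUq3:
  assumes "0 < q"
  shows "star_algebra (SUq3_alg q)"
proof -
  interpret SUq3_matrix "full_product (SUq3_reps q)" q "u_SUq3 q" by (rule SUq3_matrix_full [OF assms])
  show ?thesis
    unfolding SUq3_alg_def
    by (rule star_algebra_generated) (use star_entry_generated in \<open>auto simp only: entries_def entry\<close>)
qed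

lemma SUq3_evaluation:
  assumes "0 < q" "r \<in> SUq3_reps q"
  shows "star_hom (SUq3_alg q) B_l2 (\<lambda>x. x r)"
proof -
  interpret SUq3_matrix "full_product (SUq3_reps q)" q "u_SUq3 q" by (rule SUq3_matrix_full [OF assms(1)])
  have sub: "carrier (SUq3_alg q) \<subseteq> carrier (full_product (SUq3_reps q))"
    using generated_subset [of "entries (u_SUq3 q)"] entry by (auto simp only: SUq3_alg_def entries_def) auto
  show ?thesis
    using evaluation_star_hom [OF assms(2)] sub
    by (auto simp: star_hom_def alg_hom_def ring_hom_def linear_map_def SUq3_alg_def Pi_iff subset_iff)
qed

lemma residual_SUq3:
  assumes "0 < q"
  shows "residual (SUq3_alg q)"
  unfolding residual_def
proof (intro ballI impI)
  interpret SUq3_matrix "full_product (SUq3_reps q)" q "u_SUq3 q" by (rule SUq3_matrix_full [OF assms])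
  fix x assume x: "x \<in> carrier (SUq3_alg q)" "x \<noteq> \<zero>\<^bsub>SUq3_alg q\<^esub>"
  then have "x \<in> carrier (full_product (SUq3_reps q))"
    using generated_subset [of "entries (u_SUq3 q)" x] entry by (auto simp only: SUq3_alg_def entries_def) auto
  moreover have "x \<noteq> (\<lambda>r\<in>SUq3_reps q. \<zero>\<^bsub>B_l2\<^esub>)" using x(2) by (simp add: SUq3_alg_def)
  ultimately obtain r where "r \<in> SUq3_reps q" "x r \<noteq> \<zero>\<^bsub>B_l2\<^esub>"
    by (metis (no_types, lifting) PiE_restrict full_product_simps(1) restrict_ext)
  then show "\<exists>\<phi>. star_hom (SUq3_alg q) B_l2 \<phi> \<and> \<phi> x \<noteq> \<zero>\<^bsub>B_l2\<^esub>"
    using SUq3_evaluation [OF assms] by blast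
qed

lemma matrix_generated_SUq3:
  assumes "0 < q"
  shows "matrix_generated (SUq3_alg q) q (u_SUq3 q)"
proof -
  interpret F: SUq3_matrix "full_product (SUq3_reps q)" q "u_SUq3 q" by (rule SUq3_matrix_full [OF assms])
  interpret star_algebra "SUq3_alg q" by (rule star_algebra_SUq3 [OF assms])
  have c: "u_SUq3 q i j \<in> carrier (SUq3_alg q)" if "i \<in> {1..3}" "j \<in> {1..3}" for i j
    using that by (auto simp: SUq3_alg_def entries_def intro!: generated_alg.incl)
  show ?thesis
  proof unfold_locales
    show "SUq3_relations q (SUq3_alg q) (u_SUq3 q)"
    proof (rule SUq3_relations_jointly [OF star_algebra_axioms star_algebra_B_l2 c,
        where F = "(\<lambda>r x. x r) ` SUq3_reps q"])
      fix x y assume x: "x \<in> carrier (SUq3_alg q)" and y: "y \<in> carrier (SUq3_alg q)"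
        and eq: "\<And>f. f \<in> (\<lambda>r x. x r) ` SUq3_reps q \<Longrightarrow> f x = f y"
      show "x = y"
      proof (rule extensionalityI [of x "SUq3_reps q" y])
        have "carrier (SUq3_alg q) \<subseteq> carrier (full_product (SUq3_reps q))"
          using F.generated_subset [of "entries (u_SUq3 q)"] F.entry by (auto simp only: SUq3_alg_def entries_def) auto
        with x y show "x \<in> extensional (SUq3_reps q)" "y \<in> extensional (SUq3_reps q)"
          by (auto simp: PiE_def)
      qed (use eq in blast)
    next
      fix f assume "f \<in> (\<lambda>r (x :: SUq3_elem). x r) ` SUq3_reps q"
      then obtain r where r: "r \<in> SUq3_reps q" "f = (\<lambda>x. x r)" by auto
      then show "star_hom (SUq3_alg q) B_l2 f" by (simp add: SUq3_evaluation [OF assms])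
      show "SUq3_relations q B_l2 (\<lambda>i j. f (u_SUq3 q i j))"
        using SUq3_reps_rel [OF r(1)] by (simp add: r(2) u_SUq3_apply [OF r(1)])
    qed
    show "carrier (SUq3_alg q) = generated_alg (SUq3_alg q) (entries (u_SUq3 q))"
      by (simp add: SUq3_alg_def)
    show "separated (SUq3_alg q)" by (rule residual_separated [OF residual_SUq3 [OF assms]])
  qed (rule assms)
qed

text \<open>Polynomial relations among the \<open>u\<^sub>i\<^sub>j\<close> are those valid in every representation, so a matrix
  over a residual algebra satisfies all of them as soon as it satisfies the defining ones.\<close>

lemma SUq3_universal:
  fixes B :: "('b, 'm) star_alg_scheme"
  assumes q: "0 < q" and B: "star_algebra B" "residual B" and b: "SUq3_relations q B b"
  shows "\<exists>f. star_hom (SUq3_alg q) B f \<and> (\<forall>i\<in>{1..3}. \<forall>j\<in>{1..3}. f (u_SUq3 q i j) = b i j)"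
proof -
  interpret B: star_algebra B by fact
  interpret O: matrix_generated "SUq3_alg q" q "u_SUq3 q" by (rule matrix_generated_SUq3 [OF q])
  let ?O = "SUq3_alg q"
  let ?I = "{1..3} \<times> {1..3} :: (nat \<times> nat) set"
  \<comment> \<open>Terms have all pairs of naturals as generators. Outside the index range both
    assignments take the value zero, which every homomorphism preserves, so they still
    correspond.\<close>
  define g where "g z = (if z \<in> ?I then u_SUq3 q (fst z) (snd z) else \<zero>\<^bsub>?O\<^esub>)" for z
  define h where "h z = (if z \<in> ?I then b (fst z) (snd z) else \<zero>\<^bsub>B\<^esub>)" for z
  have bc: "b i j \<in> carrier B" if "i \<in> {1..3}" "j \<in> {1..3}" for i j
    using b that by (auto simp: SUq3_relations_def)
  have g: "range g \<subseteq> carrier ?O" using O.entry by (auto simp: g_def simp del: atLeastAtMost_iff)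
  have h: "range h \<subseteq> carrier B" using bc by (auto simp: h_def simp del: atLeastAtMost_iff)
  have surj: "\<exists>t. x = term_eval ?O g t" if "x \<in> carrier ?O" for x
  proof (rule generated_term_eval)
    have "entries (u_SUq3 q) \<subseteq> range g"
    proof
      fix y assume "y \<in> entries (u_SUq3 q)"
      then obtain i j where "i \<in> {1..3}" "j \<in> {1..3}" "y = u_SUq3 q i j" by (auto simp: entries_def)
      then have "y = g (i, j)" by (simp add: g_def)
      then show "y \<in> range g" by blast
    qed
    moreover have "x \<in> generated_alg ?O (entries (u_SUq3 q))"
      using that by (subst O.gen [symmetric])
    ultimately show "x \<in> generated_alg ?O (range g)" by (rule generated_alg_mono [rotated])
  qed
  have eq: "term_eval B h s = term_eval B h t" if st: "term_eval ?O g s = term_eval ?O g t" for s t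
  proof (rule ccontr)
    assume ne: "term_eval B h s \<noteq> term_eval B h t"
    let ?d = "term_eval B h s \<oplus>\<^bsub>B\<^esub> (- 1) \<odot>\<^bsub>B\<^esub> term_eval B h t"
    note tc = B.term_eval_closed [OF h]
    have "?d \<noteq> \<zero>\<^bsub>B\<^esub>"
    proof
      assume "?d = \<zero>\<^bsub>B\<^esub>"
      then have "term_eval B h s = 1 \<odot>\<^bsub>B\<^esub> term_eval B h t" by (intro B.eq_of_add_zero tc)
      with ne tc show False by simp
    qed
    then obtain \<phi> where \<phi>: "star_hom B B_l2 \<phi>" "\<phi> ?d \<noteq> \<zero>\<^bsub>B_l2\<^esub>"
      using B(2) tc unfolding residual_def by (metis B.a_closed B.scal_closed)
    \<comment> \<open>Composing the solution \<open>b\<close> with \<phi> gives one of the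
      representations over which the product is taken. Evaluation at it sends the u to these
      operators, so terms equal in the u have equal images under \<phi>.\<close>
    define r where "r = (\<lambda>z\<in>?I. \<phi> (b (fst z) (snd z)))"
    have "SUq3_relations q B_l2 (\<lambda>i j. r (i, j)) \<longleftrightarrow> SUq3_relations q B_l2 (\<lambda>i j. \<phi> (b i j))"
      by (rule SUq3_relations_cong) (simp add: r_def)
    then have r: "r \<in> SUq3_reps q"
      using SUq3_relations_hom [OF B(1) star_algebra_B_l2 \<phi>(1) b] by (simp add: SUq3_reps_def r_def curry_def)
    note ev = SUq3_evaluation [OF q r]
    have gh: "g z r = \<phi> (h z)" for z
    proof (cases "z \<in> ?I")
      case True
      then show ?thesis by (simp add: g_def h_def u_SUq3_apply [OF r]) (simp add: r_def)
    next
      case False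
      have "\<zero>\<^bsub>?O\<^esub> r = \<zero>\<^bsub>B_l2\<^esub>"
        by (rule linear_map_zero [OF alg_hom_linear [OF star_hom_alg [OF ev]] O.star_algebra_axioms star_algebra_B_l2])
      moreover have "\<phi> \<zero>\<^bsub>B\<^esub> = \<zero>\<^bsub>B_l2\<^esub>"
        by (rule linear_map_zero [OF alg_hom_linear [OF star_hom_alg [OF \<phi>(1)]] B(1) star_algebra_B_l2])
      ultimately show ?thesis using False by (simp only: g_def h_def if_False)
    qed
    have "\<phi> (term_eval B h t') = term_eval ?O g t' r" for t'
      using star_hom_term_eval [OF B(1) \<phi>(1) h, of t'] star_hom_term_eval [OF O.star_algebra_axioms ev g, of t']
      by (simp add: gh)
    then have e: "\<phi> (term_eval B h s) = \<phi> (term_eval B h t)" using st by simp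
    interpret L: star_algebra B_l2 by (rule star_algebra_B_l2)
    note h\<phi> = alg_homD [OF star_hom_alg [OF \<phi>(1)]]
    have "\<phi> ?d = \<phi> (term_eval B h t) \<oplus>\<^bsub>B_l2\<^esub> (- 1) \<odot>\<^bsub>B_l2\<^esub> \<phi> (term_eval B h t)"
      using tc e by (simp only: h\<phi> B.scal_closed)
    also have "\<dots> = \<zero>\<^bsub>B_l2\<^esub>" by (rule L.minus_scal_cancel) (rule h\<phi>(1) [OF tc])
    finally show False using \<phi>(2) by blast
  qed
  obtain f where f: "star_hom ?O B f" "\<And>z. f (g z) = h z"
    using star_hom_from_terms [OF O.star_algebra_axioms B(1) g h surj eq] by blast
  have "f (u_SUq3 q i j) = b i j" if "i \<in> {1..3}" "j \<in> {1..3}" for i j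
    using f(2) [of "(i, j)"] that by (simp add: g_def h_def)
  with f(1) show ?thesis by blast
qed

section \<open>Generators and relations of \<open>\<O>(U\<^sub>q(2))\<close>\<close>

context
  fixes R :: "('g star_term \<times> 'g star_term) set"
begin

lemma pres_class_eq_iff: "pres_class R x = pres_class R y \<longleftrightarrow> pres_eq R x y"
proof
  assume "pres_class R x = pres_class R y"
  then have "y \<in> pres_class R x" by (simp add: pres_class_def pres_eq.refl)
  then show "pres_eq R x y" by (simp add: pres_class_def)
next
  assume "pres_eq R x y"
  then show "pres_class R x = pres_class R y"
    unfolding pres_class_def by (blast intro: pres_eq.sym pres_eq.trans)
qed

lemma presented_simps:
  "carrier (presented_star_alg R) = range (pres_class R)"
  "pres_class R x \<otimes>\<^bsub>presented_star_alg R\<^esub> pres_class R y = pres_class R (Mult x y)"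
  "pres_class R x \<oplus>\<^bsub>presented_star_alg R\<^esub> pres_class R y = pres_class R (Add x y)"
  "c \<odot>\<^bsub>presented_star_alg R\<^esub> pres_class R x = pres_class R (Smult c x)"
  "star (presented_star_alg R) (pres_class R x) = pres_class R (Star x)"
  "\<one>\<^bsub>presented_star_alg R\<^esub> = pres_class R One" "\<zero>\<^bsub>presented_star_alg R\<^esub> = pres_class R (Smult 0 One)"
  unfolding presented_star_alg_def pres_class_def
  by (auto intro: pres_eq.cong_mult pres_eq.cong_add pres_eq.cong_smult pres_eq.cong_star pres_eq.refl
      dest: pres_eq.trans [rotated] intro: pres_eq.trans)

text \<open>On representatives each axiom is a rule of \<open>pres_eq\<close>, up to the direction
  of \<open>smult_smult\<close>.\<close>

lemma star_algebra_presented: "star_algebra (presented_star_alg R)"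
proof (rule star_algebraI, unfold presented_simps(1))
  fix X Y Z c d
  assume "X \<in> range (pres_class R)" "Y \<in> range (pres_class R)" "Z \<in> range (pres_class R)"
  then obtain x y z where [simp]: "X = pres_class R x" "Y = pres_class R y" "Z = pres_class R z" by blast
  show "X \<oplus>\<^bsub>presented_star_alg R\<^esub> Y \<in> range (pres_class R)" "X \<otimes>\<^bsub>presented_star_alg R\<^esub> Y \<in> range (pres_class R)"
    "c \<odot>\<^bsub>presented_star_alg R\<^esub> X \<in> range (pres_class R)" "star (presented_star_alg R) X \<in> range (pres_class R)"
    by (simp_all add: presented_simps(2-) rangeI)
qed ((elim rangeE)?, (hypsubst)?, simp only: presented_simps(2-) pres_class_eq_iff rangeI,
   (fast intro: pres_eq.add_assoc pres_eq.add_comm pres_eq.add_zero pres_eq.add_inv pres_eq.mult_assoc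
     pres_eq.mult_one_left pres_eq.mult_one_right pres_eq.distrib_left pres_eq.distrib_right pres_eq.smult_add
     pres_eq.add_smult pres_eq.smult_smult pres_eq.smult_one pres_eq.smult_mult_left pres_eq.smult_mult_right
     pres_eq.star_star pres_eq.star_add pres_eq.star_smult pres_eq.star_mult pres_eq.smult_smult [THEN pres_eq.sym])?)+

lemma term_eval_presented: "term_eval (presented_star_alg R) (\<lambda>g. pres_class R (Gen g)) t = pres_class R t"
  by (induction t) (simp_all add: presented_simps)

lemma presented_sound:
  assumes "star_algebra B" "range h \<subseteq> carrier B"
    and rel: "\<And>x y. (x, y) \<in> R \<Longrightarrow> term_eval B h x = term_eval B h y" and "pres_eq R x y"
  shows "term_eval B h x = term_eval B h y"
proof -
  interpret B: star_algebra B by fact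
  note [simp] = B.term_eval_closed [OF assms(2)]
  show ?thesis using assms(4)
    by induction (simp_all add: rel B.a_assoc B.m_assoc B.l_distr B.r_distr B.scal_add B.add_scal B.scal_mult
      B.star_add B.star_smult B.star_mult B.uminus_scal [symmetric] B.l_neg B.r_neg B.a_lcomm B.a_comm)
qed

lemma presented_universal:
  assumes "star_algebra B" "range h \<subseteq> carrier B"
    and rel: "\<And>x y. (x, y) \<in> R \<Longrightarrow> term_eval B h x = term_eval B h y"
  shows "\<exists>f. star_hom (presented_star_alg R) B f \<and> (\<forall>g. f (pres_class R (Gen g)) = h g)"
proof (rule star_hom_from_terms [OF star_algebra_presented assms(1) _ assms(2)])
  show "range (\<lambda>g. pres_class R (Gen g)) \<subseteq> carrier (presented_star_alg R)"
    by (auto simp: presented_simps)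
  show "\<exists>t. x = term_eval (presented_star_alg R) (\<lambda>g. pres_class R (Gen g)) t"
    if "x \<in> carrier (presented_star_alg R)" for x
    using that by (auto simp: presented_simps term_eval_presented)
  show "term_eval B h s = term_eval B h t"
    if "term_eval (presented_star_alg R) (\<lambda>g. pres_class R (Gen g)) s =
        term_eval (presented_star_alg R) (\<lambda>g. pres_class R (Gen g)) t" for s t
    using that presented_sound [OF assms(1,2) rel, of s t] unfolding term_eval_presented pres_class_eq_iff by blast
qed

end

lemma star_algebra_Uq2: "star_algebra (Uq2_alg q)"
  by (simp add: Uq2_alg_def star_algebra_presented)

lemma Uq2_triple_gen: "Uq2_triple q (Uq2_alg q) (gen_Uq2 q Gen_u) (gen_Uq2 q Gen_alpha) (gen_Uq2 q Gen_gamma)"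
  unfolding Uq2_triple_def gen_Uq2_def Uq2_alg_def presented_simps pres_class_eq_iff
  by (intro conjI rangeI; rule pres_eq.rel, simp add: Uq2_relations_def)

lemma v_Uq2_eq:
  "v_Uq2 q = v_matrix q (Uq2_alg q) (gen_Uq2 q Gen_u) (gen_Uq2 q Gen_alpha) (gen_Uq2 q Gen_gamma)"
  by (simp add: v_Uq2_def v_matrix_def Let_def fun_eq_iff)

lemma Uq2_triple_universal:
  assumes B: "star_algebra B" and t: "Uq2_triple q B u \<alpha> \<gamma>"
  shows "\<exists>f. star_hom (Uq2_alg q) B f \<and> f (gen_Uq2 q Gen_u) = u \<and> f (gen_Uq2 q Gen_alpha) = \<alpha> \<and>
    f (gen_Uq2 q Gen_gamma) = \<gamma>"
proof -
  interpret star_algebra B by fact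
  define h where "h g = (case g of Gen_u \<Rightarrow> u | Gen_alpha \<Rightarrow> \<alpha> | Gen_gamma \<Rightarrow> \<gamma>)" for g
  have cl: "u \<in> carrier B" "\<alpha> \<in> carrier B" "\<gamma> \<in> carrier B"
    and uu: "u \<otimes>\<^bsub>B\<^esub> star B u = \<one>\<^bsub>B\<^esub>" "star B u \<otimes>\<^bsub>B\<^esub> u = \<one>\<^bsub>B\<^esub>"
    and ug: "u \<otimes>\<^bsub>B\<^esub> \<alpha> = \<alpha> \<otimes>\<^bsub>B\<^esub> u" "u \<otimes>\<^bsub>B\<^esub> \<gamma> = \<gamma> \<otimes>\<^bsub>B\<^esub> u"
    using t unfolding Uq2_triple_def by blast+
  have h: "range h \<subseteq> carrier B" using cl by (auto simp: h_def split: Uq2_gen.splits)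
  note tc = term_eval_closed [OF h]
  \<comment> \<open>Centrality of u is a relation for every term, whereas a triple grants it for
    \<alpha> and \<gamma> only. The induction passes adjoints by unitarity of u.\<close>
  have central: "u \<otimes>\<^bsub>B\<^esub> term_eval B h x = term_eval B h x \<otimes>\<^bsub>B\<^esub> u" for x
  proof (induction x)
    case (Gen g)
    then show ?case using ug by (cases g) (simp_all add: h_def)
  next
    case (Mult x y)
    have "u \<otimes>\<^bsub>B\<^esub> (term_eval B h x \<otimes>\<^bsub>B\<^esub> term_eval B h y) = (u \<otimes>\<^bsub>B\<^esub> term_eval B h x) \<otimes>\<^bsub>B\<^esub> term_eval B h y"
      by (simp add: m_assoc tc cl)
    also have "\<dots> = term_eval B h x \<otimes>\<^bsub>B\<^esub> (u \<otimes>\<^bsub>B\<^esub> term_eval B h y)"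
      unfolding Mult.IH(1) by (simp add: m_assoc tc cl)
    also have "\<dots> = (term_eval B h x \<otimes>\<^bsub>B\<^esub> term_eval B h y) \<otimes>\<^bsub>B\<^esub> u"
      unfolding Mult.IH(2) by (simp add: m_assoc tc cl)
    finally show ?case by simp
  next
    case (Star x)
    then show ?case using unitary_commutes(2) [OF cl(1) tc uu Star] by simp
  qed (simp_all add: cl tc l_distr r_distr scal_mult)
  have rel: "term_eval B h x = term_eval B h y" if "(x, y) \<in> Uq2_relations q" for x y
    using that t central unfolding Uq2_relations_def Uq2_triple_def
    by (auto simp: h_def)
  obtain f where "star_hom (Uq2_alg q) B f" "\<And>g. f (gen_Uq2 q g) = h g"
    using presented_universal [OF B h rel] unfolding Uq2_alg_def gen_Uq2_def by blast
  then show ?thesis by (intro exI [of _ f]) (simp add: h_def)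
qed

lemma v_matrix_hom:
  assumes "star_hom A B f" "star_algebra A" "star_algebra B" "u \<in> carrier A" "\<alpha> \<in> carrier A" "\<gamma> \<in> carrier A"
  shows "f (v_matrix q A u \<alpha> \<gamma> i j) = v_matrix q B (f u) (f \<alpha>) (f \<gamma>) i j"
proof -
  interpret star_algebra A by fact
  note fa = star_hom_alg [OF assms(1)]
  show ?thesis
    using assms(4-) by (simp add: v_matrix_def alg_homD [OF fa] star_homD [OF assms(1)]
      linear_map_zero [OF alg_hom_linear [OF fa] assms(2,3)])
qed

lemma gen_Uq2_closed [simp]: "gen_Uq2 q g \<in> carrier (Uq2_alg q)"
  by (simp add: gen_Uq2_def Uq2_alg_def presented_simps)

text \<open>The target may be an arbitrary star algebra, because relations are imposed on terms. The
  solution is rebuilt from its entries (1,1), (2,2) and (3,2), as all others are forced.\<close>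

lemma Uq2_universal:
  assumes b: "SUq3_matrix B q b" and block: "block_matrix B b"
  shows "\<exists>f. star_hom (Uq2_alg q) B f \<and> (\<forall>i\<in>{1..3}. \<forall>j\<in>{1..3}. f (v_Uq2 q i j) = b i j)"
proof -
  interpret SUq3_matrix B q b by fact
  note t = Uq2_triple_of_block_matrix [OF b block]
  obtain f where f: "star_hom (Uq2_alg q) B f" "f (gen_Uq2 q Gen_u) = b 1 1"
    "f (gen_Uq2 q Gen_alpha) = b 2 2" "f (gen_Uq2 q Gen_gamma) = b 3 2"
    using Uq2_triple_universal [OF star_algebra_axioms t(1)] by blast
  have "f (v_Uq2 q i j) = b i j" if "i \<in> {1..3}" "j \<in> {1..3}" for i j
    unfolding v_Uq2_eq t(2) [OF that]
    by (simp add: v_matrix_hom [OF f(1) star_algebra_Uq2 star_algebra_axioms] f(2-))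
  with f(1) show ?thesis by blast
qed

lemma SUq3_matrix_Uq2:
  assumes "0 < q"
  shows "SUq3_matrix (Uq2_alg q) q (v_Uq2 q)"
  unfolding v_Uq2_eq
  by (intro SUq3_matrix.intro SUq3_matrix_axioms.intro star_algebra_Uq2 assms
      SUq3_relations_v_matrix Uq2_triple_gen)

lemma block_v_Uq2: "block_matrix (Uq2_alg q) (v_Uq2 q)"
  by (simp add: block_matrix_def v_Uq2_eq v_matrix_values)

lemma Uq2_generated:
  assumes "0 < q"
  shows "carrier (Uq2_alg q) = generated_alg (Uq2_alg q) (entries (v_Uq2 q))"
proof -
  interpret SUq3_matrix "Uq2_alg q" q "v_Uq2 q" by (rule SUq3_matrix_Uq2 [OF assms])
  let ?G = "generated_alg (Uq2_alg q) (entries (v_Uq2 q))"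
  have sub: "entries (v_Uq2 q) \<subseteq> carrier (Uq2_alg q)" by (auto simp: entries_def)
  \<comment> \<open>The cofactor formula keeps the generated set closed under \<open>star\<close>,
    so terms containing \<open>Star\<close> also evaluate into it.\<close>
  have "star_algebra ((Uq2_alg q)\<lparr>carrier := ?G\<rparr>)"
    by (rule star_algebra_generated [OF sub]) (use star_entry_generated in \<open>auto simp only: entries_def\<close>)
  then interpret G: star_algebra "(Uq2_alg q)\<lparr>carrier := ?G\<rparr>" .
  have g: "gen_Uq2 q x \<in> ?G" for x
  proof -
    have "gen_Uq2 q x \<in> entries (v_Uq2 q)"
    proof (cases x)
      case Gen_u
      then have "gen_Uq2 q x = v_Uq2 q 1 1" by (simp add: v_Uq2_eq v_matrix_values)
      then show ?thesis unfolding entries_def by force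
    next
      case Gen_alpha
      then have "gen_Uq2 q x = v_Uq2 q 2 2" by (simp add: v_Uq2_eq v_matrix_values)
      then show ?thesis unfolding entries_def by force
    next
      case Gen_gamma
      then have "gen_Uq2 q x = v_Uq2 q 3 2" by (simp add: v_Uq2_eq v_matrix_values)
      then show ?thesis unfolding entries_def by force
    qed
    then show ?thesis by (rule generated_alg.incl)
  qed
  have "term_eval (Uq2_alg q) (gen_Uq2 q) t \<in> ?G" for t
    by (induction t) (use g G.star_closed in \<open>auto intro: generated_alg.intros\<close>)
  moreover have "\<exists>t. x = term_eval (Uq2_alg q) (gen_Uq2 q) t" if "x \<in> carrier (Uq2_alg q)" for x
    using that unfolding Uq2_alg_def gen_Uq2_def by (auto simp: presented_simps term_eval_presented)
  ultimately show ?thesis using generated_subset [OF sub] by blast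
qed

section \<open>Representations of U_q(2) by weighted shifts\<close>

definition diag_op :: "(nat \<Rightarrow> complex) \<Rightarrow> l2_op" where
  "diag_op d = (\<lambda>x\<in>l2. \<lambda>n. d n * x n)"

lemma diag_op_bounded:
  assumes "\<And>n. cmod (d n) \<le> 1"
  shows "diag_op d \<in> bounded_l2_ops"
proof (rule bounded_l2_opsI [of _ 1])
  fix x :: "nat \<Rightarrow> complex" assume x: "x \<in> l2"
  have le: "cmod (d n * x n) \<le> cmod (x n)" for n
    using assms [of n] by (simp add: norm_mult mult_left_le_one_le)
  show "diag_op d x \<in> l2" using l2_dominated(1) [OF x le] x by (simp add: diag_op_def)
  show "sqnorm (diag_op d x) \<le> 1 * sqnorm x" using sqnorm_mono [OF x le] x by (simp add: diag_op_def)
qed (simp_all add: diag_op_def algebra_simps)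

lemma diag_op_adjoint:
  assumes "\<And>n. cmod (d n) \<le> 1"
  shows "l2_adjoint (diag_op d) = diag_op (\<lambda>n. cnj (d n))"
  by (rule l2_adjoint_eqI [OF diag_op_bounded]) (simp_all add: assms diag_op_def l2_inner_def mult_ac)

text \<open>A weighted unilateral shift: it maps \<open>unit (Suc n)\<close> to
  \<open>w (Suc n)\<close> times \<open>unit n\<close> and kills \<open>unit 0\<close>;
  \<open>raise_op\<close> is its adjoint.\<close>

definition lower_op :: "(nat \<Rightarrow> real) \<Rightarrow> l2_op" where
  "lower_op w = (\<lambda>x\<in>l2. \<lambda>n. of_real (w (Suc n)) * x (Suc n))"

definition raise_op :: "(nat \<Rightarrow> real) \<Rightarrow> l2_op" where
  "raise_op w = (\<lambda>x\<in>l2. \<lambda>n. if n = 0 then 0 else of_real (w n) * x (n - 1))"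

lemma l2_Suc:
  assumes "x \<in> l2"
  shows "(\<lambda>n. x (Suc n)) \<in> l2" "sqnorm (\<lambda>n. x (Suc n)) \<le> sqnorm x"
proof -
  have s: "summable (\<lambda>n. (cmod (x n))\<^sup>2)" by (rule l2D [OF assms])
  then show "(\<lambda>n. x (Suc n)) \<in> l2" by (intro l2I) (simp add: summable_Suc_iff [of "\<lambda>n. (cmod (x n))\<^sup>2"])
  show "sqnorm (\<lambda>n. x (Suc n)) \<le> sqnorm x"
    using suminf_split_head [OF s] by (simp add: sqnorm_def)
qed

lemma l2_shift:
  assumes "x \<in> l2" "y 0 = 0" "\<And>n. y (Suc n) = x n"
  shows "y \<in> l2" "sqnorm y = sqnorm x"
proof -
  have "summable (\<lambda>n. (cmod (y (Suc n)))\<^sup>2)" using l2D [OF assms(1)] by (simp add: assms(3))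
  then have s: "summable (\<lambda>n. (cmod (y n))\<^sup>2)" by (simp add: summable_Suc_iff [of "\<lambda>n. (cmod (y n))\<^sup>2"])
  then show "y \<in> l2" by (rule l2I)
  show "sqnorm y = sqnorm x"
    using suminf_split_head [OF s] by (simp add: sqnorm_def assms(2,3))
qed

context
  fixes w :: "nat \<Rightarrow> real"
  assumes w: "\<And>n. \<bar>w n\<bar> \<le> 1"
begin

lemma lower_op_bounded: "lower_op w \<in> bounded_l2_ops"
proof (rule bounded_l2_opsI [of _ 1])
  fix x :: "nat \<Rightarrow> complex" assume x: "x \<in> l2"
  have le: "cmod (of_real (w (Suc n)) * x (Suc n)) \<le> cmod (x (Suc n))" for n
    using w [of "Suc n"] by (simp add: norm_mult mult_left_le_one_le)
  show "lower_op w x \<in> l2" using l2_dominated(1) [OF l2_Suc(1) [OF x] le] x by (simp add: lower_op_def)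
  show "sqnorm (lower_op w x) \<le> 1 * sqnorm x"
    using sqnorm_mono [OF l2_Suc(1) [OF x] le] l2_Suc(2) [OF x] x by (simp add: lower_op_def)
qed (simp_all add: lower_op_def algebra_simps)

lemma raise_op_bounded: "raise_op w \<in> bounded_l2_ops"
proof (rule bounded_l2_opsI [of _ 1])
  fix x :: "nat \<Rightarrow> complex" assume x: "x \<in> l2"
  have le: "cmod (of_real (w (Suc n)) * x n) \<le> cmod (x n)" for n
    using w [of "Suc n"] by (simp add: norm_mult mult_left_le_one_le)
  note sh = l2_shift [OF l2_dominated(1) [OF x le], of "raise_op w x"]
  show "raise_op w x \<in> l2" by (rule sh) (simp_all add: raise_op_def x)
  have "sqnorm (raise_op w x) = sqnorm (\<lambda>n. of_real (w (Suc n)) * x n)"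
    by (rule sh) (simp_all add: raise_op_def x)
  then show "sqnorm (raise_op w x) \<le> 1 * sqnorm x"
    using sqnorm_mono [OF x le] by simp
qed (auto simp: raise_op_def algebra_simps)

lemma lower_op_adjoint: "l2_adjoint (lower_op w) = raise_op w"
proof (rule l2_adjoint_eqI [OF raise_op_bounded])
  fix x y assume x: "x \<in> l2" and y: "y \<in> l2"
  have s: "summable (\<lambda>n. x n * cnj (raise_op w y n))"
    by (intro l2_inner_summable x bounded_l2_opsD(2) [OF raise_op_bounded] y)
  show "l2_inner (lower_op w x) y = l2_inner x (raise_op w y)"
    using suminf_split_head [OF s] x y
    by (simp add: l2_inner_def lower_op_def raise_op_def mult_ac)
qed

end

text \<open>The familiar representation of quantum SU(2), with a phase w on \<gamma> and with u
  acting as the scalar z. Since \<gamma> has eigenvalues of modulus q^n, the relation \<open>star A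
  \<alpha> \<otimes> \<alpha> \<oplus> \<gamma> \<otimes> star A \<gamma> = \<one>\<close> dictates
  the weights of \<alpha>.\<close>

lemma Uq2_representation:
  assumes q: "0 < q" "q < 1" and z: "cmod z = 1" and w: "cmod w = 1"
  shows "Uq2_triple q B_l2 (diag_op (\<lambda>n. z)) (lower_op (\<lambda>n. sqrt (1 - q ^ (2 * n))))
    (diag_op (\<lambda>n. w * of_real q ^ n))"
proof -
  define v where "v = (\<lambda>n. sqrt (1 - q ^ (2 * n)))"
  have p: "q ^ n \<le> 1" "0 \<le> q ^ n" for n using q by (simp_all add: power_le_one)
  have ww: "v n * v n = 1 - q ^ (2 * n)" for n using p(1) [of "2 * n"] by (simp add: v_def)
  have w1: "\<bar>v n\<bar> \<le> 1" for n using p [of "2 * n"] by (simp add: v_def)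
  have d1: "cmod z \<le> 1" "\<And>n. cmod (w * of_real q ^ n) \<le> 1"
    using z w p q by (simp_all add: norm_mult norm_power)
  have zz: "z * cnj z = 1" "cnj z * z = 1" "w * cnj w = 1" "cnj w * w = 1"
    using z w by (simp_all flip: complex_norm_square add: mult.commute [of "cnj _"])
  have ww': "complex_of_real (v n) * complex_of_real (v n) = 1 - of_real q ^ (2 * n)" for n
    by (simp only: ww flip: of_real_mult) simp
  note b = diag_op_bounded [OF d1(1)] diag_op_bounded [OF d1(2)] lower_op_bounded [OF w1] raise_op_bounded [OF w1]
  have b': "diag_op (\<lambda>n. cnj z) \<in> bounded_l2_ops" "diag_op (\<lambda>n. cnj w * of_real q ^ n) \<in> bounded_l2_ops"
    using d1(1) d1(2) [unfolded norm_mult] by (auto intro!: diag_op_bounded simp: norm_mult)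
  note adj = diag_op_adjoint [OF d1(1)] diag_op_adjoint [OF d1(2), simplified] lower_op_adjoint [OF w1]
  note l2 = bounded_l2_opsD(2) [OF b(1)] bounded_l2_opsD(2) [OF b(2)] bounded_l2_opsD(2) [OF b(3)]
    bounded_l2_opsD(2) [OF b(4)] bounded_l2_opsD(2) [OF b'(1)] bounded_l2_opsD(2) [OF b'(2)]
  have ev: "\<And>x n. x \<in> l2 \<Longrightarrow> diag_op d x n = d n * x n"
    "\<And>x n. x \<in> l2 \<Longrightarrow> lower_op v x n = of_real (v (Suc n)) * x (Suc n)"
    "\<And>x n. x \<in> l2 \<Longrightarrow> raise_op v x n = (if n = 0 then 0 else of_real (v n) * x (n - 1))" for d v
    by (simp_all add: diag_op_def lower_op_def raise_op_def)
  have c: "w * complex_of_real q ^ n * (cnj w * complex_of_real q ^ n * y) = complex_of_real q ^ (2 * n) * y"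
    "complex_of_real (v n) * (complex_of_real (v n) * y) = (1 - of_real q ^ (2 * n)) * y" for n y
  proof -
    have "w * complex_of_real q ^ n * (cnj w * complex_of_real q ^ n * y) =
        (w * cnj w) * (complex_of_real q ^ n * complex_of_real q ^ n) * y"
      by (simp only: mult_ac)
    then show "w * complex_of_real q ^ n * (cnj w * complex_of_real q ^ n * y) = complex_of_real q ^ (2 * n) * y"
      by (simp add: zz mult_2 power_add)
    show "complex_of_real (v n) * (complex_of_real (v n) * y) = (1 - of_real q ^ (2 * n)) * y"
      by (simp only: ww' flip: mult.assoc)
  qed
  show ?thesis
    unfolding Uq2_triple_def B_l2_simps v_def [symmetric] adj
  proof (intro conjI b restrict_ext ext)
    fix x :: "nat \<Rightarrow> complex" and n assume x: "x \<in> l2"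
    note ev' = ev l2 x
    show "diag_op (\<lambda>n. z) (diag_op (\<lambda>n. cnj z) x) n = x n"
      "diag_op (\<lambda>n. cnj z) (diag_op (\<lambda>n. z) x) n = x n"
      by (simp_all add: ev' zz flip: mult.assoc)
    show "diag_op (\<lambda>n. z) (lower_op v x) n = lower_op v (diag_op (\<lambda>n. z) x) n"
      "diag_op (\<lambda>n. z) (diag_op (\<lambda>n. w * complex_of_real q ^ n) x) n =
        diag_op (\<lambda>n. w * complex_of_real q ^ n) (diag_op (\<lambda>n. z) x) n"
      by (simp_all add: ev' mult_ac)
    show "lower_op v (diag_op (\<lambda>n. w * complex_of_real q ^ n) x) n =
        complex_of_real q * (\<lambda>x\<in>l2. diag_op (\<lambda>n. w * complex_of_real q ^ n) (lower_op v x)) x n"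
      by (simp add: ev' mult_ac)
    show "diag_op (\<lambda>n. w * complex_of_real q ^ n) (diag_op (\<lambda>n. cnj w * complex_of_real q ^ n) x) n =
        diag_op (\<lambda>n. cnj w * complex_of_real q ^ n) (diag_op (\<lambda>n. w * complex_of_real q ^ n) x) n"
      by (simp add: ev' mult_ac)
    show "lower_op v (diag_op (\<lambda>n. cnj w * complex_of_real q ^ n) x) n =
        complex_of_real q * (\<lambda>x\<in>l2. diag_op (\<lambda>n. cnj w * complex_of_real q ^ n) (lower_op v x)) x n"
      by (simp add: ev' mult_ac)
    \<comment> \<open>At n = 0 the value 0 of the raising operator agrees with the factor 1 -
      q^0.\<close>
    have e: "raise_op v (lower_op v x) n = (1 - complex_of_real q ^ (2 * n)) * x n"
      "lower_op v (raise_op v x) n = (1 - complex_of_real q ^ (2 * Suc n)) * x n"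
      "diag_op (\<lambda>n. w * complex_of_real q ^ n) (diag_op (\<lambda>n. cnj w * complex_of_real q ^ n) x) n =
        complex_of_real q ^ (2 * n) * x n"
      by (cases n; simp add: ev' c) (simp_all add: ev' c)
    show "(\<lambda>x\<in>l2. raise_op v (lower_op v x)) x n + (\<lambda>x\<in>l2. diag_op (\<lambda>n. w * complex_of_real q ^ n)
        (diag_op (\<lambda>n. cnj w * complex_of_real q ^ n) x)) x n = x n"
      using x by (simp add: e left_diff_distrib)
    show "(\<lambda>x\<in>l2. lower_op v (raise_op v x)) x n + (\<lambda>x\<in>l2. \<lambda>n. (complex_of_real q)\<^sup>2 *
        (\<lambda>x\<in>l2. diag_op (\<lambda>n. w * complex_of_real q ^ n) (diag_op (\<lambda>n. cnj w * complex_of_real q ^ n) x)) x n) x n = x n"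
      using x by (simp add: e left_diff_distrib power2_eq_square)
  qed
qed

section \<open>Spanning monomials of O(U_q(2))\<close>

definition int_power :: "('a, 'm) star_alg_scheme \<Rightarrow> 'a \<Rightarrow> int \<Rightarrow> 'a" where
  "int_power A x k = (if 0 \<le> k then x [^]\<^bsub>A\<^esub> nat k else star A x [^]\<^bsub>A\<^esub> nat (- k))"

text \<open>Negative exponents in \<open>int_power\<close> stand for powers of the adjoint. For u
  these are inverses; for \<alpha> this lets one integer record the powers of \<alpha> and of its
  adjoint, which need not occur together.\<close>

definition Uq2_monomial :: "('a, 'm) star_alg_scheme \<Rightarrow> 'a \<Rightarrow> 'a \<Rightarrow> 'a \<Rightarrow> int \<times> int \<times> nat \<times> nat \<Rightarrow> 'a" where
  "Uq2_monomial A u \<alpha> \<gamma> = (\<lambda>(k, a, b, c).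
     \<gamma> [^]\<^bsub>A\<^esub> b \<otimes>\<^bsub>A\<^esub> (star A \<gamma> [^]\<^bsub>A\<^esub> c \<otimes>\<^bsub>A\<^esub> (int_power A u k \<otimes>\<^bsub>A\<^esub> int_power A \<alpha> a)))"

lemma alg_hom_nat_pow:
  assumes "alg_hom A B f" "star_algebra A" "star_algebra B" "x \<in> carrier A"
  shows "f (x [^]\<^bsub>A\<^esub> (n::nat)) = f x [^]\<^bsub>B\<^esub> n"
proof -
  interpret A: star_algebra A by fact
  interpret B: star_algebra B by fact
  show ?thesis by (induction n) (simp_all add: alg_homD [OF assms(1)] assms(4))
qed

lemma star_hom_Uq2_monomial:
  assumes f: "star_hom A B f" and AB: "star_algebra A" "star_algebra B"
    and cl: "u \<in> carrier A" "\<alpha> \<in> carrier A" "\<gamma> \<in> carrier A"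
  shows "f (Uq2_monomial A u \<alpha> \<gamma> i) = Uq2_monomial B (f u) (f \<alpha>) (f \<gamma>) i"
proof -
  interpret A: star_algebra A by fact
  note fa = star_hom_alg [OF f]
  have "f (int_power A x k) = int_power B (f x) k" "int_power A x k \<in> carrier A" if "x \<in> carrier A" for x k
    using that by (simp_all add: int_power_def alg_hom_nat_pow [OF fa AB] star_homD [OF f] A.star_closed del: pow_nat)
  then show ?thesis
    using cl by (cases i) (simp add: Uq2_monomial_def alg_homD [OF fa] alg_hom_nat_pow [OF fa AB] star_homD [OF f] A.star_closed)
qed

context star_algebra begin

lemma int_power_closed [simp]: "x \<in> carrier A \<Longrightarrow> int_power A x k \<in> carrier A"
  by (simp add: int_power_def star_closed del: pow_nat)

lemma q_commute_pow:
  assumes "x \<in> carrier A" "y \<in> carrier A" "x \<otimes> y = r \<odot> (y \<otimes> x)"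
  shows "x \<otimes> y [^] (n::nat) = r ^ n \<odot> (y [^] n \<otimes> x)"
proof (induction n)
  case (Suc n)
  have "x \<otimes> (y [^] n \<otimes> y) = (x \<otimes> y [^] n) \<otimes> y" using assms by (simp add: m_assoc)
  also have "\<dots> = r ^ n \<odot> (y [^] n \<otimes> (x \<otimes> y))"
    unfolding Suc using assms(1,2) by (simp add: m_assoc scal_mult)
  also have "\<dots> = r ^ Suc n \<odot> ((y [^] n \<otimes> y) \<otimes> x)"
    unfolding assms(3) using assms(1,2) by (simp add: m_assoc scal_mult mult.commute)
  finally show ?case by simp
qed (use assms in simp)

lemma commute_pow:
  assumes "x \<in> carrier A" "y \<in> carrier A" "x \<otimes> y = y \<otimes> x"
  shows "x \<otimes> y [^] (n::nat) = y [^] n \<otimes> x"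
  using q_commute_pow [of x y 1 n] assms by simp

lemma int_power_unitary:
  assumes "u \<in> carrier A" "u \<otimes> star A u = \<one>" "star A u \<otimes> u = \<one>"
  shows "u \<otimes> int_power A u k = int_power A u (k + 1)" "star A u \<otimes> int_power A u k = int_power A u (k - 1)"
proof -
  note [simp] = star_closed assms
  have c: "x \<otimes> (y \<otimes> z) = z" if "x \<otimes> y = \<one>" "x \<in> carrier A" "y \<in> carrier A" "z \<in> carrier A" for x y z
    using that by (simp flip: m_assoc)
  have pow: "x \<otimes> x [^] n = x [^] Suc n" if "x \<in> carrier A" for x and n :: nat
    using commute_pow [OF that that] by simp
  have canc: "x \<otimes> y [^] Suc n = y [^] n" if "x \<otimes> y = \<one>" "x \<in> carrier A" "y \<in> carrier A" for x y and n :: nat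
    unfolding pow [OF that(3), symmetric] using that by (simp add: c)
  show "u \<otimes> int_power A u k = int_power A u (k + 1)"
  proof (cases k rule: int_cases3)
    case (neg n)
    then show ?thesis using canc [of u "star A u" "n - 1"] by (auto simp: int_power_def nat_diff_distrib One_nat_def simp del: pow_nat)
  qed (simp_all add: int_power_def pow nat_add_distrib del: pow_nat)
  show "star A u \<otimes> int_power A u k = int_power A u (k - 1)"
  proof (cases k rule: int_cases3)
    case (pos n)
    then show ?thesis using canc [of "star A u" u "n - 1"] by (auto simp: int_power_def nat_diff_distrib One_nat_def simp del: pow_nat)
  next
    case (neg n)
    moreover have "nat (1 + int n) = Suc n" by simp
    ultimately show ?thesis using pow [of "star A u" n] by (simp add: int_power_def del: pow_nat)
  qed (simp add: int_power_def)
qed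

context
  fixes q u \<alpha> \<gamma>
  assumes q: "0 < q" and triple: "Uq2_triple q A u \<alpha> \<gamma>"
begin

abbreviation (input) "\<mu> \<equiv> Uq2_monomial A u \<alpha> \<gamma>"

lemma triple_closed: "u \<in> carrier A" "\<alpha> \<in> carrier A" "\<gamma> \<in> carrier A"
  using triple unfolding Uq2_triple_def by blast+

lemma triple_rel:
  "u \<otimes> star A u = \<one>" "star A u \<otimes> u = \<one>"
  "\<alpha> \<otimes> \<gamma> = complex_of_real q \<odot> (\<gamma> \<otimes> \<alpha>)" "star A \<gamma> \<otimes> \<gamma> = \<gamma> \<otimes> star A \<gamma>"
  "\<alpha> \<otimes> star A \<gamma> = complex_of_real q \<odot> (star A \<gamma> \<otimes> \<alpha>)"
  "star A \<alpha> \<otimes> \<alpha> \<oplus> \<gamma> \<otimes> star A \<gamma> = \<one>"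
  "\<alpha> \<otimes> star A \<alpha> \<oplus> (complex_of_real q)\<^sup>2 \<odot> (\<gamma> \<otimes> star A \<gamma>) = \<one>"
  using triple unfolding Uq2_triple_def by auto

lemma triple_u_central:
  "\<alpha> \<otimes> u = u \<otimes> \<alpha>" "\<alpha> \<otimes> star A u = star A u \<otimes> \<alpha>" "\<gamma> \<otimes> u = u \<otimes> \<gamma>" "\<gamma> \<otimes> star A u = star A u \<otimes> \<gamma>"
  "star A \<alpha> \<otimes> u = u \<otimes> star A \<alpha>" "star A \<alpha> \<otimes> star A u = star A u \<otimes> star A \<alpha>"
  "star A \<gamma> \<otimes> u = u \<otimes> star A \<gamma>" "star A \<gamma> \<otimes> star A u = star A u \<otimes> star A \<gamma>"
proof -
  have c: "u \<otimes> \<alpha> = \<alpha> \<otimes> u" "u \<otimes> \<gamma> = \<gamma> \<otimes> u" using triple unfolding Uq2_triple_def by blast+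
  note a = unitary_commutes [OF triple_closed(1,2) triple_rel(1,2) c(1)]
    and g = unitary_commutes [OF triple_closed(1,3) triple_rel(1,2) c(2)]
  show "\<alpha> \<otimes> u = u \<otimes> \<alpha>" "\<alpha> \<otimes> star A u = star A u \<otimes> \<alpha>" "\<gamma> \<otimes> u = u \<otimes> \<gamma>" "\<gamma> \<otimes> star A u = star A u \<otimes> \<gamma>"
    "star A \<alpha> \<otimes> u = u \<otimes> star A \<alpha>" "star A \<alpha> \<otimes> star A u = star A u \<otimes> star A \<alpha>"
    "star A \<gamma> \<otimes> u = u \<otimes> star A \<gamma>" "star A \<gamma> \<otimes> star A u = star A u \<otimes> star A \<gamma>"
    using c a g unitary_commutes(1) [OF triple_closed(1) _ triple_rel(1,2) a(2)]
      unitary_commutes(1) [OF triple_closed(1) _ triple_rel(1,2) g(2)]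
    by (simp_all add: star_closed triple_closed)
qed

text \<open>On its way x meets b + c factors \<gamma> or \<open>star A \<gamma>\<close>, each at the
  cost r, and passes the powers of u freely. The values r = q, 1/q and 1 cover \<alpha>, its
  adjoint, and \<gamma> with its adjoint.\<close>

lemma commute_past:
  assumes x: "x \<in> carrier A" and y: "y \<in> carrier A"
    and "x \<otimes> \<gamma> = r \<odot> (\<gamma> \<otimes> x)" "x \<otimes> star A \<gamma> = r \<odot> (star A \<gamma> \<otimes> x)"
    and "x \<otimes> u = u \<otimes> x" "x \<otimes> star A u = star A u \<otimes> x"
  shows "x \<otimes> (\<gamma> [^] b \<otimes> (star A \<gamma> [^] c \<otimes> (int_power A u k \<otimes> y))) =
    r ^ (b + c) \<odot> (\<gamma> [^] b \<otimes> (star A \<gamma> [^] c \<otimes> (int_power A u k \<otimes> (x \<otimes> y))))"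
proof -
  note cl = triple_closed star_closed
  have mv: "x \<otimes> (g \<otimes> z) = s \<odot> (g \<otimes> (x \<otimes> z))"
    if "x \<otimes> g = s \<odot> (g \<otimes> x)" "g \<in> carrier A" "z \<in> carrier A" for g z s
  proof -
    have "x \<otimes> (g \<otimes> z) = (x \<otimes> g) \<otimes> z" using x that(2,3) by (simp add: m_assoc)
    also have "\<dots> = s \<odot> (g \<otimes> (x \<otimes> z))" unfolding that(1) using x that(2,3) by (simp add: m_assoc scal_mult)
    finally show ?thesis .
  qed
  have "x \<otimes> int_power A u k = int_power A u k \<otimes> x"
    unfolding int_power_def using commute_pow x cl assms(5,6) by (auto simp del: pow_nat)
  then have u: "x \<otimes> int_power A u k = 1 \<odot> (int_power A u k \<otimes> x)" using x cl by simp
  show ?thesis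
    using x y cl by (simp add: mv [OF u] mv [OF q_commute_pow [OF x _ assms(3)]] mv [OF q_commute_pow [OF x _ assms(4)]]
      scal_mult power_add)
qed

text \<open>Only for negative a does \<alpha> meet its adjoint, and then the last defining relation
  replaces their product by 1 minus a multiple of \<open>\<gamma> \<otimes> star A \<gamma>\<close>.
  The disjunction is all that the span argument asks for.\<close>

lemma alpha_int_power:
  "\<alpha> \<otimes> int_power A \<alpha> a = int_power A \<alpha> (a + 1) \<or>
   \<alpha> \<otimes> int_power A \<alpha> a = int_power A \<alpha> (a + 1) \<oplus> (- (complex_of_real q)\<^sup>2) \<odot> (\<gamma> \<otimes> (star A \<gamma> \<otimes> int_power A \<alpha> (a + 1)))"
proof (cases a rule: int_cases3)
  case (neg n)
  note cl = triple_closed star_closed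
  define y where "y = star A \<alpha> [^] (n - 1)"
  have y: "y \<in> carrier A" by (simp add: y_def cl)
  have p: "star A \<alpha> [^] n = star A \<alpha> \<otimes> y"
    using commute_pow [of "star A \<alpha>" "star A \<alpha>" "n - 1"] neg(2) cl nat_pow_Suc [of "star A \<alpha>" "n - 1"]
    by (simp add: y_def del: nat_pow_Suc)
  have e: "int_power A \<alpha> a = star A \<alpha> \<otimes> y" "int_power A \<alpha> (a + 1) = y"
    using neg p by (auto simp: int_power_def y_def nat_diff_distrib One_nat_def simp del: pow_nat)
  have "\<alpha> \<otimes> (star A \<alpha> \<otimes> y) = (\<alpha> \<otimes> star A \<alpha>) \<otimes> y" using y cl by (simp add: m_assoc)
  also have "\<alpha> \<otimes> star A \<alpha> = \<one> \<oplus> (- (complex_of_real q)\<^sup>2) \<odot> (\<gamma> \<otimes> star A \<gamma>)"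
    using triple_rel(7) cl by (simp flip: triple_rel(7) add: a_assoc) (simp flip: add_scal)
  also have "\<dots> \<otimes> y = y \<oplus> (- (complex_of_real q)\<^sup>2) \<odot> (\<gamma> \<otimes> (star A \<gamma> \<otimes> y))"
    using y cl by (simp add: l_distr scal_mult m_assoc)
  finally show ?thesis unfolding e by blast
qed (use triple_closed commute_pow [of \<alpha> \<alpha>] in \<open>simp_all add: int_power_def nat_add_distrib del: pow_nat\<close>)

text \<open>Counterpart for positive a, where the product of adjoint and \<alpha> carries no factor
  q squared.\<close>

lemma alpha_star_int_power:
  "star A \<alpha> \<otimes> int_power A \<alpha> a = int_power A \<alpha> (a - 1) \<or>
   star A \<alpha> \<otimes> int_power A \<alpha> a = int_power A \<alpha> (a - 1) \<oplus> (- 1) \<odot> (\<gamma> \<otimes> (star A \<gamma> \<otimes> int_power A \<alpha> (a - 1)))"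
proof (cases a rule: int_cases3)
  case (pos n)
  note cl = triple_closed star_closed
  define y where "y = \<alpha> [^] (n - 1)"
  have y: "y \<in> carrier A" by (simp add: y_def cl)
  have p: "\<alpha> [^] n = \<alpha> \<otimes> y"
    using commute_pow [of \<alpha> \<alpha> "n - 1"] pos(2) cl nat_pow_Suc [of \<alpha> "n - 1"]
    by (simp add: y_def del: nat_pow_Suc)
  have e: "int_power A \<alpha> a = \<alpha> \<otimes> y" "int_power A \<alpha> (a - 1) = y"
    using pos p by (auto simp: int_power_def y_def nat_diff_distrib One_nat_def simp del: pow_nat)
  have "star A \<alpha> \<otimes> (\<alpha> \<otimes> y) = (star A \<alpha> \<otimes> \<alpha>) \<otimes> y" using y cl by (simp add: m_assoc)
  also have "star A \<alpha> \<otimes> \<alpha> = \<one> \<oplus> (- 1) \<odot> (\<gamma> \<otimes> star A \<gamma>)"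
    using cl by (simp flip: triple_rel(6) add: a_assoc) (simp flip: uminus_scal add: r_neg)
  also have "\<dots> \<otimes> y = y \<oplus> (- 1) \<odot> (\<gamma> \<otimes> (star A \<gamma> \<otimes> y))"
    using y cl by (simp add: l_distr scal_mult m_assoc)
  finally show ?thesis unfolding e by blast
next
  case (neg n)
  have "nat (1 + int n) = Suc n" by simp
  then show ?thesis using neg triple_closed star_closed commute_pow [of "star A \<alpha>" "star A \<alpha>" n]
    by (simp add: int_power_def del: pow_nat)
qed (use triple_closed in \<open>simp add: int_power_def star_closed del: pow_nat\<close>)

lemma monomial_closed [simp]: "\<mu> i \<in> carrier A"
  by (cases i) (simp add: Uq2_monomial_def triple_closed star_closed)

text \<open>Left multiplication by a generator or its adjoint changes one exponent. In the two
  \<alpha>-cases it can add a second monomial, in which b and c are both larger by one.\<close>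

lemma monomial_step:
  assumes "x \<in> {u, star A u, \<alpha>, star A \<alpha>, \<gamma>, star A \<gamma>}"
  shows "\<exists>p. x \<otimes> \<mu> i = lin_comb A \<mu> p"
proof -
  obtain k a b c where i: "i = (k, a, b, c)" by (cases i)
  note cl = triple_closed star_closed
  have single: "\<exists>p. r \<odot> \<mu> j = lin_comb A \<mu> p" for r j
    by (rule exI [of _ "Poly_Mapping.single j r"]) (simp add: lin_comb_single)
  note single1 = single [of 1, simplified]
  have add: "\<exists>p. r \<odot> \<mu> j \<oplus> s \<odot> \<mu> l = lin_comb A \<mu> p" for r j s l
    by (rule exI [of _ "Poly_Mapping.single j r + Poly_Mapping.single l s"]) (simp add: lin_comb_single lin_comb_add)
  have gg: "star A \<gamma> \<otimes> \<gamma> = 1 \<odot> (\<gamma> \<otimes> star A \<gamma>)" using triple_rel(4) cl by simp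
  \<comment> \<open>A pair \<open>\<gamma>\<close>, \<open>star A \<gamma>\<close> created behind
    the power of u commutes with everything before it; carried to the front, it raises b and c by
    one.\<close>
  have ext: "\<gamma> [^] b \<otimes> (star A \<gamma> [^] c \<otimes> (int_power A u k \<otimes> (\<gamma> \<otimes> (star A \<gamma> \<otimes> y)))) =
      \<gamma> [^] Suc b \<otimes> (star A \<gamma> [^] Suc c \<otimes> (int_power A u k \<otimes> y))" if y: "y \<in> carrier A" for y
  proof -
    have 1: "\<gamma> \<otimes> (\<gamma> [^] b \<otimes> (star A \<gamma> [^] c \<otimes> (int_power A u k \<otimes> z))) =
        \<gamma> [^] b \<otimes> (star A \<gamma> [^] c \<otimes> (int_power A u k \<otimes> (\<gamma> \<otimes> z)))" if "z \<in> carrier A" for z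
      using commute_past [of \<gamma> z 1] that cl triple_rel(4) triple_u_central by simp
    have 2: "star A \<gamma> \<otimes> (\<gamma> [^] b \<otimes> (star A \<gamma> [^] c \<otimes> (int_power A u k \<otimes> z))) =
        \<gamma> [^] b \<otimes> (star A \<gamma> [^] c \<otimes> (int_power A u k \<otimes> (star A \<gamma> \<otimes> z)))" if "z \<in> carrier A" for z
      using commute_past [of "star A \<gamma>" z 1] that cl triple_rel(4) triple_u_central by simp
    have 3: "star A \<gamma> \<otimes> \<gamma> [^] b = \<gamma> [^] b \<otimes> star A \<gamma>"
      by (rule commute_pow) (simp_all add: cl triple_rel(4))
    have "\<gamma> \<otimes> (star A \<gamma> \<otimes> (\<gamma> [^] b \<otimes> (star A \<gamma> [^] c \<otimes> (int_power A u k \<otimes> y)))) =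
       (\<gamma> \<otimes> \<gamma> [^] b) \<otimes> ((star A \<gamma> \<otimes> star A \<gamma> [^] c) \<otimes> (int_power A u k \<otimes> y))"
      using y cl 3 by (simp flip: m_assoc)
    moreover have "\<gamma> \<otimes> \<gamma> [^] b = \<gamma> [^] Suc b" "star A \<gamma> \<otimes> star A \<gamma> [^] c = star A \<gamma> [^] Suc c"
      using commute_pow [of \<gamma> \<gamma>] commute_pow [of "star A \<gamma>" "star A \<gamma>"] cl by simp_all
    ultimately show ?thesis using y cl by (simp add: 1 2 del: nat_pow_Suc)
  qed
  \<comment> \<open>A factor commuting with \<gamma> and its adjoint travels to the power of u and
    changes its exponent only. This handles u and \<open>star A u\<close> together.\<close>
  have ins: "x \<otimes> (\<gamma> [^] b \<otimes> (star A \<gamma> [^] c \<otimes> (int_power A u k \<otimes> int_power A \<alpha> a))) =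
      \<gamma> [^] b \<otimes> (star A \<gamma> [^] c \<otimes> (int_power A u k' \<otimes> int_power A \<alpha> a))"
    if "x \<in> carrier A" "\<gamma> \<otimes> x = x \<otimes> \<gamma>" "star A \<gamma> \<otimes> x = x \<otimes> star A \<gamma>" "x \<otimes> int_power A u k = int_power A u k'" for x k'
  proof -
    have 1: "x \<otimes> \<gamma> [^] b = \<gamma> [^] b \<otimes> x" "x \<otimes> star A \<gamma> [^] c = star A \<gamma> [^] c \<otimes> x"
      using that cl by (simp_all add: commute_pow)
    have 2: "x \<otimes> (y \<otimes> z) = y \<otimes> (x \<otimes> z)" if "x \<otimes> y = y \<otimes> x" "y \<in> carrier A" "z \<in> carrier A" for y z
      using that \<open>x \<in> carrier A\<close> by (simp flip: m_assoc)
    have 3: "x \<otimes> (int_power A u k \<otimes> z) = int_power A u k' \<otimes> z" if "z \<in> carrier A" for z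
      using that \<open>x \<in> carrier A\<close> cl \<open>x \<otimes> int_power A u k = _\<close> by (simp flip: m_assoc)
    show ?thesis using cl by (simp add: 2 [OF 1(1)] 2 [OF 1(2)] 3)
  qed
  consider "x = u" | "x = star A u" | "x = \<gamma>" | "x = star A \<gamma>" | "x = \<alpha>" | "x = star A \<alpha>" using assms by blast
  then show ?thesis
  proof cases
    case 1
    have "x \<otimes> \<mu> i = \<mu> (k + 1, a, b, c)"
      unfolding 1 i Uq2_monomial_def split using ins [of u "k + 1"] int_power_unitary(1) triple_u_central cl triple_rel by simp
    then show ?thesis using single1 by simp
  next
    case 2
    have "x \<otimes> \<mu> i = \<mu> (k - 1, a, b, c)"
      unfolding 2 i Uq2_monomial_def split using ins [of "star A u" "k - 1"] int_power_unitary(2) triple_u_central cl triple_rel by simp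
    then show ?thesis using single1 by simp
  next
    case 3
    have "x \<otimes> \<mu> i = \<mu> (k, a, Suc b, c)"
      unfolding 3 i Uq2_monomial_def split
      using commute_pow [of \<gamma> \<gamma>] cl by (simp flip: m_assoc)
    then show ?thesis using single1 by simp
  next
    case 4
    have "star A \<gamma> \<otimes> \<gamma> [^] b = \<gamma> [^] b \<otimes> star A \<gamma>"
      by (rule commute_pow) (simp_all add: cl triple_rel(4))
    then have "star A \<gamma> \<otimes> (\<gamma> [^] b \<otimes> z) = \<gamma> [^] b \<otimes> (star A \<gamma> \<otimes> z)" if "z \<in> carrier A" for z
      using cl that by (simp flip: m_assoc)
    moreover have "star A \<gamma> \<otimes> (star A \<gamma> [^] c \<otimes> z) = star A \<gamma> [^] Suc c \<otimes> z" if "z \<in> carrier A" for z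
      using commute_pow [of "star A \<gamma>" "star A \<gamma>"] cl that by (simp flip: m_assoc)
    ultimately have "x \<otimes> \<mu> i = \<mu> (k, a, b, Suc c)"
      unfolding 4 i Uq2_monomial_def split using cl by (simp del: nat_pow_Suc)
    then show ?thesis using single1 by simp
  next
    case 5
    have "x \<otimes> \<mu> i = complex_of_real q ^ (b + c) \<odot> (\<gamma> [^] b \<otimes> (star A \<gamma> [^] c \<otimes> (int_power A u k \<otimes> (\<alpha> \<otimes> int_power A \<alpha> a))))"
      unfolding 5 i Uq2_monomial_def split
      using cl triple_rel triple_u_central by (intro commute_past) auto
    with alpha_int_power [of a] have "x \<otimes> \<mu> i = complex_of_real q ^ (b + c) \<odot> \<mu> (k, a + 1, b, c) \<or>
      x \<otimes> \<mu> i = complex_of_real q ^ (b + c) \<odot> \<mu> (k, a + 1, b, c) \<oplus>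
        (complex_of_real q ^ (b + c) * (- (complex_of_real q)\<^sup>2)) \<odot> \<mu> (k, a + 1, Suc b, Suc c)"
      unfolding Uq2_monomial_def split
      using cl by (auto simp: r_distr scal_mult scal_add ext simp del: nat_pow_Suc)
    with single add show ?thesis by metis
  next
    case 6
    have q': "complex_of_real q \<noteq> 0" using q by simp
    have "star A \<gamma> \<otimes> star A \<alpha> = complex_of_real q \<odot> (star A \<alpha> \<otimes> star A \<gamma>)"
      "\<gamma> \<otimes> star A \<alpha> = complex_of_real q \<odot> (star A \<alpha> \<otimes> \<gamma>)"
      using arg_cong [OF triple_rel(3), of "star A"] arg_cong [OF triple_rel(5), of "star A"] cl
      by (simp_all add: star_mult star_smult star_star)
    \<comment> \<open>The adjoints of the q-commutation relations, solved in the other direction;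
      this is where q must be invertible.\<close>
    then have c: "star A \<alpha> \<otimes> \<gamma> = inverse (complex_of_real q) \<odot> (\<gamma> \<otimes> star A \<alpha>)"
      "star A \<alpha> \<otimes> star A \<gamma> = inverse (complex_of_real q) \<odot> (star A \<gamma> \<otimes> star A \<alpha>)"
      using cl q' by simp_all
    have "x \<otimes> \<mu> i = inverse (complex_of_real q) ^ (b + c) \<odot> (\<gamma> [^] b \<otimes> (star A \<gamma> [^] c \<otimes> (int_power A u k \<otimes> (star A \<alpha> \<otimes> int_power A \<alpha> a))))"
      unfolding 6 i Uq2_monomial_def split
      using cl c triple_u_central by (intro commute_past) auto
    with alpha_star_int_power [of a] have "x \<otimes> \<mu> i = inverse (complex_of_real q) ^ (b + c) \<odot> \<mu> (k, a - 1, b, c) \<or>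
      x \<otimes> \<mu> i = inverse (complex_of_real q) ^ (b + c) \<odot> \<mu> (k, a - 1, b, c) \<oplus>
        (inverse (complex_of_real q) ^ (b + c) * (- 1)) \<odot> \<mu> (k, a - 1, Suc b, Suc c)"
      unfolding Uq2_monomial_def split
      using cl by (auto simp: r_distr scal_mult scal_add ext simp del: nat_pow_Suc)
    with single add show ?thesis by metis
  qed
qed

text \<open>The span of the monomials is stable under left multiplication by the generators, hence
  by everything they generate, and it contains 1.\<close>

lemma monomials_span:
  assumes "x \<in> generated_alg A {u, star A u, \<alpha>, star A \<alpha>, \<gamma>, star A \<gamma>}" (is "_ \<in> generated_alg A ?X")
  shows "\<exists>p. x = lin_comb A \<mu> p"
proof -
  have X: "?X \<subseteq> carrier A" using triple_closed star_closed by auto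
  have add: "\<exists>p. lin_comb A \<mu> p1 \<oplus> lin_comb A \<mu> p2 = lin_comb A \<mu> p" for p1 p2
    by (metis lin_comb_add monomial_closed)
  have scal: "\<exists>p'. r \<odot> lin_comb A \<mu> p = lin_comb A \<mu> p'" for r p
  proof (induction p rule: laurent_induct)
    case (single d c)
    show ?case by (rule exI [of _ "Poly_Mapping.single d (r * c)"]) (simp add: lin_comb_single)
  next
    case (add p p')
    then obtain s s' where "r \<odot> lin_comb A \<mu> p = lin_comb A \<mu> s" "r \<odot> lin_comb A \<mu> p' = lin_comb A \<mu> s'" by blast
    then show ?case by (intro exI [of _ "s + s'"]) (simp add: lin_comb_add scal_add)
  qed
  have "\<exists>p'. x \<otimes> lin_comb A \<mu> p = lin_comb A \<mu> p'" for p
    using assms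
  proof (induction arbitrary: p)
    case (incl x)
    show ?case
    proof (induction p rule: laurent_induct)
      case (single d c)
      obtain s where "x \<otimes> \<mu> d = lin_comb A \<mu> s" using monomial_step [OF incl] by blast
      then show ?case using scal [of c s] X incl by (auto simp: lin_comb_single scal_mult)
    next
      case (add p p')
      then obtain s s' where "x \<otimes> lin_comb A \<mu> p = lin_comb A \<mu> s" "x \<otimes> lin_comb A \<mu> p' = lin_comb A \<mu> s'" by blast
      moreover have "x \<in> carrier A" using X incl by blast
      ultimately show ?case by (intro exI [of _ "s + s'"]) (simp add: lin_comb_add r_distr)
    qed
  next
    case one
    show ?case by auto
  next
    case (add x y)
    then obtain s s' where "x \<otimes> lin_comb A \<mu> p = lin_comb A \<mu> s" "y \<otimes> lin_comb A \<mu> p = lin_comb A \<mu> s'" by blast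
    then show ?case using add.hyps generated_subset [OF X]
      by (intro exI [of _ "s + s'"]) (simp add: lin_comb_add l_distr subset_eq)
  next
    case (mult x y)
    then obtain s where "y \<otimes> lin_comb A \<mu> p = lin_comb A \<mu> s" by blast
    moreover obtain s' where "x \<otimes> lin_comb A \<mu> s = lin_comb A \<mu> s'" using mult.IH(1) by blast
    ultimately show ?case using mult.hyps generated_subset [OF X] by (intro exI [of _ s']) (simp add: m_assoc subset_eq)
  next
    case (smult x r)
    then obtain s where "x \<otimes> lin_comb A \<mu> p = lin_comb A \<mu> s" by blast
    then show ?case using smult.hyps generated_subset [OF X] scal [of r s] by (auto simp: scal_mult subset_eq)
  qed
  \<comment> \<open>Stability is applied to the monomial with all exponents zero, which is the
    unit.\<close>
  then obtain p where "x \<otimes> lin_comb A \<mu> (Poly_Mapping.single (0, 0, 0, 0) 1) = lin_comb A \<mu> p" by blast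
  moreover have "lin_comb A \<mu> (Poly_Mapping.single (0, 0, 0, 0) 1) = \<one>"
    by (simp add: lin_comb_single) (simp add: Uq2_monomial_def int_power_def triple_closed star_closed del: pow_nat)
  ultimately show ?thesis using generated_subset [OF X] assms by (intro exI [of _ p]) auto
qed

end

end

section \<open>Matrix coefficients of the monomials\<close>

lemma diag_op_pow:
  assumes "\<And>n. cmod (d n) \<le> 1" "x \<in> l2"
  shows "(diag_op d [^]\<^bsub>B_l2\<^esub> (b::nat)) x = (\<lambda>n. d n ^ b * x n)"
proof -
  interpret B: star_algebra B_l2 by (rule star_algebra_B_l2)
  have d: "diag_op d \<in> carrier B_l2" using diag_op_bounded [OF assms(1)] by simp
  have "(diag_op d [^]\<^bsub>B_l2\<^esub> b) x = (\<lambda>n. d n ^ b * x n)" if "x \<in> l2" for x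
    using that
  proof (induction b arbitrary: x)
    case (Suc b)
    have "diag_op d x \<in> l2" using bounded_l2_opsD(2) [OF diag_op_bounded [OF assms(1)] Suc.prems] by simp
    from Suc.IH [OF this] show ?case using Suc.prems by (simp add: diag_op_def mult_ac)
  qed simp
  then show ?thesis using assms(2) .
qed

text \<open>Each coordinate of a shifted vector is one coordinate of x times a product of weights,
  which are nonzero from index 1 on. For negative a the raising operator leaves zeros in the first
  coordinates, whence the case \<open>int m + a < 0\<close>.\<close>

lemma lower_op_pow:
  assumes "\<And>n. \<bar>w n\<bar> \<le> 1" and nz: "\<And>n. w (Suc n) \<noteq> 0"
  shows "\<exists>s. s \<noteq> 0 \<and> (\<forall>x\<in>l2. (int_power B_l2 (lower_op w) a) x m =
    (if int m + a < 0 then 0 else s * x (nat (int m + a))))"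
proof -
  interpret B: star_algebra B_l2 by (rule star_algebra_B_l2)
  note b = lower_op_bounded [of w, OF assms(1)] raise_op_bounded [of w, OF assms(1)]
  note l = b [THEN bounded_l2_opsD(2)]
  have ev: "lower_op w x n = of_real (w (Suc n)) * x (Suc n)"
    "raise_op w x n = (if n = 0 then 0 else of_real (w n) * x (n - 1))" if "x \<in> l2" for x n
    using that by (simp_all add: lower_op_def raise_op_def)
  have lower: "\<exists>s. s \<noteq> 0 \<and> (\<forall>x\<in>l2. (lower_op w [^]\<^bsub>B_l2\<^esub> j) x m = s * x (m + j))" for j :: nat
  proof (induction j)
    case (Suc j)
    then obtain s where "s \<noteq> 0" "\<forall>x\<in>l2. (lower_op w [^]\<^bsub>B_l2\<^esub> j) x m = s * x (m + j)" by blast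
    then show ?case using l nz [of "m + j"]
      by (intro exI [of _ "s * of_real (w (Suc (m + j)))"]) (simp add: ev)
  qed (auto intro: exI [of _ 1])
  have raise: "\<exists>s. s \<noteq> 0 \<and> (\<forall>x\<in>l2. (raise_op w [^]\<^bsub>B_l2\<^esub> j) x m = (if m < j then 0 else s * x (m - j)))" for j :: nat
  proof (induction j)
    case (Suc j)
    then obtain s where s: "s \<noteq> 0"
      "\<forall>x\<in>l2. (raise_op w [^]\<^bsub>B_l2\<^esub> j) x m = (if m < j then 0 else s * x (m - j))" by blast
    show ?case
    proof (cases "m \<le> j")
      case True
      \<comment> \<open>In this range the coordinate vanishes, so 1 serves as the nonzero
        witness.\<close>
      then show ?thesis using s l by (intro exI [of _ 1]) (auto simp: ev)
    next
      case False
      then have "w (m - j) \<noteq> 0" "m - Suc j = m - j - 1" using nz [of "m - Suc j"] by (simp_all add: Suc_diff_Suc)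
      then show ?thesis using s l False
        by (intro exI [of _ "s * of_real (w (m - j))"]) (auto simp: ev)
    qed
  qed (auto intro: exI [of _ 1])
  show ?thesis
  proof (cases "0 \<le> a")
    case True
    then show ?thesis using lower [of "nat a"] by (simp add: int_power_def nat_add_distrib del: pow_nat)
  next
    case False
    then obtain s where "s \<noteq> 0"
      "\<forall>x\<in>l2. (raise_op w [^]\<^bsub>B_l2\<^esub> nat (- a)) x m = (if m < nat (- a) then 0 else s * x (m - nat (- a)))"
      using raise by blast
    moreover have "nat (int m + a) = m - nat (- a)" "int m + a < 0 \<longleftrightarrow> m < nat (- a)" using False by auto
    ultimately show ?thesis using False
      by (intro exI [of _ s]) (simp add: int_power_def lower_op_adjoint [of w, OF assms(1)] del: pow_nat)
  qed
qed

text \<open>The exponent a governs the shift and the factor s, while k, b, c enter through a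
  multiplicative function of (z, w, m). As s is uniform in k, b, c, it can be divided out among
  monomials with the same a.\<close>

lemma Uq2_monomial_coefficient:
  fixes q :: real
  assumes q: "0 < q" "q < 1" and z: "cmod z = 1" and w: "cmod w = 1"
  shows "\<exists>s. s \<noteq> 0 \<and> (\<forall>x\<in>l2. \<forall>k b c. Uq2_monomial B_l2 (diag_op (\<lambda>n. z))
      (lower_op (\<lambda>n. sqrt (1 - q ^ (2 * n)))) (diag_op (\<lambda>n. w * of_real q ^ n)) (k, a, b, c) x m =
    torus_char z w (k, int b - int c) * of_real q ^ (m * (b + c)) *
      (if int m + a < 0 then 0 else s * x (nat (int m + a))))"
proof -
  interpret B: star_algebra B_l2 by (rule star_algebra_B_l2)
  have p: "q ^ n \<le> 1" "0 \<le> q ^ n" for n using q by (simp_all add: power_le_one)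
  let ?v = "\<lambda>n. sqrt (1 - q ^ (2 * n))"
  have v: "\<bar>?v n\<bar> \<le> 1" "?v (Suc n) \<noteq> 0" for n
    using p [of "2 * n"] power_Suc_less_one [OF q, of "2 * n + 1"] by auto
  have d: "cmod z \<le> 1" "cmod (inverse z) \<le> 1" "\<And>n. cmod (w * of_real q ^ n) \<le> 1" "\<And>n. cmod (cnj w * of_real q ^ n) \<le> 1"
    using z w p q by (simp_all add: norm_mult norm_power norm_inverse)
  obtain s where s: "s \<noteq> 0" "\<And>x. x \<in> l2 \<Longrightarrow> (int_power B_l2 (lower_op ?v) a) x m =
      (if int m + a < 0 then 0 else s * x (nat (int m + a)))"
    using lower_op_pow [of ?v a m] v by blast
  have nz: "z \<noteq> 0" "w \<noteq> 0" using z w by auto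
  note adj = diag_op_adjoint [OF d(1)] diag_op_adjoint [OF d(3), simplified]
  have zk: "(int_power B_l2 (diag_op (\<lambda>n. z)) k) x = (\<lambda>n. z powi k * x n)" if "x \<in> l2" for k x
    using that by (simp add: int_power_def power_int_def diag_op_pow d adj unimodular_cnj [OF z] del: pow_nat)
  note bd = diag_op_bounded [OF d(1)] diag_op_bounded [OF d(3)] diag_op_bounded [OF d(4)]
    lower_op_bounded [of ?v, OF v(1)]
  have cl: "int_power B_l2 (lower_op ?v) a \<in> bounded_l2_ops" "int_power B_l2 (diag_op (\<lambda>n. z)) k \<in> bounded_l2_ops"
    "diag_op (\<lambda>n. cnj w * of_real q ^ n) [^]\<^bsub>B_l2\<^esub> c \<in> bounded_l2_ops" for k and c :: nat
    using B.int_power_closed B.nat_pow_closed bd by simp_all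
  have "Uq2_monomial B_l2 (diag_op (\<lambda>n. z)) (lower_op ?v) (diag_op (\<lambda>n. w * of_real q ^ n)) (k, a, b, c) x m =
      torus_char z w (k, int b - int c) * of_real q ^ (m * (b + c)) * (if int m + a < 0 then 0 else s * x (nat (int m + a)))"
    if x: "x \<in> l2" for x k b c
  proof -
    define y where "y = int_power B_l2 (lower_op ?v) a x"
    have y: "y \<in> l2" unfolding y_def by (rule bounded_l2_opsD(2) [OF cl(1) x])
    note y1 = bounded_l2_opsD(2) [OF cl(2) y, of k]
    note y2 = bounded_l2_opsD(2) [OF cl(3) y1, of c]
    have "Uq2_monomial B_l2 (diag_op (\<lambda>n. z)) (lower_op ?v) (diag_op (\<lambda>n. w * of_real q ^ n)) (k, a, b, c) x m =
      (w * of_real q ^ m) ^ b * ((cnj w * of_real q ^ m) ^ c * (z powi k * y m))"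
      unfolding Uq2_monomial_def split B_l2_simps adj using x y y1 y2
      by (simp only: restrict_apply' diag_op_pow d y_def [symmetric]) (simp only: zk)
    also have "\<dots> = torus_char z w (k, int b - int c) * of_real q ^ (m * (b + c)) * y m"
    proof -
      have "(complex_of_real q ^ m) ^ b * (complex_of_real q ^ m) ^ c = complex_of_real q ^ (m * (b + c))"
        by (simp add: ring_distribs flip: power_mult power_add)
      then show ?thesis
        using nz by (simp add: torus_char_def power_mult_distrib unimodular_cnj [OF w] power_int_diff field_simps
            del: power_mult_distrib) (simp add: power_mult_distrib field_simps)
    qed
    finally show ?thesis by (simp add: y_def s(2) x)
  qed
  with s(1) show ?thesis by blast
qed

lemma generated_alg_least:
  assumes "X \<subseteq> generated_alg A Y"
  shows "generated_alg A X \<subseteq> generated_alg A Y"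
proof
  fix x assume "x \<in> generated_alg A X"
  then show "x \<in> generated_alg A Y"
    by induction (use assms in \<open>auto intro: generated_alg.intros\<close>)
qed

lemma Uq2_generators:
  fixes q :: real
  assumes "0 < q"
  defines "u \<equiv> gen_Uq2 q Gen_u" and "\<alpha> \<equiv> gen_Uq2 q Gen_alpha" and "\<gamma> \<equiv> gen_Uq2 q Gen_gamma"
  shows "carrier (Uq2_alg q) \<subseteq> generated_alg (Uq2_alg q)
    {u, star (Uq2_alg q) u, \<alpha>, star (Uq2_alg q) \<alpha>, \<gamma>, star (Uq2_alg q) \<gamma>}" (is "_ \<subseteq> generated_alg _ ?X")
proof -
  interpret A: star_algebra "Uq2_alg q" by (rule star_algebra_Uq2)
  have g: "x \<in> generated_alg (Uq2_alg q) ?X" if "x \<in> ?X" for x using that by (rule generated_alg.incl)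
  have "v_Uq2 q i j \<in> generated_alg (Uq2_alg q) ?X" for i j
    unfolding v_Uq2_eq u_def [symmetric] \<alpha>_def [symmetric] \<gamma>_def [symmetric]
    by (simp add: v_matrix_def g A.generated_zero generated_alg.mult generated_alg.smult)
  then have "entries (v_Uq2 q) \<subseteq> generated_alg (Uq2_alg q) ?X" by (auto simp: entries_def)
  then show ?thesis unfolding Uq2_generated [OF assms(1)] by (rule generated_alg_least)
qed

lemma residual_Uq2:
  assumes q: "0 < q" "q < 1"
  shows "residual (Uq2_alg q)"
proof -
  interpret A: star_algebra "Uq2_alg q" by (rule star_algebra_Uq2)
  let ?u = "gen_Uq2 q Gen_u" and ?\<alpha> = "gen_Uq2 q Gen_alpha" and ?\<gamma> = "gen_Uq2 q Gen_gamma"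
  let ?st = "star (Uq2_alg q)"
  let ?X = "{?u, ?st ?u, ?\<alpha>, ?st ?\<alpha>, ?\<gamma>, ?st ?\<gamma>}"
  let ?\<mu> = "Uq2_monomial (Uq2_alg q) ?u ?\<alpha> ?\<gamma>"
  note triple = Uq2_triple_gen [of q]
  have span: "\<exists>p. x = lin_comb (Uq2_alg q) ?\<mu> p" if "x \<in> carrier (Uq2_alg q)" for x
    using A.monomials_span [OF q(1) triple] Uq2_generators [OF q(1)] that by blast
  show ?thesis
    unfolding residual_def
  proof (intro ballI impI, rule ccontr)
    fix x assume x: "x \<in> carrier (Uq2_alg q)" "x \<noteq> \<zero>\<^bsub>Uq2_alg q\<^esub>"
      and none: "\<nexists>\<phi>. star_hom (Uq2_alg q) B_l2 \<phi> \<and> \<phi> x \<noteq> \<zero>\<^bsub>B_l2\<^esub>"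
    obtain p where p: "x = lin_comb (Uq2_alg q) ?\<mu> p" using span [OF x(1)] by blast
    have "Poly_Mapping.lookup p (k0, a0, b0, c0) = 0" for k0 a0 b0 c0
    proof -
      \<comment> \<open>The monomials of p with a fixed shift; the test vector below makes all
        others contribute zero.\<close>
      define I where "I = {i \<in> Poly_Mapping.keys p. fst (snd i) = a0}"
      \<comment> \<open>Offset that keeps \<open>m + a0\<close> nonnegative for every
        \<open>m = N + m'\<close>, so that the shifted coordinate exists.\<close>
      define N where "N = nat (- a0)"
      define \<chi> where "\<chi> = (\<lambda>(k, a :: int, b, c) (z, w, m). torus_char z w (k, int b - int c) * complex_of_real q ^ (m * (b + c)))"
      let ?M = "{(z, w, m). cmod z = 1 \<and> cmod w = 1} :: (complex \<times> complex \<times> nat) set"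
      \<comment> \<open>The offset is moved into the coefficients: \<chi> is multiplicative, and its
        value at (1, 1, N) is a nonzero power of q that cancels afterwards. The third parameter can
        thus run over the whole semigroup of naturals.\<close>
      have "\<forall>i\<in>I. Poly_Mapping.lookup p i * \<chi> i (1, 1, N) = 0"
      proof (rule characters_independent [where M = ?M and \<chi> = \<chi> and
            f = "\<lambda>(z, w, m) (z', w', m'). (z * z', w * w', m + m')"])
        show "finite I" by (simp add: I_def)
        show "\<exists>x\<in>?M. \<chi> i x \<noteq> 0" for i
          by (rule bexI [of _ "(1, 1, 0)"]) (auto simp: \<chi>_def torus_char_def split: prod.splits)
        show "\<exists>x\<in>?M. \<chi> i x \<noteq> \<chi> j x" if ij: "i \<in> I" "j \<in> I" "i \<noteq> j" for i j
        proof -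
          obtain k b c k' b' c' where i: "i = (k, a0, b, c)" and j: "j = (k', a0, b', c')"
            using ij unfolding I_def by (cases i, cases j) auto
          show ?thesis
          proof (cases "(k, int b - int c) = (k', int b' - int c')")
            case True
            \<comment> \<open>The phases see k and b - c. If these agree, distinct monomials must
              differ in b + c, and powers of q with different exponents are different because 0 < q
              < 1.\<close>
            with ij(3) i j have "b + c \<noteq> b' + c'" by auto
            then have "q ^ (b + c) \<noteq> q ^ (b' + c')" using q by (metis power_inject_exp' less_irrefl)
            then have "complex_of_real q ^ (b + c) \<noteq> complex_of_real q ^ (b' + c')"
              by (metis of_real_eq_iff of_real_power)
            then show ?thesis
              by (intro bexI [of _ "(1, 1, 1)"]) (simp_all add: \<chi>_def torus_char_def i j)
          next
            case False
            then obtain z w where "cmod z = 1" "cmod w = 1"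
              "torus_char z w (k, int b - int c) \<noteq> torus_char z w (k', int b' - int c')"
              using torus_chars_distinct by blast
            then show ?thesis
              by (intro bexI [of _ "(z, w, 0)"]) (simp_all add: \<chi>_def i j)
          qed
        qed
        show "(\<Sum>i\<in>I. Poly_Mapping.lookup p i * \<chi> i (1, 1, N) * \<chi> i y) = 0" if "y \<in> ?M" for y
        proof -
          obtain z w m' where y: "y = (z, w, m')" and zw: "cmod z = 1" "cmod w = 1" using \<open>y \<in> ?M\<close> by auto
          let ?b = "(diag_op (\<lambda>n. z))" and ?l = "lower_op (\<lambda>n. sqrt (1 - q ^ (2 * n)))" and ?d = "diag_op (\<lambda>n. w * complex_of_real q ^ n)"
          define m where "m = N + m'"
          \<comment> \<open>The unit vector that a shift by \<open>a0\<close> brings to coordinate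
            m; any other shift brings a zero there.\<close>
          define e where "e = unit (nat (int m + a0))"
          have e: "e \<in> l2" "e (nat (int m + a0)) = 1" by (simp_all add: e_def) (simp add: unit_def)
          obtain f where f: "star_hom (Uq2_alg q) B_l2 f" "f ?u = ?b" "f ?\<alpha> = ?l" "f ?\<gamma> = ?d"
            using Uq2_triple_universal [OF star_algebra_B_l2 Uq2_representation [OF q zw]] by blast
          obtain s where s: "s \<noteq> 0" "\<And>x k b c. x \<in> l2 \<Longrightarrow> Uq2_monomial B_l2 ?b ?l ?d (k, a0, b, c) x m =
              torus_char z w (k, int b - int c) * of_real q ^ (m * (b + c)) *
              (if int m + a0 < 0 then 0 else s * x (nat (int m + a0)))"
            using Uq2_monomial_coefficient [OF q zw, of a0 m] by blast
          have m: "0 \<le> int m + a0" by (simp add: m_def N_def)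
          have lin: "linear_map (Uq2_alg q) complex_alg (\<lambda>x. f x e m)"
            unfolding e_def using linear_map_compose [OF alg_hom_linear [OF star_hom_alg [OF f(1)]] linear_map_coefficient] .
          have mono: "f (?\<mu> i) e m = (if i \<in> I then s * (\<chi> i (1, 1, N) * \<chi> i y) else 0)"
            if "i \<in> Poly_Mapping.keys p" for i
          proof -
            obtain k a b c where i: "i = (k, a, b, c)" by (cases i)
            have fi: "f (?\<mu> i) = Uq2_monomial B_l2 ?b ?l ?d i"
              using star_hom_Uq2_monomial [OF f(1) star_algebra_Uq2 star_algebra_B_l2] f(2-4) by simp
            show ?thesis
            proof (cases "a = a0")
              case True
              show ?thesis
                unfolding fi [unfolded i True] i True s(2) [OF e(1)] using that e m True
                by (simp add: i I_def \<chi>_def y torus_char_def m_def power_add ring_distribs mult_ac)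
            next
              case False
              obtain s' where s': "\<And>x k b c. x \<in> l2 \<Longrightarrow> Uq2_monomial B_l2 ?b ?l ?d (k, a, b, c) x m =
                  torus_char z w (k, int b - int c) * of_real q ^ (m * (b + c)) *
                  (if int m + a < 0 then 0 else s' * x (nat (int m + a)))"
                using Uq2_monomial_coefficient [OF q zw, of a m] by blast
              have "e (nat (int m + a)) = 0" if "\<not> int m + a < 0"
                using False that m by (auto simp: e_def unit_def)
              then show ?thesis using False e by (auto simp: fi [unfolded i] i s' I_def)
            qed
          qed
          have "f x = \<zero>\<^bsub>B_l2\<^esub>" using none f(1) by blast
          then have "0 = f x e m" using e by simp
          also have "\<dots> = (\<Sum>i\<in>Poly_Mapping.keys p. f (Poly_Mapping.lookup p i \<odot>\<^bsub>Uq2_alg q\<^esub> ?\<mu> i) e m)"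
            unfolding p lin_comb_def
            by (subst linear_map_finsum [OF lin star_algebra_Uq2 star_algebra_complex])
              (auto simp: finsum_complex A.monomial_closed [OF q(1) triple])
          also have "\<dots> = (\<Sum>i\<in>Poly_Mapping.keys p. Poly_Mapping.lookup p i * f (?\<mu> i) e m)"
            using linear_mapD(3) [OF lin] A.monomial_closed [OF q(1) triple] by simp
          also have "\<dots> = (\<Sum>i\<in>Poly_Mapping.keys p. if i \<in> I then s * (Poly_Mapping.lookup p i * \<chi> i (1, 1, N) * \<chi> i y) else 0)"
            by (intro sum.cong HOL.refl) (simp add: mono mult_ac)
          also have "\<dots> = (\<Sum>i\<in>I. s * (Poly_Mapping.lookup p i * \<chi> i (1, 1, N) * \<chi> i y))"
            by (simp add: I_def sum.inter_filter)
          finally show ?thesis using s(1) by (simp add: sum_distrib_left [symmetric])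
        qed
      qed (auto simp: \<chi>_def torus_char_def norm_mult power_int_mult_distrib power_add ring_distribs mult_ac)
      then have "\<forall>i\<in>I. Poly_Mapping.lookup p i = 0"
        using q by (auto simp: \<chi>_def torus_char_def)
      then show ?thesis by (cases "(k0, a0, b0, c0) \<in> Poly_Mapping.keys p") (auto simp: I_def in_keys_iff)
    qed
    then have "p = 0" by (intro poly_mapping_eqI) (auto simp: split_paired_all)
    then show False using x(2) by (simp add: p lin_comb_def)
  qed
qed

section \<open>Hopf structures and gradings\<close>

lemma matrix_generated_Uq2:
  assumes "0 < q" "q < 1"
  shows "matrix_generated (Uq2_alg q) q (v_Uq2 q)"
  by (intro matrix_generated.intro matrix_generated_axioms.intro SUq3_matrix_Uq2 Uq2_generated assms(1)
      residual_separated star_algebra_Uq2 residual_Uq2 assms)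

context matrix_generated begin

text \<open>The coproduct matrix is the product of the solutions in the two legs, and entries from
  different legs commute.\<close>

lemma SUq3_matrix_comult: "SUq3_matrix AT q (matrix_comult A a)"
proof (intro SUq3_matrix.intro SUq3_matrix_axioms.intro AA.star_algebra_tensor q_pos)
  have "star_hom A AT (\<lambda>x. AA.pure x \<one>)" "star_hom A AT (\<lambda>x. AA.pure \<one> x)"
    by (auto simp: star_hom_def AA.pure_mult AA.pure_add_left AA.pure_add_right AA.pure_smult_left
        AA.pure_smult_right AA.pure_star tensor_alg_simps(1) intro!: alg_homI)
  from this [THEN SUq3_relations_hom [OF star_algebra_axioms AA.star_algebra_tensor _ rel]]
  have m: "SUq3_matrix AT q (\<lambda>i j. AA.pure (a i j) \<one>)" "SUq3_matrix AT q (\<lambda>i j. AA.pure \<one> (a i j))"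
    by (auto intro!: SUq3_matrix.intro SUq3_matrix_axioms.intro AA.star_algebra_tensor q_pos)
  have "SUq3_relations q AT (\<lambda>i j. \<Oplus>\<^bsub>AT\<^esub>k\<in>{1..3}. AA.pure (a i k) \<one> \<otimes>\<^bsub>AT\<^esub> AA.pure \<one> (a k j))"
    by (rule SUq3_relations_mult [OF m]) (simp add: AA.pure_mult del: atLeastAtMost_iff)
  also have "?this \<longleftrightarrow> SUq3_relations q AT (matrix_comult A a)"
    by (rule SUq3_relations_cong)
      (simp add: matrix_comult_def AA.pure_mult del: atLeastAtMost_iff cong: finsum_scong)
  finally show "SUq3_relations q AT (matrix_comult A a)" .
qed

lemma pure_zero: "x \<in> carrier A \<Longrightarrow> AA.pure \<zero> x = \<zero>\<^bsub>AT\<^esub>" "x \<in> carrier A \<Longrightarrow> AA.pure x \<zero> = \<zero>\<^bsub>AT\<^esub>"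
  using AA.pure_smult_left [of \<zero> x 0] AA.pure_smult_right [of x \<zero> 0] AA.pure_closed [of \<zero> x] AA.pure_closed [of x \<zero>]
  by simp_all

lemma block_matrix_comult:
  assumes "block_matrix A a"
  shows "block_matrix AT (matrix_comult A a)"
proof -
  have z: "a 1 2 = \<zero>" "a 1 3 = \<zero>" "a 2 1 = \<zero>" "a 3 1 = \<zero>" using assms by (simp_all add: block_matrix_def)
  show ?thesis
    unfolding block_matrix_def matrix_comult_def by (simp add: AA.T.finsum_three Pi_iff) (simp add: z pure_zero)
qed

text \<open>The inputs are a coproduct, a map \<open>p\<close> to the torus and the unitary
  antipode. Following \<open>p\<close> by torus characters gives all diagonal characters: the point
  (1, 1) is the counit, and other points rescale the unitary antipode into the antipode.\<close>

lemma matrix_hopf_structure: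
  assumes D: "\<exists>D. star_hom A AT D \<and> (\<forall>i\<in>{1..3}. \<forall>j\<in>{1..3}. D (a i j) = matrix_comult A a i j)"
    and p: "star_hom A torus_alg p" "\<And>i j. i \<in> {1..3} \<Longrightarrow> j \<in> {1..3} \<Longrightarrow> p (a i j) = diag_T2 i j"
    and R: "\<exists>R. star_hom A (opposite A) R \<and> (\<forall>i\<in>{1..3}. \<forall>j\<in>{1..3}.
      R (a i j) = (complex_of_real q powi (int j - int i)) \<odot> star A (a j i))"
  shows "\<exists>D e S. matrix_hopf A a = make_hopf A D e S \<and> matrix_hopf_algebra A q a D e S"
proof -
  let ?D = "matrix_star_map A AT a (matrix_comult A a)"
  let ?e = "matrix_star_map A complex_alg a (\<lambda>i j. if i = j then 1 else 0)"
  let ?S = "matrix_alg_map A (opposite A) a (\<lambda>i j. star A (a j i))"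
  have ch: "alg_hom A complex_alg (\<lambda>y. lin_comb complex_alg (torus_char z w) (p y))"
    "lin_comb complex_alg (torus_char z w) (p (a i j)) =
      (if i \<noteq> j then 0 else if i = 1 then z else if i = 2 then w else inverse (z * w))"
    if "z \<noteq> 0" "w \<noteq> 0" "i \<in> {1..3}" "j \<in> {1..3}" for z w i j
  proof -
    show "alg_hom A complex_alg (\<lambda>y. lin_comb complex_alg (torus_char z w) (p y))"
      by (rule alg_hom_compose [OF star_hom_alg [OF p(1)] torus_char_alg_hom [OF that(1,2)]])
    have "lin_comb complex_alg (torus_char z w) (U_monom d) = torus_char z w d"
      "lin_comb complex_alg (torus_char z w) 0 = 0" for d
      using torus_char_props [OF that(1,2)] by (simp_all add: lin_comb_U [OF star_algebra_complex])
    then show "lin_comb complex_alg (torus_char z w) (p (a i j)) =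
      (if i \<noteq> j then 0 else if i = 1 then z else if i = 2 then w else inverse (z * w))"
      using that by (simp add: p(2) diag_T2_eq column_degree_def torus_char_def power_int_minus field_simps
          del: atLeastAtMost_iff)
  qed
  have "star_hom A complex_alg (\<lambda>y. lin_comb complex_alg (torus_char 1 1) (p y))"
    by (rule star_hom_compose [OF p(1) torus_char_star_hom]) simp_all
  then have "star_hom A complex_alg ?e" "\<And>i j. i \<in> {1..3} \<Longrightarrow> j \<in> {1..3} \<Longrightarrow> ?e (a i j) = (if i = j then 1 else 0)"
    by (rule matrix_star_map, simp add: ch(2) del: atLeastAtMost_iff)+
  moreover have "star_hom A AT ?D" "\<And>i j. i \<in> {1..3} \<Longrightarrow> j \<in> {1..3} \<Longrightarrow> ?D (a i j) = matrix_comult A a i j"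
    using D matrix_star_map [of AT] by blast+
  ultimately interpret matrix_bialgebra A q a ?D ?e by unfold_locales
  obtain R where R: "star_hom A (opposite A) R" "\<And>i j. i \<in> {1..3} \<Longrightarrow> j \<in> {1..3} \<Longrightarrow>
      R (a i j) = (complex_of_real q powi (int j - int i)) \<odot> star A (a j i)"
    using assms(4) by blast
  have "\<exists>S. alg_hom A (opposite A) S \<and> (\<forall>i\<in>{1..3}. \<forall>j\<in>{1..3}. S (a i j) = star A (a j i))"
  proof (rule antipode_exists [OF _ star_hom_alg [OF R(1)] R(2)])
    fix z w :: complex assume "z \<noteq> 0" "w \<noteq> 0"
    note c = ch [OF this]
    show "\<exists>f. alg_hom A complex_alg f \<and> (\<forall>i\<in>{1..3}. \<forall>j\<in>{1..3}.
        f (a i j) = (if i \<noteq> j then 0 else if i = 1 then z else if i = 2 then w else inverse (z * w)))"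
      by (intro exI [of _ "\<lambda>y. lin_comb complex_alg (torus_char z w) (p y)"] conjI ballI c(2) c(1) [of 1 1]) simp_all
  qed
  then obtain S where S: "alg_hom A (opposite A) S" "\<And>i j. i \<in> {1..3} \<Longrightarrow> j \<in> {1..3} \<Longrightarrow> S (a i j) = star A (a j i)"
    by blast
  have "alg_hom A (opposite A) ?S" "\<And>i j. i \<in> {1..3} \<Longrightarrow> j \<in> {1..3} \<Longrightarrow> ?S (a i j) = star A (a j i)"
    by (rule matrix_alg_map [OF S]; assumption)+
  then have "matrix_hopf_algebra A q a ?D ?e ?S" by unfold_locales
  moreover have "matrix_hopf A a = make_hopf A ?D ?e ?S" by (simp add: matrix_hopf_def matrix_comult_def [abs_def])
  ultimately show ?thesis by blast
qed

end

lemma pi0_exists: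
  assumes "0 < q"
  shows "\<exists>p. star_hom (SUq3_alg q) torus_alg p \<and> (\<forall>i\<in>{1..3}. \<forall>j\<in>{1..3}. p (u_SUq3 q i j) = diag_T2 i j)"
  by (rule SUq3_universal [OF assms star_algebra_torus residual_torus SUq3_matrix.rel [OF SUq3_matrix_torus [OF assms]]])

lemma pi1_exists:
  assumes "0 < q"
  shows "\<exists>p. star_hom (Uq2_alg q) torus_alg p \<and> (\<forall>i\<in>{1..3}. \<forall>j\<in>{1..3}. p (v_Uq2 q i j) = diag_T2 i j)"
  by (rule Uq2_universal [OF SUq3_matrix_torus [OF assms]]) (simp add: block_matrix_def diag_T2_def)

lemma SUq3_hopf:
  assumes "0 < q"
  shows "\<exists>D e S. O_SUq3 q = make_hopf (SUq3_alg q) D e S \<and> matrix_hopf_algebra (SUq3_alg q) q (u_SUq3 q) D e S"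
proof -
  interpret matrix_generated "SUq3_alg q" q "u_SUq3 q" by (rule matrix_generated_SUq3 [OF assms])
  obtain p where "star_hom (SUq3_alg q) torus_alg p" "\<And>i j. i \<in> {1..3} \<Longrightarrow> j \<in> {1..3} \<Longrightarrow> p (u_SUq3 q i j) = diag_T2 i j"
    using pi0_exists [OF assms] by blast
  then show ?thesis
    unfolding O_SUq3_eq using residual_SUq3 [OF assms]
    by (intro matrix_hopf_structure SUq3_universal AA.star_algebra_tensor residual_tensor star_algebra_axioms
        star_algebra_opposite residual_opposite SUq3_relations_opposite assms SUq3_matrix.rel [OF SUq3_matrix_comult]
        SUq3_matrix_axioms)
qed

lemma Uq2_hopf:
  assumes "0 < q" "q < 1"
  shows "\<exists>D e S. O_Uq2 q = make_hopf (Uq2_alg q) D e S \<and> matrix_hopf_algebra (Uq2_alg q) q (v_Uq2 q) D e S"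
proof -
  interpret matrix_generated "Uq2_alg q" q "v_Uq2 q" by (rule matrix_generated_Uq2 [OF assms])
  obtain p where p: "star_hom (Uq2_alg q) torus_alg p" "\<And>i j. i \<in> {1..3} \<Longrightarrow> j \<in> {1..3} \<Longrightarrow> p (v_Uq2 q i j) = diag_T2 i j"
    using pi1_exists [OF assms(1)] by blast
  show ?thesis
    unfolding O_Uq2_def
  proof (rule matrix_hopf_structure [OF _ p])
    show "\<exists>D. star_hom (Uq2_alg q) AT D \<and> (\<forall>i\<in>{1..3}. \<forall>j\<in>{1..3}. D (v_Uq2 q i j) = matrix_comult (Uq2_alg q) (v_Uq2 q) i j)"
      by (rule Uq2_universal [OF SUq3_matrix_comult block_matrix_comult [OF block_v_Uq2]])
    show "\<exists>R. star_hom (Uq2_alg q) (opposite (Uq2_alg q)) R \<and> (\<forall>i\<in>{1..3}. \<forall>j\<in>{1..3}. R (v_Uq2 q i j) =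
        (complex_of_real q powi (int j - int i)) \<odot>\<^bsub>Uq2_alg q\<^esub> star (Uq2_alg q) (v_Uq2 q j i))"
    proof (rule Uq2_universal)
      show "SUq3_matrix (opposite (Uq2_alg q)) q (\<lambda>i j. (complex_of_real q powi (int j - int i)) \<odot>\<^bsub>Uq2_alg q\<^esub> star (Uq2_alg q) (v_Uq2 q j i))"
        by (intro SUq3_matrix.intro SUq3_matrix_axioms.intro star_algebra_opposite star_algebra_axioms q_pos
            SUq3_relations_opposite SUq3_matrix_axioms)
      show "block_matrix (opposite (Uq2_alg q)) (\<lambda>i j. (complex_of_real q powi (int j - int i)) \<odot>\<^bsub>Uq2_alg q\<^esub> star (Uq2_alg q) (v_Uq2 q j i))"
        using block_v_Uq2 [of q] by (simp add: block_matrix_def)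
    qed
  qed
qed

section \<open>Gradings as torus coactions\<close>

inductive_set additive_span :: "('a, 'm) star_alg_scheme \<Rightarrow> 'a set \<Rightarrow> 'a set"
  for A :: "('a, 'm) star_alg_scheme" and X :: "'a set" where
  incl: "x \<in> X \<Longrightarrow> x \<in> additive_span A X"
| add: "x \<in> additive_span A X \<Longrightarrow> y \<in> additive_span A X \<Longrightarrow> x \<oplus>\<^bsub>A\<^esub> y \<in> additive_span A X"

locale graded_coaction = star_algebra_pair A torus_alg
  for A :: "('a, 'm) star_alg_scheme" and c :: "'a \<Rightarrow> ('a, laurent2) tensor" and X :: "('a \<times> (int \<times> int)) set" +
  assumes c_hom: "alg_hom A T c"
    and X_closed: "(x, d) \<in> X \<Longrightarrow> x \<in> carrier A" and c_X: "(x, d) \<in> X \<Longrightarrow> c x = pure x (U_monom d)"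
begin

lemma homogeneous_coaction:
  assumes "(x, d) \<in> homogeneous A X"
  shows "x \<in> carrier A \<and> c x = pure x (U_monom d)"
  using assms
proof induction
  case (zero d)
  have "pure \<zero>\<^bsub>A\<^esub> (U_monom d) = \<zero>\<^bsub>T\<^esub>"
    using pure_smult_left [of "\<zero>\<^bsub>A\<^esub>" "U_monom d" 0] pure_closed [of "\<zero>\<^bsub>A\<^esub>" "U_monom d"] by simp
  then show ?case
    by (simp add: linear_map_zero [OF alg_hom_linear [OF c_hom] A.star_algebra_axioms star_algebra_tensor])
next
  case one
  show ?case by (simp add: alg_homD [OF c_hom] tensor_alg_simps U_monom_0 flip: zero_prod_def)
qed (use X_closed c_X in \<open>auto simp: alg_homD [OF c_hom] pure_mult U_monom_add pure_add_left pure_smult_left\<close>)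

text \<open>Sums of homogeneous elements form a subalgebra: products distribute over the sums, and
  scalars stay within each homogeneous component.\<close>

lemma homogeneous_span:
  assumes "x \<in> generated_alg A (fst ` X)"
  shows "x \<in> additive_span A (fst ` homogeneous A X)" (is "_ \<in> ?S")
proof -
  have Sc: "x \<in> carrier A" if "x \<in> ?S" for x
    using that by induction (use homogeneous_coaction in auto)
  have mult: "x \<otimes>\<^bsub>A\<^esub> y \<in> ?S" if x: "x \<in> ?S" and y: "y \<in> ?S" for x y
    using x
  proof induction
    case (incl x)
    then obtain d where d: "(x, d) \<in> homogeneous A X" by auto
    then have "x \<in> carrier A" using homogeneous_coaction by blast
    from y show ?case
    proof induction
      case (incl y)
      then obtain e where "(y, e) \<in> homogeneous A X" by auto
      from homogeneous.mult [OF d this] show ?case by (intro additive_span.incl) force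
    next
      case (add y y')
      then show ?case using \<open>x \<in> carrier A\<close> Sc by (simp add: A.r_distr additive_span.add)
    qed
  next
    case (add x x')
    then show ?case using y Sc by (simp add: A.l_distr additive_span.add)
  qed
  have smult: "r \<odot>\<^bsub>A\<^esub> x \<in> ?S" if "x \<in> ?S" for x r
    using that
  proof induction
    case (incl x)
    then obtain d where "(x, d) \<in> homogeneous A X" by auto
    from homogeneous.smult [OF this, of r] show ?case by (intro additive_span.incl) force
  next
    case (add x x')
    then show ?case using Sc by (simp add: A.scal_add additive_span.add)
  qed
  show ?thesis using assms
  proof induction
    case (incl x)
    then show ?case by (auto intro!: additive_span.incl intro: homogeneous.gen rev_image_eqI)
  next
    case one
    show ?case using homogeneous.one [of A X] by (intro additive_span.incl) force
  qed (simp_all add: additive_span.add mult smult)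
qed

text \<open>The slice \<open>P\<close> reads off the coefficient of \<open>U_monom d\<close> in the
  second leg, so \<open>P (c x)\<close> is the degree d part of x. It is homogeneous because x is a
  sum of homogeneous elements, and for an element of coaction degree d it returns the element
  itself.\<close>

lemma homogeneous_of_coaction:
  assumes gen: "carrier A \<subseteq> generated_alg A (fst ` X)" and sep: "separated A"
    and y: "y \<in> carrier A" "c y = pure y (U_monom d)"
  shows "(y, d) \<in> homogeneous A X"
proof -
  let ?g = "\<lambda>a t. Poly_Mapping.lookup t d \<odot>\<^bsub>A\<^esub> a"
  define P where "P = tensor_lift A ?g"
  note bil = bilinear_scal_right [OF linear_map_lookup]
  note lin = tensor_lift_linear [OF A.star_algebra_axioms sep bil, of d, folded P_def]
  have P: "P (pure a (U_monom e)) = (if e = d then a else \<zero>\<^bsub>A\<^esub>)" if "a \<in> carrier A" for a e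
    using tensor_lift_pure [OF A.star_algebra_axioms sep bil, of a "U_monom e" d] that
    by (simp add: P_def U_monom_def lookup_single when_def)
  have "(P (c x), d) \<in> homogeneous A X \<and> x \<in> carrier A" if "x \<in> additive_span A (fst ` homogeneous A X)" for x
    using that
  proof induction
    case (incl x)
    then obtain e where e: "(x, e) \<in> homogeneous A X" by auto
    then show ?case using homogeneous_coaction [OF e] P [of x e] homogeneous.zero [of A d X] by auto
  next
    case (add x x')
    then show ?case
      by (simp add: alg_homD [OF c_hom] linear_mapD [OF lin] homogeneous.add)
  qed
  then have "(P (c y), d) \<in> homogeneous A X" using homogeneous_span gen y(1) by blast
  then show ?thesis using y P by simp
qed

end

context matrix_bialgebra begin

context
  fixes p
  assumes p_hom: "star_hom A torus_alg p"
    and p_entry: "\<forall>i\<in>{1..3}. \<forall>j\<in>{1..3}. p (a i j) = diag_T2 i j"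
begin

definition coaction :: "'a \<Rightarrow> ('a, laurent2) tensor" where
  "coaction x = tensor_map A torus_alg (\<lambda>x. x) p (D x)"

interpretation At: star_algebra_pair A torus_alg
  by (intro star_algebra_pair.intro star_algebra_axioms star_algebra_torus)

lemma coaction_star_hom: "star_hom A At.T coaction"
  unfolding coaction_def
  by (intro star_hom_compose [OF D_hom] tensor_map_star_hom star_algebra_axioms star_algebra_torus star_hom_id p_hom)

text \<open>The map \<open>p\<close> kills the entries off the diagonal, so one term of the
  coproduct survives and carries the exponent of column j. The identity as \<open>f\<close> gives
  the coaction; a homomorphism into O(U_q(2)) gives the coaction of its values.\<close>

lemma map_comult_diag:
  assumes "star_algebra B" "alg_hom A B f" "i \<in> {1..3}" "j \<in> {1..3}"
  shows "tensor_map B torus_alg f p (D (a i j)) = pure_tensor B torus_alg (f (a i j)) (U_monom (column_degree j))"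
proof -
  interpret B: star_algebra_pair B torus_alg
    by (intro star_algebra_pair.intro assms(1) star_algebra_torus)
  note pa = star_hom_alg [OF p_hom]
  note s = star_algebra_axioms star_algebra_axioms assms(1) star_algebra_torus
  note pr = tensor_map_pure [OF s alg_hom_linear [OF assms(2)] alg_hom_linear [OF pa]]
  have fc: "f (a k l) \<in> carrier B" if "k \<in> {1..3}" "l \<in> {1..3}" for k l
    using alg_homD(1) [OF assms(2) entry [OF that]] .
  have z: "B.pure b 0 = \<zero>\<^bsub>B.T\<^esub>" if "b \<in> carrier B" for b
    using B.pure_smult_right [of b 0 0] B.pure_closed [of b 0] that by simp
  have "tensor_map B torus_alg f p (D (a i j)) = (\<Oplus>\<^bsub>B.T\<^esub>k\<in>{1..3}. B.pure (f (a i k)) (diag_T2 k j))"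
    using assms(3,4)
    by (subst lift_D_entry [OF B.star_algebra_tensor alg_hom_linear [OF tensor_map_alg_hom [OF s assms(2) pa]]])
      (auto intro!: finsum_scong [unfolded simp_implies_def] simp: pr p_entry simp del: atLeastAtMost_iff)
  also have "\<dots> = B.pure (f (a i j)) (diag_T2 j j)"
    by (rule B.T.finsum_delta) (use assms(3,4) fc z in \<open>auto simp: diag_T2_eq simp del: atLeastAtMost_iff\<close>)
  finally show ?thesis by (simp add: diag_T2_eq)
qed

lemma coaction_entry:
  "i \<in> {1..3} \<Longrightarrow> j \<in> {1..3} \<Longrightarrow> coaction (a i j) = At.pure (a i j) (U_monom (column_degree j))"
  unfolding coaction_def by (rule map_comult_diag [OF star_algebra_axioms star_hom_alg [OF star_hom_id]])

text \<open>The counit in the first leg undoes the coaction, so a torus map can be recovered from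
  the degrees it defines.\<close>

lemma torus_map_of_coaction:
  assumes "x \<in> carrier A"
  shows "p x = tensor_lift torus_alg (\<lambda>b t. e b \<odot>\<^bsub>torus_alg\<^esub> t) (coaction x)"
proof -
  note L = At.tensor_lift_scal_left [OF separated_torus e_alg]
  note Lp = At.tensor_lift_pure [OF star_algebra_torus separated_torus At.bilinear_scal_left [OF alg_hom_linear [OF e_alg]]]
  show ?thesis
  proof (rule alg_hom_ext [OF star_hom_alg [OF p_hom] alg_hom_compose [OF star_hom_alg [OF coaction_star_hom] L] _ assms])
    fix i j :: nat assume ij: "i \<in> {1..3}" "j \<in> {1..3}"
    show "p (a i j) = tensor_lift torus_alg (\<lambda>b t. e b \<odot>\<^bsub>torus_alg\<^esub> t) (coaction (a i j))"
      using ij Lp [of "a i j" "U_monom (column_degree j)"]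
      by (simp add: coaction_entry p_entry e_entry diag_T2_eq del: atLeastAtMost_iff)
  qed
qed

end

end

lemma star_U_monom: "star torus_alg (U_monom d) = U_monom (- d)"
  by (simp add: U_monom_def star_torus_single)

definition Uq2_degrees :: "real \<Rightarrow> (Uq2_elem \<times> (int \<times> int)) set" where
  "Uq2_degrees q = {(gen_Uq2 q g, degree_Uq2 g) |g. True} \<union> {(star (Uq2_alg q) (gen_Uq2 q g), - degree_Uq2 g) |g. True}"

lemma Uq2_degrees_generate:
  assumes "0 < q"
  shows "carrier (Uq2_alg q) \<subseteq> generated_alg (Uq2_alg q) (fst ` Uq2_degrees q)"
proof -
  have "gen_Uq2 q g \<in> fst ` Uq2_degrees q" for g
    by (rule image_eqI [of _ _ "(gen_Uq2 q g, degree_Uq2 g)"]) (auto simp: Uq2_degrees_def)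
  moreover have "star (Uq2_alg q) (gen_Uq2 q g) \<in> fst ` Uq2_degrees q" for g
    by (rule image_eqI [of _ _ "(star (Uq2_alg q) (gen_Uq2 q g), - degree_Uq2 g)"]) (auto simp: Uq2_degrees_def)
  ultimately have "{gen_Uq2 q Gen_u, star (Uq2_alg q) (gen_Uq2 q Gen_u), gen_Uq2 q Gen_alpha,
      star (Uq2_alg q) (gen_Uq2 q Gen_alpha), gen_Uq2 q Gen_gamma, star (Uq2_alg q) (gen_Uq2 q Gen_gamma)} \<subseteq>
      fst ` Uq2_degrees q"
    by blast
  then show ?thesis using generated_alg_mono [OF subsetD [OF Uq2_generators [OF assms]]] by (intro subsetI)
qed

section \<open>Compatibility with gradings versus commutation with the torus maps\<close>

locale SUq3_to_Uq2 =
  SU: matrix_hopf_algebra "SUq3_alg q" q "u_SUq3 q" D e S + U: matrix_hopf_algebra "Uq2_alg q" q "v_Uq2 q" D' e' S'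
  for q D e S D' e' S' +
  fixes p p'
  assumes p: "star_hom (SUq3_alg q) torus_alg p" "\<forall>i\<in>{1..3}. \<forall>j\<in>{1..3}. p (u_SUq3 q i j) = diag_T2 i j"
    and p': "star_hom (Uq2_alg q) torus_alg p'" "\<forall>i\<in>{1..3}. \<forall>j\<in>{1..3}. p' (v_Uq2 q i j) = diag_T2 i j"
begin

abbreviation "SUA \<equiv> SUq3_alg q"
abbreviation "UA \<equiv> Uq2_alg q"

abbreviation "c' \<equiv> U.coaction p'"

lemma graded_coaction_Uq2: "graded_coaction UA c' (Uq2_degrees q)"
proof -
  note cs = U.coaction_star_hom [OF p'] and ce = U.coaction_entry [OF p']
  interpret Ut: star_algebra_pair UA torus_alg
    by (intro star_algebra_pair.intro U.star_algebra_axioms star_algebra_torus)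
  \<comment> \<open>The generators u, \<alpha>, \<gamma> are entries of columns 1, 2, 2, whose
    degrees are those in \<open>degree_Uq2\<close>.\<close>
  have g: "c' (gen_Uq2 q g) = Ut.pure (gen_Uq2 q g) (U_monom (degree_Uq2 g))" for g
    using ce [of 1 1] ce [of 2 2] ce [of 3 2] by (cases g) (simp_all add: v_Uq2_eq v_matrix_def column_degree_def)
  show ?thesis
  proof unfold_locales
    show "alg_hom UA Ut.T c'" by (rule star_hom_alg [OF cs])
    fix x d assume "(x, d) \<in> Uq2_degrees q"
    then obtain h where h: "x = gen_Uq2 q h \<and> d = degree_Uq2 h \<or> x = star UA (gen_Uq2 q h) \<and> d = - degree_Uq2 h"
      by (auto simp: Uq2_degrees_def)
    then show "x \<in> carrier UA" using U.star_closed by auto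
    show "c' x = Ut.pure x (U_monom d)"
      using h g star_homD [OF cs, OF gen_Uq2_closed] by (auto simp: Ut.pure_star star_U_monom)
  qed
qed

lemma graded_hom_iff:
  assumes f: "star_hom SUA UA f"
    and comult: "\<And>x. x \<in> carrier SUA \<Longrightarrow> D' (f x) = tensor_map UA UA f f (D x)"
    and counit: "\<And>x. x \<in> carrier SUA \<Longrightarrow> e' (f x) = e x"
  shows "(\<forall>x d. (x, d) \<in> homogeneous SUA {(u_SUq3 q i j, column_degree j) |i j. i \<in> {1..3} \<and> j \<in> {1..3}} \<longrightarrow>
      (f x, d) \<in> homogeneous UA (Uq2_degrees q)) \<longleftrightarrow> (\<forall>x\<in>carrier SUA. p' (f x) = p x)"
    (is "(\<forall>x d. _ \<in> ?G \<longrightarrow> _ \<in> ?G') \<longleftrightarrow> _")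
proof
  interpret graded_coaction UA c' "Uq2_degrees q" by (rule graded_coaction_Uq2)
  note fa = star_hom_alg [OF f]
  note pa = star_hom_alg [OF p(1)] and pa' = star_hom_alg [OF p'(1)]
  {
    assume compat: "\<forall>x d. (x, d) \<in> ?G \<longrightarrow> (f x, d) \<in> ?G'"
    note Lp = tensor_lift_pure [OF star_algebra_torus separated_torus bilinear_scal_left [OF alg_hom_linear [OF U.e_alg]]]
    have "p' (f x) = p x" if "x \<in> carrier SUA" for x
    proof (rule SU.alg_hom_ext [OF alg_hom_compose [OF fa pa'] pa _ that])
      fix i j :: nat assume ij: "i \<in> {1..3}" "j \<in> {1..3}"
      let ?y = "f (u_SUq3 q i j)"
      have "(u_SUq3 q i j, column_degree j) \<in> ?G" using ij by (intro homogeneous.gen) blast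
      \<comment> \<open>Compatibility is used on entries only; there it says that the image has the
        coaction degree of its column.\<close>
      then have y: "?y \<in> carrier UA" "c' ?y = pure ?y (U_monom (column_degree j))"
        using compat homogeneous_coaction by blast+
      have "p' ?y = e' ?y \<odot>\<^bsub>torus_alg\<^esub> U_monom (column_degree j)"
        unfolding U.torus_map_of_coaction [OF p' y(1)] y(2) using Lp [OF y(1), of "U_monom (column_degree j)"] by simp
      then show "p' ?y = p (u_SUq3 q i j)"
        using ij by (simp add: counit SU.e_entry p(2) diag_T2_eq del: atLeastAtMost_iff)
    qed
    then show "\<forall>x\<in>carrier SUA. p' (f x) = p x" by blast
  }
  assume comm: "\<forall>x\<in>carrier SUA. p' (f x) = p x"
  note sS = SU.star_algebra_axioms and sU = U.star_algebra_axioms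
  have "c' (f x) = tensor_map UA torus_alg f p (D x)" if "x \<in> carrier SUA" for x
  proof -
    note id = star_hom_alg [OF star_hom_id [of UA]]
    note m1 = tensor_map_alg_hom [OF sS sS sU sU fa fa]
    note m2 = tensor_map_alg_hom [OF sU sU sU star_algebra_torus id pa']
    note m3 = tensor_map_alg_hom [OF sS sS sU star_algebra_torus fa pa]
    note p1 = tensor_map_pure [OF sS sS sU sU alg_hom_linear [OF fa] alg_hom_linear [OF fa]]
    note p2 = tensor_map_pure [OF sU sU sU star_algebra_torus alg_hom_linear [OF id] alg_hom_linear [OF pa']]
    note p3 = tensor_map_pure [OF sS sS sU star_algebra_torus alg_hom_linear [OF fa] alg_hom_linear [OF pa]]
    \<comment> \<open>On pure tensors the composite applies \<open>f\<close> to the first leg and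
      \<open>p'\<close> after \<open>f\<close> to the second; the assumption replaces the latter by
      \<open>p\<close>.\<close>
    let ?P = "\<lambda>t. tensor_map UA torus_alg (\<lambda>x. x) p' (tensor_map UA UA f f t) = tensor_map UA torus_alg f p t"
    have "?P t" if "t \<in> carrier SU.AT" for t
    proof (rule SU.AA.tensor_induct [where P = ?P, OF that])
      fix a b assume "a \<in> carrier SUA" "b \<in> carrier SUA"
      then show "?P (SU.AA.pure a b)" using comm by (simp add: p1 p2 p3 alg_homD(1) [OF fa])
    next
      fix s t assume "s \<in> carrier SU.AT" "t \<in> carrier SU.AT" "?P s" "?P t"
      then show "?P (s \<oplus>\<^bsub>SU.AT\<^esub> t)" by (simp add: alg_homD [OF m1] alg_homD [OF m2] alg_homD [OF m3])
    qed
    then show ?thesis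
      using that alg_homD(1) [OF SU.D_alg that] by (simp add: U.coaction_def [OF p'] comult)
  qed
  \<comment> \<open>The images of the entries thus have the right coaction degree, which is
    converted into homogeneity by \<open>homogeneous_of_coaction\<close>; products and sums then
    follow.\<close>
  then have ce: "c' (f (u_SUq3 q i j)) = pure (f (u_SUq3 q i j)) (U_monom (column_degree j))"
    if "i \<in> {1..3}" "j \<in> {1..3}" for i j
    using that SU.map_comult_diag [OF p sU fa that] by (simp del: atLeastAtMost_iff)
  have "(f x, d) \<in> ?G' \<and> x \<in> carrier SUA" if "(x, d) \<in> ?G" for x d
    using that
  proof induction
    case (gen x d)
    then obtain i j where ij: "i \<in> {1..3}" "j \<in> {1..3}" "x = u_SUq3 q i j" "d = column_degree j" by blast
    then have "f x \<in> carrier UA" using alg_homD(1) [OF fa SU.entry] by simp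
    with ij ce show ?case
      using homogeneous_of_coaction [OF Uq2_degrees_generate [OF SU.q_pos] U.sep] by simp
  next
    case (zero d)
    show ?case by (simp add: linear_map_zero [OF alg_hom_linear [OF fa] sS sU] homogeneous.zero)
  qed (auto simp: alg_homD [OF fa] intro: homogeneous.intros)
  then show "\<forall>x d. (x, d) \<in> ?G \<longrightarrow> (f x, d) \<in> ?G'" by blast
qed

end

lemma matrix_star_map_make_hopf [simp]:
  "matrix_star_map (make_hopf A D e S) B = matrix_star_map A B"
  "matrix_star_map B (make_hopf A D e S) = matrix_star_map B A"
  by (simp_all add: matrix_star_map_def fun_eq_iff)

theorem lemma3p2:
  fixes q :: real
  assumes "0 < q" and "q < 1"
  shows "(\<exists>!f. is_matrix_star_map (O_SUq3 q) (O_Uq2 q) (u_SUq3 q) (v_Uq2 q) f) \<and>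
         (\<exists>!f. is_matrix_star_map (O_SUq3 q) O_T2 (u_SUq3 q) diag_T2 f) \<and>
         (\<exists>!f. is_matrix_star_map (O_Uq2 q) O_T2 (v_Uq2 q) diag_T2 f) \<and>
         hopf_star_epi (O_SUq3 q) O_T2 (pi0_hat q) \<and>
         hopf_star_epi (O_Uq2 q) O_T2 (pi1_hat q) \<and>
         hopf_star_epi (O_SUq3 q) (O_Uq2 q) (pi_map q) \<and>
         compatible_with_gradings q (pi_map q) \<and>
         (\<forall>x\<in>carrier (O_SUq3 q). pi1_hat q (pi_map q x) = pi0_hat q x) \<and>
         (\<forall>f. hopf_star_hom (O_SUq3 q) (O_Uq2 q) f \<longrightarrow>
            (compatible_with_gradings q f \<longleftrightarrow>
             (\<forall>x\<in>carrier (O_SUq3 q). pi1_hat q (f x) = pi0_hat q x)))"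
proof -
  \<comment> \<open>Both Hopf algebras are split into a star algebra and three attached maps. Star
    maps and degrees see the star algebra only, so the claims about them reduce to it.\<close>
  obtain D e S where O: "O_SUq3 q = make_hopf (SUq3_alg q) D e S"
    and H: "matrix_hopf_algebra (SUq3_alg q) q (u_SUq3 q) D e S"
    using SUq3_hopf [OF assms(1)] by blast
  obtain D' e' S' where O': "O_Uq2 q = make_hopf (Uq2_alg q) D' e' S'"
    and H': "matrix_hopf_algebra (Uq2_alg q) q (v_Uq2 q) D' e' S'"
    using Uq2_hopf [OF assms] by blast
  interpret SU: matrix_hopf_algebra "SUq3_alg q" q "u_SUq3 q" D e S by (rule H)
  interpret U: matrix_hopf_algebra "Uq2_alg q" q "v_Uq2 q" D' e' S' by (rule H')
  note HT = matrix_hopf_torus [OF assms(1)]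
  obtain f where f: "star_hom (SUq3_alg q) (Uq2_alg q) f"
    "\<And>i j. i \<in> {1..3} \<Longrightarrow> j \<in> {1..3} \<Longrightarrow> f (u_SUq3 q i j) = v_Uq2 q i j"
    using SUq3_universal [OF assms(1) U.star_algebra_axioms residual_Uq2 [OF assms] U.rel] by blast
  obtain f0 where f0: "star_hom (SUq3_alg q) torus_alg f0"
    "\<And>i j. i \<in> {1..3} \<Longrightarrow> j \<in> {1..3} \<Longrightarrow> f0 (u_SUq3 q i j) = diag_T2 i j"
    using pi0_exists [OF assms(1)] by blast
  obtain f1 where f1: "star_hom (Uq2_alg q) torus_alg f1"
    "\<And>i j. i \<in> {1..3} \<Longrightarrow> j \<in> {1..3} \<Longrightarrow> f1 (v_Uq2 q i j) = diag_T2 i j"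
    using pi1_exists [OF assms(1)] by blast
  have defs: "pi_map q = matrix_star_map (SUq3_alg q) (Uq2_alg q) (u_SUq3 q) (v_Uq2 q)"
    "pi0_hat q = matrix_star_map (SUq3_alg q) torus_alg (u_SUq3 q) diag_T2"
    "pi1_hat q = matrix_star_map (Uq2_alg q) torus_alg (v_Uq2 q) diag_T2"
    by (simp_all add: pi_map_def pi0_hat_def pi1_hat_def O O' O_T2_eq)
  have pi: "star_hom (SUq3_alg q) (Uq2_alg q) (pi_map q)"
    "\<And>i j. i \<in> {1..3} \<Longrightarrow> j \<in> {1..3} \<Longrightarrow> pi_map q (u_SUq3 q i j) = v_Uq2 q i j"
    unfolding defs by (rule SU.matrix_star_map [OF f]; assumption)+
  have pi0: "star_hom (SUq3_alg q) torus_alg (pi0_hat q)"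
    "\<And>i j. i \<in> {1..3} \<Longrightarrow> j \<in> {1..3} \<Longrightarrow> pi0_hat q (u_SUq3 q i j) = diag_T2 i j"
    unfolding defs by (rule SU.matrix_star_map [OF f0]; assumption)+
  have pi1: "star_hom (Uq2_alg q) torus_alg (pi1_hat q)"
    "\<And>i j. i \<in> {1..3} \<Longrightarrow> j \<in> {1..3} \<Longrightarrow> pi1_hat q (v_Uq2 q i j) = diag_T2 i j"
    unfolding defs by (rule U.matrix_star_map [OF f1]; assumption)+
  interpret SUq3_to_Uq2 q D e S D' e' S' "pi0_hat q" "pi1_hat q"
    using pi0 pi1 by unfold_locales blast+
  have comm: "pi1_hat q (pi_map q x) = pi0_hat q x" if "x \<in> carrier (SUq3_alg q)" for x
    by (rule SU.alg_hom_ext [OF alg_hom_compose [OF star_hom_alg [OF pi(1)] star_hom_alg [OF pi1(1)]]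
        star_hom_alg [OF pi0(1)] _ that]) (simp only: pi(2) pi0(2) pi1(2))
  have graded: "compatible_with_gradings q g \<longleftrightarrow> (\<forall>x\<in>carrier (SUq3_alg q). pi1_hat q (g x) = pi0_hat q x)"
    if "hopf_star_hom (O_SUq3 q) (O_Uq2 q) g" for g
    unfolding compatible_with_gradings_def graded_SUq3_def graded_Uq2_def O O' make_hopf_homogeneous make_hopf_simps
      Uq2_degrees_def [symmetric]
    using that by (intro graded_hom_iff) (simp_all add: hopf_star_hom_def O O')
  have epi: "hopf_star_epi (O_SUq3 q) (O_Uq2 q) (pi_map q)" "hopf_star_epi (O_SUq3 q) O_T2 (pi0_hat q)"
    "hopf_star_epi (O_Uq2 q) O_T2 (pi1_hat q)"
    unfolding O O' O_T2_eq
    by (rule matrix_hopf_hom [OF H H' pi(1)] matrix_hopf_hom [OF H HT pi0(1)] matrix_hopf_hom [OF H' HT pi1(1)],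
      rule pi(2) pi0(2) pi1(2); assumption)+
  have ex: "\<exists>!f. is_matrix_star_map (SUq3_alg q) (Uq2_alg q) (u_SUq3 q) (v_Uq2 q) f"
    "\<exists>!f. is_matrix_star_map (SUq3_alg q) torus_alg (u_SUq3 q) diag_T2 f"
    "\<exists>!f. is_matrix_star_map (Uq2_alg q) torus_alg (v_Uq2 q) diag_T2 f"
    by (rule SU.matrix_star_map_unique [OF f] SU.matrix_star_map_unique [OF f0] U.matrix_star_map_unique [OF f1]; assumption)+
  show ?thesis
    using epi graded comm ex by (simp add: O O' O_T2_eq hopf_star_epi_def)
qed

end
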